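(* Let $d\in\mathbb{N}$, $s\in(0,1)$, $0<\lambda\le\Lambda$, $T>0$. Let $K:\mathbb{R}\times\mathbb{R}^d\times\mathbb{R}^d\to[0,\infty]$ be measurable with $K(t;x,y)=K(t;y,x)\le\Lambda|x-y|^{-d-2s}$ for all $t,x,y$, and assume the coercivity condition $$\iint_{B_r(x_o)\times B_r(x_o)}|v(x)-v(y)|^2K(t;x,y)\,dy\,dx\ge\lambda\,[v]^2_{H^s(B_r(x_o))}$$ for all $t\in\mathbb{R}$, $r>0$, $x_o\in\mathbb{R}^d$ and $v\in H^s(B_r(x_o))$. Let $u$ be a nonnegative global weak solution to $\partial_tu-\mathcal{L}_tu=0$ in $(0,T]\times\mathbb{R}^d$, and let $t,\tau\in(0,T)$. Then there exists $c>1$, depending only on $d,s,\lambda,\Lambda$ and $T$, such that $$c^{-1}\|u(\tau)\|_{L^1(\mathbb{R}^d;\mu)}\le\|u(t)\|_{L^1(\mathbb{R}^d;\mu)}\le c\,\|u(\tau)\|_{L^1(\mathbb{R}^d;\mu)}.$$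
   Context: $B_r(x_o)$ is the ball of radius $r$ centered at $x_o$, $B_r=B_r(0)$, and $[v]^2_{H^s(B)}=\iint_{B\times B}\frac{|v(x)-v(y)|^2}{|x-y|^{d+2s}}dy\,dx$. The operator is $-\mathcal{L}_t u(t,x)=\mathrm{p.v.}\int_{\mathbb{R}^d}(u(t,x)-u(t,y))K(t;x,y)\,dy$, with bilinear form $$\mathcal{E}^{(t)}(u,v)=\int_{\mathbb{R}^d}\int_{\mathbb{R}^d}(u(x)-u(y))(v(x)-v(y))K(t;x,y)\,dy\,dx.$$ $L^1(\mathbb{R}^d;\mu)$ is the space of $u\in L^1_{\mathrm{loc}}(\mathbb{R}^d)$ with $\|u\|_{L^1(\mathbb{R}^d;\mu)}=\int_{\mathbb{R}^d}\frac{|u(x)|}{(1+|x|)^{d+2s}}dx<\infty$. Local weak (super)solution: for an interval $I\subset\mathbb{R}$ and a bounded domain $\Omega\subset\mathbb{R}^d$, $u\in L^\infty(I;L^2_{\mathrm{loc}}(\Omega))\cap L^2(I;H^s_{\mathrm{loc}}(\Omega))\cap L^1(I;L^1(\mathbb{R}^d;\mu))$ is a weak supersolution to $\partial_tu-\mathcal{L}_tu=0$ in $I\times\Omega$ if $$-\int_I\int_{\mathbb{R}^d}u\,\partial_t\phi\,dx\,dt+\int_I\mathcal{E}^{(t)}(u(t),\phi(t))\,dt\ge0$$ for every $\phi\ge0$, $\phi\in H^1(I;L^2(\Omega))\cap L^2(I;H^s(\mathbb{R}^d))$ whose support is compactly contained in $\mathrm{int}(I)\times\Omega$. It is a weak subsolution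 if $-u$ is a weak supersolution, and a weak solution if it is both. Global weak solution in $I\times\mathbb{R}^d$: $u\in L^\infty(I;L^2_{\mathrm{loc}}(\mathbb{R}^d))\cap L^2(I;H^s_{\mathrm{loc}}(\mathbb{R}^d))\cap L^1(I;L^1(\mathbb{R}^d;\mu))$ which is a weak solution in $I\times B_R$ for every $R>0$. $u(t)=u(t,\cdot)$ refers to the representative of $u$ that is continuous in time with values in $L^2_{\mathrm{loc}}(\mathbb{R}^d)$. *)

theory Defs
  imports "HOL-Analysis.Analysis"
begin

text \<open>The space \<open>\<real>\<^sup>d\<close> is a type of class \<open>euclidean_space\<close> with \<open>d = DIM('a)\<close>. Norms take
  values in \<open>[0, \<infinity>]\<close>, so that membership in a space is finiteness of its norm. Functions of
  time and space are curried; elements of Bochner spaces are represented by jointly Lebesgue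
  measurable functions.\<close>

section \<open>Function spaces\<close>

definition L2_norm_sq :: "'a::euclidean_space set \<Rightarrow> ('a \<Rightarrow> real) \<Rightarrow> ennreal" where
  "L2_norm_sq B v = (\<integral>\<^sup>+x. ennreal ((v x)\<^sup>2) \<partial>lebesgue_on B)"

text \<open>On the diagonal the integrand is \<open>0 / 0 = 0\<close>; the diagonal is a null set.\<close>

definition Hs_seminorm_sq :: "real \<Rightarrow> 'a::euclidean_space set \<Rightarrow> ('a \<Rightarrow> real) \<Rightarrow> ennreal" where
  "Hs_seminorm_sq s B v =
     (\<integral>\<^sup>+(x, y). ennreal ((v x - v y)\<^sup>2 / norm (x - y) powr (real DIM('a) + 2 * s))
        \<partial>lebesgue_on (B \<times> B))"

definition Hs_norm_sq :: "real \<Rightarrow> 'a::euclidean_space set \<Rightarrow> ('a \<Rightarrow> real) \<Rightarrow> ennreal" where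
  "Hs_norm_sq s B v = L2_norm_sq B v + Hs_seminorm_sq s B v"

definition Hs_space :: "real \<Rightarrow> 'a::euclidean_space set \<Rightarrow> ('a \<Rightarrow> real) set" where
  "Hs_space s B = {v. v \<in> borel_measurable (lebesgue_on B) \<and> Hs_norm_sq s B v < \<infinity>}"

definition L1mu_norm :: "real \<Rightarrow> ('a::euclidean_space \<Rightarrow> real) \<Rightarrow> ennreal" where
  "L1mu_norm s v =
     (\<integral>\<^sup>+x. ennreal (\<bar>v x\<bar> / (1 + norm x) powr (real DIM('a) + 2 * s)) \<partial>lebesgue)"

definition Linf_L2loc ::
  "real set \<Rightarrow> 'a::euclidean_space set \<Rightarrow> (real \<Rightarrow> 'a \<Rightarrow> real) \<Rightarrow> bool" where
  "Linf_L2loc I \<Omega> u \<longleftrightarrow>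
     (\<forall>C. compact C \<and> C \<subseteq> \<Omega> \<longrightarrow>
        (\<exists>M::real. AE t in lebesgue_on I. L2_norm_sq C (u t) \<le> ennreal M))"

definition L2_Hsloc ::
  "real \<Rightarrow> real set \<Rightarrow> 'a::euclidean_space set \<Rightarrow> (real \<Rightarrow> 'a \<Rightarrow> real) \<Rightarrow> bool" where
  "L2_Hsloc s I \<Omega> u \<longleftrightarrow>
     (\<forall>\<Omega>'. open \<Omega>' \<and> compact (closure \<Omega>') \<and> closure \<Omega>' \<subseteq> \<Omega> \<longrightarrow>
        (\<integral>\<^sup>+t. Hs_norm_sq s \<Omega>' (u t) \<partial>lebesgue_on I) < \<infinity>)"

definition L1_L1mu :: "real \<Rightarrow> real set \<Rightarrow> (real \<Rightarrow> 'a::euclidean_space \<Rightarrow> real) \<Rightarrow> bool" where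
  "L1_L1mu s I u \<longleftrightarrow> (\<integral>\<^sup>+t. L1mu_norm s (u t) \<partial>lebesgue_on I) < \<infinity>"

definition solution_space ::
  "real \<Rightarrow> real set \<Rightarrow> 'a::euclidean_space set \<Rightarrow> (real \<Rightarrow> 'a \<Rightarrow> real) \<Rightarrow> bool" where
  "solution_space s I \<Omega> u \<longleftrightarrow>
     (\<lambda>(t, x). u t x) \<in> borel_measurable (lebesgue_on (I \<times> UNIV)) \<and>
     Linf_L2loc I \<Omega> u \<and> L2_Hsloc s I \<Omega> u \<and> L1_L1mu s I u"

section \<open>Test functions\<close>

definition Cc_infty :: "real set \<Rightarrow> (real \<Rightarrow> real) set" where
  "Cc_infty J = {\<eta>. (\<forall>n t. (deriv ^^ n) \<eta> field_differentiable at t) \<and>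
     compact (closure {t. \<eta> t \<noteq> 0}) \<and> closure {t. \<eta> t \<noteq> 0} \<subseteq> J}"

text \<open>\<open>\<phi> \<in> H\<^sup>1(I; L\<^sup>2(\<Omega>))\<close> with weak time derivative \<open>\<psi>\<close>. The identity
  \<open>\<integral> \<eta>' \<phi> dt = - \<integral> \<eta> \<psi> dt\<close> between elements of \<open>L\<^sup>2(\<Omega>)\<close> is read
  pointwise almost everywhere in \<open>\<Omega>\<close>.\<close>

definition H1_L2_deriv ::
  "real set \<Rightarrow> 'a::euclidean_space set \<Rightarrow> (real \<Rightarrow> 'a \<Rightarrow> real) \<Rightarrow> (real \<Rightarrow> 'a \<Rightarrow> real) \<Rightarrow> bool" where
  "H1_L2_deriv I \<Omega> \<phi> \<psi> \<longleftrightarrow>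
     (\<lambda>(t, x). \<phi> t x) \<in> borel_measurable (lebesgue_on (I \<times> \<Omega>)) \<and>
     (\<lambda>(t, x). \<psi> t x) \<in> borel_measurable (lebesgue_on (I \<times> \<Omega>)) \<and>
     (\<integral>\<^sup>+t. L2_norm_sq \<Omega> (\<phi> t) \<partial>lebesgue_on I) < \<infinity> \<and>
     (\<integral>\<^sup>+t. L2_norm_sq \<Omega> (\<psi> t) \<partial>lebesgue_on I) < \<infinity> \<and>
     (\<forall>\<eta>\<in>Cc_infty (interior I). AE x in lebesgue_on \<Omega>.
        (LINT t|lebesgue_on I. deriv \<eta> t * \<phi> t x) = - (LINT t|lebesgue_on I. \<eta> t * \<psi> t x))"

text \<open>\<open>\<phi>\<close> is the test function and \<open>\<psi>\<close> is \<open>\<partial>\<^sub>t\<phi>\<close>.\<close>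

definition test_function ::
  "real \<Rightarrow> real set \<Rightarrow> 'a::euclidean_space set \<Rightarrow> (real \<Rightarrow> 'a \<Rightarrow> real) \<Rightarrow> (real \<Rightarrow> 'a \<Rightarrow> real) \<Rightarrow> bool" where
  "test_function s I \<Omega> \<phi> \<psi> \<longleftrightarrow>
     (\<forall>t x. 0 \<le> \<phi> t x) \<and>
     H1_L2_deriv I \<Omega> \<phi> \<psi> \<and>
     (\<lambda>(t, x). \<phi> t x) \<in> borel_measurable (lebesgue_on (I \<times> UNIV)) \<and>
     (\<integral>\<^sup>+t. Hs_norm_sq s UNIV (\<phi> t) \<partial>lebesgue_on I) < \<infinity> \<and>
     compact (closure {(t, x). \<phi> t x \<noteq> 0}) \<and>
     closure {(t, x). \<phi> t x \<noteq> 0} \<subseteq> interior I \<times> \<Omega>"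

section \<open>Kernels and weak solutions\<close>

text \<open>The upper bound is \<open>\<infinity>\<close>, hence void, on the diagonal; since \<open>0 powr a = 0\<close> the case
  \<open>x = y\<close> is excluded explicitly.\<close>

definition admissible_kernel ::
  "real \<Rightarrow> real \<Rightarrow> real \<Rightarrow> (real \<Rightarrow> 'a::euclidean_space \<Rightarrow> 'a \<Rightarrow> ennreal) \<Rightarrow> bool" where
  "admissible_kernel s lam Lam K \<longleftrightarrow>
     (\<lambda>(t, x, y). K t x y) \<in> borel_measurable lebesgue \<and>
     (\<forall>t x y. K t x y = K t y x) \<and>
     (\<forall>t x y. x \<noteq> y \<longrightarrow> K t x y \<le> ennreal (Lam * norm (x - y) powr (- real DIM('a) - 2 * s))) \<and>
     (\<forall>t x\<^sub>o. \<forall>r>0. \<forall>v\<in>Hs_space s (ball x\<^sub>o r).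
        (\<integral>\<^sup>+(x, y). ennreal (\<bar>v x - v y\<bar>\<^sup>2) * K t x y \<partial>lebesgue_on (ball x\<^sub>o r \<times> ball x\<^sub>o r))
          \<ge> ennreal lam * Hs_seminorm_sq s (ball x\<^sub>o r) v)"

text \<open>The value \<open>K = \<infinity>\<close> is possible only on the diagonal, where the integrand vanishes.\<close>

definition energy ::
  "('a::euclidean_space \<Rightarrow> 'a \<Rightarrow> ennreal) \<Rightarrow> ('a \<Rightarrow> real) \<Rightarrow> ('a \<Rightarrow> real) \<Rightarrow> real" where
  "energy k u v =
     (LINT x|lebesgue. LINT y|lebesgue. (u x - u y) * (v x - v y) * enn2real (k x y))"

text \<open>Since \<open>\<phi>\<close> vanishes outside \<open>I \<times> \<Omega>\<close>, so does \<open>\<partial>\<^sub>t\<phi>\<close>, and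
  the first integral over \<open>\<real>\<^sup>d\<close> is one over \<open>\<Omega>\<close>, where \<open>\<psi>\<close> is determined.\<close>

definition weak_supersolution ::
  "real \<Rightarrow> (real \<Rightarrow> 'a::euclidean_space \<Rightarrow> 'a \<Rightarrow> ennreal) \<Rightarrow> real set \<Rightarrow> 'a set \<Rightarrow>
   (real \<Rightarrow> 'a \<Rightarrow> real) \<Rightarrow> bool" where
  "weak_supersolution s K I \<Omega> u \<longleftrightarrow>
     solution_space s I \<Omega> u \<and>
     (\<forall>\<phi> \<psi>. test_function s I \<Omega> \<phi> \<psi> \<longrightarrow>
        - (LINT t|lebesgue_on I. LINT x|lebesgue_on \<Omega>. u t x * \<psi> t x)
        + (LINT t|lebesgue_on I. energy (K t) (u t) (\<phi> t)) \<ge> 0)"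

definition weak_subsolution ::
  "real \<Rightarrow> (real \<Rightarrow> 'a::euclidean_space \<Rightarrow> 'a \<Rightarrow> ennreal) \<Rightarrow> real set \<Rightarrow> 'a set \<Rightarrow>
   (real \<Rightarrow> 'a \<Rightarrow> real) \<Rightarrow> bool" where
  "weak_subsolution s K I \<Omega> u \<longleftrightarrow> weak_supersolution s K I \<Omega> (\<lambda>t x. - u t x)"

definition weak_solution ::
  "real \<Rightarrow> (real \<Rightarrow> 'a::euclidean_space \<Rightarrow> 'a \<Rightarrow> ennreal) \<Rightarrow> real set \<Rightarrow> 'a set \<Rightarrow>
   (real \<Rightarrow> 'a \<Rightarrow> real) \<Rightarrow> bool" where
  "weak_solution s K I \<Omega> u \<longleftrightarrow> weak_supersolution s K I \<Omega> u \<and> weak_subsolution s K I \<Omega> u"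

definition global_weak_solution ::
  "real \<Rightarrow> (real \<Rightarrow> 'a::euclidean_space \<Rightarrow> 'a \<Rightarrow> ennreal) \<Rightarrow> real set \<Rightarrow>
   (real \<Rightarrow> 'a \<Rightarrow> real) \<Rightarrow> bool" where
  "global_weak_solution s K I u \<longleftrightarrow>
     solution_space s I UNIV u \<and> (\<forall>R>0. weak_solution s K I (ball 0 R) u)"

definition ae_nonneg :: "real set \<Rightarrow> (real \<Rightarrow> 'a::euclidean_space \<Rightarrow> real) \<Rightarrow> bool" where
  "ae_nonneg I u \<longleftrightarrow> (AE (t, x) in lebesgue_on (I \<times> UNIV). 0 \<le> u t x)"

text \<open>\<open>v\<close> is the representative of \<open>u\<close> that is continuous on \<open>I\<close> with values in
  \<open>L\<^sup>2\<^sub>l\<^sub>o\<^sub>c(\<real>\<^sup>d)\<close>.\<close>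

definition continuous_representative ::
  "real set \<Rightarrow> (real \<Rightarrow> 'a::euclidean_space \<Rightarrow> real) \<Rightarrow> (real \<Rightarrow> 'a \<Rightarrow> real) \<Rightarrow> bool" where
  "continuous_representative I u v \<longleftrightarrow>
     (AE (t, x) in lebesgue_on (I \<times> UNIV). v t x = u t x) \<and>
     (\<forall>t\<in>I. v t \<in> borel_measurable lebesgue \<and> (\<forall>R>0. L2_norm_sq (ball 0 R) (v t) < \<infinity>)) \<and>
     (\<forall>t\<in>I. \<forall>R>0.
        ((\<lambda>r. L2_norm_sq (ball 0 R) (\<lambda>x. v r x - v t x)) \<longlongrightarrow> 0) (at t within I))"

end

theory Submission
  imports Defs
begin

text \<open>Let \<open>w x = (1 + |x|)\<^sup>-\<^sup>d\<^sup>-\<^sup>2\<^sup>s\<close>. The heart of the matter is a local bound: if \<open>u\<close> solves the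
  equation and the mass of \<open>u t0\<close> on the ball of radius 2 around \<open>c\<close> plus the time integral of
  \<open>\<integral> u t x * w (x - c) dx\<close> is at most 1, then the mass of \<open>u t\<close> on the ball of radius 1 is bounded,
  for \<open>t\<close> before or after \<open>t0\<close>. Testing with a cutoff shows that the local mass changes by at most
  \<open>\<integral>\<integral> |u x - u y| |W x - W y| k\<close>; the part near the diagonal is split by Cauchy--Schwarz into
  the dissipation of the concave entropy, obtained by testing with \<open>W * (1 - (1 + u) powr - \<alpha>)\<close>,
  and \<open>\<integral> (1 + u) powr (1 + \<alpha>)\<close>. Since \<open>\<alpha>\<close> is small, coercivity and a pointwise Sobolev inequality
  bound the latter by a sublinear power of the same quantities on a slightly larger ball, and
  iterating over shrinking annuli closes the estimate.

  Multiplying the scaled local bound by \<open>w c\<close>, integrating over \<open>c\<close> and using \<open>w * w \<le> C w\<close> gives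
  \<open>N t \<le> A (N t0 + \<integral> N)\<close> for the weighted mass \<open>N\<close>, in both time directions. On time
  intervals of length \<open>1 / (2 A)\<close> the integral is absorbed, and finitely many such intervals cover
  \<open>(0, T)\<close>.\<close>

section \<open>Integration and translation\<close>

text \<open>The obstacle is the flux near the diagonal. For s \<ge> 1/2 the product of |x - y| with
  the kernel bound is not locally integrable, so a Lipschitz cutoff alone does not bound the drift
  by the mass of \<open>u\<close>; and since \<open>K\<close> is merely measurable, no cancellation
  between x + h and x - h can help. As only the mass is under control, a quadratic energy estimate
  is out of reach. The test function has to be a bounded function of \<open>u\<close>, and the
  resulting dissipation degenerates where \<open>u\<close> is large. Such a test function has no
  time derivative. It is therefore frozen at the end of a short time interval, convexity replaces
  the chain rule, and averaging over the end time turns the error into an L1 translate in time of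
  the flux away from the diagonal. The entropy inequality runs forward only. The backward bound
  survives because the local masses at any two times differ by at most the drift, so the entropy at
  the initial time is bounded wherever \<open>t0\<close> lies. The truncation is not homogeneous, so
  the local bound is obtained under a normalisation and transferred by the linearity of the
  equation.\<close>

lemma nn_integral_lborel_pair:
  fixes f :: "'a::euclidean_space \<times> 'b::euclidean_space \<Rightarrow> ennreal"
  assumes "f \<in> borel_measurable borel"
  shows "(\<integral>\<^sup>+z. f z \<partial>lborel) = (\<integral>\<^sup>+x. \<integral>\<^sup>+y. f (x, y) \<partial>lborel \<partial>lborel)"
proof -
  have "f \<in> borel_measurable (lborel \<Otimes>\<^sub>M lborel)"
    using assms by (simp add: lborel_prod)
  from lborel.nn_integral_fst[OF this] show ?thesis
    by (simp add: lborel_prod)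
qed

lemma nn_integral_lborel_translate:
  fixes f :: "'a::euclidean_space \<Rightarrow> ennreal"
  assumes [measurable]: "f \<in> borel_measurable borel"
  shows "(\<integral>\<^sup>+x. f (x - c) \<partial>lborel) = (\<integral>\<^sup>+x. f x \<partial>lborel)"
proof -
  have "(\<integral>\<^sup>+x. f x \<partial>lborel) = (\<integral>\<^sup>+x. f x \<partial>distr lborel borel ((+) (-c)))"
    by (simp add: lborel_distr_plus)
  also have "\<dots> = (\<integral>\<^sup>+x. f (-c + x) \<partial>lborel)"
    by (subst nn_integral_distr) auto
  finally show ?thesis by (simp add: algebra_simps)
qed

lemma tendsto_0_le_ennreal_eps:
  fixes f :: "nat \<Rightarrow> ennreal"
  assumes "\<And>r::real. 0 < r \<Longrightarrow> eventually (\<lambda>n. f n \<le> ennreal r) sequentially"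
  shows "f \<longlonglongrightarrow> 0"
proof (rule order_tendstoI)
  fix a :: ennreal assume "0 < a"
  then obtain r :: real where r: "0 < r" "ennreal r < a"
  proof (cases a)
    case (real x)
    then show ?thesis using \<open>0 < a\<close> by (intro that[of "x/2"]) (auto simp: ennreal_less_iff)
  qed (auto intro: that[of 1])
  show "eventually (\<lambda>n. f n < a) sequentially"
    using assms[OF r(1)] by eventually_elim (use r(2) in auto)
qed simp

text \<open>\<open>U\<close> and its translate have the same finite measure, so the two halves of
  their symmetric difference have equal measure, and only the points of \<open>U\<close> outside the
  translate matter. By openness a fixed point of \<open>U\<close> is eventually not among them, and
  the indicator of \<open>U\<close> dominates.\<close>

lemma tendsto_translate_open:
  fixes U :: "'a::euclidean_space set"
  assumes U: "open U" and fin: "emeasure lborel U < \<infinity>" and e: "e \<longlonglongrightarrow> 0"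
  shows "(\<lambda>n. \<integral>\<^sup>+x. ennreal \<bar>indicator U (x - e n) - indicator U x\<bar> \<partial>lborel) \<longlonglongrightarrow> 0"
proof -
  have [measurable]: "U \<in> sets borel" using U by simp
  let ?d = "\<lambda>n x. indicator U x * (1 - indicator U (x - e n)) :: ennreal"
  have key: "(\<integral>\<^sup>+x. ennreal \<bar>indicator U (x - e n) - indicator U x\<bar> \<partial>lborel) = 2 * (\<integral>\<^sup>+x. ?d n x \<partial>lborel)" for n
  proof -
    let ?b = "\<lambda>x. indicator U x * indicator U (x - e n) :: ennreal"
    let ?d' = "\<lambda>x. indicator U (x - e n) * (1 - indicator U x) :: ennreal"
    have "(\<integral>\<^sup>+x. ?b x \<partial>lborel) + (\<integral>\<^sup>+x. ?d n x \<partial>lborel) = emeasure lborel U"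
      by (subst nn_integral_add[symmetric]) (auto intro!: trans[OF nn_integral_cong nn_integral_indicator] split: split_indicator)
    moreover have "(\<integral>\<^sup>+x. ?b x \<partial>lborel) + (\<integral>\<^sup>+x. ?d' x \<partial>lborel) = emeasure lborel U"
    proof -
      have "(\<integral>\<^sup>+x. ?b x \<partial>lborel) + (\<integral>\<^sup>+x. ?d' x \<partial>lborel) = (\<integral>\<^sup>+x. indicator U (x - e n) \<partial>lborel)"
        by (subst nn_integral_add[symmetric]) (auto intro!: nn_integral_cong split: split_indicator)
      also have "\<dots> = emeasure lborel U"
        by (subst nn_integral_lborel_translate) auto
      finally show ?thesis .
    qed
    moreover have "(\<integral>\<^sup>+x. ?b x \<partial>lborel) < \<infinity>"
    proof -
      have "(\<integral>\<^sup>+x. ?b x \<partial>lborel) \<le> (\<integral>\<^sup>+x. indicator U x \<partial>lborel)"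
        by (intro nn_integral_mono) (auto split: split_indicator)
      then show ?thesis using fin by (simp add: le_less_trans)
    qed
    ultimately have eq: "(\<integral>\<^sup>+x. ?d n x \<partial>lborel) = (\<integral>\<^sup>+x. ?d' x \<partial>lborel)"
      using ennreal_add_left_cancel[of "\<integral>\<^sup>+x. ?b x \<partial>lborel" "\<integral>\<^sup>+x. ?d n x \<partial>lborel" "\<integral>\<^sup>+x. ?d' x \<partial>lborel"]
      by (simp add: less_top[symmetric])
    have "(\<integral>\<^sup>+x. ennreal \<bar>indicator U (x - e n) - indicator U x\<bar> \<partial>lborel) = (\<integral>\<^sup>+x. ?d n x + ?d' x \<partial>lborel)"
      by (intro nn_integral_cong) (auto split: split_indicator)
    also have "\<dots> = (\<integral>\<^sup>+x. ?d n x \<partial>lborel) + (\<integral>\<^sup>+x. ?d' x \<partial>lborel)"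
      by (subst nn_integral_add) auto
    finally show ?thesis unfolding eq[symmetric] by (simp add: mult_2)
  qed
  have "(\<lambda>n. \<integral>\<^sup>+x. ?d n x \<partial>lborel) \<longlonglongrightarrow> (\<integral>\<^sup>+x. 0 \<partial>(lborel::'a measure))"
  proof (rule nn_integral_dominated_convergence)
    show "AE x in lborel. (\<lambda>n. ?d n x) \<longlonglongrightarrow> 0"
    proof (rule AE_I2)
      fix x
      show "(\<lambda>n. ?d n x) \<longlonglongrightarrow> 0"
      proof (cases "x \<in> U")
        case True
        have "(\<lambda>n. x - e n) \<longlonglongrightarrow> x - 0" by (intro tendsto_intros e)
        then have "eventually (\<lambda>n. x - e n \<in> U) sequentially"
          using True U by (auto dest: topological_tendstoD)
        then have "eventually (\<lambda>n. ?d n x = 0) sequentially"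
          by eventually_elim simp
        then show ?thesis by (rule tendsto_eventually)
      qed simp
    qed
    show "(\<integral>\<^sup>+x. indicator U x \<partial>(lborel::'a measure)) < \<infinity>" using fin by simp
  qed (auto split: split_indicator)
  then have "(\<lambda>n. 2 * (\<integral>\<^sup>+x. ?d n x \<partial>lborel)) \<longlonglongrightarrow> 2 * 0"
    by (intro ennreal_tendsto_cmult) auto
  then show ?thesis by (simp add: key)
qed

text \<open>The class of functions with the property is closed under sums and \<open>L\<^sup>1\<close> limits and contains
  the indicators of open sets, hence of all Borel sets by outer regularity.\<close>

lemma tendsto_translate_L1:
  fixes g :: "'a::euclidean_space \<Rightarrow> real"
  assumes g: "integrable lborel g" and e: "e \<longlonglongrightarrow> 0"
  shows "(\<lambda>n. \<integral>\<^sup>+x. ennreal \<bar>g (x - e n) - g x\<bar> \<partial>lborel) \<longlonglongrightarrow> 0"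
proof -
  let ?P = "\<lambda>g :: 'a \<Rightarrow> real. (\<lambda>n. \<integral>\<^sup>+x. ennreal \<bar>g (x - e n) - g x\<bar> \<partial>lborel) \<longlonglongrightarrow> 0"
  \<comment> \<open>Stability under L1 limits: translation preserves the L1 distance of
    \<open>f\<close> and \<open>h\<close>, so that distance is counted twice and the translation
    error of \<open>h\<close> once.\<close>
  have approx: "?P f" if f: "f \<in> borel_measurable borel"
    and ap: "\<And>r::real. 0 < r \<Longrightarrow> \<exists>h. h \<in> borel_measurable borel \<and> ?P h \<and> (\<integral>\<^sup>+x. ennreal \<bar>f x - h x\<bar> \<partial>lborel) \<le> ennreal r" for f
  proof (rule tendsto_0_le_ennreal_eps)
    fix r :: real assume r: "0 < r"
    then obtain h where h[measurable]: "h \<in> borel_measurable borel" and Ph: "?P h" and le: "(\<integral>\<^sup>+x. ennreal \<bar>f x - h x\<bar> \<partial>lborel) \<le> ennreal (r/4)"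
      using ap[of "r/4"] by auto
    note f[measurable]
    have "eventually (\<lambda>n. (\<integral>\<^sup>+x. ennreal \<bar>h (x - e n) - h x\<bar> \<partial>lborel) < ennreal (r/2)) sequentially"
      using order_tendstoD(2)[OF Ph, of "ennreal (r/2)"] r by simp
    then show "eventually (\<lambda>n. (\<integral>\<^sup>+x. ennreal \<bar>f (x - e n) - f x\<bar> \<partial>lborel) \<le> ennreal r) sequentially"
    proof eventually_elim
      case (elim n)
      have "(\<integral>\<^sup>+x. ennreal \<bar>f (x - e n) - f x\<bar> \<partial>lborel) \<le>
        (\<integral>\<^sup>+x. ennreal \<bar>f (x - e n) - h (x - e n)\<bar> + ennreal \<bar>h (x - e n) - h x\<bar> + ennreal \<bar>f x - h x\<bar> \<partial>lborel)"
        by (intro nn_integral_mono) (auto simp flip: ennreal_plus intro!: ennreal_leI)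
      also have "\<dots> = (\<integral>\<^sup>+x. ennreal \<bar>f (x - e n) - h (x - e n)\<bar> \<partial>lborel) + (\<integral>\<^sup>+x. ennreal \<bar>h (x - e n) - h x\<bar> \<partial>lborel) + (\<integral>\<^sup>+x. ennreal \<bar>f x - h x\<bar> \<partial>lborel)"
        by (simp add: nn_integral_add)
      also have "(\<integral>\<^sup>+x. ennreal \<bar>f (x - e n) - h (x - e n)\<bar> \<partial>lborel) = (\<integral>\<^sup>+x. ennreal \<bar>f x - h x\<bar> \<partial>lborel)"
        by (rule nn_integral_lborel_translate[of "\<lambda>x. ennreal \<bar>f x - h x\<bar>"]) simp
      also have "(\<integral>\<^sup>+x. ennreal \<bar>f x - h x\<bar> \<partial>lborel) + (\<integral>\<^sup>+x. ennreal \<bar>h (x - e n) - h x\<bar> \<partial>lborel) + (\<integral>\<^sup>+x. ennreal \<bar>f x - h x\<bar> \<partial>lborel)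
         \<le> ennreal (r/4) + ennreal (r/2) + ennreal (r/4)"
        using le elim by (intro add_mono) auto
      also have "\<dots> = ennreal r" using r by (simp flip: ennreal_plus)
      finally show ?case .
    qed
  qed
  show ?thesis using g
  proof (induction rule: integrable_induct)
    case (base A c)
    then have A[measurable]: "A \<in> sets borel" and fA: "emeasure lborel A < \<infinity>" by auto
    have ind: "?P (indicator A)"
    proof (rule approx)
      fix r :: real assume r: "0 < r"
      obtain U where U: "open U" "A \<subseteq> U" "emeasure lborel (U - A) < ennreal r"
        using outer_regular_lborel[OF _ r, of A] A by (auto )
      have [measurable]: "U \<in> sets borel" using U(1) by simp
      have "emeasure lborel U = emeasure lborel (A \<union> (U - A))"
        using U(2) by (intro arg_cong[of _ _ "emeasure lborel"]) auto
      also have "\<dots> \<le> emeasure lborel A + emeasure lborel (U - A)"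
        by (intro emeasure_subadditive) auto
      also have "\<dots> < \<infinity>" using fA U(3) by (auto simp: less_top[symmetric] top_unique)
      finally have "?P (indicator U)" by (intro tendsto_translate_open U e)
      moreover have "(\<integral>\<^sup>+x. ennreal \<bar>indicator A x - indicator U x\<bar> \<partial>lborel) \<le> ennreal r"
      proof -
        have "(\<integral>\<^sup>+x. ennreal \<bar>indicator A x - indicator U x\<bar> \<partial>lborel) = (\<integral>\<^sup>+x. indicator (U - A) x \<partial>lborel)"
          using U(2) by (intro nn_integral_cong) (auto split: split_indicator)
        then show ?thesis using U(3) by simp
      qed
      ultimately show "\<exists>h. h \<in> borel_measurable borel \<and> ?P h \<and> (\<integral>\<^sup>+x. ennreal \<bar>indicator A x - h x\<bar> \<partial>lborel) \<le> ennreal r"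
        by (intro exI[of _ "indicator U"]) auto
    qed simp
    have "(\<integral>\<^sup>+x. ennreal \<bar>indicator A (x - e n) *\<^sub>R c - indicator A x *\<^sub>R c\<bar> \<partial>lborel)
        = ennreal \<bar>c\<bar> * (\<integral>\<^sup>+x. ennreal \<bar>indicator A (x - e n) - indicator A x\<bar> \<partial>lborel)" for n
      by (subst nn_integral_cmult[symmetric])
        (auto intro!: nn_integral_cong simp: ennreal_mult[symmetric] split: split_indicator)
    moreover have "(\<lambda>n. ennreal \<bar>c\<bar> * (\<integral>\<^sup>+x. ennreal \<bar>indicator A (x - e n) - indicator A x\<bar> \<partial>lborel)) \<longlonglongrightarrow> ennreal \<bar>c\<bar> * 0"
      by (intro ennreal_tendsto_cmult ind) auto
    ultimately show ?case by simp
  next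
    case (add f g)
    have [measurable]: "f \<in> borel_measurable borel" "g \<in> borel_measurable borel" using add by auto
    have "(\<lambda>n. (\<integral>\<^sup>+x. ennreal \<bar>f (x - e n) - f x\<bar> \<partial>lborel) + (\<integral>\<^sup>+x. ennreal \<bar>g (x - e n) - g x\<bar> \<partial>lborel)) \<longlonglongrightarrow> 0 + 0"
      by (intro tendsto_add add)
    then have lim: "(\<lambda>n. (\<integral>\<^sup>+x. ennreal \<bar>f (x - e n) - f x\<bar> \<partial>lborel) + (\<integral>\<^sup>+x. ennreal \<bar>g (x - e n) - g x\<bar> \<partial>lborel)) \<longlonglongrightarrow> 0"
      by simp
    show ?case
    proof (rule tendsto_sandwich[OF _ _ tendsto_const lim])
      show "eventually (\<lambda>n. (\<integral>\<^sup>+x. ennreal \<bar>f (x - e n) + g (x - e n) - (f x + g x)\<bar> \<partial>lborel)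
         \<le> (\<integral>\<^sup>+x. ennreal \<bar>f (x - e n) - f x\<bar> \<partial>lborel) + (\<integral>\<^sup>+x. ennreal \<bar>g (x - e n) - g x\<bar> \<partial>lborel)) sequentially"
        by (intro always_eventually allI, subst nn_integral_add[symmetric])
          (auto intro!: nn_integral_mono ennreal_leI simp flip: ennreal_plus)
    qed auto
  next
    case (lim f S)
    have [measurable]: "f \<in> borel_measurable borel" "\<And>i. S i \<in> borel_measurable borel" using lim by auto
    have "(\<lambda>i. \<integral>\<^sup>+x. ennreal \<bar>f x - S i x\<bar> \<partial>lborel) \<longlonglongrightarrow> (\<integral>\<^sup>+x. 0 \<partial>(lborel::'a measure))"
    \<comment> \<open>The approximating functions satisfy |S i x| \<le> 2 |f x|, hence the
      dominating function 3 |f x|.\<close>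
    proof (rule nn_integral_dominated_convergence)
      show "(\<integral>\<^sup>+x. ennreal (3 * \<bar>f x\<bar>) \<partial>lborel) < \<infinity>"
      proof -
        have "integrable lborel (\<lambda>x. 3 * \<bar>f x\<bar>)" using lim by auto
        then show ?thesis by (subst nn_integral_eq_integral) auto
      qed
      show "AE x in lborel. ennreal \<bar>f x - S i x\<bar> \<le> ennreal (3 * \<bar>f x\<bar>)" for i
      proof (intro AE_I2 ennreal_leI)
        fix x :: 'a
        show "\<bar>f x - S i x\<bar> \<le> 3 * \<bar>f x\<bar>" using lim(3)[of x i] by simp
      qed
      show "AE x in lborel. (\<lambda>i. ennreal \<bar>f x - S i x\<bar>) \<longlonglongrightarrow> 0"
      proof (rule AE_I2)
        fix x :: 'a
        have "(\<lambda>i. \<bar>f x - S i x\<bar>) \<longlonglongrightarrow> \<bar>f x - f x\<bar>" using lim(2)[of x] by (intro tendsto_intros) auto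
        then show "(\<lambda>i. ennreal \<bar>f x - S i x\<bar>) \<longlonglongrightarrow> 0"
          by (metis abs_zero diff_self ennreal_0 tendsto_ennrealI)
      qed
    qed auto
    then have L: "(\<lambda>i. \<integral>\<^sup>+x. ennreal \<bar>f x - S i x\<bar> \<partial>lborel) \<longlonglongrightarrow> 0" by simp
    show ?case
    proof (rule approx)
      fix r :: real assume "0 < r"
      then have "eventually (\<lambda>i. (\<integral>\<^sup>+x. ennreal \<bar>f x - S i x\<bar> \<partial>lborel) < ennreal r) sequentially"
        using order_tendstoD(2)[OF L, of "ennreal r"] by simp
      then obtain i where "(\<integral>\<^sup>+x. ennreal \<bar>f x - S i x\<bar> \<partial>lborel) < ennreal r"
        by (auto simp: eventually_sequentially)
      then show "\<exists>h. h \<in> borel_measurable borel \<and> ?P h \<and> (\<integral>\<^sup>+x. ennreal \<bar>f x - h x\<bar> \<partial>lborel) \<le> ennreal r"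
        using lim by (intro exI[of _ "S i"]) auto
    qed simp
  qed
qed

section \<open>Integrals of powers of the distance\<close>

lemma ball_in_borel [measurable]: "ball (c::'a::euclidean_space) r \<in> sets borel"
  by simp

text \<open>The integrand is dominated by the sum of the constants \<open>g n\<close> on the balls
  of radius \<open>r n\<close>, and the volumes turn this sum into a geometric series. The centre,
  where a negative power is singular, is discarded as a null set.\<close>

lemma nn_integral_dyadic_le:
  fixes f :: "'a::euclidean_space \<Rightarrow> ennreal"
  assumes A: "0 \<le> A" and R: "0 \<le> R" and q: "0 \<le> q" "q < 1"
    and le: "\<And>y. y \<noteq> c \<Longrightarrow> f y \<noteq> 0 \<Longrightarrow> \<exists>n. dist c y < r n \<and> f y \<le> ennreal (g n)"
    and nn: "\<And>n. 0 \<le> r n" "\<And>n. 0 \<le> g n"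
    and bd: "\<And>n. g n * r n ^ DIM('a) \<le> A * q ^ n"
  shows "(\<integral>\<^sup>+y. f y \<partial>lborel) \<le> ennreal (unit_ball_vol (real DIM('a)) * A / (1 - q))"
proof -
  let ?w = "unit_ball_vol (real DIM('a))"
  have "(\<integral>\<^sup>+y. f y \<partial>lborel) \<le> (\<integral>\<^sup>+y. (\<Sum>n. ennreal (g n) * indicator (ball c (r n)) y) \<partial>lborel)"
  proof (rule nn_integral_mono_AE)
    have "AE y in lborel. y \<noteq> c" by (rule AE_lborel_singleton)
    then show "AE y in lborel. f y \<le> (\<Sum>n. ennreal (g n) * indicator (ball c (r n)) y)"
    proof eventually_elim
      case (elim y)
      show ?case
      proof (cases "f y = 0")
        case False
        then obtain n where n: "dist c y < r n" "f y \<le> ennreal (g n)" using le elim by blast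
        then have "f y \<le> ennreal (g n) * indicator (ball c (r n)) y" by simp
        also have "\<dots> = (\<Sum>i\<in>{n}. ennreal (g i) * indicator (ball c (r i)) y)"
          by (subst sum.insert) auto
        also have "\<dots> \<le> (\<Sum>n. ennreal (g n) * indicator (ball c (r n)) y)"
          by (rule sum_le_suminf) auto
        finally show ?thesis .
      qed simp
    qed
  qed
  also have "\<dots> = (\<Sum>n. \<integral>\<^sup>+y. ennreal (g n) * indicator (ball c (r n)) y \<partial>lborel)"
    by (rule nn_integral_suminf) measurable
  also have "\<dots> = (\<Sum>n. ennreal (g n * (?w * r n ^ DIM('a))))"
    using nn by (subst nn_integral_cmult_indicator) (auto simp: emeasure_ball ennreal_mult[symmetric] unit_ball_vol_nonneg)
  also have "\<dots> \<le> (\<Sum>n. ennreal (?w * A * q ^ n))"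
  proof (intro suminf_le summableI ennreal_leI)
    fix n
    have "?w * (g n * r n ^ DIM('a)) \<le> ?w * (A * q ^ n)" by (intro mult_left_mono bd) (auto simp: unit_ball_vol_nonneg)
    then show "g n * (?w * r n ^ DIM('a)) \<le> ?w * A * q ^ n" by (simp add: algebra_simps)
  qed
  also have "\<dots> = ennreal (\<Sum>n. ?w * A * q ^ n)"
    using q A by (intro suminf_ennreal2) (auto simp: unit_ball_vol_nonneg intro!: summable_mult summable_geometric)
  also have "(\<Sum>n. ?w * A * q ^ n) = ?w * A / (1 - q)"
    using q by (subst suminf_mult) (auto simp: suminf_geometric summable_geometric)
  finally show ?thesis .
qed

text \<open>Dyadic shells shrinking to the centre: the n-th one contributes a multiple of 2 powr (-e
  n) with e = q + d > 0. The factor 2 powr |q| compares the values of the power at the inner and the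
  outer radius when q is negative.\<close>

lemma nn_integral_powr_ball_le:
  assumes q: "- real DIM('a) < q"
  obtains C where "0 < C"
    "\<And>c::'a::euclidean_space. (\<integral>\<^sup>+y. ennreal (norm (c - y) powr q) * indicator (ball c 1) y \<partial>lborel) \<le> ennreal C"
proof -
  define e where "e = q + real DIM('a)"
  have e: "0 < e" using q by (simp add: e_def)
  let ?C = "unit_ball_vol (real DIM('a)) * (2 powr \<bar>q\<bar>) / (1 - 2 powr (-e))"
  have le: "(\<integral>\<^sup>+y. ennreal (norm (c - y) powr q) * indicator (ball c 1) y \<partial>lborel) \<le> ennreal ?C" for c :: 'a
  proof (rule nn_integral_dyadic_le[where c=c and r="\<lambda>n. 2 powr (- real n)" and g="\<lambda>n. 2 powr \<bar>q\<bar> * (2 powr (- real n)) powr q"])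
    show "2 powr - e < 1" using e by (simp add: powr_minus inverse_less_1_iff)
    fix y assume y: "y \<noteq> c" "ennreal (norm (c - y) powr q) * indicator (ball c 1) y \<noteq> 0"
    define t where "t = dist c y"
    have t: "0 < t" "t < 1" using y by (auto simp: t_def split: split_indicator_asm)
    \<comment> \<open>Ceiling minus one instead of a floor: the balls are open, so t < 2 powr (-n)
      has to be strict also when t is a power of two.\<close>
    define n where "n = nat (\<lceil>- log 2 t\<rceil> - 1)"
    have l: "0 < - log 2 t" using t by simp
    have n1: "real n < - log 2 t" "- log 2 t \<le> real n + 1"
      using l unfolding n_def by linarith+
    have tl: "t = 2 powr (log 2 t)" using t by simp
    have a: "t < 2 powr (- real n)" using n1(1) by (subst tl) simp
    have b: "2 powr (- real n - 1) \<le> t" using n1(2) le_log_iff[of 2 t "- real n - 1"] t by simp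
    have "t powr q \<le> 2 powr \<bar>q\<bar> * (2 powr (- real n)) powr q"
    proof (cases "0 \<le> q")
      case True
      have "t powr q \<le> (2 powr (- real n)) powr q" using True t a by (intro powr_mono2) auto
      also have "\<dots> \<le> 2 powr \<bar>q\<bar> * (2 powr (- real n)) powr q" by (simp add: ge_one_powr_ge_zero)
      finally show ?thesis .
    next
      case False
      have ex: "(- real n - 1) * q = - q + - real n * q" by (simp add: algebra_simps)
      have "t powr q \<le> (2 powr (- real n - 1)) powr q" using False t b by (intro powr_mono2') auto
      also have "\<dots> = 2 powr \<bar>q\<bar> * (2 powr (- real n)) powr q"
        using False unfolding powr_powr ex powr_add by simp
      finally show ?thesis .
    qed
    then show "\<exists>n. dist c y < 2 powr - real n \<and> ennreal (norm (c - y) powr q) * indicator (ball c 1) y \<le> ennreal (2 powr \<bar>q\<bar> * (2 powr - real n) powr q)"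
      using a by (intro exI[of _ n]) (auto simp: t_def dist_norm ennreal_leI split: split_indicator)
  next
    fix n
    show "2 powr \<bar>q\<bar> * (2 powr - real n) powr q * (2 powr - real n) ^ DIM('a) \<le> 2 powr \<bar>q\<bar> * (2 powr - e) ^ n"
      by (simp add: powr_powr powr_realpow[symmetric] powr_add[symmetric] e_def algebra_simps)
  qed auto
  have "1 - 2 powr (-e) > 0" using e by (simp add: powr_minus inverse_less_1_iff)
  then have "0 < ?C" by (auto intro!: divide_pos_pos mult_pos_pos)
  then show ?thesis using that le by blast
qed

text \<open>Here the dyadic balls grow, with radius 2 powr (n + 1), and the decay beats their volume
  because p > d.\<close>

lemma nn_integral_decay_le:
  assumes p: "real DIM('a) < p"
  obtains C where "0 < C"
    "\<And>c::'a::euclidean_space. (\<integral>\<^sup>+y. ennreal ((1 + norm (c - y)) powr (- p)) \<partial>lborel) \<le> ennreal C"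
proof -
  define e where "e = p - real DIM('a)"
  have e: "0 < e" using p by (simp add: e_def)
  let ?C = "unit_ball_vol (real DIM('a)) * 2 ^ DIM('a) / (1 - 2 powr (-e))"
  have le: "(\<integral>\<^sup>+y. ennreal ((1 + norm (c - y)) powr (- p)) \<partial>lborel) \<le> ennreal ?C" for c :: 'a
  proof (rule nn_integral_dyadic_le[where c=c and r="\<lambda>n. 2 powr (real n + 1)" and g="\<lambda>n. 2 powr (- p * real n)"])
    show "2 powr - e < 1" using e by (simp add: powr_minus inverse_less_1_iff)
    fix y
    define t where "t = 1 + dist c y"
    have t: "1 \<le> t" by (auto simp: t_def)
    define n where "n = nat \<lfloor>log 2 t\<rfloor>"
    have l: "0 \<le> log 2 t" using t by simp
    have n1: "real n \<le> log 2 t" "log 2 t < real n + 1"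
      using l unfolding n_def by linarith+
    have tl: "t = 2 powr (log 2 t)" using t by simp
    have a: "t < 2 powr (real n + 1)" using n1(2) by (subst tl) simp
    have b: "2 powr (real n) \<le> t" using n1(1) le_log_iff[of 2 t "real n"] t by simp
    have "t powr (- p) \<le> (2 powr real n) powr (- p)" using p b by (intro powr_mono2') auto
    then have "t powr (- p) \<le> 2 powr (- p * real n)" by (simp add: powr_powr mult.commute)
    then show "\<exists>n. dist c y < 2 powr (real n + 1) \<and> ennreal ((1 + norm (c - y)) powr (- p)) \<le> ennreal (2 powr (- p * real n))"
      using a by (intro exI[of _ n]) (auto simp: t_def dist_norm ennreal_leI)
  next
    fix n
    have "(2::real) ^ DIM('a) = 2 powr (real DIM('a))" by (simp add: powr_realpow)
    moreover have "(2 powr (real n + 1)) ^ DIM('a) = 2 powr ((real n + 1) * real DIM('a))"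
      by (subst powr_realpow[symmetric]) (auto simp: powr_powr)
    moreover have "(2 powr - e) ^ n = 2 powr (- e * real n)"
      by (subst powr_realpow[symmetric]) (auto simp: powr_powr)
    moreover have "- p * real n + (real n + 1) * real DIM('a) = real DIM('a) + - e * real n"
      by (simp add: e_def algebra_simps)
    ultimately show "2 powr (- p * real n) * (2 powr (real n + 1)) ^ DIM('a) \<le> 2 ^ DIM('a) * (2 powr - e) ^ n"
      by (simp add: powr_add[symmetric])
  qed auto
  have "1 - 2 powr (-e) > 0" using e by (simp add: powr_minus inverse_less_1_iff)
  then have "0 < ?C" by (auto intro!: divide_pos_pos mult_pos_pos)
  then show ?thesis using that le by blast
qed

text \<open>The sequence \<open>M * c ^ j\<close> with \<open>c powr (1 - \<gamma>) = b\<close> and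
  \<open>M powr (1 - \<gamma>) = C * c powr \<gamma>\<close> solves the recursion with equality. The
  quotient Y of \<open>X\<close> by this solution satisfies Y j \<le> Y (j + 1) powr \<gamma> and is
  bounded because b \<le> c, so Y 0 is at most B powr (\<gamma> ^ n), which tends to 1. The a priori
  constant \<open>Cu\<close> disappears in this limit. It may therefore depend on the solution,
  while \<open>M\<close> does not.\<close>

lemma sublinear_iteration:
  fixes C b \<gamma> :: real
  assumes C: "1 \<le> C" and b: "1 \<le> b" and \<gamma>: "0 < \<gamma>" "\<gamma> < 1"
  obtains M where "1 \<le> M"
    "\<And>X Cu. (\<And>j. 1 \<le> X j) \<Longrightarrow> (\<And>j. X j \<le> C * b ^ j * X (Suc j) powr \<gamma>) \<Longrightarrow>
       (\<And>j. X j \<le> Cu * b ^ j) \<Longrightarrow> X 0 \<le> M"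
proof -
  define c where "c = b powr (1 / (1 - \<gamma>))"
  define M where "M = (C * c powr \<gamma>) powr (1 / (1 - \<gamma>))"
  have cb: "c powr (1 - \<gamma>) = b" using b \<gamma> by (simp add: c_def powr_powr)
  have c1: "1 \<le> c" unfolding c_def using b \<gamma> by (intro ge_one_powr_ge_zero) auto
  have "b powr 1 \<le> b powr (1 / (1 - \<gamma>))" using b \<gamma> by (intro powr_mono) (auto simp: field_simps)
  then have bc: "b \<le> c" using b by (simp add: c_def)
  have g1: "1 \<le> C * c powr \<gamma>" using C c1 \<gamma> mult_mono[of 1 C 1 "c powr \<gamma>"] by (simp add: ge_one_powr_ge_zero)
  have M1: "1 \<le> M" unfolding M_def using g1 \<gamma> by (intro ge_one_powr_ge_zero) auto
  have MM: "M powr (1 - \<gamma>) = C * c powr \<gamma>" using g1 \<gamma> by (simp add: M_def powr_powr)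
  have "X 0 \<le> M" if X1: "\<And>j. 1 \<le> X j" and rec: "\<And>j. X j \<le> C * b ^ j * X (Suc j) powr \<gamma>"
    and bd: "\<And>j. X j \<le> Cu * b ^ j" for X Cu
  proof -
    define Y where "Y j = X j / (M * c ^ j)" for j
    have pos: "0 < M * c ^ j" for j using M1 c1 by simp
    have Ypos: "0 < Y j" for j unfolding Y_def using pos X1[of j] by (intro divide_pos_pos) auto
    have XY: "X j = M * c ^ j * Y j" for j using pos[of j] M1 c1 by (simp add: Y_def)
    have step: "Y j \<le> Y (Suc j) powr \<gamma>" for j
    proof -
      have "X (Suc j) powr \<gamma> = M powr \<gamma> * (c powr \<gamma>) * (c ^ j) powr \<gamma> * Y (Suc j) powr \<gamma>"
        unfolding XY using M1 c1 Ypos[of "Suc j"] by (simp add: powr_mult)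
      moreover have "b ^ j = (c ^ j) powr (1 - \<gamma>)"
        using c1 by (simp add: cb[symmetric] powr_realpow[symmetric] powr_powr mult.commute)
      ultimately have "X j \<le> C * (c ^ j) powr (1 - \<gamma>) * (M powr \<gamma> * (c powr \<gamma>) * (c ^ j) powr \<gamma> * Y (Suc j) powr \<gamma>)"
        using rec[of j] by simp
      also have "\<dots> = (C * c powr \<gamma>) * M powr \<gamma> * ((c ^ j) powr (1 - \<gamma>) * (c ^ j) powr \<gamma>) * Y (Suc j) powr \<gamma>"
        by simp
      also have "\<dots> = M * c ^ j * Y (Suc j) powr \<gamma>"
        unfolding MM[symmetric] using M1 c1 by (simp add: powr_add[symmetric])
      finally show ?thesis unfolding XY[of j] using pos[of j] by (rule mult_left_le_imp_le)
    qed
    define B where "B = max 1 Cu"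
    have YB: "Y j \<le> B" for j
    proof -
      have "X j \<le> B * c ^ j"
        using bd[of j] b bc by (intro order_trans[OF bd] mult_mono power_mono) (auto simp: B_def)
      also have "\<dots> \<le> B * (M * c ^ j)" using M1 c1 by (intro mult_left_mono) (auto simp: B_def)
      finally show ?thesis unfolding Y_def using pos[of j] by (simp add: divide_le_eq mult.commute)
    qed
    have it: "Y 0 \<le> Y n powr (\<gamma> ^ n)" for n
    proof (induction n)
      case (Suc n)
      have "Y 0 \<le> Y n powr (\<gamma> ^ n)" by fact
      also have "\<dots> \<le> (Y (Suc n) powr \<gamma>) powr (\<gamma> ^ n)" using step Ypos[of n] \<gamma> by (intro powr_mono2) auto
      finally show ?case by (simp add: powr_powr)
    qed (use Ypos in simp)
    have it2: "Y 0 \<le> B powr (\<gamma> ^ n)" for n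
      using it[of n] powr_mono2[of "\<gamma> ^ n" "Y n" B] YB[of n] Ypos[of n] \<gamma> by auto
    have B0: "B \<noteq> 0" by (simp add: B_def)
    have "(\<lambda>n. B powr (\<gamma> ^ n)) \<longlonglongrightarrow> B powr 0"
      using \<gamma> B0 by (intro tendsto_intros LIMSEQ_realpow_zero) auto
    then have "Y 0 \<le> B powr 0" using it2 by (intro LIMSEQ_le_const) auto
    then have "Y 0 \<le> 1" using B0 by simp
    then show ?thesis unfolding XY using M1 by simp
  qed
  then show ?thesis using that M1 by blast
qed

section \<open>Truncations\<close>

text \<open>The function \<open>trunc \<alpha>\<close> is the derivative of \<open>trunc_prim \<alpha>\<close>; \<open>\<alpha> * trunc_form \<alpha> a b\<close> is at most
  \<open>(a - b) * (trunc \<alpha> a - trunc \<alpha> b)\<close>, and \<open>trunc_form \<alpha> a b\<close> dominates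
  \<open>(trunc_root \<alpha> a - trunc_root \<alpha> b)\<^sup>2\<close>.\<close>

definition trunc :: "real \<Rightarrow> real \<Rightarrow> real" where
  "trunc \<alpha> u = 1 - (1 + u) powr (- \<alpha>)"

definition trunc_prim :: "real \<Rightarrow> real \<Rightarrow> real" where
  "trunc_prim \<alpha> u = u - ((1 + u) powr (1 - \<alpha>) - 1) / (1 - \<alpha>)"

definition trunc_root :: "real \<Rightarrow> real \<Rightarrow> real" where
  "trunc_root \<alpha> u = (1 + u) powr ((1 - \<alpha>) / 2)"

definition trunc_form :: "real \<Rightarrow> real \<Rightarrow> real \<Rightarrow> real" where
  "trunc_form \<alpha> a b = (a - b)\<^sup>2 * (1 + max a b) powr (- 1 - \<alpha>)"

lemma trunc_measurable [measurable]: "trunc \<alpha> \<in> borel_measurable borel"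
  unfolding trunc_def by measurable

lemma trunc_prim_measurable [measurable]: "trunc_prim \<alpha> \<in> borel_measurable borel"
  unfolding trunc_prim_def by measurable

lemma trunc_root_measurable [measurable]: "trunc_root \<alpha> \<in> borel_measurable borel"
  unfolding trunc_root_def by measurable

lemma trunc_form_measurable [measurable]:
  assumes [measurable]: "f \<in> borel_measurable M" "g \<in> borel_measurable M"
  shows "(\<lambda>x. trunc_form \<alpha> (f x) (g x)) \<in> borel_measurable M"
  unfolding trunc_form_def by measurable

context
  fixes \<alpha> :: real
  assumes \<alpha>: "0 < \<alpha>" "\<alpha> < 1"
begin

lemma trunc_0 [simp]: "trunc \<alpha> 0 = 0" by (simp add: trunc_def)

lemma trunc_mono: "0 \<le> a \<Longrightarrow> a \<le> b \<Longrightarrow> trunc \<alpha> a \<le> trunc \<alpha> b"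
  unfolding trunc_def using \<alpha> by (simp add: powr_mono2')

lemma trunc_nonneg: "0 \<le> a \<Longrightarrow> 0 \<le> trunc \<alpha> a"
  using trunc_mono[of 0 a] by simp

lemma trunc_le_1: "trunc \<alpha> a \<le> 1"
  unfolding trunc_def by simp

lemma trunc_MVT:
  assumes "0 \<le> a" "a < b"
  obtains z where "a < z" "z < b" "trunc \<alpha> b - trunc \<alpha> a = (b - a) * (\<alpha> * (1 + z) powr (- 1 - \<alpha>))"
proof -
  have "\<exists>z. a < z \<and> z < b \<and> trunc \<alpha> b - trunc \<alpha> a = (b - a) * (\<alpha> * (1 + z) powr (- 1 - \<alpha>))"
    unfolding trunc_def
  proof (rule MVT2[OF assms(2)])
    fix x assume "a \<le> x" "x \<le> b"
    then have "0 < 1 + x" using assms by simp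
    then show "((\<lambda>u. 1 - (1 + u) powr - \<alpha>) has_real_derivative \<alpha> * (1 + x) powr (- 1 - \<alpha>)) (at x)"
      by (auto intro!: derivative_eq_intros simp: minus_diff_commute)
  qed
  then show ?thesis using that by blast
qed

lemma trunc_lipschitz:
  assumes "0 \<le> a" "0 \<le> b"
  shows "\<bar>trunc \<alpha> a - trunc \<alpha> b\<bar> \<le> \<bar>a - b\<bar>"
proof -
  have "\<bar>trunc \<alpha> a - trunc \<alpha> b\<bar> \<le> \<bar>a - b\<bar>" if ab: "0 \<le> a" "a < b" for a b
  proof -
    obtain z where z: "a < z" "z < b" "trunc \<alpha> b - trunc \<alpha> a = (b - a) * (\<alpha> * (1 + z) powr (- 1 - \<alpha>))"
      using trunc_MVT ab by blast
    have "(1 + z) powr (- 1 - \<alpha>) \<le> 1 powr (- 1 - \<alpha>)" using z ab \<alpha> by (intro powr_mono2') auto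
    then have "\<alpha> * (1 + z) powr (- 1 - \<alpha>) \<le> 1" using \<alpha> mult_mono[of \<alpha> 1 "(1 + z) powr (- 1 - \<alpha>)" 1] by simp
    then have "(b - a) * (\<alpha> * (1 + z) powr (- 1 - \<alpha>)) \<le> (b - a) * 1" using ab by (intro mult_left_mono) auto
    then show ?thesis using z trunc_mono[of a b] ab by simp
  qed
  from this[of a b] this[of b a] assms show ?thesis by (cases a b rule: linorder_cases) (auto simp: abs_minus_commute)
qed

text \<open>The derivative of \<open>trunc \<alpha>\<close> decreases, so at the intermediate point
  of the mean value theorem it is at least its value at the larger of the two arguments.\<close>

lemma trunc_form_le:
  assumes "0 \<le> a" "0 \<le> b"
  shows "\<alpha> * trunc_form \<alpha> a b \<le> (a - b) * (trunc \<alpha> a - trunc \<alpha> b)"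
proof -
  have *: "\<alpha> * trunc_form \<alpha> a b \<le> (b - a) * (trunc \<alpha> b - trunc \<alpha> a)" if ab: "0 \<le> a" "a < b" for a b
  proof -
    obtain z where z: "a < z" "z < b" "trunc \<alpha> b - trunc \<alpha> a = (b - a) * (\<alpha> * (1 + z) powr (- 1 - \<alpha>))"
      using trunc_MVT ab by blast
    have "(1 + b) powr (- 1 - \<alpha>) \<le> (1 + z) powr (- 1 - \<alpha>)" using z ab \<alpha> by (intro powr_mono2') auto
    then have "\<alpha> * (b - a)\<^sup>2 * (1 + b) powr (- 1 - \<alpha>) \<le> \<alpha> * (b - a)\<^sup>2 * (1 + z) powr (- 1 - \<alpha>)"
      using \<alpha> by (intro mult_left_mono) auto
    then show ?thesis unfolding trunc_form_def z(3) using ab by (simp add: power2_eq_square max_def algebra_simps)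
  qed
  show ?thesis
  proof (cases a b rule: linorder_cases)
    case less
    then show ?thesis using *[of a b] assms by (simp add: algebra_simps)
  next
    case greater
    then show ?thesis using *[of b a] assms by (simp add: trunc_form_def max.commute power2_commute)
  qed (simp add: trunc_form_def)
qed

lemma trunc_form_nonneg: "0 \<le> trunc_form \<alpha> a b" by (simp add: trunc_form_def)

text \<open>For B \<le> A and \<beta> \<le> 1 one has B/A \<le> (B/A) powr \<beta>, which gives A
  powr \<beta> - B powr \<beta> \<le> (A - B) * A powr (\<beta> - 1). With \<beta> = (1 -
  \<alpha>)/2 the square of the last power has exponent -1 - \<alpha>, that of
  \<open>trunc_form\<close>.\<close>

lemma trunc_root_diff_le:
  assumes "0 \<le> a" "0 \<le> b"
  shows "(trunc_root \<alpha> a - trunc_root \<alpha> b)\<^sup>2 \<le> trunc_form \<alpha> a b"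
proof -
  have *: "(trunc_root \<alpha> a - trunc_root \<alpha> b)\<^sup>2 \<le> trunc_form \<alpha> a b" if ab: "0 \<le> b" "b \<le> a" for a b
  proof -
    define \<beta> where "\<beta> = (1 - \<alpha>) / 2"
    have \<beta>: "0 < \<beta>" "\<beta> \<le> 1" using \<alpha> by (auto simp: \<beta>_def)
    define A where "A = 1 + a"
    define B where "B = 1 + b"
    have AB: "1 \<le> B" "B \<le> A" "1 \<le> A" using ab by (auto simp: A_def B_def)
    have le: "B powr \<beta> \<le> A powr \<beta>" using AB \<beta> by (intro powr_mono2) auto
    have "(B / A) powr 1 \<le> (B / A) powr \<beta>"
      using AB \<beta> by (intro powr_mono') auto
    then have "B / A * A powr \<beta> \<le> (B / A) powr \<beta> * A powr \<beta>" using AB by (intro mult_right_mono) auto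
    also have "\<dots> = B powr \<beta>" using AB by (simp add: powr_divide)
    finally have "A powr \<beta> - B powr \<beta> \<le> (A - B) * (A powr \<beta> / A)" using AB by (simp add: field_simps)
    then have "(A powr \<beta> - B powr \<beta>)\<^sup>2 \<le> ((A - B) * (A powr \<beta> / A))\<^sup>2"
      using le by (intro power_mono) auto
    also have "\<dots> = (A - B)\<^sup>2 * A powr (- 1 - \<alpha>)"
    proof -
      have e: "(- 1 - \<alpha>) = (\<beta> - 1) * real 2" by (simp add: \<beta>_def field_simps)
      have "A powr (- 1 - \<alpha>) = (A powr (\<beta> - 1))\<^sup>2"
        unfolding e powr_powr[symmetric] using AB by (subst powr_realpow) auto
      also have "A powr (\<beta> - 1) = A powr \<beta> / A" using AB by (simp add: powr_diff)
      finally have "A powr (- 1 - \<alpha>) = (A powr \<beta> / A)\<^sup>2" .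
      then show ?thesis by (simp only: power_mult_distrib)
    qed
    finally show ?thesis
      using ab by (simp add: trunc_form_def trunc_root_def A_def B_def \<beta>_def max_def)
  qed
  show ?thesis
  proof (cases "b \<le> a")
    case False
    then show ?thesis using *[of a b] assms by (simp add: trunc_form_def max.commute power2_commute)
  qed (use * assms in auto)
qed

text \<open>The tangent inequality of a convex function, with the slope taken at \<open>b\<close>:
  in the application \<open>b\<close> is the value at the later time, where the test function is
  frozen.\<close>

lemma trunc_prim_convex:
  assumes "0 \<le> a" "0 \<le> b"
  shows "trunc_prim \<alpha> b - trunc_prim \<alpha> a \<le> trunc \<alpha> b * (b - a)"
proof -
  have *: "\<exists>z. a < z \<and> z < b \<and> trunc_prim \<alpha> b - trunc_prim \<alpha> a = (b - a) * trunc \<alpha> z" if ab: "0 \<le> a" "a < b" for a b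
    unfolding trunc_prim_def
  proof (rule MVT2[OF ab(2)])
    fix x assume "a \<le> x" "x \<le> b"
    then have "0 < 1 + x" using ab by simp
    then show "((\<lambda>u. u - ((1 + u) powr (1 - \<alpha>) - 1) / (1 - \<alpha>)) has_real_derivative trunc \<alpha> x) (at x)"
      using \<alpha> by (auto intro!: derivative_eq_intros simp: trunc_def)
  qed
  show ?thesis
  proof (cases a b rule: linorder_cases)
    case less
    then obtain z where z: "a < z" "z < b" "trunc_prim \<alpha> b - trunc_prim \<alpha> a = (b - a) * trunc \<alpha> z"
      using * assms by blast
    then show ?thesis using trunc_mono[of z b] assms less by (simp add: mult.commute mult_right_mono)
  next
    case greater
    then obtain z where z: "b < z" "z < a" "trunc_prim \<alpha> a - trunc_prim \<alpha> b = (a - b) * trunc \<alpha> z"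
      using * assms by blast
    have "(a - b) * trunc \<alpha> b \<le> (a - b) * trunc \<alpha> z" using trunc_mono[of b z] z assms greater by (intro mult_left_mono) auto
    then show ?thesis using z(3) by (simp add: algebra_simps)
  qed simp
qed

lemma trunc_prim_lipschitz:
  assumes "0 \<le> a" "0 \<le> b"
  shows "\<bar>trunc_prim \<alpha> a - trunc_prim \<alpha> b\<bar> \<le> \<bar>a - b\<bar>"
proof -
  have *: "trunc_prim \<alpha> b - trunc_prim \<alpha> a \<le> \<bar>a - b\<bar>" if "0 \<le> a" "0 \<le> b" for a b
  proof -
    have "trunc \<alpha> b * (b - a) \<le> 1 * \<bar>a - b\<bar>"
      using that trunc_nonneg[of b] trunc_le_1[of b] abs_ge_self[of "b - a"]
      by (metis abs_ge_zero abs_minus_commute mult_left_mono mult_right_mono order_trans)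
    then show ?thesis using trunc_prim_convex[OF that] by simp
  qed
  show ?thesis using *[of a b] *[of b a] assms by (simp add: abs_minus_commute abs_le_iff)
qed

lemma trunc_prim_nonneg: "0 \<le> u \<Longrightarrow> 0 \<le> trunc_prim \<alpha> u"
  using trunc_prim_convex[of u 0] by (simp add: trunc_prim_def)

lemma trunc_prim_le: "0 \<le> u \<Longrightarrow> trunc_prim \<alpha> u \<le> u"
  using trunc_prim_lipschitz[of u 0] by (simp add: trunc_prim_def)

lemma trunc_root_lipschitz:
  assumes "0 \<le> a" "0 \<le> b"
  shows "(trunc_root \<alpha> a - trunc_root \<alpha> b)\<^sup>2 \<le> (a - b)\<^sup>2"
proof -
  have "(1 + max a b) powr (- 1 - \<alpha>) \<le> 1 powr (- 1 - \<alpha>)" using assms \<alpha> by (intro powr_mono2') auto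
  then have "trunc_form \<alpha> a b \<le> (a - b)\<^sup>2 * 1" unfolding trunc_form_def by (intro mult_left_mono) auto
  then show ?thesis using trunc_root_diff_le[OF assms] by simp
qed

lemma trunc_root_le: "0 \<le> a \<Longrightarrow> (trunc_root \<alpha> a)\<^sup>2 \<le> 1 + a"
proof -
  assume a: "0 \<le> a"
  have "(trunc_root \<alpha> a)\<^sup>2 = (1 + a) powr (1 - \<alpha>)"
    using a by (simp add: trunc_root_def power2_eq_square powr_add[symmetric])
  also have "\<dots> \<le> (1 + a) powr 1" using a \<alpha> by (intro powr_mono) auto
  finally show ?thesis using a by simp
qed

text \<open>Cauchy--Schwarz with the weight \<open>1 + max a b\<close>, which is chosen so that the first factor is
  controlled by the energy of the truncation.\<close>

lemma trunc_form_young: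
  assumes "0 \<le> a" "0 \<le> b" "0 \<le> x" "0 \<le> y"
  shows "\<bar>a - b\<bar> * \<bar>x\<^sup>2 - y\<^sup>2\<bar> \<le> \<alpha> / 4 * (trunc_form \<alpha> a b * ((x\<^sup>2 + y\<^sup>2) / 2))
    + 4 / \<alpha> * ((x - y)\<^sup>2 * (1 + max a b) powr (1 + \<alpha>))"
proof -
  define m where "m = 1 + max a b"
  have m: "0 < m" using assms by (simp add: m_def)
  define P where "P = \<bar>a - b\<bar> * m powr ((- 1 - \<alpha>) / 2) * (x + y)"
  define R where "R = \<bar>x - y\<bar> * m powr ((1 + \<alpha>) / 2)"
  have PR: "P * R = \<bar>a - b\<bar> * \<bar>x\<^sup>2 - y\<^sup>2\<bar>"
  proof -
    have "m powr ((- 1 - \<alpha>) / 2) * m powr ((1 + \<alpha>) / 2) = m powr 0"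
      by (subst powr_add[symmetric]) (simp add: field_simps)
    moreover have "\<bar>x\<^sup>2 - y\<^sup>2\<bar> = \<bar>x - y\<bar> * (x + y)"
      using assms by (simp add: power2_eq_square square_diff_square_factored abs_mult mult.commute)
    ultimately show ?thesis using m unfolding P_def R_def by (simp add: algebra_simps)
  qed
  have P2: "P\<^sup>2 = trunc_form \<alpha> a b * (x + y)\<^sup>2"
    unfolding P_def trunc_form_def m_def[symmetric] using m
    by (simp add: power_mult_distrib powr_power diff_divide_distrib)
  have R2: "R\<^sup>2 = (x - y)\<^sup>2 * m powr (1 + \<alpha>)"
    unfolding R_def using m by (simp add: power_mult_distrib powr_power add_divide_distrib)
  have xy: "(x + y)\<^sup>2 \<le> 2 * (x\<^sup>2 + y\<^sup>2)"
    using sum_squares_bound[of x y] by (simp add: power2_sum)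
  \<comment> \<open>The weights are set so that the dissipation enters the final bound with the
    factor \<alpha>/4, small enough to be absorbed later. The factor 4 between \<alpha>/16 and
    \<alpha>/4 comes from replacing (x + y)^2 by four times the mean of the squares.\<close>
  have "0 \<le> (\<alpha> / 4 * P - 2 * R)\<^sup>2" by simp
  then have "\<alpha> * (P * R) \<le> \<alpha>\<^sup>2 / 16 * P\<^sup>2 + 4 * R\<^sup>2" by (simp add: power2_eq_square algebra_simps)
  then have "P * R \<le> \<alpha> / 16 * P\<^sup>2 + 4 / \<alpha> * R\<^sup>2" using \<alpha> by (simp add: field_simps power2_eq_square)
  also have "\<alpha> / 16 * P\<^sup>2 \<le> \<alpha> / 16 * (trunc_form \<alpha> a b * (2 * (x\<^sup>2 + y\<^sup>2)))"
    unfolding P2 using xy \<alpha> trunc_form_nonneg by (intro mult_left_mono) auto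
  also have "\<alpha> / 16 * (trunc_form \<alpha> a b * (2 * (x\<^sup>2 + y\<^sup>2))) = \<alpha> / 4 * (trunc_form \<alpha> a b * ((x\<^sup>2 + y\<^sup>2) / 2))"
    by (simp add: field_simps)
  finally show ?thesis unfolding PR R2 m_def by simp
qed

text \<open>For a \<ge> 1 and b \<le> a/2 the ratio of 1 + b to 1 + a is at most 3/4, so the two
  roots differ by a fixed fraction of the larger one.\<close>

lemma trunc_root_gap:
  assumes "1 \<le> a" "0 \<le> b" "b \<le> a / 2"
  shows "(1 - (3/4) powr ((1 - \<alpha>) / 2))\<^sup>2 * (1 + a) powr (1 - \<alpha>) \<le> (trunc_root \<alpha> a - trunc_root \<alpha> b)\<^sup>2"
proof -
  let ?\<beta> = "(1 - \<alpha>) / 2"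
  have \<beta>: "0 < ?\<beta>" using \<alpha> by simp
  have "trunc_root \<alpha> b \<le> (3/4 * (1 + a)) powr ?\<beta>"
    unfolding trunc_root_def using assms \<beta> by (intro powr_mono2) auto
  also have "\<dots> = (3/4) powr ?\<beta> * trunc_root \<alpha> a"
    unfolding trunc_root_def using assms by (subst powr_mult) auto
  finally have le: "(1 - (3/4) powr ?\<beta>) * trunc_root \<alpha> a \<le> trunc_root \<alpha> a - trunc_root \<alpha> b"
    by (simp add: algebra_simps)
  have "(3/4) powr ?\<beta> \<le> (1::real)" using \<beta> by (simp add: powr_le1)
  then have "((1 - (3/4) powr ?\<beta>) * trunc_root \<alpha> a)\<^sup>2 \<le> (trunc_root \<alpha> a - trunc_root \<alpha> b)\<^sup>2"
    using le by (intro power_mono mult_nonneg_nonneg) (auto simp: trunc_root_def)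
  moreover have "(trunc_root \<alpha> a)\<^sup>2 = (1 + a) powr (1 - \<alpha>)"
    using assms by (simp add: trunc_root_def power2_eq_square powr_add[symmetric])
  ultimately show ?thesis by (simp add: power_mult_distrib)
qed

text \<open>On a ball around \<open>x\<close> whose volume is \<open>4 m / U x\<close>, the function \<open>U\<close> is at most \<open>U x / 2\<close> on
  at least half of the ball, by Markov's inequality.\<close>

lemma trunc_root_sobolev_pointwise:
  fixes U :: "'a::euclidean_space \<Rightarrow> real" and x :: 'a
  defines "d \<equiv> real DIM('a)" and "w \<equiv> unit_ball_vol (real DIM('a))"
  assumes U[measurable]: "U \<in> borel_measurable borel" and U0: "\<And>y. 0 \<le> U y"
    and s: "0 < s" and m: "0 < m" and \<rho>: "0 < \<rho>" and Ux: "1 \<le> U x"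
    and mass: "(\<integral>\<^sup>+y. ennreal (U y) * indicator (ball x \<rho>) y \<partial>lborel) \<le> ennreal m"
    and rad: "4 * m \<le> w * \<rho> ^ DIM('a) * U x"
  shows "ennreal ((1 - (3/4) powr ((1 - \<alpha>) / 2))\<^sup>2 * (w / 2) * (w / 4) powr (2 * s / d)
      * ((1 + U x) powr (1 - \<alpha>) * (U x / m) powr (2 * s / d)))
    \<le> (\<integral>\<^sup>+y. ennreal ((trunc_root \<alpha> (U x) - trunc_root \<alpha> (U y))\<^sup>2 * norm (x - y) powr (- (d + 2 * s)))
        * indicator (ball x \<rho>) y \<partial>lborel)"
proof -
  have d: "0 < d" by (simp add: d_def)
  have w: "0 < w" by (simp add: w_def)
  define q where "q = 4 * m / (w * U x)"
  have q: "0 < q" using m w Ux by (simp add: q_def)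
  define r where "r = q powr (1 / d)"
  have r: "0 < r" using q by (simp add: r_def)
  have rd: "r ^ DIM('a) = q" using q d by (simp add: r_def powr_realpow[symmetric] powr_powr d_def)
  have "q \<le> \<rho> ^ DIM('a)" using rad w Ux by (simp add: q_def field_simps)
  then have r\<rho>: "r \<le> \<rho>" using rd r \<rho> by (metis power_mono_iff DIM_positive less_imp_le)
  let ?E = "{y \<in> ball x r. U y \<le> U x / 2}" and ?E' = "{y \<in> ball x r. 1 \<le> ennreal (2 / U x) * ennreal (U y)}"
  have "emeasure lborel ?E' \<le> ennreal (2 / U x) * (\<integral>\<^sup>+y. ennreal (U y) * indicator (ball x r) y \<partial>lborel)"
    by (rule nn_integral_Markov_inequality) auto
  also have "\<dots> \<le> ennreal (2 / U x) * ennreal m"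
    using r\<rho> by (intro mult_left_mono order_trans[OF nn_integral_mono mass]) (auto split: split_indicator)
  also have "\<dots> = ennreal (2 * m / U x)" using Ux m by (simp add: ennreal_mult[symmetric])
  finally have E': "emeasure lborel ?E' \<le> ennreal (2 * m / U x)" .
  have [measurable]: "?E \<in> sets borel" "?E' \<in> sets borel" by measurable
  have "ennreal (4 * m / U x) = emeasure lborel (ball x r)"
    using r w Ux rd by (simp add: emeasure_ball w_def[symmetric] q_def)
  also have "ball x r = ?E \<union> ?E'"
    using Ux U0 by (auto simp: ennreal_mult[symmetric] field_simps ennreal_1[symmetric] simp del: ennreal_1)
  also have "emeasure lborel (?E \<union> ?E') \<le> emeasure lborel ?E + emeasure lborel ?E'"
    by (rule emeasure_subadditive) auto
  also have "\<dots> \<le> emeasure lborel ?E + ennreal (2 * m / U x)" by (intro add_left_mono E')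
  finally have "ennreal (4 * m / U x) - ennreal (2 * m / U x) \<le> emeasure lborel ?E"
    by (simp add: ennreal_minus_le_iff add.commute)
  then have E: "ennreal (2 * m / U x) \<le> emeasure lborel ?E"
    using Ux m by (simp add: ennreal_minus field_simps)
  \<comment> \<open>A lower bound of the integrand on \<open>?E\<close>, from
    \<open>trunc_root_gap\<close> and |x - y| < r. Since r ^ d = q, the power of \<open>r\<close>
    contains one full factor proportional to U x / m. That factor cancels against the measure 2 m /
    U x of the good set, and the exponent 2 s / d remains.\<close>
  define k where "k = (1 - (3/4) powr ((1 - \<alpha>) / 2))\<^sup>2 * (1 + U x) powr (1 - \<alpha>) * r powr (- (d + 2 * s))"
  have k: "0 \<le> k" by (simp add: k_def)
  have "r powr (- (d + 2 * s)) = q powr (- (1 + 2 * s / d))"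
    using d by (simp add: r_def powr_powr) (simp add: add_divide_distrib diff_divide_distrib)
  also have "\<dots> = (w / 4 * (U x / m)) powr (1 + 2 * s / d)"
  proof -
    have "q = 1 / (w / 4 * (U x / m))" using m w Ux by (simp add: q_def field_simps)
    moreover have "0 < w / 4 * (U x / m)" using m w Ux by simp
    moreover have "(1 / z) powr (- e) = z powr e" if "0 < z" for z e :: real
      using that by (simp add: powr_minus_divide powr_divide)
    ultimately show ?thesis by metis
  qed
  also have "\<dots> = (w / 4 * (U x / m)) * ((w / 4) powr (2 * s / d) * (U x / m) powr (2 * s / d))"
    using m w Ux by (simp add: powr_add powr_mult powr_divide)
  finally have rp: "r powr (- (d + 2 * s)) = (w / 4 * (U x / m)) * ((w / 4) powr (2 * s / d) * (U x / m) powr (2 * s / d))" .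
  have "(1 - (3/4) powr ((1 - \<alpha>) / 2))\<^sup>2 * (w / 2) * (w / 4) powr (2 * s / d)
      * ((1 + U x) powr (1 - \<alpha>) * (U x / m) powr (2 * s / d)) = k * (2 * m / U x)"
    unfolding k_def rp using m Ux by (simp add: field_simps)
  also have "ennreal \<dots> = ennreal k * ennreal (2 * m / U x)" using k m Ux by (intro ennreal_mult) auto
  also have "\<dots> \<le> ennreal k * emeasure lborel ?E" by (intro mult_left_mono E) auto
  also have "\<dots> = (\<integral>\<^sup>+y. ennreal k * indicator ?E y \<partial>lborel)"
    by (subst nn_integral_cmult_indicator) auto
  also have "\<dots> \<le> (\<integral>\<^sup>+y. ennreal ((trunc_root \<alpha> (U x) - trunc_root \<alpha> (U y))\<^sup>2 * norm (x - y) powr (- (d + 2 * s)))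
        * indicator (ball x \<rho>) y \<partial>lborel)"
  proof (rule nn_integral_mono)
    fix y
    show "ennreal k * indicator ?E y \<le> ennreal ((trunc_root \<alpha> (U x) - trunc_root \<alpha> (U y))\<^sup>2 * norm (x - y) powr (- (d + 2 * s)))
        * indicator (ball x \<rho>) y"
    proof (cases "y \<in> ?E")
      case True
      then have "y \<noteq> x" using Ux by auto
      then have n: "0 < norm (x - y)" "norm (x - y) < r" using True by (auto simp: dist_norm)
      have "k \<le> (trunc_root \<alpha> (U x) - trunc_root \<alpha> (U y))\<^sup>2 * norm (x - y) powr (- (d + 2 * s))"
        unfolding k_def using n d s True U0 Ux by (intro mult_mono trunc_root_gap powr_mono2') auto
      then show ?thesis using True r\<rho> by (simp add: ennreal_leI)
    qed simp
  qed
  finally show ?thesis .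
qed

end

section \<open>Projections, signed integrals and the tail of the kernel\<close>

lemma measurable_fst_borel [measurable]:
  "fst \<in> borel_measurable (borel :: ('a::second_countable_topology \<times> 'b::second_countable_topology) measure)"
  by (simp add: borel_prod[symmetric])

lemma measurable_snd_borel [measurable]:
  "snd \<in> borel_measurable (borel :: ('a::second_countable_topology \<times> 'b::second_countable_topology) measure)"
  by (simp add: borel_prod[symmetric])

lemma measurable_fst_lborel [measurable]:
  "fst \<in> borel_measurable (lborel :: ('a::euclidean_space \<times> 'b::euclidean_space) measure)"
  by simp

lemma measurable_snd_lborel [measurable]:
  "snd \<in> borel_measurable (lborel :: ('a::euclidean_space \<times> 'b::euclidean_space) measure)"
  by simp

text \<open>If \<open>f\<close> is not integrable, its Bochner integral is 0 and the bound is
  trivial.\<close>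

lemma ennreal_integral_le: "ennreal (\<integral>x. f x \<partial>M) \<le> (\<integral>\<^sup>+x. ennreal (f x) \<partial>M)"
proof (cases "integrable M f")
  case True
  have "ennreal (\<integral>x. f x \<partial>M) \<le> ennreal (\<integral>x. max 0 (f x) \<partial>M)"
    using True by (intro ennreal_leI integral_mono) auto
  also have "\<dots> = (\<integral>\<^sup>+x. ennreal (max 0 (f x)) \<partial>M)"
    using True by (intro nn_integral_eq_integral[symmetric]) auto
  also have "\<dots> = (\<integral>\<^sup>+x. ennreal (f x) \<partial>M)"
    by (intro nn_integral_cong) (simp add: max_def ennreal_neg)
  finally show ?thesis .
qed (simp add: not_integrable_integral_eq)

text \<open>A device for leaving signed integrals. The flux \<open>X\<close> has a sign-changing
  density and is known only through the inequality for its integral, whereas the error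
  \<open>E\<close> may have infinite integral, in which case nothing is claimed. The result contains
  no subtraction and can be used in \<open>ennreal\<close>.\<close>

lemma nn_integral_le_add_integral:
  fixes X E :: "'b \<Rightarrow> real"
  assumes X: "integrable M X" and E: "E \<in> borel_measurable M" "\<And>x. 0 \<le> E x"
    and le: "\<And>x. g x \<le> ennreal (E x + X x)" "\<And>x. 0 \<le> E x + X x"
    and AB: "(\<integral>x. X x \<partial>M) \<le> A - B" and "0 \<le> A" "0 \<le> B"
  shows "(\<integral>\<^sup>+x. g x \<partial>M) + ennreal B \<le> (\<integral>\<^sup>+x. ennreal (E x) \<partial>M) + ennreal A"
proof (cases "(\<integral>\<^sup>+x. ennreal (E x) \<partial>M) = \<infinity>")
  case False
  then have iE: "integrable M E"
    using E by (intro integrableI_nonneg) (auto simp: less_top[symmetric])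
  have "(\<integral>\<^sup>+x. g x \<partial>M) + ennreal B \<le> (\<integral>\<^sup>+x. ennreal (E x + X x) \<partial>M) + ennreal B"
    by (intro add_right_mono nn_integral_mono le)
  also have "(\<integral>\<^sup>+x. ennreal (E x + X x) \<partial>M) = ennreal ((\<integral>x. E x \<partial>M) + (\<integral>x. X x \<partial>M))"
    using iE X le by (subst nn_integral_eq_integral) auto
  also have "\<dots> + ennreal B = ennreal ((\<integral>x. E x \<partial>M) + (\<integral>x. X x \<partial>M) + B)"
  proof (rule ennreal_plus[symmetric])
    have "0 \<le> (\<integral>x. E x + X x \<partial>M)" using le by (intro Bochner_Integration.integral_nonneg) auto
    then show "0 \<le> (\<integral>x. E x \<partial>M) + (\<integral>x. X x \<partial>M)" using iE X by simp
  qed fact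
  also have "\<dots> \<le> ennreal ((\<integral>x. E x \<partial>M) + A)" using AB by (intro ennreal_leI) auto
  also have "\<dots> = (\<integral>\<^sup>+x. ennreal (E x) \<partial>M) + ennreal A"
    using iE E assms by (subst nn_integral_eq_integral) (auto intro!: ennreal_plus Bochner_Integration.integral_nonneg)
  finally show ?thesis .
qed simp

text \<open>If |x - y| \<ge> \<delta> and y lies in the ball, then 1 + |x - c| is at most (R +
  2)/\<delta> times |x - y|, so the kernel is bounded by the weight at x and y ranges over a set of
  finite volume. If x lies in the ball, the same comparison bounds the kernel by the weight at y,
  which is integrable, while the weight at x is bounded below. The constant is uniform in the
  centre, in \<delta> and in \<open>h\<close>.\<close>

lemma nn_integral_far_le:
  fixes p :: real
  assumes p: "real DIM('a) < p" and R: "0 \<le> R"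
  obtains C where "0 < C"
    "\<And>c \<delta> h. 0 < \<delta> \<Longrightarrow> \<delta> \<le> 1 \<Longrightarrow> h \<in> borel_measurable borel \<Longrightarrow>
      (\<integral>\<^sup>+x. \<integral>\<^sup>+y. h x * ennreal (norm (x - y) powr (-p)) *
         indicator {z. \<delta> \<le> norm (fst z - snd z) \<and> (fst z \<in> ball c R \<or> snd z \<in> ball c R)} (x, y) \<partial>lborel \<partial>lborel)
      \<le> ennreal (C * \<delta> powr (-p)) * (\<integral>\<^sup>+x. h x * ennreal ((1 + norm (x - c)) powr (-p)) \<partial>(lborel::'a::euclidean_space measure))"
proof -
  obtain Cw where Cw: "0 < Cw" "\<And>c::'a. (\<integral>\<^sup>+y. ennreal ((1 + norm (c - y)) powr (- p)) \<partial>lborel) \<le> ennreal Cw"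
    using nn_integral_decay_le[OF p] by blast
  define V where "V = unit_ball_vol (real DIM('a)) * R ^ DIM('a)"
  have V: "0 \<le> V" using R by (simp add: V_def unit_ball_vol_nonneg)
  have p0: "0 < p" using p by (meson DIM_positive less_trans of_nat_0_less_iff)
  define C where "C = (R + 2) powr p * (V + (1 + R) powr p * Cw)"
  have C: "0 < C" unfolding C_def using R V Cw by (intro mult_pos_pos add_nonneg_pos) auto
  have main: "(\<integral>\<^sup>+x. \<integral>\<^sup>+y. h x * ennreal (norm (x - y) powr (-p)) *
         indicator {z. \<delta> \<le> norm (fst z - snd z) \<and> (fst z \<in> ball c R \<or> snd z \<in> ball c R)} (x, y) \<partial>lborel \<partial>lborel)
      \<le> ennreal (C * \<delta> powr (-p)) * (\<integral>\<^sup>+x. h x * ennreal ((1 + norm (x - c)) powr (-p)) \<partial>lborel)"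
    if \<delta>: "0 < \<delta>" "\<delta> \<le> 1" and h[measurable]: "h \<in> borel_measurable borel" for c :: 'a and \<delta> h
  proof -
    define m where "m = ((R + 2) / \<delta>) powr p"
    have m: "0 \<le> m" by (simp add: m_def)
    have key: "norm (x - y) powr (-p) \<le> m * (1 + norm (x - c)) powr (-p)"
      if "\<delta> \<le> norm (x - y)" "y \<in> ball c R" for x y :: 'a
    proof -
      have n: "0 < norm (x - y)" using that \<delta> by linarith
      have "norm (x - c) \<le> norm (x - y) + norm (y - c)"
        using norm_triangle_ineq[of "x - y" "y - c"] by simp
      also have "norm (y - c) \<le> R" using that by (simp add: dist_norm norm_minus_commute)
      finally have "1 + norm (x - c) \<le> (1 + R) * 1 + norm (x - y)" by simp
      also have "\<dots> \<le> (1 + R) * (norm (x - y) / \<delta>) + norm (x - y) / \<delta>"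
        using that \<delta> R n by (intro add_mono mult_left_mono) (auto simp: field_simps)
      also have "\<dots> = (R + 2) / \<delta> * norm (x - y)"
        using \<delta> by (simp add: algebra_simps flip: add_divide_distrib)
      finally have "((R + 2) / \<delta> * norm (x - y)) powr (-p) \<le> (1 + norm (x - c)) powr (-p)"
        using p0 by (intro powr_mono2') (auto simp: add_pos_nonneg)
      then have "m * (((R + 2) / \<delta>) powr (-p) * norm (x - y) powr (-p)) \<le> m * (1 + norm (x - c)) powr (-p)"
        using m by (subst (asm) powr_mult) (use \<delta> R in \<open>auto intro: mult_left_mono\<close>)
      moreover have "m * ((R + 2) / \<delta>) powr (-p) = 1"
        unfolding m_def using \<delta> R by (subst powr_add[symmetric]) simp
      ultimately show ?thesis by (simp add: mult.assoc[symmetric])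
    qed
    let ?I = "\<lambda>x. ennreal ((1 + norm (x - c)) powr (-p))"
    have inner: "(\<integral>\<^sup>+y. h x * ennreal (norm (x - y) powr (-p)) *
         indicator {z. \<delta> \<le> norm (fst z - snd z) \<and> (fst z \<in> ball c R \<or> snd z \<in> ball c R)} (x, y) \<partial>lborel)
         \<le> ennreal (C * \<delta> powr (-p)) * (h x * ?I x)" for x
    proof -
      have "(\<integral>\<^sup>+y. h x * ennreal (norm (x - y) powr (-p)) *
         indicator {z. \<delta> \<le> norm (fst z - snd z) \<and> (fst z \<in> ball c R \<or> snd z \<in> ball c R)} (x, y) \<partial>lborel)
        \<le> (\<integral>\<^sup>+y. h x * (ennreal m * ?I x) * indicator (ball c R) y
             + h x * (ennreal ((1 + R) powr p) * ?I x) * ennreal m * ennreal ((1 + norm (c - y)) powr (-p)) \<partial>lborel)"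
      proof (rule nn_integral_mono)
        fix y
        show "h x * ennreal (norm (x - y) powr (-p)) *
         indicator {z. \<delta> \<le> norm (fst z - snd z) \<and> (fst z \<in> ball c R \<or> snd z \<in> ball c R)} (x, y)
         \<le> h x * (ennreal m * ?I x) * indicator (ball c R) y
             + h x * (ennreal ((1 + R) powr p) * ?I x) * ennreal m * ennreal ((1 + norm (c - y)) powr (-p))"
        proof (cases "\<delta> \<le> norm (x - y) \<and> y \<in> ball c R")
          case True
          have "h x * ennreal (norm (x - y) powr (-p)) \<le> h x * (ennreal m * ?I x)"
            using key[of x y] True m by (intro mult_left_mono) (auto simp: ennreal_mult[symmetric] intro: ennreal_leI)
          also have "\<dots> \<le> h x * (ennreal m * ?I x) * indicator (ball c R) y
             + h x * (ennreal ((1 + R) powr p) * ?I x) * ennreal m * ennreal ((1 + norm (c - y)) powr (-p))"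
            using True by simp
          finally show ?thesis using True by simp
        next
          case F: False
          show ?thesis
          proof (cases "\<delta> \<le> norm (x - y) \<and> x \<in> ball c R")
            case True
            have 1: "norm (x - y) powr (-p) \<le> m * (1 + norm (c - y)) powr (-p)"
              using key[of y x] True by (simp add: norm_minus_commute)
            have "(1 + R) powr (-p) \<le> (1 + norm (x - c)) powr (-p)"
              using True p0 by (intro powr_mono2') (auto simp: dist_norm norm_minus_commute add_pos_nonneg)
            then have "(1 + R) powr p * (1 + R) powr (-p) \<le> (1 + R) powr p * (1 + norm (x - c)) powr (-p)"
              by (intro mult_left_mono) auto
            moreover have "(1 + R) powr p * (1 + R) powr (-p) = 1"
              using R by (subst powr_add[symmetric]) simp
            ultimately have 2: "1 \<le> (1 + R) powr p * (1 + norm (x - c)) powr (-p)" by simp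
            have "1 * norm (x - y) powr (-p) \<le> ((1 + R) powr p * (1 + norm (x - c)) powr (-p)) * (m * (1 + norm (c - y)) powr (-p))"
              using 1 2 by (intro mult_mono) auto
            then have "ennreal (norm (x - y) powr (-p)) \<le> ennreal ((1 + R) powr p) * ?I x * (ennreal m * ennreal ((1 + norm (c - y)) powr (-p)))"
              using m by (simp add: ennreal_mult[symmetric] ennreal_leI)
            then have "h x * ennreal (norm (x - y) powr (-p)) \<le> h x * (ennreal ((1 + R) powr p) * ?I x * (ennreal m * ennreal ((1 + norm (c - y)) powr (-p))))"
              by (intro mult_left_mono) auto
            also have "\<dots> = h x * (ennreal ((1 + R) powr p) * ?I x) * ennreal m * ennreal ((1 + norm (c - y)) powr (-p))"
              by (simp add: mult_ac)
            finally show ?thesis using True by (simp add: add_increasing)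
          qed (use F in auto)
        qed
      qed
      also have "\<dots> = h x * (ennreal m * ?I x) * ennreal V
         + h x * (ennreal ((1 + R) powr p) * ?I x) * ennreal m * (\<integral>\<^sup>+y. ennreal ((1 + norm (c - y)) powr (-p)) \<partial>lborel)"
        using R by (simp add: nn_integral_add nn_integral_cmult nn_integral_cmult_indicator emeasure_ball V_def)
      also have "\<dots> \<le> h x * (ennreal m * ?I x) * ennreal V
         + h x * (ennreal ((1 + R) powr p) * ?I x) * ennreal m * ennreal Cw"
        by (intro add_left_mono mult_left_mono Cw) auto
      also have "\<dots> = (ennreal m * ennreal V + ennreal ((1 + R) powr p) * ennreal m * ennreal Cw) * (h x * ?I x)"
        by (simp add: algebra_simps)
      also have "ennreal m * ennreal V + ennreal ((1 + R) powr p) * ennreal m * ennreal Cw = ennreal (m * V + (1 + R) powr p * m * Cw)"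
        using m V Cw(1) by (simp add: ennreal_mult[symmetric] ennreal_plus[symmetric] del: ennreal_plus)
      also have "m * V + (1 + R) powr p * m * Cw = C * \<delta> powr (-p)"
        using \<delta> R by (simp add: m_def C_def powr_divide powr_minus field_simps)
      finally show ?thesis .
    qed
    have "(\<integral>\<^sup>+x. \<integral>\<^sup>+y. h x * ennreal (norm (x - y) powr (-p)) *
         indicator {z. \<delta> \<le> norm (fst z - snd z) \<and> (fst z \<in> ball c R \<or> snd z \<in> ball c R)} (x, y) \<partial>lborel \<partial>lborel)
        \<le> (\<integral>\<^sup>+x. ennreal (C * \<delta> powr (-p)) * (h x * ?I x) \<partial>lborel)"
      by (intro nn_integral_mono inner)
    also have "\<dots> = ennreal (C * \<delta> powr (-p)) * (\<integral>\<^sup>+x. h x * ?I x \<partial>lborel)"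
      by (rule nn_integral_cmult) measurable
    finally show ?thesis .
  qed
  show ?thesis using that[OF C] main by blast
qed

section \<open>Nonlocal energies and fluxes\<close>

text \<open>Since \<open>p\<close> is a \<open>defines\<close> parameter, it is not an argument of the predicate
  \<open>nonlocal_data\<close>.\<close>

locale nonlocal_data =
  fixes s Lam T :: real
    and u :: "real \<Rightarrow> 'a::euclidean_space \<Rightarrow> real"
    and k :: "real \<Rightarrow> 'a \<Rightarrow> 'a \<Rightarrow> real"
  fixes p :: real
  defines "p \<equiv> real DIM('a) + 2 * s"
  assumes s: "0 < s" "s < 1" and Lam: "0 < Lam"
    and u_meas: "(\<lambda>(t, x). u t x) \<in> borel_measurable borel"
    and k_meas: "(\<lambda>(t, x, y). k t x y) \<in> borel_measurable borel"
    and u_nonneg: "\<And>t x. 0 \<le> u t x"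
    and k_nonneg: "\<And>t x y. 0 \<le> k t x y"
    and k_le: "\<And>t x y. k t x y \<le> Lam * norm (x - y) powr (- p)"
    and u_tail: "(\<integral>\<^sup>+t. (\<integral>\<^sup>+x. ennreal (u t x) * ennreal ((1 + norm x) powr (- p)) \<partial>lborel) * indicator {0<..<T} t \<partial>lborel) < \<infinity>"
    and u_Hs: "\<And>R. 0 < R \<Longrightarrow> (\<integral>\<^sup>+t. (\<integral>\<^sup>+z. ennreal ((u t (fst z) - u t (snd z))\<^sup>2 * norm (fst z - snd z) powr (- p))
        * indicator (ball 0 R \<times> ball 0 R) z \<partial>lborel) * indicator {0<..<T} t \<partial>lborel) < \<infinity>"
begin

lemma d_p: "real DIM('a) < p" "0 < p"
  using s by (auto simp: p_def add_pos_pos)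

lemma u_measurable [measurable (raw)]:
  assumes [measurable]: "f \<in> borel_measurable M" "g \<in> borel_measurable M"
  shows "(\<lambda>x. u (f x) (g x)) \<in> borel_measurable M"
  using measurable_compose[OF _ u_meas, of "\<lambda>x. (f x, g x)" M] by simp

lemma k_measurable [measurable (raw)]:
  assumes [measurable]: "f \<in> borel_measurable M" "g \<in> borel_measurable M" "h \<in> borel_measurable M"
  shows "(\<lambda>x. k (f x) (g x) (h x)) \<in> borel_measurable M"
  using measurable_compose[OF _ k_meas, of "\<lambda>x. (f x, g x, h x)" M] by simp

text \<open>Pairs with no point in the ball belong neither to \<open>near\<close> nor to
  \<open>far\<close>: there a function supported in the ball has zero increment, so these pairs
  never contribute.\<close>

definition near :: "real \<Rightarrow> real \<Rightarrow> ('a \<times> 'a) set" where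
  "near R \<delta> = {z. norm (fst z - snd z) < \<delta> \<and> (fst z \<in> ball 0 R \<or> snd z \<in> ball 0 R)}"

definition far :: "real \<Rightarrow> real \<Rightarrow> ('a \<times> 'a) set" where
  "far R \<delta> = {z. \<delta> \<le> norm (fst z - snd z) \<and> (fst z \<in> ball 0 R \<or> snd z \<in> ball 0 R)}"

lemma near_sets [measurable]: "near R \<delta> \<in> sets borel"
  unfolding near_def by measurable

lemma far_sets [measurable]: "far R \<delta> \<in> sets borel"
  unfolding far_def by measurable

text \<open>The summand |x - y|^2 makes one density dominate the increments of \<open>u\<close>, of
  a Lipschitz cutoff, and of the product of a cutoff with a Lipschitz function of
  \<open>u\<close>.\<close>

definition near_dens :: "real \<Rightarrow> real \<Rightarrow> real \<Rightarrow> 'a \<times> 'a \<Rightarrow> real" where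
  "near_dens R \<delta> t z = ((u t (fst z) - u t (snd z))\<^sup>2 + (norm (fst z - snd z))\<^sup>2) * norm (fst z - snd z) powr (- p)
      * indicator (near R \<delta>) z"

lemma near_dens_measurable [measurable (raw)]:
  assumes [measurable]: "f \<in> borel_measurable M" "g \<in> borel_measurable M"
  shows "(\<lambda>x. near_dens R \<delta> (f x) (g x)) \<in> borel_measurable M"
  unfolding near_dens_def by measurable

lemma near_dens_nonneg: "0 \<le> near_dens R \<delta> t z"
  by (simp add: near_dens_def)

definition near_energy :: "real \<Rightarrow> real \<Rightarrow> ennreal" where
  "near_energy R \<delta> = (\<integral>\<^sup>+t. (\<integral>\<^sup>+z. ennreal (near_dens R \<delta> t z) \<partial>lborel) * indicator {0<..<T} t \<partial>lborel)"

text \<open>Two powers of |x - y| reduce the singularity to the exponent 2 - p, which exceeds -d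
  because s < 1.\<close>

lemma near_lipschitz_finite:
  assumes "0 \<le> R"
  shows "(\<integral>\<^sup>+z. ennreal ((norm (fst z - snd z))\<^sup>2 * norm (fst z - snd z) powr (- p)) * indicator (near R 1) z \<partial>lborel) < \<infinity>"
proof -
  have q: "- real DIM('a) < 2 - p" using s by (simp add: p_def)
  obtain C where C: "0 < C" "\<And>c::'a. (\<integral>\<^sup>+y. ennreal (norm (c - y) powr (2 - p)) * indicator (ball c 1) y \<partial>lborel) \<le> ennreal C"
    by (rule nn_integral_powr_ball_le[OF q], rule that)
  have "(\<integral>\<^sup>+z. ennreal ((norm (fst z - snd z))\<^sup>2 * norm (fst z - snd z) powr (- p)) * indicator (near R 1) z \<partial>lborel)
     \<le> (\<integral>\<^sup>+z. ennreal (norm (fst z - snd z) powr (2 - p)) * indicator {z. norm (fst z - snd z) < 1} z * indicator (ball 0 (R + 1)) (fst z) \<partial>(lborel :: ('a \<times> 'a) measure))"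
  proof (rule nn_integral_mono)
    fix z :: "'a \<times> 'a"
    have "(norm (fst z - snd z))\<^sup>2 * norm (fst z - snd z) powr (- p) = norm (fst z - snd z) powr (2 - p)"
      by (cases "fst z = snd z") (auto simp: powr_diff powr_minus field_simps simp flip: powr_numeral)
    moreover have "norm (fst z) < R + 1" if "norm (fst z - snd z) < 1" "norm (snd z) < R"
      using norm_triangle_ineq2[of "fst z" "snd z"] that by linarith
    ultimately show "ennreal ((norm (fst z - snd z))\<^sup>2 * norm (fst z - snd z) powr (- p)) * indicator (near R 1) z
      \<le> ennreal (norm (fst z - snd z) powr (2 - p)) * indicator {z. norm (fst z - snd z) < 1} z * indicator (ball 0 (R + 1)) (fst z)"
      by (auto simp: near_def split: split_indicator)
  qed
  also have "\<dots> = (\<integral>\<^sup>+x. (\<integral>\<^sup>+y. ennreal (norm (x - y) powr (2 - p)) * indicator (ball x 1) y \<partial>lborel) * indicator (ball 0 (R + 1)) x \<partial>(lborel :: 'a measure))"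
    by (subst nn_integral_lborel_pair) (auto simp: nn_integral_multc dist_norm indicator_def)
  also have "\<dots> \<le> (\<integral>\<^sup>+x. ennreal C * indicator (ball 0 (R + 1)) x \<partial>(lborel :: 'a measure))"
    by (intro nn_integral_mono mult_right_mono C) auto
  also have "\<dots> = ennreal C * emeasure lborel (ball (0::'a) (R + 1))" by (rule nn_integral_cmult_indicator) auto
  also have "\<dots> < \<infinity>" using assms by (simp add: emeasure_ball ennreal_mult_less_top)
  finally show ?thesis .
qed

lemma near_energy_finite:
  assumes R: "0 < R"
  shows "near_energy R 1 < \<infinity>"
proof -
  let ?L = "\<integral>\<^sup>+z. ennreal ((norm (fst z - snd z))\<^sup>2 * norm (fst z - snd z) powr (- p)) * indicator (near R 1) z \<partial>(lborel :: ('a \<times> 'a) measure)"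
  let ?B = "ball (0::'a) (R + 1) \<times> ball (0::'a) (R + 1)"
  have [measurable]: "?B \<in> sets borel" by (intro borel_open open_Times) auto
  have sub: "z \<in> ?B" if "z \<in> near R 1" for z
    using that norm_triangle_ineq2[of "fst z" "snd z"] norm_triangle_ineq3[of "snd z" "fst z"]
    by (cases z) (auto simp: near_def norm_minus_commute abs_le_iff)
  have "near_energy R 1 \<le> (\<integral>\<^sup>+t. (\<integral>\<^sup>+z. ennreal ((u t (fst z) - u t (snd z))\<^sup>2 * norm (fst z - snd z) powr (- p)) * indicator ?B z \<partial>lborel) * indicator {0<..<T} t
      + ?L * indicator {0<..<T} t \<partial>lborel)"
    unfolding near_energy_def
  proof (rule nn_integral_mono)
    fix t
    have "(\<integral>\<^sup>+z. ennreal (near_dens R 1 t z) \<partial>lborel) \<le> (\<integral>\<^sup>+z. ennreal ((u t (fst z) - u t (snd z))\<^sup>2 * norm (fst z - snd z) powr (- p)) * indicator ?B z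
       + ennreal ((norm (fst z - snd z))\<^sup>2 * norm (fst z - snd z) powr (- p)) * indicator (near R 1) z \<partial>lborel)"
      using sub by (intro nn_integral_mono)
        (auto simp: near_dens_def ring_distribs intro!: ennreal_leI simp flip: ennreal_plus split: split_indicator)
    also have "\<dots> = (\<integral>\<^sup>+z. ennreal ((u t (fst z) - u t (snd z))\<^sup>2 * norm (fst z - snd z) powr (- p)) * indicator ?B z \<partial>lborel) + ?L"
      by (rule nn_integral_add) measurable
    finally show "(\<integral>\<^sup>+z. ennreal (near_dens R 1 t z) \<partial>lborel) * indicator {0<..<T} t
      \<le> (\<integral>\<^sup>+z. ennreal ((u t (fst z) - u t (snd z))\<^sup>2 * norm (fst z - snd z) powr (- p)) * indicator ?B z \<partial>lborel) * indicator {0<..<T} t + ?L * indicator {0<..<T} t"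
      by (auto split: split_indicator)
  qed
  also have "\<dots> = (\<integral>\<^sup>+t. (\<integral>\<^sup>+z. ennreal ((u t (fst z) - u t (snd z))\<^sup>2 * norm (fst z - snd z) powr (- p)) * indicator ?B z \<partial>lborel) * indicator {0<..<T} t \<partial>lborel)
      + ?L * emeasure lborel {0<..<T}"
    by (subst nn_integral_add) (auto simp: nn_integral_cmult_indicator)
  also have "\<dots> < \<infinity>"
    using u_Hs[of "R + 1"] R near_lipschitz_finite[of R]
    by (cases "0 \<le> T") (auto simp: ennreal_mult_less_top emeasure_lborel_box_eq)
  finally show ?thesis .
qed

text \<open>The set \<open>near R \<delta>\<close> decreases to a subset of the diagonal, where the density vanishes.\<close>

lemma near_energy_tendsto:
  assumes R: "0 < R"
  shows "(\<lambda>n. near_energy R (1 / real (Suc n))) \<longlonglongrightarrow> 0"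
proof -
  let ?f = "\<lambda>\<delta> q. ennreal (near_dens R \<delta> (fst q) (snd q)) * indicator {0<..<T} (fst q)"
  have eq: "near_energy R \<delta> = (\<integral>\<^sup>+q. ?f \<delta> q \<partial>lborel)" for \<delta>
    unfolding near_energy_def by (subst nn_integral_lborel_pair) (auto simp: nn_integral_multc)
  have "(\<lambda>n. \<integral>\<^sup>+q. ?f (1 / real (Suc n)) q \<partial>lborel) \<longlonglongrightarrow> (\<integral>\<^sup>+q. 0 \<partial>(lborel :: (real \<times> 'a \<times> 'a) measure))"
  proof (rule nn_integral_dominated_convergence[where w="?f 1"])
    show "(\<integral>\<^sup>+q. ?f 1 q \<partial>lborel) < \<infinity>" using near_energy_finite[OF R] eq by simp
    show "AE q in lborel. ?f (1 / real (Suc n)) q \<le> ?f 1 q" for n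
    proof (intro AE_I2 mult_right_mono ennreal_leI)
      fix q :: "real \<times> 'a \<times> 'a"
      define e where "e = 1 / real (Suc n)"
      have "e \<le> 1" by (simp add: e_def)
      then show "near_dens R (1 / real (Suc n)) (fst q) (snd q) \<le> near_dens R 1 (fst q) (snd q)"
        unfolding e_def[symmetric] near_dens_def by (intro mult_left_mono) (auto simp: near_def split: split_indicator)
    qed auto
    show "AE q in lborel. (\<lambda>n. ?f (1 / real (Suc n)) q) \<longlonglongrightarrow> 0"
    proof (rule AE_I2)
      fix q :: "real \<times> 'a \<times> 'a"
      define r where "r = norm (fst (snd q) - snd (snd q))"
      show "(\<lambda>n. ?f (1 / real (Suc n)) q) \<longlonglongrightarrow> 0"
      proof (cases "r = 0")
        case True
        then have "\<And>n. near_dens R (1 / real (Suc n)) (fst q) (snd q) = 0" by (simp add: near_dens_def r_def)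
        then show ?thesis by simp
      next
        case False
        then have "0 < r" by (simp add: r_def)
        then have "eventually (\<lambda>n. 1 / real (Suc n) < r) sequentially"
          using LIMSEQ_inverse_real_of_nat by (auto dest!: order_tendstoD(2) simp: inverse_eq_divide)
        then have "eventually (\<lambda>n. ?f (1 / real (Suc n)) q = 0) sequentially"
          by eventually_elim (auto simp: near_dens_def near_def r_def)
        then show ?thesis by (rule tendsto_eventually)
      qed
    qed
  qed auto
  then show ?thesis by (simp add: eq)
qed

text \<open>A single function on space-time, cut off to the time interval, so that continuity of
  translations in L1 can be applied to it. No increment of a test function is included: the flux
  away from the diagonal is integrable by itself.\<close>

definition far_flux :: "real \<Rightarrow> real \<Rightarrow> real \<times> 'a \<times> 'a \<Rightarrow> real" where
  "far_flux R \<delta> q = (u (fst q) (fst (snd q)) - u (fst q) (snd (snd q))) * k (fst q) (fst (snd q)) (snd (snd q))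
     * indicator (far R \<delta>) (snd q) * indicator {0<..<T} (fst q)"

lemma far_flux_measurable [measurable (raw)]:
  assumes [measurable]: "f \<in> borel_measurable M"
  shows "(\<lambda>x. far_flux R \<delta> (f x)) \<in> borel_measurable M"
  unfolding far_flux_def by measurable

text \<open>An increment of \<open>u\<close> is at most the sum of its two values, whose
  contributions agree because \<open>far\<close> is symmetric. \<open>nn_integral_far_le\<close>
  reduces each to the weighted mass, which is integrable in time by \<open>u_tail\<close>.\<close>

lemma far_flux_integrable:
  assumes R: "0 \<le> R" and \<delta>: "0 < \<delta>" "\<delta> \<le> 1"
  shows "integrable lborel (far_flux R \<delta>)"
proof (rule integrableI_bounded)
  obtain C where C: "0 < C" "\<And>c \<delta> h. 0 < \<delta> \<Longrightarrow> \<delta> \<le> 1 \<Longrightarrow> h \<in> borel_measurable borel \<Longrightarrow>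
      (\<integral>\<^sup>+x. \<integral>\<^sup>+y. h x * ennreal (norm (x - y) powr (-p)) *
         indicator {z. \<delta> \<le> norm (fst z - snd z) \<and> (fst z \<in> ball c R \<or> snd z \<in> ball c R)} (x, y) \<partial>lborel \<partial>lborel)
      \<le> ennreal (C * \<delta> powr (-p)) * (\<integral>\<^sup>+x. h x * ennreal ((1 + norm (x - c)) powr (-p)) \<partial>(lborel::'a measure))"
    by (rule nn_integral_far_le[OF d_p(1) R], rule that)
  let ?g = "\<lambda>t z. ennreal (u t (fst z)) * ennreal (norm (fst z - snd z) powr (-p)) * indicator (far R \<delta>) z"
  let ?g' = "\<lambda>t z. ennreal (u t (snd z)) * ennreal (norm (fst z - snd z) powr (-p)) * indicator (far R \<delta>) z"
  let ?N = "\<lambda>t. \<integral>\<^sup>+x. ennreal (u t x) * ennreal ((1 + norm x) powr (- p)) \<partial>lborel"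
  have 1: "(\<integral>\<^sup>+z. ?g t z \<partial>lborel) \<le> ennreal (C * \<delta> powr (-p)) * ?N t" for t
    using C(2)[OF \<delta>, of "\<lambda>x. ennreal (u t x)" 0] by (subst nn_integral_lborel_pair) (auto simp: far_def)
  have "(\<integral>\<^sup>+z. ?g' t z \<partial>lborel) = (\<integral>\<^sup>+y. \<integral>\<^sup>+x. ?g' t (x, y) \<partial>lborel \<partial>lborel)" for t
    by (subst nn_integral_lborel_pair) (auto intro!: lborel_pair.Fubini'[symmetric])
  also have "(\<integral>\<^sup>+y. \<integral>\<^sup>+x. ?g' t (x, y) \<partial>lborel \<partial>lborel) = (\<integral>\<^sup>+z. ?g t z \<partial>lborel)" for t
    by (subst nn_integral_lborel_pair) (auto intro!: nn_integral_cong simp: far_def norm_minus_commute conj_commute disj_commute split: split_indicator)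
  finally have 2: "(\<integral>\<^sup>+z. ?g' t z \<partial>lborel) = (\<integral>\<^sup>+z. ?g t z \<partial>lborel)" for t .
  have "(\<integral>\<^sup>+q. ennreal (norm (far_flux R \<delta> q)) \<partial>lborel) \<le> (\<integral>\<^sup>+q. ennreal Lam * (?g (fst q) (snd q) + ?g' (fst q) (snd q)) * indicator {0<..<T} (fst q) \<partial>lborel)"
  proof (rule nn_integral_mono)
    fix q :: "real \<times> 'a \<times> 'a"
    obtain t x y where q: "q = (t, x, y)" by (cases q) auto
    have "\<bar>u t x - u t y\<bar> * k t x y \<le> (u t x + u t y) * (Lam * norm (x - y) powr (-p))"
      using u_nonneg[of t x] u_nonneg[of t y] k_le k_nonneg by (intro mult_mono) auto
    then have "\<bar>(u t x - u t y) * k t x y\<bar> \<le> Lam * (u t x * norm (x - y) powr (-p) + u t y * norm (x - y) powr (-p))"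
      using k_nonneg[of t x y] unfolding abs_mult by (simp add: algebra_simps)
    then show "ennreal (norm (far_flux R \<delta> q)) \<le> ennreal Lam * (?g (fst q) (snd q) + ?g' (fst q) (snd q)) * indicator {0<..<T} (fst q)"
      using u_nonneg k_nonneg[of t x y] Lam by (auto simp: q far_flux_def ennreal_mult[symmetric] ennreal_plus[symmetric]
        intro!: ennreal_leI split: split_indicator simp del: ennreal_plus)
  qed
  also have "\<dots> = (\<integral>\<^sup>+t. ennreal Lam * (2 * (\<integral>\<^sup>+z. ?g t z \<partial>lborel)) * indicator {0<..<T} t \<partial>lborel)"
    by (subst nn_integral_lborel_pair) (auto simp: nn_integral_multc nn_integral_cmult nn_integral_add 2 mult_2)
  also have "\<dots> \<le> (\<integral>\<^sup>+t. ennreal Lam * (2 * (ennreal (C * \<delta> powr (-p)) * ?N t)) * indicator {0<..<T} t \<partial>lborel)"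
    by (intro nn_integral_mono mult_right_mono mult_left_mono 1) auto
  also have "\<dots> = ennreal Lam * (2 * ennreal (C * \<delta> powr (-p))) * (\<integral>\<^sup>+t. ?N t * indicator {0<..<T} t \<partial>lborel)"
    by (subst nn_integral_cmult[symmetric]) (auto simp: mult_ac)
  also have "\<dots> < \<infinity>" using u_tail by (simp add: ennreal_mult_less_top ennreal_mult_eq_top_iff)
  finally show "(\<integral>\<^sup>+q. ennreal (norm (far_flux R \<delta> q)) \<partial>lborel) < \<infinity>" .
qed measurable

definition flux :: "('a \<Rightarrow> real) \<Rightarrow> real \<times> 'a \<times> 'a \<Rightarrow> real" where
  "flux \<zeta> q = (u (fst q) (fst (snd q)) - u (fst q) (snd (snd q))) * (\<zeta> (fst (snd q)) - \<zeta> (snd (snd q)))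
     * k (fst q) (fst (snd q)) (snd (snd q))"

lemma flux_measurable [measurable (raw)]:
  assumes [measurable]: "f \<in> borel_measurable M" "\<zeta> \<in> borel_measurable borel"
  shows "(\<lambda>x. flux \<zeta> (f x)) \<in> borel_measurable M"
  unfolding flux_def by measurable

text \<open>Near the diagonal both differences are square integrable against the kernel; away from it
  \<open>\<zeta>\<close> is bounded and the tail of \<open>u\<close> is integrable.\<close>

lemma flux_integrable:
  assumes R: "0 < R" and \<zeta>[measurable]: "\<zeta> \<in> borel_measurable borel"
    and \<zeta>b: "\<And>x. 0 \<le> \<zeta> x" "\<And>x. \<zeta> x \<le> 1" "\<And>x. R \<le> norm x \<Longrightarrow> \<zeta> x = 0"
    and fin: "(\<integral>\<^sup>+z. ennreal ((\<zeta> (fst z) - \<zeta> (snd z))\<^sup>2 * norm (fst z - snd z) powr (- p)) \<partial>lborel) < \<infinity>"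
  shows "integrable lborel (\<lambda>q. indicator {0<..<T} (fst q) * flux \<zeta> q)"
proof (rule integrableI_bounded)
  let ?Z = "\<lambda>z. (\<zeta> (fst z) - \<zeta> (snd z))\<^sup>2 * norm (fst z - snd z) powr (- p)"
  let ?b = "\<lambda>q. ennreal Lam * (ennreal (near_dens R 1 (fst q) (snd q)) + ennreal (?Z (snd q))) * indicator {0<..<T} (fst q)"
  have "(\<integral>\<^sup>+q. ennreal (norm (indicator {0<..<T} (fst q) * flux \<zeta> q)) \<partial>lborel)
    \<le> (\<integral>\<^sup>+q. ?b q + ennreal (norm (far_flux R 1 q)) \<partial>lborel)"
  proof (rule nn_integral_mono)
    fix q :: "real \<times> 'a \<times> 'a"
    obtain t x y where q: "q = (t, x, y)" by (cases q) auto
    let ?J = "norm (x - y) powr (-p)"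
    consider "t \<notin> {0<..<T}" | "R \<le> norm x" "R \<le> norm y" | "t \<in> {0<..<T}" "(x, y) \<in> near R 1" | "t \<in> {0<..<T}" "(x, y) \<in> far R 1"
      by (auto simp: near_def far_def) force+
    then show "ennreal (norm (indicator {0<..<T} (fst q) * flux \<zeta> q)) \<le> ?b q + ennreal (norm (far_flux R 1 q))"
    proof cases
      case 3
      have "\<bar>u t x - u t y\<bar> * \<bar>\<zeta> x - \<zeta> y\<bar> \<le> (u t x - u t y)\<^sup>2 + (\<zeta> x - \<zeta> y)\<^sup>2"
        using sum_squares_bound[of "\<bar>u t x - u t y\<bar>" "\<bar>\<zeta> x - \<zeta> y\<bar>"]
          mult_nonneg_nonneg[of "\<bar>u t x - u t y\<bar>" "\<bar>\<zeta> x - \<zeta> y\<bar>"] unfolding mult.assoc power2_abs by linarith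
      then have "\<bar>u t x - u t y\<bar> * \<bar>\<zeta> x - \<zeta> y\<bar> * k t x y \<le> ((u t x - u t y)\<^sup>2 + (\<zeta> x - \<zeta> y)\<^sup>2) * (Lam * ?J)"
        using k_le[of t x y] k_nonneg[of t x y] by (intro mult_mono) auto
      also have "\<dots> \<le> Lam * (near_dens R 1 t (x, y) + ?Z (x, y))"
        using 3 Lam by (simp add: near_dens_def algebra_simps)
      finally have "norm (flux \<zeta> q) \<le> Lam * (near_dens R 1 t (x, y) + ?Z (x, y))"
        using k_nonneg[of t x y] by (simp add: flux_def q abs_mult)
      then have "ennreal (norm (indicator {0<..<T} (fst q) * flux \<zeta> q)) \<le> ?b q"
        using 3 Lam near_dens_nonneg[of R 1 t "(x, y)"] by (simp add: q ennreal_mult[symmetric] ennreal_plus[symmetric] ennreal_leI del: ennreal_plus)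
      then show ?thesis by (simp add: add_increasing2)
    next
      case 4
      have "\<bar>\<zeta> x - \<zeta> y\<bar> \<le> 1" using \<zeta>b(1,2)[of x] \<zeta>b(1,2)[of y] by linarith
      then have "\<bar>u t x - u t y\<bar> * \<bar>\<zeta> x - \<zeta> y\<bar> * k t x y \<le> \<bar>u t x - u t y\<bar> * 1 * k t x y"
        using k_nonneg by (intro mult_right_mono mult_left_mono) auto
      then show ?thesis using 4 k_nonneg[of t x y] by (auto simp: q flux_def far_flux_def abs_mult intro!: add_increasing ennreal_leI)
    qed (auto simp: q flux_def \<zeta>b)
  qed
  also have "\<dots> = (\<integral>\<^sup>+q. ?b q \<partial>lborel) + (\<integral>\<^sup>+q. ennreal (norm (far_flux R 1 q)) \<partial>lborel)"
    by (rule nn_integral_add) measurable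
  also have "(\<integral>\<^sup>+q. ?b q \<partial>lborel) = ennreal Lam * (near_energy R 1 + (\<integral>\<^sup>+z. ennreal (?Z z) \<partial>lborel) * emeasure lborel {0<..<T})"
  proof -
    have "(\<integral>\<^sup>+q. ?b q \<partial>lborel) = (\<integral>\<^sup>+t. ennreal Lam * ((\<integral>\<^sup>+z. ennreal (near_dens R 1 t z) \<partial>lborel) * indicator {0<..<T} t + (\<integral>\<^sup>+z. ennreal (?Z z) \<partial>lborel) * indicator {0<..<T} t) \<partial>lborel)"
      by (subst nn_integral_lborel_pair) (auto simp: nn_integral_multc nn_integral_cmult nn_integral_add algebra_simps)
    also have "\<dots> = ennreal Lam * (\<integral>\<^sup>+t. (\<integral>\<^sup>+z. ennreal (near_dens R 1 t z) \<partial>lborel) * indicator {0<..<T} t + (\<integral>\<^sup>+z. ennreal (?Z z) \<partial>lborel) * indicator {0<..<T} t \<partial>lborel)"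
      by (rule nn_integral_cmult) measurable
    also have "(\<integral>\<^sup>+t. (\<integral>\<^sup>+z. ennreal (near_dens R 1 t z) \<partial>lborel) * indicator {0<..<T} t + (\<integral>\<^sup>+z. ennreal (?Z z) \<partial>lborel) * indicator {0<..<T} t \<partial>lborel)
      = near_energy R 1 + (\<integral>\<^sup>+z. ennreal (?Z z) \<partial>lborel) * emeasure lborel {0<..<T}"
      unfolding near_energy_def by (subst nn_integral_add) (auto simp: nn_integral_cmult_indicator)
    finally show ?thesis .
  qed
  also have "ennreal Lam * (near_energy R 1 + (\<integral>\<^sup>+z. ennreal (?Z z) \<partial>lborel) * emeasure lborel {0<..<T}) + (\<integral>\<^sup>+q. ennreal (norm (far_flux R 1 q)) \<partial>lborel) < \<infinity>"
    using near_energy_finite[OF R] fin far_flux_integrable[of R 1] R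
    by (cases "0 \<le> T") (auto simp: ennreal_mult_less_top integrable_iff_bounded)
  finally show "(\<integral>\<^sup>+q. ennreal (norm (indicator {0<..<T} (fst q) * flux \<zeta> q)) \<partial>lborel) < \<infinity>" .
qed measurable

text \<open>Finiteness of the \<open>H\<^sup>s\<close> seminorm only concerns a neighbourhood of the diagonal.\<close>

lemma seminorm_finite:
  assumes R: "0 < R" and \<zeta>[measurable]: "\<zeta> \<in> borel_measurable borel"
    and \<zeta>b: "\<And>x. 0 \<le> \<zeta> x" "\<And>x. \<zeta> x \<le> 1" "\<And>x. R \<le> norm x \<Longrightarrow> \<zeta> x = 0"
    and L: "0 \<le> L" "\<And>x y. (\<zeta> x - \<zeta> y)\<^sup>2 \<le> L * ((g x - g y)\<^sup>2 + (norm (x - y))\<^sup>2)"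
    and g[measurable]: "g \<in> borel_measurable borel"
    and fin: "(\<integral>\<^sup>+z. ennreal (((g (fst z) - g (snd z))\<^sup>2 + (norm (fst z - snd z))\<^sup>2) * norm (fst z - snd z) powr (- p)
      * indicator (near R 1) z) \<partial>lborel) < \<infinity>"
  shows "(\<integral>\<^sup>+z. ennreal ((\<zeta> (fst z) - \<zeta> (snd z))\<^sup>2 * norm (fst z - snd z) powr (- p)) \<partial>lborel) < \<infinity>"
proof -
  obtain C where C: "0 < C" "\<And>c \<delta> h. 0 < \<delta> \<Longrightarrow> \<delta> \<le> 1 \<Longrightarrow> h \<in> borel_measurable borel \<Longrightarrow>
      (\<integral>\<^sup>+x. \<integral>\<^sup>+y. h x * ennreal (norm (x - y) powr (-p)) *
         indicator {z. \<delta> \<le> norm (fst z - snd z) \<and> (fst z \<in> ball c R \<or> snd z \<in> ball c R)} (x, y) \<partial>lborel \<partial>lborel)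
      \<le> ennreal (C * \<delta> powr (-p)) * (\<integral>\<^sup>+x. h x * ennreal ((1 + norm (x - c)) powr (-p)) \<partial>(lborel::'a measure))"
    by (rule nn_integral_far_le[OF d_p(1) less_imp_le[OF R]], rule that)
  obtain Cw where Cw: "\<And>c::'a. (\<integral>\<^sup>+y. ennreal ((1 + norm (c - y)) powr (- p)) \<partial>lborel) \<le> ennreal Cw"
    by (rule nn_integral_decay_le[OF d_p(1)], rule that)
  let ?G = "\<lambda>z. ((g (fst z) - g (snd z))\<^sup>2 + (norm (fst z - snd z))\<^sup>2) * norm (fst z - snd z) powr (- p) * indicator (near R 1) z"
  let ?F = "\<lambda>z. ennreal (norm (fst z - snd z) powr (-p)) * indicator (far R 1) z"
  have "(\<integral>\<^sup>+z. ennreal ((\<zeta> (fst z) - \<zeta> (snd z))\<^sup>2 * norm (fst z - snd z) powr (- p)) \<partial>lborel)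
    \<le> (\<integral>\<^sup>+z. ennreal L * ennreal (?G z) + ?F z \<partial>lborel)"
  proof (rule nn_integral_mono)
    fix z :: "'a \<times> 'a"
    obtain x y where z: "z = (x, y)" by (cases z) auto
    consider "R \<le> norm x" "R \<le> norm y" | "(x, y) \<in> near R 1" | "(x, y) \<in> far R 1"
      by (auto simp: near_def far_def) force+
    then show "ennreal ((\<zeta> (fst z) - \<zeta> (snd z))\<^sup>2 * norm (fst z - snd z) powr (- p)) \<le> ennreal L * ennreal (?G z) + ?F z"
    proof cases
      case 2
      have "(\<zeta> x - \<zeta> y)\<^sup>2 * norm (x - y) powr (- p) \<le> L * ?G (x, y)"
        using mult_right_mono[OF L(2)[of x y], of "norm (x - y) powr (- p)"] 2 by (simp add: mult.assoc)
      then show ?thesis using L(1) by (auto simp: z ennreal_mult[symmetric] ennreal_leI intro!: add_increasing2)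
    next
      case 3
      have "\<bar>\<zeta> x - \<zeta> y\<bar> \<le> 1" using \<zeta>b(1,2)[of x] \<zeta>b(1,2)[of y] by linarith
      then have "(\<zeta> x - \<zeta> y)\<^sup>2 \<le> 1" by (simp add: abs_square_le_1)
      then have "(\<zeta> x - \<zeta> y)\<^sup>2 * norm (x - y) powr (- p) \<le> norm (x - y) powr (- p)"
        using mult_right_mono[of "(\<zeta> x - \<zeta> y)\<^sup>2" 1 "norm (x - y) powr (- p)"] by simp
      then show ?thesis using 3 by (auto simp: z ennreal_leI intro!: add_increasing)
    qed (auto simp: z \<zeta>b)
  qed
  also have "\<dots> = ennreal L * (\<integral>\<^sup>+z. ennreal (?G z) \<partial>lborel) + (\<integral>\<^sup>+z. ?F z \<partial>lborel)"
    by (subst nn_integral_add) (auto simp: nn_integral_cmult)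
  also have "(\<integral>\<^sup>+z. ?F z \<partial>lborel) \<le> ennreal C * (\<integral>\<^sup>+x. ennreal ((1 + norm (0 - x)) powr (-p)) \<partial>(lborel::'a measure))"
    using C(2)[of 1 "\<lambda>_. 1" 0] by (subst nn_integral_lborel_pair) (auto simp: far_def)
  also have "\<dots> \<le> ennreal C * ennreal Cw" by (intro mult_left_mono Cw) auto
  finally show ?thesis using fin by (auto simp: ennreal_mult_less_top less_top[symmetric] top_unique ennreal_mult_eq_top_iff)
qed

end

section \<open>The entropy inequality\<close>

text \<open>The elementary bound z \<le> \<eta> + z^2/\<eta>, with \<eta> chosen so that \<eta>
  times the volume of the ball is half of the tolerance.\<close>

lemma L1_ball_tendsto:
  fixes w :: "'b \<Rightarrow> 'a::euclidean_space \<Rightarrow> real"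
  assumes [measurable]: "\<And>r. w r \<in> borel_measurable borel" and R: "0 < R"
    and lim: "((\<lambda>r. \<integral>\<^sup>+x. ennreal ((w r x)\<^sup>2) * indicator (ball 0 R) x \<partial>lborel) \<longlongrightarrow> 0) F"
  shows "((\<lambda>r. \<integral>\<^sup>+x. ennreal \<bar>w r x\<bar> * indicator (ball 0 R) x \<partial>lborel) \<longlongrightarrow> 0) F"
proof (rule order_tendstoI)
  fix e :: ennreal assume "0 < e"
  then obtain e' :: real where e': "0 < e'" "ennreal e' < e"
  proof (cases e)
    case (real x)
    then show ?thesis using \<open>0 < e\<close> by (intro that[of "x/2"]) (auto simp: ennreal_less_iff)
  qed (auto intro: that[of 1])
  define V where "V = unit_ball_vol (real DIM('a)) * R ^ DIM('a)"
  have V: "0 < V" using R by (simp add: V_def)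
  define \<eta> where "\<eta> = e' / (2 * V)"
  have \<eta>: "0 < \<eta>" using e' V by (simp add: \<eta>_def)
  have "eventually (\<lambda>r. (\<integral>\<^sup>+x. ennreal ((w r x)\<^sup>2) * indicator (ball 0 R) x \<partial>lborel) < ennreal (\<eta> * e' / 2)) F"
    using lim \<eta> e' by (intro order_tendstoD(2)) auto
  then show "eventually (\<lambda>r. (\<integral>\<^sup>+x. ennreal \<bar>w r x\<bar> * indicator (ball 0 R) x \<partial>lborel) < e) F"
  proof eventually_elim
    case (elim r)
    have "(\<integral>\<^sup>+x. ennreal \<bar>w r x\<bar> * indicator (ball 0 R) x \<partial>lborel)
       \<le> (\<integral>\<^sup>+x. ennreal \<eta> * indicator (ball 0 R) x + ennreal (1 / \<eta>) * (ennreal ((w r x)\<^sup>2) * indicator (ball 0 R) x) \<partial>lborel)"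
    proof (rule nn_integral_mono)
      fix x
      have "z \<le> \<eta> + 1 / \<eta> * z\<^sup>2" if "0 \<le> z" for z :: real
      proof (cases "z \<le> \<eta>")
        case False
        then have "z * \<eta> \<le> z * z" using that by (intro mult_left_mono) auto
        then have "z \<le> 1 / \<eta> * z\<^sup>2" using \<eta> by (simp add: field_simps power2_eq_square)
        then show ?thesis using \<eta> by simp
      qed (use \<eta> in \<open>simp add: add_increasing2\<close>)
      from this[of "\<bar>w r x\<bar>"]
      show "ennreal \<bar>w r x\<bar> * indicator (ball 0 R) x \<le> ennreal \<eta> * indicator (ball 0 R) x + ennreal (1 / \<eta>) * (ennreal ((w r x)\<^sup>2) * indicator (ball 0 R) x)"
        using \<eta> by (auto simp: ennreal_mult[symmetric] ennreal_plus[symmetric] intro!: ennreal_leI simp del: ennreal_plus split: split_indicator)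
    qed
    also have "\<dots> = ennreal \<eta> * ennreal V + ennreal (1 / \<eta>) * (\<integral>\<^sup>+x. ennreal ((w r x)\<^sup>2) * indicator (ball 0 R) x \<partial>lborel)"
      using R by (subst nn_integral_add) (auto simp: nn_integral_cmult nn_integral_cmult_indicator emeasure_ball V_def)
    also have "\<dots> \<le> ennreal \<eta> * ennreal V + ennreal (1 / \<eta>) * ennreal (\<eta> * e' / 2)"
      using elim by (intro add_left_mono mult_left_mono) auto
    also have "\<dots> = ennreal e'"
      using \<eta> V e' by (simp add: ennreal_mult[symmetric] ennreal_plus[symmetric] \<eta>_def del: ennreal_plus)
    finally show ?case using e' by simp
  qed
qed simp

lemma L1_ball_finite:
  fixes f :: "'a::euclidean_space \<Rightarrow> real"
  assumes [measurable]: "f \<in> borel_measurable borel" and nonneg: "\<And>x. 0 \<le> f x"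
    and fin: "(\<integral>\<^sup>+x. ennreal ((f x)\<^sup>2) * indicator (ball 0 R) x \<partial>lborel) < \<infinity>"
  shows "(\<integral>\<^sup>+x. ennreal (f x) * indicator (ball 0 R) x \<partial>lborel) < \<infinity>"
proof -
  have "(\<integral>\<^sup>+x. ennreal (f x) * indicator (ball 0 R) x \<partial>lborel)
    \<le> (\<integral>\<^sup>+x. ennreal ((f x)\<^sup>2) * indicator (ball 0 R) x + indicator (ball 0 R) x \<partial>lborel)"
  proof (rule nn_integral_mono)
    fix x
    have "f x \<le> (f x)\<^sup>2 + 1" using sum_squares_bound[of "f x" 1] nonneg[of x] by simp
    from ennreal_leI[OF this]
    show "ennreal (f x) * indicator (ball 0 R) x \<le> ennreal ((f x)\<^sup>2) * indicator (ball 0 R) x + indicator (ball 0 R) x"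
      by (simp split: split_indicator)
  qed
  also have "\<dots> = (\<integral>\<^sup>+x. ennreal ((f x)\<^sup>2) * indicator (ball 0 R) x \<partial>lborel) + emeasure lborel (ball (0::'a) R)"
    by (subst nn_integral_add) auto
  also have "\<dots> < \<infinity>" using fin emeasure_lborel_ball_finite[of "0::'a" R] by simp
  finally show ?thesis .
qed

text \<open>Two representatives of one solution: \<open>u\<close> is jointly Borel measurable, whereas \<open>v\<close> is
  continuous in time and meaningful at every single time.\<close>

locale nonlocal_flow = nonlocal_data s Lam T u k p
  for s Lam T :: real
    and u :: "real \<Rightarrow> 'a::euclidean_space \<Rightarrow> real"
    and k :: "real \<Rightarrow> 'a \<Rightarrow> 'a \<Rightarrow> real" and p :: real +
  fixes lam :: real and v :: "real \<Rightarrow> 'a \<Rightarrow> real"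
  assumes lam: "0 < lam"
    and v_meas [measurable]: "\<And>t. v t \<in> borel_measurable borel"
    and v_nonneg: "\<And>t x. 0 \<le> v t x"
    and v_eq: "AE t in lborel. t \<in> {0<..<T} \<longrightarrow> (AE x in lborel. v t x = u t x)"
    and v_sq: "\<And>t R. t \<in> {0<..<T} \<Longrightarrow> 0 < R \<Longrightarrow> (\<integral>\<^sup>+x. ennreal ((v t x)\<^sup>2) * indicator (ball 0 R) x \<partial>lborel) < \<infinity>"
    and v_cont: "\<And>t R. t \<in> {0<..<T} \<Longrightarrow> 0 < R \<Longrightarrow>
      ((\<lambda>r. \<integral>\<^sup>+x. ennreal ((v r x - v t x)\<^sup>2) * indicator (ball 0 R) x \<partial>lborel) \<longlongrightarrow> 0) (at t)"
    and weak: "\<And>a b R \<zeta>. 0 < a \<Longrightarrow> a < b \<Longrightarrow> b < T \<Longrightarrow> 0 < R \<Longrightarrow> \<zeta> \<in> borel_measurable borel \<Longrightarrow>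
      (\<And>x. 0 \<le> \<zeta> x) \<Longrightarrow> (\<And>x. \<zeta> x \<le> 1) \<Longrightarrow> (\<And>x. R \<le> norm x \<Longrightarrow> \<zeta> x = 0) \<Longrightarrow>
      (\<integral>\<^sup>+z. ennreal ((\<zeta> (fst z) - \<zeta> (snd z))\<^sup>2 * norm (fst z - snd z) powr (- p)) \<partial>lborel) < \<infinity> \<Longrightarrow>
      (\<integral>x. v b x * \<zeta> x \<partial>lborel) - (\<integral>x. v a x * \<zeta> x \<partial>lborel)
        = - (\<integral>q. indicator {a<..<b} (fst q) * flux \<zeta> q \<partial>lborel)"
    and coercive: "AE t in lborel. t \<in> {0<..<T} \<longrightarrow> (\<forall>c r g. 0 < r \<longrightarrow> g \<in> borel_measurable borel \<longrightarrow>
      (\<integral>\<^sup>+x. ennreal ((g x)\<^sup>2) * indicator (ball c r) x \<partial>lborel) < \<infinity> \<longrightarrow>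
      (\<integral>\<^sup>+z. ennreal ((g (fst z) - g (snd z))\<^sup>2 * norm (fst z - snd z) powr (- p)) * indicator (ball c r \<times> ball c r) z \<partial>lborel) < \<infinity> \<longrightarrow>
      ennreal lam * (\<integral>\<^sup>+z. ennreal ((g (fst z) - g (snd z))\<^sup>2 * norm (fst z - snd z) powr (- p)) * indicator (ball c r \<times> ball c r) z \<partial>lborel)
      \<le> (\<integral>\<^sup>+z. ennreal ((g (fst z) - g (snd z))\<^sup>2 * k t (fst z) (snd z)) * indicator (ball c r \<times> ball c r) z \<partial>lborel))"
begin

lemma v_L1_tendsto:
  assumes t: "t \<in> {0<..<T}" and R: "0 < R"
  shows "((\<lambda>r. \<integral>\<^sup>+x. ennreal \<bar>v r x - v t x\<bar> * indicator (ball 0 R) x \<partial>lborel) \<longlongrightarrow> 0) (at t)"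
  by (rule L1_ball_tendsto[OF _ R v_cont[OF t R]]) measurable

lemma v_L1_finite:
  assumes t: "t \<in> {0<..<T}" and R: "0 < R"
  shows "(\<integral>\<^sup>+x. ennreal (v t x) * indicator (ball 0 R) x \<partial>lborel) < \<infinity>"
  by (rule L1_ball_finite[OF v_meas v_nonneg v_sq[OF t R]])

end

text \<open>The cutoff is a parameter, since the iteration runs with a whole sequence of cutoffs for
  one solution.\<close>

locale nonlocal_test = nonlocal_flow s Lam T u k p lam v
  for s Lam T :: real
    and u :: "real \<Rightarrow> 'a::euclidean_space \<Rightarrow> real"
    and k :: "real \<Rightarrow> 'a \<Rightarrow> 'a \<Rightarrow> real" and p lam :: real
    and v :: "real \<Rightarrow> 'a \<Rightarrow> real" +
  fixes W :: "'a \<Rightarrow> real" and R L \<alpha> :: real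
  assumes W_meas [measurable]: "W \<in> borel_measurable borel"
    and W: "\<And>x. 0 \<le> W x" "\<And>x. W x \<le> 1" "\<And>x. R \<le> norm x \<Longrightarrow> W x = 0" and R: "0 < R"
    and L: "0 \<le> L" "\<And>x y. \<bar>W x - W y\<bar> \<le> L * norm (x - y)"
    and \<alpha>: "0 < \<alpha>" "\<alpha> < 1"
begin

lemma v_mult_integrable:
  assumes "t \<in> {0<..<T}" "G \<in> borel_measurable borel" "\<And>x. \<bar>G x\<bar> \<le> v t x * W x"
  shows "integrable lborel G"
proof (rule integrableI_bounded)
  have "(\<integral>\<^sup>+x. ennreal (norm (G x)) \<partial>lborel) \<le> (\<integral>\<^sup>+x. ennreal (v t x) * indicator (ball 0 R) x \<partial>lborel)"
  proof (rule nn_integral_mono)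
    fix x
    have "v t x * W x \<le> v t x * 1" using W v_nonneg by (intro mult_left_mono) auto
    then show "ennreal (norm (G x)) \<le> ennreal (v t x) * indicator (ball 0 R) x"
      using assms(3)[of x] W(3)[of x] by (auto intro!: ennreal_leI split: split_indicator simp: not_less)
  qed
  also have "\<dots> < \<infinity>" using v_L1_finite assms R by blast
  finally show "(\<integral>\<^sup>+x. ennreal (norm (G x)) \<partial>lborel) < \<infinity>" .
qed (use assms in simp)

definition drift :: "real \<Rightarrow> 'a \<times> 'a \<Rightarrow> real" where
  "drift t z = \<bar>u t (fst z) - u t (snd z)\<bar> * \<bar>W (fst z) - W (snd z)\<bar> * k t (fst z) (snd z)"

lemma drift_measurable [measurable (raw)]:
  assumes [measurable]: "f \<in> borel_measurable M" "g \<in> borel_measurable M"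
  shows "(\<lambda>x. drift (f x) (g x)) \<in> borel_measurable M"
  unfolding drift_def by measurable

lemma drift_nonneg: "0 \<le> drift t z"
  using k_nonneg by (simp add: drift_def)

definition Drift :: "real \<Rightarrow> real \<Rightarrow> ennreal" where
  "Drift a b = (\<integral>\<^sup>+t. (\<integral>\<^sup>+z. ennreal (drift t z) \<partial>lborel) * indicator {a<..<b} t \<partial>lborel)"

lemma W_seminorm:
  "(\<integral>\<^sup>+z. ennreal ((W (fst z) - W (snd z))\<^sup>2 * norm (fst z - snd z) powr (- p)) \<partial>lborel) < \<infinity>"
proof (rule seminorm_finite[OF R W_meas W])
  show "0 \<le> L\<^sup>2" by simp
  show "(W x - W y)\<^sup>2 \<le> L\<^sup>2 * (((\<lambda>_. 0) x - (\<lambda>_. 0) y)\<^sup>2 + (norm (x - y))\<^sup>2)" for x y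
    using power_mono[OF L(2)[of x y], of 2] by (simp add: power_mult_distrib)
  show "(\<integral>\<^sup>+z. ennreal ((((\<lambda>_. 0) (fst z) - (\<lambda>_. 0) (snd z))\<^sup>2 + (norm (fst z - snd z))\<^sup>2) * norm (fst z - snd z) powr (- p)
      * indicator (near R 1) z) \<partial>lborel) < \<infinity>"
    using near_lipschitz_finite[of R] R by (simp add: ennreal_mult ennreal_indicator)
qed auto

text \<open>The balance identity with the cutoff as test function. Only the absolute value of the
  flux is kept, so the bound is the same forward and backward in time.\<close>

lemma mass_change_le_Drift:
  assumes ab: "0 < a" "a < b" "b < T"
  shows "(\<integral>\<^sup>+x. ennreal (v b x * W x) \<partial>lborel) \<le> (\<integral>\<^sup>+x. ennreal (v a x * W x) \<partial>lborel) + Drift a b"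
    and "(\<integral>\<^sup>+x. ennreal (v a x * W x) \<partial>lborel) \<le> (\<integral>\<^sup>+x. ennreal (v b x * W x) \<partial>lborel) + Drift a b"
proof -
  let ?X = "\<lambda>q. indicator {a<..<b} (fst q) * flux W q"
  have eq: "(\<integral>x. v b x * W x \<partial>lborel) - (\<integral>x. v a x * W x \<partial>lborel) = - (\<integral>q. ?X q \<partial>lborel)"
    by (intro weak[OF ab R W_meas W W_seminorm])
  have int: "integrable lborel (\<lambda>x. v t x * W x)" if "t \<in> {a, b}" for t
    using that ab v_nonneg W by (intro v_mult_integrable[of t]) (auto simp: abs_mult)
  have nn: "(\<integral>\<^sup>+x. ennreal (v t x * W x) \<partial>lborel) = ennreal (\<integral>x. v t x * W x \<partial>lborel)" if "t \<in> {a, b}" for t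
    using int[OF that] v_nonneg W by (intro nn_integral_eq_integral) auto
  have ge: "0 \<le> (\<integral>x. v t x * W x \<partial>lborel)" for t
    using v_nonneg W by (intro Bochner_Integration.integral_nonneg) auto
  have D: "(\<integral>\<^sup>+q. ennreal \<bar>?X q\<bar> \<partial>lborel) = Drift a b"
  proof -
    have "(\<integral>\<^sup>+q. ennreal \<bar>?X q\<bar> \<partial>lborel) = (\<integral>\<^sup>+q. ennreal (drift (fst q) (snd q)) * indicator {a<..<b} (fst q) \<partial>lborel)"
      using k_nonneg by (intro nn_integral_cong) (auto simp: flux_def drift_def abs_mult split: split_indicator)
    also have "\<dots> = Drift a b"
      unfolding Drift_def by (subst nn_integral_lborel_pair) (auto simp: nn_integral_multc)
    finally show ?thesis .
  qed
  have le1: "ennreal (\<integral>q. - ?X q \<partial>lborel) \<le> Drift a b"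
    unfolding D[symmetric] by (rule order_trans[OF ennreal_integral_le]) (auto intro!: nn_integral_mono ennreal_leI)
  have le2: "ennreal (\<integral>q. ?X q \<partial>lborel) \<le> Drift a b"
    unfolding D[symmetric] by (rule order_trans[OF ennreal_integral_le]) (auto intro!: nn_integral_mono ennreal_leI)
  have eqs: "(\<integral>x. v b x * W x \<partial>lborel) = (\<integral>x. v a x * W x \<partial>lborel) + (\<integral>q. - ?X q \<partial>lborel)"
    "(\<integral>x. v a x * W x \<partial>lborel) = (\<integral>x. v b x * W x \<partial>lborel) + (\<integral>q. ?X q \<partial>lborel)" using eq by auto
  \<comment> \<open>The increment \<open>y\<close> may be negative; \<open>ennreal\<close> maps it
    to 0, and the bound then holds by monotonicity.\<close>
  have aux: "ennreal (x + y) \<le> ennreal x + z" if "ennreal y \<le> z" "0 \<le> x" for x y z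
  proof (cases "0 \<le> y")
    case True
    then show ?thesis using that by (simp add: ennreal_plus add_left_mono)
  next
    case False
    then have "ennreal (x + y) \<le> ennreal x" by (intro ennreal_leI) auto
    then show ?thesis by (simp add: add_increasing2)
  qed
  show "(\<integral>\<^sup>+x. ennreal (v b x * W x) \<partial>lborel) \<le> (\<integral>\<^sup>+x. ennreal (v a x * W x) \<partial>lborel) + Drift a b"
    using aux[OF le1 ge[of a]] nn[of a] nn[of b] eqs(1) by simp
  show "(\<integral>\<^sup>+x. ennreal (v a x * W x) \<partial>lborel) \<le> (\<integral>\<^sup>+x. ennreal (v b x * W x) \<partial>lborel) + Drift a b"
    using aux[OF le2 ge[of b]] nn[of a] nn[of b] eqs(2) by simp
qed

text \<open>The discrete product rule splits the increment of \<open>trunc \<alpha> u * W\<close>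
  into the increment of the truncation times the mean of \<open>W\<close>, and the increment of
  \<open>W\<close> times the mean of the truncation. \<open>dissip\<close> is the flux against the
  first part; the flux against the second is at most \<open>drift\<close>, as truncations lie
  between 0 and 1.\<close>

definition dissip :: "real \<Rightarrow> 'a \<times> 'a \<Rightarrow> real" where
  "dissip t z = (u t (fst z) - u t (snd z)) * (trunc \<alpha> (u t (fst z)) - trunc \<alpha> (u t (snd z)))
     * ((W (fst z) + W (snd z)) / 2) * k t (fst z) (snd z)"

lemma dissip_measurable [measurable (raw)]:
  assumes [measurable]: "f \<in> borel_measurable M" "g \<in> borel_measurable M"
  shows "(\<lambda>x. dissip (f x) (g x)) \<in> borel_measurable M"
  unfolding dissip_def by measurable

lemma dissip_nonneg: "0 \<le> dissip t z"
proof -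
  have "0 \<le> (u t (fst z) - u t (snd z)) * (trunc \<alpha> (u t (fst z)) - trunc \<alpha> (u t (snd z)))"
    using trunc_form_le[OF \<alpha> u_nonneg[of t "fst z"] u_nonneg[of t "snd z"]] trunc_form_nonneg[of \<alpha> "u t (fst z)" "u t (snd z)"] \<alpha>
    by (meson mult_nonneg_nonneg less_imp_le order_trans)
  from mult_nonneg_nonneg[OF this, of "(W (fst z) + W (snd z)) / 2"] show ?thesis
    unfolding dissip_def using W(1) by (intro mult_nonneg_nonneg[OF _ k_nonneg]) auto
qed

abbreviation testf :: "real \<Rightarrow> 'a \<Rightarrow> real" where
  "testf r x \<equiv> trunc \<alpha> (u r x) * W x"

lemma testf_bounds: "0 \<le> testf r x" "testf r x \<le> 1" "R \<le> norm x \<Longrightarrow> testf r x = 0"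
  using trunc_nonneg[OF \<alpha> u_nonneg] trunc_le_1[OF \<alpha>] W by (auto intro!: mult_nonneg_nonneg mult_le_one)

lemma testf_diff: "(testf r x - testf r y)\<^sup>2 \<le> (2 + 2 * L\<^sup>2) * ((u r x - u r y)\<^sup>2 + (norm (x - y))\<^sup>2)"
proof -
  have eq: "testf r x - testf r y = (trunc \<alpha> (u r x) - trunc \<alpha> (u r y)) * W x + trunc \<alpha> (u r y) * (W x - W y)"
    by (simp add: algebra_simps)
  have "\<bar>(trunc \<alpha> (u r x) - trunc \<alpha> (u r y)) * W x\<bar> \<le> \<bar>u r x - u r y\<bar> * 1"
    unfolding abs_mult using W by (intro mult_mono trunc_lipschitz[OF \<alpha>] u_nonneg) auto
  moreover have "\<bar>trunc \<alpha> (u r y) * (W x - W y)\<bar> \<le> 1 * (L * norm (x - y))"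
    unfolding abs_mult using L trunc_nonneg[OF \<alpha> u_nonneg] trunc_le_1[OF \<alpha>] by (intro mult_mono) auto
  ultimately have le: "\<bar>testf r x - testf r y\<bar> \<le> \<bar>u r x - u r y\<bar> + L * norm (x - y)"
    unfolding eq by (intro order_trans[OF abs_triangle_ineq add_mono]) auto
  then have "(testf r x - testf r y)\<^sup>2 \<le> (\<bar>u r x - u r y\<bar> + L * norm (x - y))\<^sup>2"
    using power_mono[OF le abs_ge_zero, of 2] by simp
  also have "\<dots> \<le> 2 * (u r x - u r y)\<^sup>2 + 2 * (L * norm (x - y))\<^sup>2"
    using sum_squares_bound[of "\<bar>u r x - u r y\<bar>" "L * norm (x - y)"] by (simp add: power2_sum)
  also have "\<dots> \<le> (2 + 2 * L\<^sup>2) * ((u r x - u r y)\<^sup>2 + (norm (x - y))\<^sup>2)"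
    by (simp add: power_mult_distrib algebra_simps)
  finally show ?thesis .
qed

text \<open>The test function is frozen at time r while the flux is taken at time t. Away from the
  diagonal the flux at t is exchanged for the flux at r at the price of the difference of
  \<open>far_flux\<close>, and the product rule produces dissipation minus drift. Near the diagonal
  only Young's inequality is used: it leaves the near energies at both times, which vanish with
  \<delta>.\<close>

lemma flux_testf_lower_bound:
  assumes t: "t \<in> {0<..<T}" and r: "r \<in> {0<..<T}" and \<delta>: "0 < \<delta>" "\<delta> \<le> 1"
  shows "dissip r z * indicator (far R \<delta>) z \<le> \<bar>far_flux R \<delta> (t, z) - far_flux R \<delta> (r, z)\<bar> + drift r z
     + Lam * (2 + 2 * L\<^sup>2) * (near_dens R \<delta> t z + near_dens R \<delta> r z) + flux (testf r) (t, z)"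
proof -
  obtain x y where z: "z = (x, y)" by (cases z) auto
  let ?C = "Lam * (2 + 2 * L\<^sup>2)"
  have C: "0 \<le> ?C" using Lam by auto
  have N: "0 \<le> ?C * (near_dens R \<delta> t z + near_dens R \<delta> r z)"
    by (rule mult_nonneg_nonneg[OF C]) (simp add: near_dens_nonneg)
  consider "R \<le> norm x" "R \<le> norm y" | "(x, y) \<in> near R \<delta>" | "(x, y) \<in> far R \<delta>"
    by (auto simp: near_def far_def) force+
  then show ?thesis
  proof cases
    case 1
    then have "z \<notin> far R \<delta>" by (auto simp: far_def z)
    moreover have "flux (testf r) (t, z) = 0" using W(3)[OF 1(1)] W(3)[OF 1(2)] by (simp add: flux_def z)
    ultimately show ?thesis using N drift_nonneg[of r z] by simp
  next
    case 2
    then have nf: "z \<notin> far R \<delta>" by (auto simp: far_def near_def z)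
    define A where "A = u t x - u t y"
    define B where "B = testf r x - testf r y"
    let ?J = "norm (x - y) powr (-p)"
    have "- (A * B) \<le> A\<^sup>2 + B\<^sup>2"
      using zero_le_power2[of "A + B"] zero_le_power2[of A] zero_le_power2[of B] unfolding power2_sum by linarith
    then have "- (A * B) * k t x y \<le> (A\<^sup>2 + B\<^sup>2) * k t x y"
      using k_nonneg by (intro mult_right_mono) auto
    also have "\<dots> \<le> (A\<^sup>2 + B\<^sup>2) * (Lam * ?J)" using k_le by (intro mult_left_mono) auto
    also have "\<dots> \<le> ?C * (near_dens R \<delta> t z + near_dens R \<delta> r z)"
    proof -
      have "A\<^sup>2 + B\<^sup>2 \<le> (2 + 2 * L\<^sup>2) * (A\<^sup>2 + (norm (x - y))\<^sup>2) + (2 + 2 * L\<^sup>2) * ((u r x - u r y)\<^sup>2 + (norm (x - y))\<^sup>2)"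
      proof (rule add_mono)
        show "B\<^sup>2 \<le> (2 + 2 * L\<^sup>2) * ((u r x - u r y)\<^sup>2 + (norm (x - y))\<^sup>2)" unfolding B_def by (rule testf_diff)
        have "1 * (A\<^sup>2 + (norm (x - y))\<^sup>2) \<le> (2 + 2 * L\<^sup>2) * (A\<^sup>2 + (norm (x - y))\<^sup>2)" by (intro mult_right_mono) auto
        then show "A\<^sup>2 \<le> (2 + 2 * L\<^sup>2) * (A\<^sup>2 + (norm (x - y))\<^sup>2)" by (rule order_trans[rotated]) simp
      qed
      then have "(A\<^sup>2 + B\<^sup>2) * (Lam * ?J) \<le> ((2 + 2 * L\<^sup>2) * (A\<^sup>2 + (norm (x - y))\<^sup>2) + (2 + 2 * L\<^sup>2) * ((u r x - u r y)\<^sup>2 + (norm (x - y))\<^sup>2)) * (Lam * ?J)"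
        using Lam by (intro mult_right_mono) auto
      also have "\<dots> = ?C * (near_dens R \<delta> t z + near_dens R \<delta> r z)"
        using 2 by (simp add: near_dens_def z A_def algebra_simps)
      finally show ?thesis .
    qed
    finally have "0 \<le> ?C * (near_dens R \<delta> t z + near_dens R \<delta> r z) + flux (testf r) (t, z)"
      by (simp add: flux_def z A_def B_def)
    then show ?thesis using nf drift_nonneg[of r z] by simp
  next
    case 3
    have ft: "far_flux R \<delta> (t, z) = (u t x - u t y) * k t x y" using 3 t by (simp add: far_flux_def z)
    have fr: "far_flux R \<delta> (r, z) = (u r x - u r y) * k r x y" using 3 r by (simp add: far_flux_def z)
    define B where "B = testf r x - testf r y"
    have B: "\<bar>B\<bar> \<le> 1" unfolding B_def using testf_bounds(1,2)[of r x] testf_bounds(1,2)[of r y] by linarith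
    have fl: "flux (testf r) (t, z) = far_flux R \<delta> (t, z) * B" using ft by (simp add: flux_def B_def z)
    have "\<bar>(far_flux R \<delta> (r, z) - far_flux R \<delta> (t, z)) * B\<bar> \<le> \<bar>far_flux R \<delta> (t, z) - far_flux R \<delta> (r, z)\<bar> * 1"
      unfolding abs_mult by (intro mult_mono B) auto
    then have 1: "far_flux R \<delta> (r, z) * B \<le> \<bar>far_flux R \<delta> (t, z) - far_flux R \<delta> (r, z)\<bar> + flux (testf r) (t, z)"
      unfolding fl by (simp add: algebra_simps abs_le_iff)
    define f where "f = (trunc \<alpha> (u r x) + trunc \<alpha> (u r y)) / 2"
    have f: "0 \<le> f" "f \<le> 1"
      using trunc_nonneg[OF \<alpha> u_nonneg[of r x]] trunc_nonneg[OF \<alpha> u_nonneg[of r y]] trunc_le_1[OF \<alpha>, of "u r x"] trunc_le_1[OF \<alpha>, of "u r y"]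
      by (auto simp: f_def)
    have eq: "far_flux R \<delta> (r, z) * B = dissip r z + (u r x - u r y) * (W x - W y) * k r x y * f"
      unfolding fr unfolding B_def dissip_def f_def z by (simp add: field_simps)
    have "\<bar>(u r x - u r y) * (W x - W y) * k r x y * f\<bar> \<le> drift r z * 1"
      unfolding abs_mult drift_def z using f k_nonneg by (intro mult_mono) auto
    then have "dissip r z \<le> far_flux R \<delta> (r, z) * B + drift r z" using eq by linarith
    then show ?thesis using 1 N 3 by (simp add: z)
  qed
qed

end

section \<open>One time step and its average over the end time\<close>

context nonlocal_test
begin

definition Dissip :: "real \<Rightarrow> real \<Rightarrow> ennreal" where
  "Dissip a b = (\<integral>\<^sup>+t. (\<integral>\<^sup>+z. ennreal (dissip t z) \<partial>lborel) * indicator {a<..<b} t \<partial>lborel)"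

lemma AE_regular_time:
  "AE r in lborel. r \<in> {0<..<T} \<longrightarrow> (AE x in lborel. v r x = u r x) \<and> (\<integral>\<^sup>+z. ennreal (near_dens R 1 r z) \<partial>lborel) < \<infinity>"
proof -
  have "AE r in lborel. (\<integral>\<^sup>+z. ennreal (near_dens R 1 r z) \<partial>lborel) * indicator {0<..<T} r \<noteq> \<infinity>"
    using near_energy_finite[OF R] unfolding near_energy_def by (intro nn_integral_PInf_AE) auto
  then show ?thesis using v_eq
    by eventually_elim (auto simp: less_top)
qed

text \<open>The balance identity is applied with a test function that is constant in time, namely
  \<open>testf r\<close>. Because \<open>trunc \<alpha>\<close> is the slope of a convex primitive
  at the later time, the change of the entropy is at most the pairing of the change of
  \<open>v\<close> with \<open>testf r\<close>. The equality of \<open>v r\<close> and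
  \<open>u r\<close> is used here since \<open>testf\<close> is built from \<open>u\<close>.\<close>

lemma convexity_step:
  assumes r: "0 < r'" "r' < r" "r < T"
    and good: "AE x in lborel. v r x = u r x" "(\<integral>\<^sup>+z. ennreal (near_dens R 1 r z) \<partial>lborel) < \<infinity>"
  shows "integrable lborel (\<lambda>q. indicator {r'<..<r} (fst q) * flux (testf r) q)"
    and "(\<integral>q. indicator {r'<..<r} (fst q) * flux (testf r) q \<partial>lborel)
      \<le> (\<integral>x. trunc_prim \<alpha> (v r' x) * W x \<partial>lborel) - (\<integral>x. trunc_prim \<alpha> (v r x) * W x \<partial>lborel)"
proof -
  let ?X = "\<lambda>q. indicator {r'<..<r} (fst q) * flux (testf r) q"
  have fin: "(\<integral>\<^sup>+z. ennreal ((testf r (fst z) - testf r (snd z))\<^sup>2 * norm (fst z - snd z) powr (- p)) \<partial>lborel) < \<infinity>"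
  proof (rule seminorm_finite[OF R _ testf_bounds _ testf_diff])
    show "(\<integral>\<^sup>+z. ennreal (((u r (fst z) - u r (snd z))\<^sup>2 + (norm (fst z - snd z))\<^sup>2) * norm (fst z - snd z) powr (- p)
      * indicator (near R 1) z) \<partial>lborel) < \<infinity>"
      using good(2) unfolding near_dens_def .
  qed auto
  have "integrable lborel (\<lambda>q. indicator {0<..<T} (fst q) * flux (testf r) q)"
    by (rule flux_integrable[OF R _ testf_bounds fin]) auto
  then show "integrable lborel ?X"
    by (rule Bochner_Integration.integrable_bound) (use r in \<open>auto split: split_indicator\<close>)
  have eq: "(\<integral>x. v r x * testf r x \<partial>lborel) - (\<integral>x. v r' x * testf r x \<partial>lborel) = - (\<integral>q. ?X q \<partial>lborel)"
    by (rule weak[OF r R _ testf_bounds fin]) auto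
  have t: "r \<in> {0<..<T}" "r' \<in> {0<..<T}" using r by auto
  have i1: "integrable lborel (\<lambda>x. trunc_prim \<alpha> (v t x) * W x)" if "t \<in> {0<..<T}" for t
    using that trunc_prim_le[OF \<alpha> v_nonneg] trunc_prim_nonneg[OF \<alpha> v_nonneg] W
    by (intro v_mult_integrable[OF that]) (auto simp: abs_mult intro!: mult_right_mono)
  have i2: "integrable lborel (\<lambda>x. v t x * testf r x)" if "t \<in> {0<..<T}" for t
  proof (rule v_mult_integrable[OF that])
    fix x
    have "\<bar>testf r x\<bar> \<le> 1 * W x"
      using trunc_le_1[OF \<alpha>] trunc_nonneg[OF \<alpha> u_nonneg] W unfolding abs_mult by (intro mult_mono) auto
    then show "\<bar>v t x * testf r x\<bar> \<le> v t x * W x"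
      using v_nonneg[of t x] unfolding abs_mult by (simp add: mult_left_mono)
  qed measurable
  have "(\<integral>x. trunc_prim \<alpha> (v r x) * W x - trunc_prim \<alpha> (v r' x) * W x \<partial>lborel)
     \<le> (\<integral>x. v r x * testf r x - v r' x * testf r x \<partial>lborel)"
  proof (rule integral_mono_AE)
    show "AE x in lborel. trunc_prim \<alpha> (v r x) * W x - trunc_prim \<alpha> (v r' x) * W x \<le> v r x * testf r x - v r' x * testf r x"
      using good(1)
    proof eventually_elim
      case (elim x)
      have "(trunc_prim \<alpha> (v r x) - trunc_prim \<alpha> (v r' x)) * W x \<le> (trunc \<alpha> (v r x) * (v r x - v r' x)) * W x"
        by (intro mult_right_mono trunc_prim_convex[OF \<alpha>] v_nonneg W)
      then show ?case using elim by (simp add: algebra_simps)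
    qed
  qed (use t i1 i2 in auto)
  then have "(\<integral>x. trunc_prim \<alpha> (v r x) * W x \<partial>lborel) - (\<integral>x. trunc_prim \<alpha> (v r' x) * W x \<partial>lborel) \<le> - (\<integral>q. ?X q \<partial>lborel)"
    using t i1 i2 eq by simp
  then show "(\<integral>q. ?X q \<partial>lborel)
      \<le> (\<integral>x. trunc_prim \<alpha> (v r' x) * W x \<partial>lborel) - (\<integral>x. trunc_prim \<alpha> (v r x) * W x \<partial>lborel)" by simp
qed

definition flux_diff :: "real \<Rightarrow> real \<Rightarrow> real \<Rightarrow> ennreal" where
  "flux_diff \<delta> t r = (\<integral>\<^sup>+z. ennreal \<bar>far_flux R \<delta> (t, z) - far_flux R \<delta> (r, z)\<bar> \<partial>lborel)"

definition near_slice :: "real \<Rightarrow> real \<Rightarrow> ennreal" where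
  "near_slice \<delta> t = (\<integral>\<^sup>+z. ennreal (near_dens R \<delta> t z) \<partial>lborel)"

definition drift_slice :: "real \<Rightarrow> ennreal" where
  "drift_slice t = (\<integral>\<^sup>+z. ennreal (drift t z) \<partial>lborel)"

definition dissip_slice :: "real \<Rightarrow> real \<Rightarrow> ennreal" where
  "dissip_slice \<delta> t = (\<integral>\<^sup>+z. ennreal (dissip t z) * indicator (far R \<delta>) z \<partial>lborel)"

text \<open>The family is an argument because both representatives occur: for \<open>u\<close> the
  entropy is measurable in time, for \<open>v\<close> it is continuous in time.\<close>

definition entropy :: "(real \<Rightarrow> 'a \<Rightarrow> real) \<Rightarrow> real \<Rightarrow> ennreal" where
  "entropy f t = (\<integral>\<^sup>+x. ennreal (trunc_prim \<alpha> (f t x) * W x) \<partial>lborel)"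

lemma slice_measurable [measurable]:
  "near_slice \<delta> \<in> borel_measurable borel" "drift_slice \<in> borel_measurable borel"
  "dissip_slice \<delta> \<in> borel_measurable borel" "entropy u \<in> borel_measurable borel"
  unfolding near_slice_def[abs_def] drift_slice_def[abs_def] dissip_slice_def[abs_def] entropy_def[abs_def] by measurable

lemma flux_diff_measurable [measurable (raw)]:
  assumes [measurable]: "f \<in> borel_measurable M" "g \<in> borel_measurable M"
  shows "(\<lambda>x. flux_diff \<delta> (f x) (g x)) \<in> borel_measurable M"
  unfolding flux_diff_def by measurable

text \<open>The pointwise lower bound is integrated over the time window and all pairs, and
  \<open>convexity_step\<close> bounds the flux term that appears. Quantities frozen at time r
  simply pick up the length of the window.\<close>

lemma entropy_step:
  assumes r: "0 < r'" "r' < r" "r < T" and \<delta>: "0 < \<delta>" "\<delta> \<le> 1"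
    and good: "AE x in lborel. v r x = u r x" "(\<integral>\<^sup>+z. ennreal (near_dens R 1 r z) \<partial>lborel) < \<infinity>"
  shows "ennreal (r - r') * dissip_slice \<delta> r + entropy v r
    \<le> (\<integral>\<^sup>+t. flux_diff \<delta> t r * indicator {r'<..<r} t \<partial>lborel) + ennreal (r - r') * drift_slice r
      + ennreal (Lam * (2 + 2 * L\<^sup>2)) * ((\<integral>\<^sup>+t. near_slice \<delta> t * indicator {r'<..<r} t \<partial>lborel) + ennreal (r - r') * near_slice \<delta> r)
      + entropy v r'"
proof -
  define C where "C = Lam * (2 + 2 * L\<^sup>2)"
  have C: "0 \<le> C" unfolding C_def using Lam by auto
  note lower = flux_testf_lower_bound[folded C_def]
  let ?I = "\<lambda>q :: real \<times> 'a \<times> 'a. indicator {r'<..<r} (fst q) :: real"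
  let ?E = "\<lambda>q. ?I q * (\<bar>far_flux R \<delta> (fst q, snd q) - far_flux R \<delta> (r, snd q)\<bar> + drift r (snd q)
     + C * (near_dens R \<delta> (fst q) (snd q) + near_dens R \<delta> r (snd q)))"
  let ?X = "\<lambda>q. ?I q * flux (testf r) q"
  let ?g = "\<lambda>q. ennreal (dissip r (snd q)) * indicator (far R \<delta>) (snd q) * indicator {r'<..<r} (fst q)"
  have rt: "r \<in> {0<..<T}" "r' \<in> {0<..<T}" using r by auto
  have ent: "ennreal (\<integral>x. trunc_prim \<alpha> (v t x) * W x \<partial>lborel) = entropy v t" if "t \<in> {0<..<T}" for t
    unfolding entropy_def using that trunc_prim_le[OF \<alpha> v_nonneg] trunc_prim_nonneg[OF \<alpha> v_nonneg] W
    by (intro nn_integral_eq_integral[symmetric] v_mult_integrable[OF that]) (auto simp: abs_mult intro!: mult_right_mono)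
  have pos: "0 \<le> ?E q" for q
    using drift_nonneg near_dens_nonneg C by (intro mult_nonneg_nonneg add_nonneg_nonneg) auto
  have le: "ennreal (dissip r (snd q)) * indicator (far R \<delta>) (snd q) * indicator {r'<..<r} (fst q) \<le> ennreal (?E q + ?X q)" "0 \<le> ?E q + ?X q" for q
  proof -
    obtain t z where q: "q = (t, z)" by (cases q) auto
    have "?g q \<le> ennreal (?E q + ?X q) \<and> 0 \<le> ?E q + ?X q"
    proof (cases "t \<in> {r'<..<r}")
      case True
      then have t: "t \<in> {0<..<T}" using r by auto
      have eq: "?E q + ?X q = \<bar>far_flux R \<delta> (t, z) - far_flux R \<delta> (r, z)\<bar> + drift r z
          + C * (near_dens R \<delta> t z + near_dens R \<delta> r z) + flux (testf r) (t, z)"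
        using True by (simp add: q)
      have "0 \<le> dissip r z * indicator (far R \<delta>) z" using dissip_nonneg by simp
      moreover have "?g q = ennreal (dissip r z * indicator (far R \<delta>) z)"
        using True by (simp add: q split: split_indicator)
      ultimately show ?thesis
        unfolding eq using lower[OF t rt(1) \<delta>, of z] by (auto intro!: ennreal_leI)
    qed (auto simp: q)
    then show "?g q \<le> ennreal (?E q + ?X q)" "0 \<le> ?E q + ?X q" by auto
  qed
  have ge: "0 \<le> (\<integral>x. trunc_prim \<alpha> (v t x) * W x \<partial>lborel)" for t
    using trunc_prim_nonneg[OF \<alpha> v_nonneg] W by (intro Bochner_Integration.integral_nonneg mult_nonneg_nonneg) auto
  have "?E \<in> borel_measurable lborel" by measurable
  from nn_integral_le_add_integral[OF convexity_step(1)[OF r good] this pos le convexity_step(2)[OF r good] ge ge]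
  have "(\<integral>\<^sup>+q. ?g q \<partial>lborel) + ennreal (\<integral>x. trunc_prim \<alpha> (v r x) * W x \<partial>lborel)
     \<le> (\<integral>\<^sup>+q. ennreal (?E q) \<partial>lborel) + ennreal (\<integral>x. trunc_prim \<alpha> (v r' x) * W x \<partial>lborel)" .
  moreover have "(\<integral>\<^sup>+q. ?g q \<partial>lborel) = ennreal (r - r') * dissip_slice \<delta> r"
  proof -
    have "(\<integral>\<^sup>+q. ?g q \<partial>lborel) = (\<integral>\<^sup>+t. dissip_slice \<delta> r * indicator {r'<..<r} t \<partial>lborel)"
      by (subst nn_integral_lborel_pair) (auto simp: nn_integral_multc dissip_slice_def)
    also have "\<dots> = dissip_slice \<delta> r * ennreal (r - r')"
      by (subst nn_integral_cmult_indicator) (use r in auto)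
    finally show ?thesis by (simp add: mult.commute)
  qed
  moreover have "(\<integral>\<^sup>+q. ennreal (?E q) \<partial>lborel) = (\<integral>\<^sup>+t. flux_diff \<delta> t r * indicator {r'<..<r} t \<partial>lborel) + ennreal (r - r') * drift_slice r
      + ennreal C * ((\<integral>\<^sup>+t. near_slice \<delta> t * indicator {r'<..<r} t \<partial>lborel) + ennreal (r - r') * near_slice \<delta> r)"
  proof -
    let ?F = "\<lambda>q. (ennreal \<bar>far_flux R \<delta> (fst q, snd q) - far_flux R \<delta> (r, snd q)\<bar> + ennreal (drift r (snd q))
      + ennreal C * (ennreal (near_dens R \<delta> (fst q) (snd q)) + ennreal (near_dens R \<delta> r (snd q)))) * indicator {r'<..<r} (fst q)"
    have "ennreal (?E q) = (ennreal \<bar>far_flux R \<delta> (fst q, snd q) - far_flux R \<delta> (r, snd q)\<bar> + ennreal (drift r (snd q))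
      + ennreal C * (ennreal (near_dens R \<delta> (fst q) (snd q)) + ennreal (near_dens R \<delta> r (snd q)))) * indicator {r'<..<r} (fst q)" for q
      using C drift_nonneg near_dens_nonneg
      by (auto simp: ennreal_mult[symmetric] ennreal_plus[symmetric] split: split_indicator simp del: ennreal_plus)
    then have "(\<integral>\<^sup>+q. ennreal (?E q) \<partial>lborel) = (\<integral>\<^sup>+q. ?F q \<partial>lborel)"
      by (intro nn_integral_cong)
    also have "\<dots> = (\<integral>\<^sup>+t. (flux_diff \<delta> t r + drift_slice r + ennreal C * (near_slice \<delta> t + near_slice \<delta> r)) * indicator {r'<..<r} t \<partial>lborel)"
      by (subst nn_integral_lborel_pair)
        (auto simp: nn_integral_multc nn_integral_add nn_integral_cmult flux_diff_def near_slice_def drift_slice_def)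
    also have "\<dots> = (\<integral>\<^sup>+t. flux_diff \<delta> t r * indicator {r'<..<r} t + drift_slice r * indicator {r'<..<r} t
       + ennreal C * (near_slice \<delta> t * indicator {r'<..<r} t + near_slice \<delta> r * indicator {r'<..<r} t) \<partial>lborel)"
      by (intro nn_integral_cong) (auto split: split_indicator)
    also have "\<dots> = (\<integral>\<^sup>+t. flux_diff \<delta> t r * indicator {r'<..<r} t \<partial>lborel) + ennreal (r - r') * drift_slice r
      + ennreal C * ((\<integral>\<^sup>+t. near_slice \<delta> t * indicator {r'<..<r} t \<partial>lborel) + ennreal (r - r') * near_slice \<delta> r)"
      using r by (simp add: nn_integral_add nn_integral_cmult nn_integral_cmult_indicator mult.commute[of "ennreal (r - r')"])
    finally show ?thesis .
  qed
  ultimately show ?thesis unfolding C_def[symmetric] using ent[OF rt(1)] ent[OF rt(2)] by simp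
qed

lemma nn_integral_reflect_window:
  fixes f :: "real \<Rightarrow> ennreal"
  assumes [measurable]: "f \<in> borel_measurable borel"
  shows "(\<integral>\<^sup>+t. f t * indicator {r - h<..<r} t \<partial>lborel) = (\<integral>\<^sup>+\<sigma>. f (r - \<sigma>) * indicator {0<..<h} \<sigma> \<partial>lborel)"
proof -
  have "(\<integral>\<^sup>+t. f t * indicator {r - h<..<r} t \<partial>lborel) = (\<integral>\<^sup>+\<sigma>. f (r + -1 * \<sigma>) * indicator {r - h<..<r} (r + -1 * \<sigma>) \<partial>lborel)"
    by (subst nn_integral_real_affine[where c="-1" and t=r]) auto
  also have "\<dots> = (\<integral>\<^sup>+\<sigma>. f (r - \<sigma>) * indicator {0<..<h} \<sigma> \<partial>lborel)"
    by (intro nn_integral_cong) (auto split: split_indicator)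
  finally show ?thesis .
qed

lemma AE_lborel_shift:
  fixes h :: real
  assumes "AE r in lborel. Q r"
  shows "AE r in lborel. Q (r - h)"
proof -
  have "AE r in distr lborel borel ((+) (- h)). Q r" by (subst lborel_distr_plus) (rule assms)
  then have "AE r in lborel. Q (- h + r)" by (rule AE_distrD[rotated]) auto
  then show ?thesis by (simp add: algebra_simps)
qed

text \<open>\<open>entropy_step\<close> with \<open>r' = r - h\<close> is integrated over the end
  time. Exchanging the end time r with the lag \<sigma> = r - t puts the flux error into the form of
  an L1 norm of a translate in time, and makes the near energies at both times integrate to at most
  \<open>near_energy\<close>. The average sees only almost every time, so \<open>u\<close> replaces
  \<open>v\<close>.\<close>

lemma entropy_averaged:
  assumes ab: "0 < h" "h < a" "a < b" "b < T" and \<delta>: "0 < \<delta>" "\<delta> \<le> 1"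
  shows "ennreal h * (\<integral>\<^sup>+r. dissip_slice \<delta> r * indicator {a<..<b} r \<partial>lborel) + (\<integral>\<^sup>+r. entropy u r * indicator {a<..<b} r \<partial>lborel)
    \<le> (\<integral>\<^sup>+r. entropy u (r - h) * indicator {a<..<b} r \<partial>lborel)
      + (\<integral>\<^sup>+\<sigma>. (\<integral>\<^sup>+r. flux_diff \<delta> (r - \<sigma>) r * indicator {a<..<b} r \<partial>lborel) * indicator {0<..<h} \<sigma> \<partial>lborel)
      + ennreal h * Drift a b + ennreal (Lam * (2 + 2 * L\<^sup>2)) * (2 * ennreal h * near_energy R \<delta>)"
proof -
  let ?C = "ennreal (Lam * (2 + 2 * L\<^sup>2))"
  let ?I = "indicator {a<..<b} :: real \<Rightarrow> ennreal" and ?H = "indicator {0<..<h} :: real \<Rightarrow> ennreal"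
  let ?S1 = "\<lambda>r. \<integral>\<^sup>+\<sigma>. flux_diff \<delta> (r - \<sigma>) r * ?H \<sigma> \<partial>lborel"
  let ?S2 = "\<lambda>r. \<integral>\<^sup>+\<sigma>. near_slice \<delta> (r - \<sigma>) * ?H \<sigma> \<partial>lborel"
  have eu: "entropy v r = entropy u r" if "AE x in lborel. v r x = u r x" for r
    unfolding entropy_def using that by (intro nn_integral_cong_AE) auto
  have "AE r in lborel. (ennreal h * dissip_slice \<delta> r + entropy u r) * ?I r
      \<le> (entropy u (r - h) + ?S1 r + ennreal h * drift_slice r + ?C * (?S2 r + ennreal h * near_slice \<delta> r)) * ?I r"
    using AE_regular_time AE_lborel_shift[OF v_eq, of h]
  proof eventually_elim
    case (elim r)
    show ?case
    proof (cases "r \<in> {a<..<b}")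
      case True
      then have r: "0 < r - h" "r - h < r" "r < T" using ab by auto
      have g: "AE x in lborel. v r x = u r x" "(\<integral>\<^sup>+z. ennreal (near_dens R 1 r z) \<partial>lborel) < \<infinity>" "AE x in lborel. v (r - h) x = u (r - h) x"
        using elim r ab by auto
      show ?thesis
        using entropy_step[OF r \<delta> g(1,2)] True eu[OF g(1)] eu[OF g(3)]
        by (simp add: nn_integral_reflect_window add_ac)
    qed simp
  qed
  then have "(\<integral>\<^sup>+r. (ennreal h * dissip_slice \<delta> r + entropy u r) * ?I r \<partial>lborel)
     \<le> (\<integral>\<^sup>+r. (entropy u (r - h) + ?S1 r + ennreal h * drift_slice r + ?C * (?S2 r + ennreal h * near_slice \<delta> r)) * ?I r \<partial>lborel)"
    by (rule nn_integral_mono_AE)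
  also have "(\<integral>\<^sup>+r. (ennreal h * dissip_slice \<delta> r + entropy u r) * ?I r \<partial>lborel)
     = (\<integral>\<^sup>+r. ennreal h * (dissip_slice \<delta> r * ?I r) + entropy u r * ?I r \<partial>lborel)"
    by (intro nn_integral_cong) (auto split: split_indicator)
  also have "\<dots> = ennreal h * (\<integral>\<^sup>+r. dissip_slice \<delta> r * ?I r \<partial>lborel) + (\<integral>\<^sup>+r. entropy u r * ?I r \<partial>lborel)"
    by (simp add: nn_integral_add nn_integral_cmult)
  also have "(\<integral>\<^sup>+r. (entropy u (r - h) + ?S1 r + ennreal h * drift_slice r + ?C * (?S2 r + ennreal h * near_slice \<delta> r)) * ?I r \<partial>lborel)
    = (\<integral>\<^sup>+r. entropy u (r - h) * ?I r + ?S1 r * ?I r + ennreal h * (drift_slice r * ?I r) + ?C * (?S2 r * ?I r + ennreal h * (near_slice \<delta> r * ?I r)) \<partial>lborel)"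
    by (intro nn_integral_cong) (auto split: split_indicator)
  also have "\<dots> = (\<integral>\<^sup>+r. entropy u (r - h) * ?I r \<partial>lborel) + (\<integral>\<^sup>+r. ?S1 r * ?I r \<partial>lborel) + ennreal h * Drift a b
      + ?C * ((\<integral>\<^sup>+r. ?S2 r * ?I r \<partial>lborel) + ennreal h * (\<integral>\<^sup>+r. near_slice \<delta> r * ?I r \<partial>lborel))"
    by (simp add: nn_integral_add nn_integral_cmult Drift_def drift_slice_def)
  also have "(\<integral>\<^sup>+r. ?S1 r * ?I r \<partial>lborel) = (\<integral>\<^sup>+\<sigma>. (\<integral>\<^sup>+r. flux_diff \<delta> (r - \<sigma>) r * ?I r \<partial>lborel) * ?H \<sigma> \<partial>lborel)"
  proof -
    have "(\<integral>\<^sup>+r. ?S1 r * ?I r \<partial>lborel) = (\<integral>\<^sup>+r. \<integral>\<^sup>+\<sigma>. flux_diff \<delta> (r - \<sigma>) r * ?H \<sigma> * ?I r \<partial>lborel \<partial>lborel)"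
      by (simp add: nn_integral_multc)
    also have "\<dots> = (\<integral>\<^sup>+\<sigma>. \<integral>\<^sup>+r. flux_diff \<delta> (r - \<sigma>) r * ?H \<sigma> * ?I r \<partial>lborel \<partial>lborel)"
      by (rule lborel_pair.Fubini') measurable
    also have "\<dots> = (\<integral>\<^sup>+\<sigma>. (\<integral>\<^sup>+r. flux_diff \<delta> (r - \<sigma>) r * ?I r \<partial>lborel) * ?H \<sigma> \<partial>lborel)"
      by (subst nn_integral_multc[symmetric]) (auto simp: mult_ac)
    finally show ?thesis .
  qed
  also have "(\<integral>\<^sup>+r. ?S2 r * ?I r \<partial>lborel) + ennreal h * (\<integral>\<^sup>+r. near_slice \<delta> r * ?I r \<partial>lborel) \<le> 2 * ennreal h * near_energy R \<delta>"
  proof -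
    have NE: "near_energy R \<delta> = (\<integral>\<^sup>+t. near_slice \<delta> t * indicator {0<..<T} t \<partial>lborel)"
      by (simp add: near_energy_def near_slice_def)
    have "(\<integral>\<^sup>+r. ?S2 r * ?I r \<partial>lborel) = (\<integral>\<^sup>+r. \<integral>\<^sup>+\<sigma>. near_slice \<delta> (r - \<sigma>) * ?H \<sigma> * ?I r \<partial>lborel \<partial>lborel)"
      by (simp add: nn_integral_multc)
    also have "\<dots> = (\<integral>\<^sup>+\<sigma>. \<integral>\<^sup>+r. near_slice \<delta> (r - \<sigma>) * ?H \<sigma> * ?I r \<partial>lborel \<partial>lborel)"
      by (rule lborel_pair.Fubini') measurable
    also have "\<dots> \<le> (\<integral>\<^sup>+\<sigma>. near_energy R \<delta> * ?H \<sigma> \<partial>lborel)"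
    proof (rule nn_integral_mono)
      fix \<sigma>
      have "(\<integral>\<^sup>+r. near_slice \<delta> (r - \<sigma>) * ?H \<sigma> * ?I r \<partial>lborel)
         \<le> (\<integral>\<^sup>+r. (near_slice \<delta> (r - \<sigma>) * indicator {0<..<T} (r - \<sigma>)) * ?H \<sigma> \<partial>lborel)"
        using ab by (intro nn_integral_mono) (auto split: split_indicator)
      also have "\<dots> = (\<integral>\<^sup>+r. near_slice \<delta> (r - \<sigma>) * indicator {0<..<T} (r - \<sigma>) \<partial>lborel) * ?H \<sigma>"
        by (rule nn_integral_multc) measurable
      also have "(\<integral>\<^sup>+r. near_slice \<delta> (r - \<sigma>) * indicator {0<..<T} (r - \<sigma>) \<partial>lborel) = near_energy R \<delta>"
        unfolding NE by (rule nn_integral_lborel_translate) measurable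
      finally show "(\<integral>\<^sup>+r. near_slice \<delta> (r - \<sigma>) * ?H \<sigma> * ?I r \<partial>lborel) \<le> near_energy R \<delta> * ?H \<sigma>" .
    qed
    also have "\<dots> = ennreal h * near_energy R \<delta>"
      using ab by (subst nn_integral_cmult_indicator) (auto simp: mult.commute)
    finally have 1: "(\<integral>\<^sup>+r. ?S2 r * ?I r \<partial>lborel) \<le> ennreal h * near_energy R \<delta>" .
    have 2: "(\<integral>\<^sup>+r. near_slice \<delta> r * ?I r \<partial>lborel) \<le> near_energy R \<delta>"
      unfolding NE using ab by (intro nn_integral_mono) (auto split: split_indicator)
    show ?thesis using add_mono[OF 1 mult_left_mono[OF 2, of "ennreal h"]] by (simp add: mult_2 ring_distribs)
  qed
  finally show ?thesis by (simp add: add_left_mono mult_left_mono)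
qed

end

section \<open>Limits in the time lag and in the distance to the diagonal\<close>

context nonlocal_test
begin

lemma entropy_diff_le:
  "entropy v r \<le> entropy v t + (\<integral>\<^sup>+x. ennreal \<bar>v r x - v t x\<bar> * indicator (ball 0 R) x \<partial>lborel)"
proof -
  have "entropy v r \<le> (\<integral>\<^sup>+x. ennreal (trunc_prim \<alpha> (v t x) * W x) + ennreal \<bar>v r x - v t x\<bar> * indicator (ball 0 R) x \<partial>lborel)"
    unfolding entropy_def
  proof (rule nn_integral_mono)
    fix x
    show "ennreal (trunc_prim \<alpha> (v r x) * W x) \<le> ennreal (trunc_prim \<alpha> (v t x) * W x) + ennreal \<bar>v r x - v t x\<bar> * indicator (ball 0 R) x"
    proof (cases "x \<in> ball 0 R")
      case True
      have "\<bar>trunc_prim \<alpha> (v r x) - trunc_prim \<alpha> (v t x)\<bar> * W x \<le> \<bar>v r x - v t x\<bar> * 1"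
        using W by (intro mult_mono trunc_prim_lipschitz[OF \<alpha>] v_nonneg) auto
      moreover have "(trunc_prim \<alpha> (v r x) - trunc_prim \<alpha> (v t x)) * W x \<le> \<bar>trunc_prim \<alpha> (v r x) - trunc_prim \<alpha> (v t x)\<bar> * W x"
        using W by (intro mult_right_mono) auto
      ultimately have "trunc_prim \<alpha> (v r x) * W x \<le> trunc_prim \<alpha> (v t x) * W x + \<bar>v r x - v t x\<bar>"
        by (simp add: left_diff_distrib)
      then have "ennreal (trunc_prim \<alpha> (v r x) * W x) \<le> ennreal (trunc_prim \<alpha> (v t x) * W x + \<bar>v r x - v t x\<bar>)"
        by (rule ennreal_leI)
      also have "\<dots> = ennreal (trunc_prim \<alpha> (v t x) * W x) + ennreal \<bar>v r x - v t x\<bar>"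
        using W trunc_prim_nonneg[OF \<alpha> v_nonneg] by (intro ennreal_plus) auto
      finally show ?thesis using True by simp
    qed (use W(3) in \<open>auto simp: not_less\<close>)
  qed
  also have "\<dots> = entropy v t + (\<integral>\<^sup>+x. ennreal \<bar>v r x - v t x\<bar> * indicator (ball 0 R) x \<partial>lborel)"
    unfolding entropy_def by (rule nn_integral_add) measurable
  finally show ?thesis .
qed

lemma entropy_continuous:
  assumes t: "t \<in> {0<..<T}" and \<epsilon>: "0 < \<epsilon>"
  obtains h where "0 < h" "\<And>r. \<bar>r - t\<bar> < h \<Longrightarrow> entropy v r \<le> entropy v t + ennreal \<epsilon>"
    "\<And>r. \<bar>r - t\<bar> < h \<Longrightarrow> entropy v t \<le> entropy v r + ennreal \<epsilon>"
proof -
  have "eventually (\<lambda>r. (\<integral>\<^sup>+x. ennreal \<bar>v r x - v t x\<bar> * indicator (ball 0 R) x \<partial>lborel) < ennreal \<epsilon>) (at t)"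
    using v_L1_tendsto[OF t R] \<epsilon> by (intro order_tendstoD(2)) auto
  then obtain h where h: "0 < h" "\<And>r. r \<noteq> t \<Longrightarrow> dist r t < h \<Longrightarrow> (\<integral>\<^sup>+x. ennreal \<bar>v r x - v t x\<bar> * indicator (ball 0 R) x \<partial>lborel) < ennreal \<epsilon>"
    unfolding eventually_at by auto
  show ?thesis
  proof (rule that[OF h(1)])
    fix r assume r: "\<bar>r - t\<bar> < h"
    show "entropy v r \<le> entropy v t + ennreal \<epsilon>"
    proof (cases "r = t")
      case False
      then show ?thesis using h(2)[of r] r
        by (intro order_trans[OF entropy_diff_le[of r t] add_left_mono]) (auto simp: dist_real_def)
    qed simp
    show "entropy v t \<le> entropy v r + ennreal \<epsilon>"
    proof (cases "r = t")
      case False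
      then show ?thesis using h(2)[of r] r
        by (intro order_trans[OF entropy_diff_le[of t r] add_left_mono]) (auto simp: dist_real_def abs_minus_commute)
    qed simp
  qed
qed

lemma flux_diff_small:
  assumes \<delta>: "0 < \<delta>" "\<delta> \<le> 1" and \<epsilon>: "0 < \<epsilon>"
  obtains h where "0 < h" "\<And>\<sigma>. 0 < \<sigma> \<Longrightarrow> \<sigma> < h \<Longrightarrow> (\<integral>\<^sup>+r. flux_diff \<delta> (r - \<sigma>) r * indicator {a<..<b} r \<partial>lborel) \<le> ennreal \<epsilon>"
proof (rule ccontr)
  assume "\<not> thesis"
  \<comment> \<open>Continuity of translations is available along sequences, so the failure of the
    claim is turned into a sequence of lags tending to 0.\<close>
  then have ex: "\<exists>\<sigma>. 0 < \<sigma> \<and> \<sigma> < 1 / real (Suc n) \<and> \<not> (\<integral>\<^sup>+r. flux_diff \<delta> (r - \<sigma>) r * indicator {a<..<b} r \<partial>lborel) \<le> ennreal \<epsilon>" for n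
    using that[of "1 / real (Suc n)"] by auto
  then obtain \<sigma> where \<sigma>: "\<And>n. 0 < \<sigma> n" "\<And>n. \<sigma> n < 1 / real (Suc n)"
    "\<And>n. \<not> (\<integral>\<^sup>+r. flux_diff \<delta> (r - \<sigma> n) r * indicator {a<..<b} r \<partial>lborel) \<le> ennreal \<epsilon>"
    by metis
  have "\<sigma> \<longlonglongrightarrow> 0"
  proof (rule tendsto_sandwich[of "\<lambda>_. 0"])
    show "eventually (\<lambda>n. 0 \<le> \<sigma> n) sequentially" "eventually (\<lambda>n. \<sigma> n \<le> 1 / real (Suc n)) sequentially"
      using \<sigma>(1,2) by (auto intro!: always_eventually less_imp_le)
    show "(\<lambda>n. 1 / real (Suc n)) \<longlonglongrightarrow> 0" using LIMSEQ_inverse_real_of_nat by (simp add: inverse_eq_divide)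
  qed auto
  then have "(\<lambda>n. (\<sigma> n, 0 :: 'a \<times> 'a)) \<longlonglongrightarrow> (0, 0)" by (intro tendsto_Pair) auto
  then have e: "(\<lambda>n. (\<sigma> n, 0 :: 'a \<times> 'a)) \<longlonglongrightarrow> 0" by (simp add: zero_prod_def)
  have "(\<lambda>n. \<integral>\<^sup>+q. ennreal \<bar>far_flux R \<delta> (q - (\<sigma> n, 0)) - far_flux R \<delta> q\<bar> \<partial>lborel) \<longlonglongrightarrow> 0"
    using R \<delta> by (intro tendsto_translate_L1[OF _ e] far_flux_integrable) auto
  then have "eventually (\<lambda>n. (\<integral>\<^sup>+q. ennreal \<bar>far_flux R \<delta> (q - (\<sigma> n, 0)) - far_flux R \<delta> q\<bar> \<partial>lborel) < ennreal \<epsilon>) sequentially"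
    using \<epsilon> by (intro order_tendstoD(2)) auto
  then obtain n where n: "(\<integral>\<^sup>+q. ennreal \<bar>far_flux R \<delta> (q - (\<sigma> n, 0)) - far_flux R \<delta> q\<bar> \<partial>lborel) < ennreal \<epsilon>"
    by (auto simp: eventually_sequentially)
  have "(\<integral>\<^sup>+r. flux_diff \<delta> (r - \<sigma> n) r * indicator {a<..<b} r \<partial>lborel) \<le> (\<integral>\<^sup>+r. flux_diff \<delta> (r - \<sigma> n) r \<partial>lborel)"
    by (intro nn_integral_mono) (auto split: split_indicator)
  also have "\<dots> = (\<integral>\<^sup>+q. ennreal \<bar>far_flux R \<delta> (q - (\<sigma> n, 0)) - far_flux R \<delta> q\<bar> \<partial>lborel)"
    unfolding flux_diff_def by (subst nn_integral_lborel_pair) auto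
  finally show False using n \<sigma>(3)[of n] by simp
qed

text \<open>The entropy is at most the mass on the ball, where the weight is bounded below.
  Finiteness is what permits cancelling the common time integral in the next estimate.\<close>

lemma entropy_u_integral_finite:
  "(\<integral>\<^sup>+r. entropy u r * indicator {0<..<T} r \<partial>lborel) < \<infinity>"
proof -
  have le: "entropy u r \<le> ennreal ((1 + R) powr p) * (\<integral>\<^sup>+x. ennreal (u r x) * ennreal ((1 + norm x) powr (- p)) \<partial>lborel)" for r
  proof -
    have "entropy u r \<le> (\<integral>\<^sup>+x. ennreal ((1 + R) powr p) * (ennreal (u r x) * ennreal ((1 + norm x) powr (- p))) \<partial>lborel)"
      unfolding entropy_def
    proof (rule nn_integral_mono)
      fix x
      show "ennreal (trunc_prim \<alpha> (u r x) * W x) \<le> ennreal ((1 + R) powr p) * (ennreal (u r x) * ennreal ((1 + norm x) powr (- p)))"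
      proof (cases "R \<le> norm x")
        case False
        have "(1 + R) powr p * (1 + R) powr (-p) \<le> (1 + R) powr p * (1 + norm x) powr (-p)"
          using False d_p by (intro mult_left_mono powr_mono2') (auto simp: add_pos_nonneg)
        moreover have "(1 + R) powr p * (1 + R) powr (-p) = 1" using R by (subst powr_add[symmetric]) simp
        ultimately have 1: "1 \<le> (1 + R) powr p * (1 + norm x) powr (-p)" by simp
        have "trunc_prim \<alpha> (u r x) * W x \<le> u r x * 1"
          using W u_nonneg by (intro mult_mono trunc_prim_le[OF \<alpha>]) auto
        also have "\<dots> \<le> u r x * ((1 + R) powr p * (1 + norm x) powr (-p))" using 1 u_nonneg by (intro mult_left_mono) auto
        finally have "ennreal (trunc_prim \<alpha> (u r x) * W x) \<le> ennreal (u r x * ((1 + R) powr p * (1 + norm x) powr (-p)))"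
          by (rule ennreal_leI)
        also have "\<dots> = ennreal ((1 + R) powr p) * (ennreal (u r x) * ennreal ((1 + norm x) powr (- p)))"
          using u_nonneg by (simp add: ennreal_mult mult_ac)
        finally show ?thesis .
      qed (simp add: W(3))
    qed
    then show ?thesis by (subst (asm) nn_integral_cmult) auto
  qed
  have "(\<integral>\<^sup>+r. entropy u r * indicator {0<..<T} r \<partial>lborel)
     \<le> (\<integral>\<^sup>+r. ennreal ((1 + R) powr p) * ((\<integral>\<^sup>+x. ennreal (u r x) * ennreal ((1 + norm x) powr (- p)) \<partial>lborel) * indicator {0<..<T} r) \<partial>lborel)"
    using le by (intro nn_integral_mono) (auto split: split_indicator)
  also have "\<dots> < \<infinity>" using u_tail by (subst nn_integral_cmult) (auto simp: ennreal_mult_less_top)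
  finally show ?thesis .
qed

text \<open>The time integrals of the entropy over (a, b) and over its translate by h share the part
  over (a, b - h). What remains are windows of length h next to b and next to a, where continuity in
  time replaces the entropy by its end value up to \<epsilon>; division by h then gives the claim.
  Each of the two windows and the flux error contributes one \<epsilon>.\<close>

lemma entropy_inequality_approx:
  assumes ab: "0 < a" "a < b" "b < T" and \<delta>: "0 < \<delta>" "\<delta> \<le> 1" and \<epsilon>: "0 < \<epsilon>"
  shows "(\<integral>\<^sup>+r. dissip_slice \<delta> r * indicator {a<..<b} r \<partial>lborel) + entropy v b
    \<le> entropy v a + Drift a b + ennreal (Lam * (2 + 2 * L\<^sup>2)) * (2 * near_energy R \<delta>) + 3 * ennreal \<epsilon>"
proof -
  let ?C = "ennreal (Lam * (2 + 2 * L\<^sup>2))"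
  let ?P = "\<integral>\<^sup>+r. dissip_slice \<delta> r * indicator {a<..<b} r \<partial>lborel"
  have tab: "a \<in> {0<..<T}" "b \<in> {0<..<T}" using ab by auto
  obtain h1 where h1: "0 < h1" "\<And>r. \<bar>r - a\<bar> < h1 \<Longrightarrow> entropy v r \<le> entropy v a + ennreal \<epsilon>"
    by (rule entropy_continuous[OF tab(1) \<epsilon>], rule that)
  obtain h2 where h2: "0 < h2" "\<And>r. \<bar>r - b\<bar> < h2 \<Longrightarrow> entropy v b \<le> entropy v r + ennreal \<epsilon>"
    by (rule entropy_continuous[OF tab(2) \<epsilon>], rule that)
  obtain h3 where h3: "0 < h3" "\<And>\<sigma>. 0 < \<sigma> \<Longrightarrow> \<sigma> < h3 \<Longrightarrow> (\<integral>\<^sup>+r. flux_diff \<delta> (r - \<sigma>) r * indicator {a<..<b} r \<partial>lborel) \<le> ennreal \<epsilon>"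
    by (rule flux_diff_small[OF \<delta> \<epsilon>, of a b], rule that)
  define h where "h = Min {h1, h2, h3, a / 2, (b - a) / 2}"
  have h: "0 < h" "h \<le> h1" "h \<le> h2" "h \<le> h3" "h < a" "h < b - a"
  proof -
    have "h \<le> a / 2" "h \<le> (b - a) / 2" unfolding h_def by (intro Min_le; simp)+
    then show "h < a" "h < b - a" using ab by auto
  qed (use h1 h2 h3 ab in \<open>auto simp: h_def\<close>)
  \<comment> \<open>The common part of the two time integrals, to be cancelled.\<close>
  define M where "M = (\<integral>\<^sup>+r. entropy u r * indicator {a<..<b - h} r \<partial>lborel)"
  have "M \<le> (\<integral>\<^sup>+r. entropy u r * indicator {0<..<T} r \<partial>lborel)"
    unfolding M_def using ab h by (intro nn_integral_mono) (auto split: split_indicator)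
  then have M: "M < \<infinity>" using entropy_u_integral_finite by (rule le_less_trans)
  have eu: "AE r in lborel. r \<in> {0<..<T} \<longrightarrow> entropy v r = entropy u r"
    using v_eq unfolding entropy_def by eventually_elim (auto intro!: nn_integral_cong_AE)
  have i: "M + ennreal h * entropy v b \<le> (\<integral>\<^sup>+r. entropy u r * indicator {a<..<b} r \<partial>lborel) + ennreal h * ennreal \<epsilon>"
  proof -
    have "ennreal h * entropy v b = (\<integral>\<^sup>+r. entropy v b * indicator {b - h<..<b} r \<partial>lborel)"
      by (subst nn_integral_cmult_indicator) (use h in \<open>auto simp: mult.commute\<close>)
    also have "\<dots> \<le> (\<integral>\<^sup>+r. entropy u r * indicator {b - h<..<b} r + ennreal \<epsilon> * indicator {b - h<..<b} r \<partial>lborel)"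
    proof (rule nn_integral_mono_AE)
      show "AE r in lborel. entropy v b * indicator {b - h<..<b} r \<le> entropy u r * indicator {b - h<..<b} r + ennreal \<epsilon> * indicator {b - h<..<b} r"
        using eu
      proof eventually_elim
        case (elim r)
        show ?case
        proof (cases "r \<in> {b - h<..<b}")
          case True
          then have "\<bar>r - b\<bar> < h2" "r \<in> {0<..<T}" using h ab by auto
          then show ?thesis using h2(2)[of r] elim True by simp
        qed simp
      qed
    qed
    also have "\<dots> = (\<integral>\<^sup>+r. entropy u r * indicator {b - h<..<b} r \<partial>lborel) + ennreal h * ennreal \<epsilon>"
      using h by (simp add: nn_integral_add nn_integral_cmult_indicator mult.commute[of "ennreal h"])
    finally have "M + ennreal h * entropy v b \<le> M + ((\<integral>\<^sup>+r. entropy u r * indicator {b - h<..<b} r \<partial>lborel) + ennreal h * ennreal \<epsilon>)"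
      by (rule add_left_mono)
    also have "\<dots> = (\<integral>\<^sup>+r. entropy u r * indicator {a<..<b - h} r + entropy u r * indicator {b - h<..<b} r \<partial>lborel) + ennreal h * ennreal \<epsilon>"
      unfolding M_def by (simp add: nn_integral_add add_ac)
    also have "\<dots> \<le> (\<integral>\<^sup>+r. entropy u r * indicator {a<..<b} r \<partial>lborel) + ennreal h * ennreal \<epsilon>"
      using h by (intro add_right_mono nn_integral_mono) (auto split: split_indicator)
    finally show ?thesis .
  qed
  have ii: "(\<integral>\<^sup>+r. entropy u (r - h) * indicator {a<..<b} r \<partial>lborel) \<le> ennreal h * (entropy v a + ennreal \<epsilon>) + M"
  proof -
    have "(\<integral>\<^sup>+r. entropy u (r - h) * indicator {a<..<b} r \<partial>lborel) = (\<integral>\<^sup>+r. entropy u (r - h) * indicator {a - h<..<b - h} (r - h) \<partial>lborel)"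
      by (intro nn_integral_cong) (auto split: split_indicator)
    also have "\<dots> = (\<integral>\<^sup>+r. entropy u r * indicator {a - h<..<b - h} r \<partial>lborel)"
      by (rule nn_integral_lborel_translate[of "\<lambda>r. entropy u r * indicator {a - h<..<b - h} r"]) measurable
    also have "\<dots> \<le> (\<integral>\<^sup>+r. (entropy v a + ennreal \<epsilon>) * indicator {a - h<..<a} r + entropy u r * indicator {a<..<b - h} r \<partial>lborel)"
    proof (rule nn_integral_mono_AE)
      show "AE r in lborel. entropy u r * indicator {a - h<..<b - h} r \<le> (entropy v a + ennreal \<epsilon>) * indicator {a - h<..<a} r + entropy u r * indicator {a<..<b - h} r"
        using eu AE_lborel_singleton[of a]
      proof eventually_elim
        case (elim r)
        show ?case
        proof (cases "r \<in> {a - h<..<a}")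
          case True
          then have "\<bar>r - a\<bar> < h1" "r \<in> {0<..<T}" using h ab by auto
          then show ?thesis using h1(2)[of r] elim True by (simp split: split_indicator)
        qed (use elim in \<open>auto split: split_indicator\<close>)
      qed
    qed
    also have "\<dots> = ennreal h * (entropy v a + ennreal \<epsilon>) + M"
      using h by (simp add: M_def nn_integral_add nn_integral_cmult_indicator mult.commute[of "ennreal h"])
    finally show ?thesis .
  qed
  have iii: "(\<integral>\<^sup>+\<sigma>. (\<integral>\<^sup>+r. flux_diff \<delta> (r - \<sigma>) r * indicator {a<..<b} r \<partial>lborel) * indicator {0<..<h} \<sigma> \<partial>lborel) \<le> ennreal h * ennreal \<epsilon>"
  proof -
    have "(\<integral>\<^sup>+\<sigma>. (\<integral>\<^sup>+r. flux_diff \<delta> (r - \<sigma>) r * indicator {a<..<b} r \<partial>lborel) * indicator {0<..<h} \<sigma> \<partial>lborel)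
      \<le> (\<integral>\<^sup>+\<sigma>. ennreal \<epsilon> * indicator {0<..<h} \<sigma> \<partial>lborel)"
      using h3(2) h(4) by (intro nn_integral_mono) (auto split: split_indicator)
    also have "\<dots> = ennreal h * ennreal \<epsilon>"
      by (subst nn_integral_cmult_indicator) (use h in \<open>auto simp: mult.commute\<close>)
    finally show ?thesis .
  qed
  have "M + ennreal h * (?P + entropy v b) = ennreal h * ?P + (M + ennreal h * entropy v b)"
    by (simp add: ring_distribs add_ac)
  also have "\<dots> \<le> ennreal h * ?P + ((\<integral>\<^sup>+r. entropy u r * indicator {a<..<b} r \<partial>lborel) + ennreal h * ennreal \<epsilon>)"
    by (intro add_left_mono i)
  also have "\<dots> = (ennreal h * ?P + (\<integral>\<^sup>+r. entropy u r * indicator {a<..<b} r \<partial>lborel)) + ennreal h * ennreal \<epsilon>"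
    by (simp add: add_ac)
  also have "\<dots> \<le> ((\<integral>\<^sup>+r. entropy u (r - h) * indicator {a<..<b} r \<partial>lborel)
      + (\<integral>\<^sup>+\<sigma>. (\<integral>\<^sup>+r. flux_diff \<delta> (r - \<sigma>) r * indicator {a<..<b} r \<partial>lborel) * indicator {0<..<h} \<sigma> \<partial>lborel)
      + ennreal h * Drift a b + ?C * (2 * ennreal h * near_energy R \<delta>)) + ennreal h * ennreal \<epsilon>"
    using h ab by (intro add_right_mono entropy_averaged \<delta>) auto
  also have "\<dots> \<le> ((ennreal h * (entropy v a + ennreal \<epsilon>) + M) + ennreal h * ennreal \<epsilon>
      + ennreal h * Drift a b + ?C * (2 * ennreal h * near_energy R \<delta>)) + ennreal h * ennreal \<epsilon>"
    by (intro add_right_mono add_mono ii iii order_refl)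
  also have "\<dots> = M + ennreal h * (entropy v a + Drift a b + ?C * (2 * near_energy R \<delta>) + (ennreal \<epsilon> + ennreal \<epsilon> + ennreal \<epsilon>))"
    by (simp add: ring_distribs add_ac mult_ac)
  also have "ennreal \<epsilon> + ennreal \<epsilon> + ennreal \<epsilon> = 3 * ennreal \<epsilon>"
    using \<epsilon> by (simp add: ennreal_plus[symmetric] ennreal_mult''[symmetric] ennreal_numeral[symmetric] del: ennreal_plus ennreal_numeral)
  finally have "ennreal h * (?P + entropy v b) \<le> ennreal h * (entropy v a + Drift a b + ?C * (2 * near_energy R \<delta>) + 3 * ennreal \<epsilon>)"
    using M by (subst (asm) ennreal_add_left_cancel_le) auto
  then show ?thesis using h by (subst (asm) ennreal_mult_le_mult_iff) auto
qed

theorem entropy_inequality: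
  assumes ab: "0 < a" "a < b" "b < T"
  shows "Dissip a b + entropy v b \<le> entropy v a + Drift a b"
proof -
  let ?C = "ennreal (Lam * (2 + 2 * L\<^sup>2))"
  let ?\<delta> = "\<lambda>n. 1 / real (Suc n)"
  let ?P = "\<lambda>n. \<integral>\<^sup>+r. dissip_slice (?\<delta> n) r * indicator {a<..<b} r \<partial>lborel"
  have \<delta>: "0 < ?\<delta> n" "?\<delta> n \<le> 1" for n by auto
  have mono: "?\<delta> m \<le> ?\<delta> n" if "n \<le> m" for n m using that by (simp add: frac_le)
  have inc: "?P n \<le> ?P m" if "n \<le> m" for n m
    unfolding dissip_slice_def using mono[OF that]
    by (intro nn_integral_mono mult_right_mono mult_left_mono) (auto simp: far_def split: split_indicator)
  have eps: "?P n + entropy v b \<le> entropy v a + Drift a b + ?C * (2 * near_energy R (?\<delta> n))" for n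
  proof (rule ennreal_le_epsilon)
    fix e :: real assume "0 < e"
    then have e: "0 < e / 3" by simp
    have "3 * ennreal (e / 3) = ennreal e"
      using e by (simp add: ennreal_mult''[symmetric] ennreal_numeral[symmetric] del: ennreal_numeral)
    then show "?P n + entropy v b \<le> entropy v a + Drift a b + ?C * (2 * near_energy R (?\<delta> n)) + ennreal e"
      using entropy_inequality_approx[OF ab \<delta> e, of n] by simp
  qed
  have lim: "(\<lambda>m. entropy v a + Drift a b + ?C * (2 * near_energy R (?\<delta> m))) \<longlonglongrightarrow> entropy v a + Drift a b + ?C * (2 * 0)"
    by (intro tendsto_add tendsto_const ennreal_tendsto_cmult near_energy_tendsto[OF R]) auto
  have le: "?P n + entropy v b \<le> entropy v a + Drift a b" for n
  proof -
    \<comment> \<open>The left side is kept at a fixed n while m tends to infinity on the right, so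
      that only the near energy changes.\<close>
    have "?P n + entropy v b \<le> entropy v a + Drift a b + ?C * (2 * near_energy R (?\<delta> m))" if "n \<le> m" for m
      using add_right_mono[OF inc[OF that], of "entropy v b"] eps[of m] by (rule order_trans)
    then have "?P n + entropy v b \<le> entropy v a + Drift a b + ?C * (2 * 0)"
      using lim by (intro LIMSEQ_le_const) auto
    then show ?thesis by simp
  qed
  let ?f = "\<lambda>n q. ennreal (dissip (fst q) (snd q)) * indicator (far R (?\<delta> n)) (snd q) * indicator {a<..<b} (fst q)"
  have P_eq: "?P n = (\<integral>\<^sup>+q. ?f n q \<partial>lborel)" for n
    unfolding dissip_slice_def by (subst nn_integral_lborel_pair) (auto simp: nn_integral_multc)
  have "Dissip a b = (\<integral>\<^sup>+q. ennreal (dissip (fst q) (snd q)) * indicator {a<..<b} (fst q) \<partial>lborel)"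
    unfolding Dissip_def by (subst nn_integral_lborel_pair) (auto simp: nn_integral_multc)
  also have "\<dots> \<le> (\<integral>\<^sup>+q. (SUP n. ?f n q) \<partial>lborel)"
  proof (rule nn_integral_mono)
    fix q :: "real \<times> 'a \<times> 'a"
    obtain t x y where q: "q = (t, x, y)" by (cases q) auto
    show "ennreal (dissip (fst q) (snd q)) * indicator {a<..<b} (fst q) \<le> (SUP n. ?f n q)"
    \<comment> \<open>The sets \<open>far R (?\<delta> n)\<close> miss the diagonal and the pairs
      with both points outside the ball; \<open>dissip\<close> vanishes on both.\<close>
    proof (cases "dissip t (x, y) = 0")
      case False
      then have "norm (x - y) \<noteq> 0" "\<not> (R \<le> norm x \<and> R \<le> norm y)"
        using W(3) by (auto simp: dissip_def)
      then obtain n where "?\<delta> n < norm (x - y)"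
        using reals_Archimedean[of "norm (x - y)"] by (auto simp: inverse_eq_divide)
      then have "(x, y) \<in> far R (?\<delta> n)" using \<open>\<not> (R \<le> norm x \<and> R \<le> norm y)\<close> by (auto simp: far_def)
      then show ?thesis by (intro SUP_upper2[of n]) (auto simp: q)
    qed (simp add: q)
  qed
  also have "\<dots> = (SUP n. \<integral>\<^sup>+q. ?f n q \<partial>lborel)"
  proof (rule nn_integral_monotone_convergence_SUP)
    show "incseq ?f"
    proof (intro incseq_SucI le_funI)
      fix n q
      have "far R (?\<delta> n) \<subseteq> far R (?\<delta> (Suc n))" using mono[of n "Suc n"] unfolding far_def by force
      then show "?f n q \<le> ?f (Suc n) q"
        by (intro mult_right_mono mult_left_mono) (auto split: split_indicator)
    qed
  qed measurable
  also have "\<dots> = (SUP n. ?P n)" by (simp only: P_eq)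
  finally have "Dissip a b + entropy v b \<le> (SUP n. ?P n) + entropy v b" by (rule add_right_mono)
  also have "\<dots> = (SUP n. ?P n + entropy v b)" by (intro ennreal_SUP_add_left[symmetric]) auto
  also have "\<dots> \<le> entropy v a + Drift a b" by (intro SUP_least le)
  finally show ?thesis .
qed

end

section \<open>The local mass bound\<close>

text \<open>The constants \<open>Cf\<close> and \<open>Cn\<close> are parameters so that the final bound visibly does not depend on the
  solution.\<close>

locale nonlocal_local = nonlocal_flow s Lam T u k p lam v
  for s Lam T :: real
    and u :: "real \<Rightarrow> 'a::euclidean_space \<Rightarrow> real"
    and k :: "real \<Rightarrow> 'a \<Rightarrow> 'a \<Rightarrow> real" and p lam :: real
    and v :: "real \<Rightarrow> 'a \<Rightarrow> real" +
  fixes c :: 'a and a b t0 Cf Cn :: real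
  assumes ab: "0 < a" "a < b" "b < T" and t0: "a \<le> t0" "t0 \<le> b"
    and mass: "(\<integral>\<^sup>+x. ennreal (v t0 x) * indicator (ball c 2) x \<partial>lborel) \<le> 1"
    and tail: "(\<integral>\<^sup>+t. (\<integral>\<^sup>+x. ennreal (u t x) * ennreal ((1 + norm (x - c)) powr (- p)) \<partial>lborel) * indicator {a<..<b} t \<partial>lborel) \<le> 1"
    and Cf: "0 < Cf" "\<And>\<delta> h. 0 < \<delta> \<Longrightarrow> \<delta> \<le> 1 \<Longrightarrow> h \<in> borel_measurable borel \<Longrightarrow>
      (\<integral>\<^sup>+x. \<integral>\<^sup>+y. h x * ennreal (norm (x - y) powr (-p)) *
         indicator {z. \<delta> \<le> norm (fst z - snd z) \<and> (fst z \<in> ball c 2 \<or> snd z \<in> ball c 2)} (x, y) \<partial>lborel \<partial>lborel)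
      \<le> ennreal (Cf * \<delta> powr (-p)) * (\<integral>\<^sup>+x. h x * ennreal ((1 + norm (x - c)) powr (-p)) \<partial>(lborel::'a measure))"
    and Cn: "0 < Cn" "\<And>x::'a. (\<integral>\<^sup>+y. ennreal (norm (x - y) powr (2 - p)) * indicator (ball x 1) y \<partial>lborel) \<le> ennreal Cn"
begin

text \<open>This choice makes \<open>1 + \<alpha>\<close> smaller than \<open>1 - \<alpha> + 2 * s / d\<close>, the exponent that the pointwise
  Sobolev inequality controls.\<close>

definition \<alpha> :: real where "\<alpha> = s / (2 * real DIM('a))"

lemma \<alpha>: "0 < \<alpha>" "\<alpha> < 1"
proof -
  have "1 \<le> real DIM('a)" by (simp add: Suc_le_eq)
  then have "s < 2 * real DIM('a)" using s by linarith
  then show "0 < \<alpha>" "\<alpha> < 1" using s by (auto simp: \<alpha>_def field_simps)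
qed

text \<open>The radii grow from 1 to 2, and the gap between two of them consists of four widths
  \<rho> j: one for the decay of the cutoff, one for partners at distance less than \<rho> j from
  its support, one for the Sobolev balls around these, and one in reserve. All of this lies where
  the next cutoff equals 1.\<close>

definition \<rho> :: "nat \<Rightarrow> real" where "\<rho> j = (1/2) ^ j / 8"

definition rad :: "nat \<Rightarrow> real" where "rad j = 2 - (1/2) ^ j"

lemma \<rho>: "0 < \<rho> j" "\<rho> j \<le> 1/8"
  by (auto simp: \<rho>_def power_le_one)

lemma rad: "1 \<le> rad j" "rad (Suc j) = rad j + 4 * \<rho> j" "rad j + 8 * \<rho> j = 2"
  by (auto simp: rad_def \<rho>_def power_le_one)

definition cut :: "nat \<Rightarrow> 'a \<Rightarrow> real" where
  "cut j x = max 0 (min 1 ((rad j + \<rho> j - norm (x - c)) / \<rho> j))"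

text \<open>The square makes the root of the weight Lipschitz, so that an increment of
  \<open>W\<close> is controlled by |x - y| times the root of the mean of \<open>W\<close>, as the
  Cauchy--Schwarz step demands.\<close>

abbreviation W :: "nat \<Rightarrow> 'a \<Rightarrow> real" where "W j x \<equiv> (cut j x)\<^sup>2"

lemma cut_measurable [measurable]: "cut j \<in> borel_measurable borel"
  unfolding cut_def[abs_def] by measurable

lemma cut: "0 \<le> cut j x" "cut j x \<le> 1"
  by (auto simp: cut_def)

lemma cut_eq_1: "norm (x - c) \<le> rad j \<Longrightarrow> cut j x = 1"
  using \<rho>[of j] by (auto simp: cut_def field_simps)

lemma cut_eq_0: "rad j + \<rho> j \<le> norm (x - c) \<Longrightarrow> cut j x = 0"
  using \<rho>[of j] by (auto simp: cut_def max_def min_def field_simps)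

lemma cut_lipschitz: "\<bar>cut j x - cut j y\<bar> \<le> norm (x - y) / \<rho> j"
proof -
  have *: "\<bar>max 0 (min 1 r) - max 0 (min 1 r')\<bar> \<le> \<bar>r - r'\<bar>" for r r' :: real by auto
  have "\<bar>cut j x - cut j y\<bar> \<le> \<bar>(rad j + \<rho> j - norm (x - c)) / \<rho> j - (rad j + \<rho> j - norm (y - c)) / \<rho> j\<bar>"
    unfolding cut_def by (rule *)
  also have "\<dots> = \<bar>norm (y - c) - norm (x - c)\<bar> / \<rho> j"
    using \<rho>[of j] by (simp add: diff_divide_distrib[symmetric])
  also have "\<dots> \<le> norm ((y - c) - (x - c)) / \<rho> j"
    using \<rho>[of j] by (intro divide_right_mono norm_triangle_ineq3) auto
  finally show ?thesis by (simp add: norm_minus_commute)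
qed

lemma W_le: "0 \<le> W j x" "W j x \<le> 1"
  using cut[of j x] by (auto simp: power_le_one)

lemma W_eq_0: "2 \<le> norm (x - c) \<Longrightarrow> W j x = 0"
  using cut_eq_0[of j x] rad(3)[of j] \<rho>[of j] by simp

lemma W_lipschitz: "\<bar>W j x - W j y\<bar> \<le> 2 / \<rho> j * norm (x - y)"
proof -
  have "\<bar>W j x - W j y\<bar> = \<bar>cut j x - cut j y\<bar> * (cut j x + cut j y)"
    using cut[of j] by (simp add: power2_eq_square square_diff_square_factored abs_mult mult.commute)
  also have "\<dots> \<le> (norm (x - y) / \<rho> j) * 2"
    using cut(2)[of j x] cut(2)[of j y] cut(1)[of j x] cut(1)[of j y] \<rho>[of j] by (intro mult_mono cut_lipschitz) auto
  finally show ?thesis by (simp add: mult.commute)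
qed

text \<open>Test functions are localised in balls around the origin; the support, a subset of the
  ball of radius 2 around \<open>c\<close>, is placed in such a ball.\<close>

sublocale J: nonlocal_test s Lam T u k p lam v "W j" "norm c + 3" "2 / \<rho> j" \<alpha> for j
proof unfold_locales
  show "W j x = 0" if "norm c + 3 \<le> norm x" for x
    using that norm_triangle_ineq2[of x c] by (intro W_eq_0) linarith
  show "\<bar>W j x - W j y\<bar> \<le> 2 / \<rho> j * norm (x - y)" for x y by (rule W_lipschitz)
qed (use W_le \<rho>[of j] \<alpha> in \<open>auto simp: add_nonneg_pos\<close>)

abbreviation D :: "nat \<Rightarrow> ennreal" where "D j \<equiv> J.Drift j a b"

abbreviation E :: "nat \<Rightarrow> ennreal" where "E j \<equiv> J.Dissip j a b"

lemma Drift_mono: "a \<le> a' \<Longrightarrow> b' \<le> b \<Longrightarrow> J.Drift j a' b' \<le> D j"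
  unfolding J.Drift_def by (intro nn_integral_mono) (auto split: split_indicator)

text \<open>Both time directions enter here: \<open>t\<close> may lie before or after
  \<open>t0\<close>, and the drift between the two times is at most that over (a, b).\<close>

lemma mass_le: "t \<in> {a..b} \<Longrightarrow> (\<integral>\<^sup>+x. ennreal (v t x * W j x) \<partial>lborel) \<le> 1 + D j"
proof -
  assume t: "t \<in> {a..b}"
  have "(\<integral>\<^sup>+x. ennreal (v t0 x * W j x) \<partial>lborel) \<le> (\<integral>\<^sup>+x. ennreal (v t0 x) * indicator (ball c 2) x \<partial>lborel)"
  proof (rule nn_integral_mono)
    fix x
    have "v t0 x * W j x \<le> v t0 x * 1" using W_le v_nonneg by (intro mult_left_mono) auto
    then show "ennreal (v t0 x * W j x) \<le> ennreal (v t0 x) * indicator (ball c 2) x"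
      using W_eq_0[of x j] by (cases "norm (x - c) < 2") (auto simp: dist_norm norm_minus_commute not_less intro!: ennreal_leI split: split_indicator)
  qed
  then have 0: "(\<integral>\<^sup>+x. ennreal (v t0 x * W j x) \<partial>lborel) \<le> 1" using mass by simp
  consider "t = t0" | "t < t0" | "t0 < t" by linarith
  then show ?thesis
  proof cases
    case 1
    then show ?thesis using 0 by (simp add: add_increasing2)
  next
    case 2
    then show ?thesis
      using J.mass_change_le_Drift(2)[of t t0 j] t ab t0 0 Drift_mono[of t t0 j]
      by (meson add_mono atLeastAtMost_iff le_less_trans less_le_trans order_trans)
  next
    case 3
    then show ?thesis
      using J.mass_change_le_Drift(1)[of t0 t j] t ab t0 0 Drift_mono[of t0 t j]
      by (meson add_mono atLeastAtMost_iff le_less_trans less_le_trans order_trans)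
  qed
qed

text \<open>One drift comes from the entropy inequality, the other from comparing the mass at time a
  with the mass at \<open>t0\<close>.\<close>

lemma Dissip_le: "E j \<le> 1 + 2 * D j"
proof -
  have "E j \<le> E j + J.entropy j v b" by simp
  also have "\<dots> \<le> J.entropy j v a + D j" by (rule J.entropy_inequality[OF ab])
  also have "J.entropy j v a \<le> (\<integral>\<^sup>+x. ennreal (v a x * W j x) \<partial>lborel)"
    unfolding J.entropy_def using W_le
    by (intro nn_integral_mono ennreal_leI mult_right_mono trunc_prim_le[OF \<alpha>] v_nonneg) auto
  also have "\<dots> \<le> 1 + D j" using ab by (intro mass_le) auto
  finally show ?thesis by (simp add: mult_2 add_ac)
qed

text \<open>A purely qualitative bound, with a constant depending on the solution through its H^s
  energy and its tail. Only the growth rate in j matters, and it is the square 256 * 4 ^ j of the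
  Lipschitz constant of the cutoff.\<close>

lemma Drift_bound: "\<exists>C. \<forall>j. D j \<le> ennreal (C * 4 ^ j)"
proof -
  define R where "R = norm c + 3"
  have R: "0 < R" unfolding R_def using norm_ge_zero[of c] by linarith
  define A where "A = enn2real (near_energy R 1)"
  have A: "near_energy R 1 = ennreal A" using near_energy_finite[OF R] by (simp add: A_def)
  define B where "B = enn2real (\<integral>\<^sup>+q. ennreal (norm (far_flux R 1 q)) \<partial>lborel)"
  have B: "(\<integral>\<^sup>+q. ennreal (norm (far_flux R 1 q)) \<partial>lborel) = ennreal B"
    using far_flux_integrable[of R 1] R by (simp add: B_def integrable_iff_bounded)
  have AB: "0 \<le> A" "0 \<le> B" by (auto simp: A_def B_def)
  have "D j \<le> ennreal ((Lam * 256 * A + B) * 4 ^ j)" for j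
  proof -
    let ?m = "Lam * (256 * 4 ^ j)"
    have m: "0 \<le> ?m" using Lam by auto
    have "((2::real) ^ j)\<^sup>2 = 4 ^ j" by (simp add: power2_eq_square flip: power_mult_distrib)
    then have \<rho>2: "(2 / \<rho> j)\<^sup>2 = 256 * 4 ^ j"
      by (simp add: \<rho>_def power_divide power_mult_distrib)
    have "D j = (\<integral>\<^sup>+q. ennreal (J.drift j (fst q) (snd q)) * indicator {a<..<b} (fst q) \<partial>lborel)"
      unfolding J.Drift_def by (subst nn_integral_lborel_pair) (auto simp: nn_integral_multc)
    also have "\<dots> \<le> (\<integral>\<^sup>+q. ennreal ?m * (ennreal (near_dens R 1 (fst q) (snd q)) * indicator {0<..<T} (fst q)) + ennreal (norm (far_flux R 1 q)) \<partial>lborel)"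
    proof (rule nn_integral_mono)
      fix q :: "real \<times> 'a \<times> 'a"
      obtain t x y where q: "q = (t, x, y)" by (cases q) auto
      consider "t \<notin> {a<..<b}" | "R \<le> norm x" "R \<le> norm y" | "t \<in> {a<..<b}" "(x, y) \<in> near R 1" | "t \<in> {a<..<b}" "(x, y) \<in> far R 1"
        by (auto simp: near_def far_def) force+
      then show "ennreal (J.drift j (fst q) (snd q)) * indicator {a<..<b} (fst q)
        \<le> ennreal ?m * (ennreal (near_dens R 1 (fst q) (snd q)) * indicator {0<..<T} (fst q)) + ennreal (norm (far_flux R 1 q))"
      proof cases
        case 2
        then have "W j x = 0" "W j y = 0" using J.W(3)[of x j] J.W(3)[of y j] by (auto simp: R_def)
        then show ?thesis by (simp add: q J.drift_def)
      next
        case 3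
        define U where "U = u t x - u t y"
        define w where "w = W j x - W j y"
        have "w\<^sup>2 \<le> (2 / \<rho> j)\<^sup>2 * (norm (x - y))\<^sup>2"
          using power_mono[OF W_lipschitz[of j x y] abs_ge_zero, of 2] unfolding w_def power_mult_distrib power2_abs .
        moreover have "\<bar>U\<bar> * \<bar>w\<bar> \<le> U\<^sup>2 + w\<^sup>2"
          using sum_squares_bound[of "\<bar>U\<bar>" "\<bar>w\<bar>"] mult_nonneg_nonneg[of "\<bar>U\<bar>" "\<bar>w\<bar>"] unfolding mult.assoc power2_abs by linarith
        moreover have "1 * U\<^sup>2 \<le> 256 * 4 ^ j * U\<^sup>2"
        proof (rule mult_right_mono)
          have "(1::real) * 1 \<le> 256 * 4 ^ j" by (intro mult_mono one_le_power) auto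
          then show "(1::real) \<le> 256 * 4 ^ j" by simp
        qed simp
        ultimately have "\<bar>U\<bar> * \<bar>w\<bar> \<le> 256 * 4 ^ j * (U\<^sup>2 + (norm (x - y))\<^sup>2)"
          unfolding \<rho>2 by (simp add: distrib_left)
        then have "\<bar>U\<bar> * \<bar>w\<bar> * k t x y \<le> (256 * 4 ^ j * (U\<^sup>2 + (norm (x - y))\<^sup>2)) * (Lam * norm (x - y) powr (-p))"
          by (rule mult_mono[OF _ k_le]) (use k_nonneg in auto)
        also have "\<dots> = ?m * near_dens R 1 t (x, y)"
          using 3 by (simp add: near_dens_def U_def)
        finally have "J.drift j t (x, y) \<le> ?m * near_dens R 1 t (x, y)"
          by (simp add: J.drift_def U_def w_def)
        then show ?thesis using 3 ab m near_dens_nonneg[of R 1 t "(x, y)"]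
          by (auto simp: q ennreal_mult[symmetric] intro!: ennreal_leI add_increasing2)
      next
        case 4
        have "\<bar>W j x - W j y\<bar> \<le> 1" using W_le[of j x] W_le[of j y] by linarith
        then have "\<bar>u t x - u t y\<bar> * \<bar>W j x - W j y\<bar> * k t x y \<le> \<bar>u t x - u t y\<bar> * 1 * k t x y"
          using k_nonneg by (intro mult_right_mono mult_left_mono) auto
        then have "J.drift j t (x, y) \<le> norm (far_flux R 1 q)"
          using 4 ab k_nonneg[of t x y] by (simp add: J.drift_def q far_flux_def abs_mult)
        then show ?thesis using 4 by (auto simp: q intro!: ennreal_leI add_increasing)
      qed (simp add: q)
    qed
    also have "\<dots> = ennreal ?m * (\<integral>\<^sup>+q. ennreal (near_dens R 1 (fst q) (snd q)) * indicator {0<..<T} (fst q) \<partial>lborel) + ennreal B"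
      by (subst nn_integral_add) (auto simp: nn_integral_cmult B simp del: real_norm_def)
    also have "(\<integral>\<^sup>+q. ennreal (near_dens R 1 (fst q) (snd q)) * indicator {0<..<T} (fst q) \<partial>lborel) = ennreal A"
      unfolding A[symmetric] near_energy_def by (subst nn_integral_lborel_pair) (auto simp: nn_integral_multc)
    also have "ennreal ?m * ennreal A + ennreal B = ennreal (?m * A + B)"
      using m AB by (simp add: ennreal_mult[symmetric] ennreal_plus[symmetric] del: ennreal_plus)
    also have "\<dots> \<le> ennreal ((Lam * 256 * A + B) * 4 ^ j)"
      using AB mult_left_mono[of 1 "4 ^ j" B] by (intro ennreal_leI) (simp add: algebra_simps)
    finally show ?thesis .
  qed
  then show ?thesis by blast
qed

end

section \<open>Splitting the drift into dissipation, powers and tail\<close>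

lemma nn_integral_lborel_swap:
  fixes f :: "'a::euclidean_space \<times> 'a \<Rightarrow> ennreal"
  assumes [measurable]: "f \<in> borel_measurable borel"
  shows "(\<integral>\<^sup>+z. f (snd z, fst z) \<partial>lborel) = (\<integral>\<^sup>+z. f z \<partial>lborel)"
proof -
  have "(\<integral>\<^sup>+z. f (snd z, fst z) \<partial>lborel) = (\<integral>\<^sup>+x. \<integral>\<^sup>+y. f (y, x) \<partial>lborel \<partial>lborel)"
    by (subst nn_integral_lborel_pair) auto
  also have "\<dots> = (\<integral>\<^sup>+y. \<integral>\<^sup>+x. f (y, x) \<partial>lborel \<partial>lborel)"
    by (rule lborel_pair.Fubini') measurable
  also have "\<dots> = (\<integral>\<^sup>+z. f z \<partial>lborel)"
    by (subst nn_integral_lborel_pair) auto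
  finally show ?thesis .
qed

context nonlocal_local
begin

definition form_dens :: "nat \<Rightarrow> real \<Rightarrow> 'a \<times> 'a \<Rightarrow> real" where
  "form_dens j t z = trunc_form \<alpha> (u t (fst z)) (u t (snd z)) * ((W j (fst z) + W j (snd z)) / 2) * k t (fst z) (snd z)"

lemma form_dens_measurable [measurable (raw)]:
  assumes [measurable]: "f \<in> borel_measurable M" "g \<in> borel_measurable M"
  shows "(\<lambda>x. form_dens j (f x) (g x)) \<in> borel_measurable M"
  unfolding form_dens_def by measurable

lemma form_dens_nonneg: "0 \<le> form_dens j t z"
  using k_nonneg by (simp add: form_dens_def trunc_form_nonneg[OF \<alpha>])

definition Form :: "nat \<Rightarrow> ennreal" where
  "Form j = (\<integral>\<^sup>+t. (\<integral>\<^sup>+z. ennreal (form_dens j t z) \<partial>lborel) * indicator {a<..<b} t \<partial>lborel)"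

lemma Form_le: "ennreal \<alpha> * Form j \<le> E j"
proof -
  have "ennreal \<alpha> * Form j = (\<integral>\<^sup>+t. (\<integral>\<^sup>+z. ennreal \<alpha> * ennreal (form_dens j t z) \<partial>lborel) * indicator {a<..<b} t \<partial>lborel)"
    unfolding Form_def by (simp add: nn_integral_cmult mult.assoc)
  also have "\<dots> \<le> E j"
    unfolding J.Dissip_def
  proof (intro nn_integral_mono mult_right_mono)
    fix t z
    have "\<alpha> * trunc_form \<alpha> (u t (fst z)) (u t (snd z)) * ((W j (fst z) + W j (snd z)) / 2) * k t (fst z) (snd z) \<le> J.dissip j t z"
      unfolding J.dissip_def using k_nonneg
      by (intro mult_right_mono trunc_form_le[OF \<alpha>] u_nonneg) auto
    then show "ennreal \<alpha> * ennreal (form_dens j t z) \<le> ennreal (J.dissip j t z)"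
      using \<alpha> form_dens_nonneg[of j t z] by (auto simp: form_dens_def ennreal_mult[symmetric] mult.assoc intro!: ennreal_leI)
  qed auto
  finally show ?thesis .
qed

definition pow_slice :: "nat \<Rightarrow> real \<Rightarrow> ennreal" where
  "pow_slice j t = (\<integral>\<^sup>+x. ennreal ((1 + u t x) powr (1 + \<alpha>)) * indicator (ball c (rad j + 2 * \<rho> j)) x \<partial>lborel)"

lemma pow_slice_measurable [measurable]: "pow_slice j \<in> borel_measurable borel"
  unfolding pow_slice_def[abs_def] by measurable

definition Pow :: "nat \<Rightarrow> ennreal" where
  "Pow j = (\<integral>\<^sup>+t. pow_slice j t * indicator {a<..<b} t \<partial>lborel)"

text \<open>\<open>edge\<close> and \<open>long\<close> carry the value of \<open>u\<close> at one
  point of the pair only; the other half is obtained by exchanging the points, so each has to be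
  integrated just once.\<close>

definition edge :: "nat \<Rightarrow> real \<Rightarrow> 'a \<times> 'a \<Rightarrow> ennreal" where
  "edge j t z = ennreal ((1 + u t (fst z)) powr (1 + \<alpha>)) * indicator (ball c (rad j + 2 * \<rho> j)) (fst z)
     * (ennreal (norm (fst z - snd z) powr (2 - p)) * indicator {z. norm (fst z - snd z) < 1} z)"

definition long :: "nat \<Rightarrow> real \<Rightarrow> 'a \<times> 'a \<Rightarrow> ennreal" where
  "long j t z = ennreal (u t (fst z)) * ennreal (norm (fst z - snd z) powr (- p))
     * indicator {z. \<rho> j \<le> norm (fst z - snd z) \<and> (fst z \<in> ball c 2 \<or> snd z \<in> ball c 2)} z"

lemma edge_long_measurable [measurable (raw)]:
  assumes [measurable]: "f \<in> borel_measurable M" "g \<in> borel_measurable M"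
  shows "(\<lambda>x. edge j (f x) (g x)) \<in> borel_measurable M" "(\<lambda>x. long j (f x) (g x)) \<in> borel_measurable M"
  unfolding edge_def long_def by measurable

text \<open>Pairs further apart than \<rho> j go into the tail term, using only that increments of
  \<open>u\<close> are at most the sum of the values. Closer pairs meeting the support of the cutoff
  lie within \<open>rad j + 2 * \<rho> j\<close> of \<open>c\<close>, and
  \<open>trunc_form_young\<close> applies; the squared increment of the cutoff makes up for the
  singularity of the kernel.\<close>

lemma drift_pointwise:
  "ennreal (J.drift j t z) \<le> ennreal (\<alpha> / 4) * ennreal (form_dens j t z)
     + ennreal (4 / \<alpha> * Lam / (\<rho> j)\<^sup>2) * (edge j t z + edge j t (snd z, fst z))
     + ennreal Lam * (long j t z + long j t (snd z, fst z))"
proof -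
  obtain x y where z: "z = (x, y)" by (cases z) auto
  let ?r = "norm (x - y)"
  consider "cut j x = 0" "cut j y = 0" | "\<rho> j \<le> ?r" "cut j x \<noteq> 0 \<or> cut j y \<noteq> 0" | "?r < \<rho> j" "cut j x \<noteq> 0 \<or> cut j y \<noteq> 0"
    by linarith
  then show ?thesis
  proof cases
    case 1
    then show ?thesis by (simp add: J.drift_def z)
  next
    case 2
    then have in2: "x \<in> ball c 2 \<or> y \<in> ball c 2"
      using W_eq_0[of x j] W_eq_0[of y j] by (auto simp: dist_norm norm_minus_commute not_le[symmetric])
    have "\<bar>W j x - W j y\<bar> \<le> 1" using W_le[of j x] W_le[of j y] by linarith
    then have "\<bar>u t x - u t y\<bar> * \<bar>W j x - W j y\<bar> * k t x y \<le> (u t x + u t y) * 1 * (Lam * ?r powr (-p))"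
      using u_nonneg[of t x] u_nonneg[of t y] k_nonneg k_le by (intro mult_mono) auto
    then have "ennreal (J.drift j t z) \<le> ennreal (Lam * (u t x * ?r powr (-p) + u t y * ?r powr (-p)))"
      by (intro ennreal_leI) (simp add: J.drift_def z algebra_simps)
    also have "\<dots> = ennreal Lam * (long j t z + long j t (snd z, fst z))"
      using 2 in2 u_nonneg Lam by (simp add: long_def z ennreal_mult ennreal_plus norm_minus_commute disj_commute)
    finally show ?thesis by (simp add: add_increasing)
  next
    case 3
    let ?Y = "(cut j x - cut j y)\<^sup>2 * (1 + max (u t x) (u t y)) powr (1 + \<alpha>)"
    have k0: "0 \<le> k t x y" by (rule k_nonneg)
    have Y0: "0 \<le> ?Y" by simp
    have x': "norm (x - c) < rad j + 2 * \<rho> j" and y': "norm (y - c) < rad j + 2 * \<rho> j"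
      using 3 cut_eq_0[of j x] cut_eq_0[of j y] norm_triangle_ineq[of "x - y" "y - c"] norm_triangle_ineq[of "y - x" "x - c"]
      by (auto simp: norm_minus_commute not_le[symmetric])
    have "\<bar>u t x - u t y\<bar> * \<bar>W j x - W j y\<bar> \<le> \<alpha> / 4 * (trunc_form \<alpha> (u t x) (u t y) * ((W j x + W j y) / 2)) + 4 / \<alpha> * ?Y"
      by (rule trunc_form_young[OF \<alpha> u_nonneg u_nonneg cut(1) cut(1)])
    then have "J.drift j t z \<le> (\<alpha> / 4 * (trunc_form \<alpha> (u t x) (u t y) * ((W j x + W j y) / 2)) + 4 / \<alpha> * ?Y) * k t x y"
      unfolding J.drift_def z using k0 by (simp add: mult_right_mono)
    also have "\<dots> = \<alpha> / 4 * form_dens j t z + 4 / \<alpha> * (?Y * k t x y)"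
      by (simp add: form_dens_def z algebra_simps)
    finally have drift_le: "J.drift j t z \<le> \<alpha> / 4 * form_dens j t z + 4 / \<alpha> * (?Y * k t x y)" .
    have "?Y * k t x y \<le> (?r\<^sup>2 / (\<rho> j)\<^sup>2 * ((1 + u t x) powr (1 + \<alpha>) + (1 + u t y) powr (1 + \<alpha>))) * (Lam * ?r powr (-p))"
    proof (rule mult_mono[OF mult_mono k_le])
      show "(cut j x - cut j y)\<^sup>2 \<le> ?r\<^sup>2 / (\<rho> j)\<^sup>2"
        using power_mono[OF cut_lipschitz[of j x y] abs_ge_zero, of 2] by (simp add: power_divide)
      show "(1 + max (u t x) (u t y)) powr (1 + \<alpha>) \<le> (1 + u t x) powr (1 + \<alpha>) + (1 + u t y) powr (1 + \<alpha>)"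
        by (simp add: max_def)
    qed (use k0 in auto)
    also have "\<dots> = Lam / (\<rho> j)\<^sup>2 * ((1 + u t x) powr (1 + \<alpha>) * (?r\<^sup>2 * ?r powr (-p)) + (1 + u t y) powr (1 + \<alpha>) * (?r\<^sup>2 * ?r powr (-p)))"
      by (simp add: field_simps)
    also have "?r\<^sup>2 * ?r powr (-p) = ?r powr (2 - p)"
      by (cases "x = y") (auto simp: powr_diff powr_minus field_simps simp flip: powr_numeral)
    finally have Y_le: "?Y * k t x y \<le> Lam / (\<rho> j)\<^sup>2 * ((1 + u t x) powr (1 + \<alpha>) * ?r powr (2 - p) + (1 + u t y) powr (1 + \<alpha>) * ?r powr (2 - p))" .
    have le: "J.drift j t z \<le> \<alpha> / 4 * form_dens j t z + 4 / \<alpha> * (Lam / (\<rho> j)\<^sup>2 * ((1 + u t x) powr (1 + \<alpha>) * ?r powr (2 - p) + (1 + u t y) powr (1 + \<alpha>) * ?r powr (2 - p)))"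
      using \<alpha> by (intro order_trans[OF drift_le] add_left_mono mult_left_mono Y_le) auto
    have r1: "?r < 1" using 3 \<rho>[of j] by linarith
    have "ennreal (J.drift j t z) \<le> ennreal (\<alpha> / 4 * form_dens j t z + 4 / \<alpha> * Lam / (\<rho> j)\<^sup>2 * ((1 + u t x) powr (1 + \<alpha>) * ?r powr (2 - p) + (1 + u t y) powr (1 + \<alpha>) * ?r powr (2 - p)))"
      using le by (intro ennreal_leI) (simp add: mult.assoc)
    also have "\<dots> = ennreal (\<alpha> / 4) * ennreal (form_dens j t z)
     + ennreal (4 / \<alpha> * Lam / (\<rho> j)\<^sup>2) * (edge j t z + edge j t (snd z, fst z))"
    proof -
      have gen: "ennreal (a * F + B * S) = ennreal a * ennreal F + ennreal B * ennreal S"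
        if "0 \<le> a" "0 \<le> F" "0 \<le> B" "0 \<le> S" for a F B S :: real
        using that by (simp add: ennreal_mult ennreal_plus)
      have eq: "edge j t z + edge j t (snd z, fst z) = ennreal ((1 + u t x) powr (1 + \<alpha>) * ?r powr (2 - p) + (1 + u t y) powr (1 + \<alpha>) * ?r powr (2 - p))"
        using x' y' r1 by (simp add: edge_def z dist_norm norm_minus_commute ennreal_mult ennreal_plus)
      show ?thesis unfolding eq by (rule gen) (use \<alpha> Lam form_dens_nonneg[of j t z] in auto)
    qed
    finally show ?thesis by (simp add: add_increasing2)
  qed
qed

text \<open>The exponent 2 - p is integrable over unit balls with constant \<open>Cn\<close>, and
  the tail is bounded through \<open>Cf\<close> and the normalisation \<open>tail\<close>. The
  factors 2 stem from the exchange of the two points.\<close>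

lemma Drift_le_Form:
  "D j \<le> ennreal (\<alpha> / 4) * Form j + ennreal (4 / \<alpha> * Lam / (\<rho> j)\<^sup>2 * (2 * Cn)) * Pow j + ennreal (2 * Lam * Cf * \<rho> j powr (- p))"
proof -
  let ?B = "4 / \<alpha> * Lam / (\<rho> j)\<^sup>2"
  let ?N = "\<lambda>t. \<integral>\<^sup>+x. ennreal (u t x) * ennreal ((1 + norm (x - c)) powr (- p)) \<partial>lborel"
  have B: "0 \<le> ?B" using \<alpha> Lam by simp
  have edge: "(\<integral>\<^sup>+z. edge j t z \<partial>lborel) \<le> ennreal Cn * pow_slice j t" for t
  proof -
    have "(\<integral>\<^sup>+z. edge j t z \<partial>lborel) = (\<integral>\<^sup>+x. (ennreal ((1 + u t x) powr (1 + \<alpha>)) * indicator (ball c (rad j + 2 * \<rho> j)) x)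
       * (\<integral>\<^sup>+y. ennreal (norm (x - y) powr (2 - p)) * indicator (ball x 1) y \<partial>lborel) \<partial>lborel)"
      unfolding edge_def by (subst nn_integral_lborel_pair) (auto simp: nn_integral_cmult dist_norm indicator_def)
    also have "\<dots> \<le> (\<integral>\<^sup>+x. (ennreal ((1 + u t x) powr (1 + \<alpha>)) * indicator (ball c (rad j + 2 * \<rho> j)) x) * ennreal Cn \<partial>lborel)"
      by (intro nn_integral_mono mult_left_mono Cn) auto
    also have "\<dots> = ennreal Cn * pow_slice j t"
      unfolding pow_slice_def by (subst nn_integral_multc) (auto simp: mult.commute)
    finally show ?thesis .
  qed
  have long: "(\<integral>\<^sup>+z. long j t z \<partial>lborel) \<le> ennreal (Cf * \<rho> j powr (-p)) * ?N t" for t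
    using Cf(2)[of "\<rho> j" "\<lambda>x. ennreal (u t x)"] \<rho>[of j] unfolding long_def by (subst nn_integral_lborel_pair) auto
  have slice: "(\<integral>\<^sup>+z. ennreal (J.drift j t z) \<partial>lborel) \<le> ennreal (\<alpha> / 4) * (\<integral>\<^sup>+z. ennreal (form_dens j t z) \<partial>lborel)
     + ennreal (?B * (2 * Cn)) * pow_slice j t + ennreal (2 * Lam * Cf * \<rho> j powr (-p)) * ?N t" for t
  proof -
    have "(\<integral>\<^sup>+z. ennreal (J.drift j t z) \<partial>lborel) \<le> (\<integral>\<^sup>+z. ennreal (\<alpha> / 4) * ennreal (form_dens j t z)
     + ennreal ?B * (edge j t z + edge j t (snd z, fst z)) + ennreal Lam * (long j t z + long j t (snd z, fst z)) \<partial>lborel)"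
      by (intro nn_integral_mono drift_pointwise)
    also have "\<dots> = ennreal (\<alpha> / 4) * (\<integral>\<^sup>+z. ennreal (form_dens j t z) \<partial>lborel)
      + ennreal ?B * (2 * (\<integral>\<^sup>+z. edge j t z \<partial>lborel)) + ennreal Lam * (2 * (\<integral>\<^sup>+z. long j t z \<partial>lborel))"
      using nn_integral_lborel_swap[of "edge j t"] nn_integral_lborel_swap[of "long j t"]
      by (simp add: nn_integral_add nn_integral_cmult mult_2)
    also have "\<dots> \<le> ennreal (\<alpha> / 4) * (\<integral>\<^sup>+z. ennreal (form_dens j t z) \<partial>lborel)
      + ennreal ?B * (2 * (ennreal Cn * pow_slice j t)) + ennreal Lam * (2 * (ennreal (Cf * \<rho> j powr (-p)) * ?N t))"
      by (intro add_mono mult_left_mono edge long order_refl) auto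
    also have "ennreal ?B * (2 * (ennreal Cn * pow_slice j t)) = ennreal (?B * (2 * Cn)) * pow_slice j t"
    proof -
      have "ennreal (?B * (2 * Cn)) = ennreal ?B * (2 * ennreal Cn)"
        using B Cn by (subst ennreal_mult) (auto simp: ennreal_mult)
      then show ?thesis by (simp add: mult.assoc)
    qed
    also have "ennreal Lam * (2 * (ennreal (Cf * \<rho> j powr (-p)) * ?N t)) = ennreal (2 * Lam * Cf * \<rho> j powr (-p)) * ?N t"
    proof -
      have "ennreal (2 * Lam * Cf * \<rho> j powr (-p)) = ennreal (Lam * (2 * (Cf * \<rho> j powr (-p))))" by (simp add: mult_ac)
      also have "\<dots> = ennreal Lam * (2 * ennreal (Cf * \<rho> j powr (-p)))"
        using Lam Cf(1) by (subst ennreal_mult) (auto simp: ennreal_mult)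
      finally show ?thesis by (simp add: mult.assoc)
    qed
    finally show ?thesis .
  qed
  have "D j \<le> (\<integral>\<^sup>+t. ennreal (\<alpha> / 4) * ((\<integral>\<^sup>+z. ennreal (form_dens j t z) \<partial>lborel) * indicator {a<..<b} t)
     + ennreal (?B * (2 * Cn)) * (pow_slice j t * indicator {a<..<b} t) + ennreal (2 * Lam * Cf * \<rho> j powr (-p)) * (?N t * indicator {a<..<b} t) \<partial>lborel)"
    unfolding J.Drift_def using slice by (intro nn_integral_mono) (auto split: split_indicator)
  also have "\<dots> = ennreal (\<alpha> / 4) * Form j + ennreal (?B * (2 * Cn)) * Pow j
     + ennreal (2 * Lam * Cf * \<rho> j powr (-p)) * (\<integral>\<^sup>+t. ?N t * indicator {a<..<b} t \<partial>lborel)"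
    unfolding Form_def Pow_def by (simp add: nn_integral_add nn_integral_cmult)
  also have "\<dots> \<le> ennreal (\<alpha> / 4) * Form j + ennreal (?B * (2 * Cn)) * Pow j + ennreal (2 * Lam * Cf * \<rho> j powr (-p)) * 1"
    by (intro add_left_mono mult_left_mono tail) auto
  finally show ?thesis by simp
qed

end

section \<open>Coercivity and the integral of (1 + u) powr (1 + \<alpha>)\<close>

context nonlocal_local
begin

definition d :: real where "d = real DIM('a)"

definition \<omega> :: real where "\<omega> = unit_ball_vol (real DIM('a))"

text \<open>The constant of \<open>trunc_root_sobolev_pointwise\<close>.\<close>

definition c0 :: real where
  "c0 = (1 - (3/4) powr ((1 - \<alpha>) / 2))\<^sup>2 * (\<omega> / 2) * (\<omega> / 4) powr (2 * s / d)"

lemma d: "1 \<le> d" "0 < d" "s < d"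
proof -
  show "1 \<le> d" by (simp add: d_def Suc_le_eq)
  then show "0 < d" "s < d" using s by auto
qed

lemma \<omega>: "0 < \<omega>" by (simp add: \<omega>_def)

lemma c0: "0 < c0"
proof -
  have "(3/4) powr ((1 - \<alpha>) / 2) < 1 powr ((1 - \<alpha>) / 2)" using \<alpha> by (intro powr_less_mono2) auto
  then show ?thesis unfolding c0_def using \<omega> by (intro mult_pos_pos) auto
qed

text \<open>The unknown of the recursion: it bounds the dissipation and the local masses of stage j,
  and is at least 1, as the iteration lemma asks. Reading the drift as a real number is sound since
  \<open>Drift_bound\<close> makes it finite.\<close>

definition X :: "nat \<Rightarrow> real" where "X j = 1 + 2 * enn2real (D j)"

lemma D_eq: "D j = ennreal (enn2real (D j))"
  using Drift_bound by (metis ennreal_enn2real ennreal_less_top le_less_trans)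

lemma X: "1 \<le> X j" "1 + D j \<le> ennreal (X j)" "1 + 2 * D j = ennreal (X j)"
proof -
  show "1 \<le> X j" by (simp add: X_def)
  have eq: "1 + 2 * ennreal r = ennreal (1 + 2 * r)" if "0 \<le> r" for r
    using that by (simp add: ennreal_plus ennreal_mult)
  show "1 + 2 * D j = ennreal (X j)" unfolding X_def by (subst D_eq, rule eq) simp
  moreover have "1 + D j \<le> 1 + 2 * D j" by (simp add: mult_2)
  ultimately show "1 + D j \<le> ennreal (X j)" by simp
qed

text \<open>The times at which the two representatives agree and coercivity can be applied to a
  function of \<open>u t\<close>; almost every time is of this kind.\<close>

definition regular :: "real \<Rightarrow> bool" where
  "regular t \<longleftrightarrow> (AE x in lborel. v t x = u t x) \<and>
     (\<integral>\<^sup>+z. ennreal ((u t (fst z) - u t (snd z))\<^sup>2 * norm (fst z - snd z) powr (- p))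
        * indicator (ball 0 (norm c + 3) \<times> ball 0 (norm c + 3)) z \<partial>lborel) < \<infinity> \<and>
     (\<forall>c r g. 0 < r \<longrightarrow> g \<in> borel_measurable borel \<longrightarrow>
      (\<integral>\<^sup>+x. ennreal ((g x)\<^sup>2) * indicator (ball c r) x \<partial>lborel) < \<infinity> \<longrightarrow>
      (\<integral>\<^sup>+z. ennreal ((g (fst z) - g (snd z))\<^sup>2 * norm (fst z - snd z) powr (- p)) * indicator (ball c r \<times> ball c r) z \<partial>lborel) < \<infinity> \<longrightarrow>
      ennreal lam * (\<integral>\<^sup>+z. ennreal ((g (fst z) - g (snd z))\<^sup>2 * norm (fst z - snd z) powr (- p)) * indicator (ball c r \<times> ball c r) z \<partial>lborel)
      \<le> (\<integral>\<^sup>+z. ennreal ((g (fst z) - g (snd z))\<^sup>2 * k t (fst z) (snd z)) * indicator (ball c r \<times> ball c r) z \<partial>lborel))"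

lemma ball_Times_borel [measurable]: "ball (x::'a) r \<times> ball (y::'a) r' \<in> sets borel"
  by (intro borel_open open_Times) auto

lemma AE_regular: "AE t in lborel. t \<in> {a<..<b} \<longrightarrow> regular t"
proof -
  let ?S = "\<lambda>t. \<integral>\<^sup>+z. ennreal ((u t (fst z) - u t (snd z))\<^sup>2 * norm (fst z - snd z) powr (- p))
        * indicator (ball 0 (norm c + 3) \<times> ball 0 (norm c + 3)) z \<partial>lborel"
  have "AE t in lborel. ?S t * indicator {0<..<T} t \<noteq> \<infinity>"
    using u_Hs[of "norm c + 3"] by (intro nn_integral_PInf_AE) (auto simp: add_nonneg_pos)
  then show ?thesis using v_eq coercive
  proof eventually_elim
    case (elim t)
    then show ?case unfolding regular_def using ab by (auto simp: less_top)
  qed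
qed

definition root_energy :: "nat \<Rightarrow> real \<Rightarrow> ennreal" where
  "root_energy j t = (\<integral>\<^sup>+z. ennreal ((trunc_root \<alpha> (u t (fst z)) - trunc_root \<alpha> (u t (snd z)))\<^sup>2 * norm (fst z - snd z) powr (- p))
     * indicator (ball c (rad j + 3 * \<rho> j) \<times> ball c (rad j + 3 * \<rho> j)) z \<partial>lborel)"

lemma ball_subset_ball_0: "ball c (rad j + 3 * \<rho> j) \<subseteq> ball 0 (norm c + 3)"
proof
  fix x assume "x \<in> ball c (rad j + 3 * \<rho> j)"
  then have "norm (x - c) < 2" using rad(3)[of j] \<rho>[of j] by (simp add: dist_norm norm_minus_commute)
  then show "x \<in> ball 0 (norm c + 3)" using norm_triangle_ineq2[of x c] by simp
qed

text \<open>Coercivity is applied to the root of the truncation on a ball where the next cutoff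
  equals 1. That this root lies in H^s of the ball is not automatic: its square is at most 1 + u,
  which is integrable there, and its increments are at most those of \<open>u\<close>.\<close>

lemma root_energy_le:
  assumes t: "t \<in> {a<..<b}" "regular t"
  shows "root_energy j t \<le> ennreal (1 / lam) * (\<integral>\<^sup>+z. ennreal (form_dens (Suc j) t z) \<partial>lborel)"
proof -
  let ?r = "rad j + 3 * \<rho> j"
  let ?B = "ball c ?r"
  let ?g = "\<lambda>x. trunc_root \<alpha> (u t x)"
  have r: "0 < ?r" using rad(1)[of j] \<rho>[of j] by linarith
  have R: "0 < norm c + 3" using norm_ge_zero[of c] by linarith
  have tT: "t \<in> {0<..<T}" using t ab by auto
  have vu: "AE x in lborel. v t x = u t x" using t(2) by (simp add: regular_def)
  have "(\<integral>\<^sup>+x. ennreal ((?g x)\<^sup>2) * indicator ?B x \<partial>lborel) \<le> (\<integral>\<^sup>+x. ennreal (v t x) * indicator (ball 0 (norm c + 3)) x + indicator ?B x \<partial>lborel)"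
  proof (rule nn_integral_mono_AE)
    show "AE x in lborel. ennreal ((?g x)\<^sup>2) * indicator ?B x \<le> ennreal (v t x) * indicator (ball 0 (norm c + 3)) x + indicator ?B x"
      using vu
    proof eventually_elim
      case (elim x)
      have "ennreal ((?g x)\<^sup>2) \<le> ennreal (1 + u t x)" by (intro ennreal_leI trunc_root_le[OF \<alpha>] u_nonneg)
      also have "\<dots> = ennreal (u t x) + 1" using u_nonneg by (simp add: ennreal_plus add.commute)
      finally show ?case using elim ball_subset_ball_0[of j] by (auto split: split_indicator)
    qed
  qed
  also have "\<dots> = (\<integral>\<^sup>+x. ennreal (v t x) * indicator (ball 0 (norm c + 3)) x \<partial>lborel) + emeasure lborel ?B"
    by (subst nn_integral_add) auto
  also have "\<dots> < \<infinity>" using v_L1_finite[OF tT R] r by (simp add: emeasure_ball)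
  finally have 1: "(\<integral>\<^sup>+x. ennreal ((?g x)\<^sup>2) * indicator ?B x \<partial>lborel) < \<infinity>" .
  have "(\<integral>\<^sup>+z. ennreal ((?g (fst z) - ?g (snd z))\<^sup>2 * norm (fst z - snd z) powr (- p)) * indicator (?B \<times> ?B) z \<partial>lborel)
    \<le> (\<integral>\<^sup>+z. ennreal ((u t (fst z) - u t (snd z))\<^sup>2 * norm (fst z - snd z) powr (- p))
        * indicator (ball 0 (norm c + 3) \<times> ball 0 (norm c + 3)) z \<partial>lborel)"
    using ball_subset_ball_0[of j] trunc_root_lipschitz[OF \<alpha> u_nonneg u_nonneg]
    by (intro nn_integral_mono mult_mono ennreal_leI mult_right_mono) (auto split: split_indicator)
  also have "\<dots> < \<infinity>" using t(2) by (simp add: regular_def)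
  finally have 2: "(\<integral>\<^sup>+z. ennreal ((?g (fst z) - ?g (snd z))\<^sup>2 * norm (fst z - snd z) powr (- p)) * indicator (?B \<times> ?B) z \<partial>lborel) < \<infinity>" .
  have "?g \<in> borel_measurable borel" by measurable
  with t(2) r 1 2 have "ennreal lam * root_energy j t \<le> (\<integral>\<^sup>+z. ennreal ((?g (fst z) - ?g (snd z))\<^sup>2 * k t (fst z) (snd z)) * indicator (?B \<times> ?B) z \<partial>lborel)"
    unfolding regular_def root_energy_def by (elim conjE allE[of _ c] allE[of _ ?r] allE[of _ ?g]) blast
  also have "\<dots> \<le> (\<integral>\<^sup>+z. ennreal (form_dens (Suc j) t z) \<partial>lborel)"
  proof (rule nn_integral_mono)
    fix z
    show "ennreal ((?g (fst z) - ?g (snd z))\<^sup>2 * k t (fst z) (snd z)) * indicator (?B \<times> ?B) z \<le> ennreal (form_dens (Suc j) t z)"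
    proof (cases "z \<in> ?B \<times> ?B")
      case True
      then have "norm (fst z - c) \<le> rad (Suc j)" "norm (snd z - c) \<le> rad (Suc j)"
        using rad(2)[of j] \<rho>[of j] by (auto simp: dist_norm norm_minus_commute)
      then have "W (Suc j) (fst z) = 1" "W (Suc j) (snd z) = 1" by (simp_all add: cut_eq_1)
      then have "(?g (fst z) - ?g (snd z))\<^sup>2 * k t (fst z) (snd z) \<le> form_dens (Suc j) t z"
        unfolding form_dens_def by (simp add: mult_right_mono k_nonneg trunc_root_diff_le[OF \<alpha> u_nonneg u_nonneg])
      then show ?thesis using True by (simp add: ennreal_leI)
    qed simp
  qed
  finally have "ennreal (1 / lam) * (ennreal lam * root_energy j t) \<le> ennreal (1 / lam) * (\<integral>\<^sup>+z. ennreal (form_dens (Suc j) t z) \<partial>lborel)"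
    by (rule mult_left_mono) simp
  moreover have "ennreal (1 / lam) * ennreal lam = 1" using lam by (simp add: ennreal_mult[symmetric])
  ultimately show ?thesis by (simp add: mult.assoc[symmetric])
qed

lemma local_mass_le:
  assumes t: "t \<in> {a<..<b}" "regular t"
  shows "(\<integral>\<^sup>+x. ennreal (u t x) * indicator (ball c (rad (Suc j))) x \<partial>lborel) \<le> ennreal (X (Suc j))"
proof -
  have "(\<integral>\<^sup>+x. ennreal (u t x) * indicator (ball c (rad (Suc j))) x \<partial>lborel) \<le> (\<integral>\<^sup>+x. ennreal (v t x * W (Suc j) x) \<partial>lborel)"
  proof (rule nn_integral_mono_AE)
    have "AE x in lborel. v t x = u t x" using t(2) by (simp add: regular_def)
    then show "AE x in lborel. ennreal (u t x) * indicator (ball c (rad (Suc j))) x \<le> ennreal (v t x * W (Suc j) x)"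
      by eventually_elim (auto simp: cut_eq_1 dist_norm norm_minus_commute split: split_indicator)
  qed
  also have "\<dots> \<le> 1 + D (Suc j)" using t by (intro mass_le) auto
  also have "\<dots> \<le> ennreal (X (Suc j))" by (rule X)
  finally show ?thesis .
qed

text \<open>By the choice of \<alpha>, 1 + \<alpha> = (1 - \<alpha>) + s/d, so only half of the
  exponent 2 s/d gained by the Sobolev inequality is spent. The other half becomes the small factor
  \<open>h powr (- s / d)\<close> above the level h.\<close>

lemma pow_le_root_energy:
  assumes u: "1 \<le> h" "h < y" and m: "0 < m"
  shows "(1 + y) powr (1 + \<alpha>) \<le> 4 * h powr (- s / d) * m powr (2 * s / d) / c0 * (c0 * ((1 + y) powr (1 - \<alpha>) * (y / m) powr (2 * s / d)))"
proof -
  have y: "1 < y" "0 < y" using u by auto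
  have sd: "0 < s / d" "s / d < 1" using s d by auto
  have "1 + \<alpha> = (1 - \<alpha>) + s / d" by (simp add: \<alpha>_def d_def field_simps)
  then have "(1 + y) powr (1 + \<alpha>) = (1 + y) powr (1 - \<alpha>) * (1 + y) powr (s / d)"
    by (simp only: powr_add)
  also have "(1 + y) powr (s / d) \<le> (2 * y) powr (s / d)" using y sd by (intro powr_mono2) auto
  also have "(2 * y) powr (s / d) = 2 powr (s / d) * y powr (s / d)" using y by (subst powr_mult) auto
  also have "2 powr (s / d) \<le> 2 powr (1::real)" using sd by (intro powr_mono) auto
  also have "y powr (s / d) = y powr (- s / d) * y powr (2 * s / d)" using y by (simp add: powr_add[symmetric])
  also have "y powr (- s / d) \<le> h powr (- s / d)" using u sd by (intro powr_mono2') auto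
  finally have "(1 + y) powr (1 + \<alpha>) \<le> (1 + y) powr (1 - \<alpha>) * (2 * (h powr (- s / d) * y powr (2 * s / d)))"
    by (simp add: mult_left_mono mult_right_mono)
  also have "\<dots> \<le> (1 + y) powr (1 - \<alpha>) * (4 * (h powr (- s / d) * y powr (2 * s / d)))"
    by (intro mult_left_mono mult_right_mono) auto
  also have "\<dots> = 4 * h powr (- s / d) * m powr (2 * s / d) / c0 * (c0 * ((1 + y) powr (1 - \<alpha>) * (y / m) powr (2 * s / d)))"
    using c0 m y by (simp add: powr_divide)
  finally show ?thesis .
qed

text \<open>Splitting at the level h. Below it, \<alpha> powers of 1 + u are bounded by a multiple
  of \<open>h powr \<alpha>\<close> and the mass remains. Above it, the pointwise Sobolev inequality
  on the ball of radius \<rho> j is used; the condition linking h to X (Suc j) says that this ball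
  is large enough for the Markov argument.\<close>

lemma pow_slice_le:
  assumes t: "t \<in> {a<..<b}" "regular t" and h: "1 \<le> h" "4 * X (Suc j) \<le> \<omega> * \<rho> j ^ DIM('a) * h"
  shows "pow_slice j t \<le> ennreal (2 * h powr \<alpha>) * (\<integral>\<^sup>+x. ennreal (1 + u t x) * indicator (ball c 2) x \<partial>lborel)
    + ennreal (4 * h powr (- s / d) * X (Suc j) powr (2 * s / d) / c0) * root_energy j t"
proof -
  let ?m = "X (Suc j)"
  let ?\<kappa> = "4 * h powr (- s / d) * ?m powr (2 * s / d) / c0"
  let ?B' = "ball c (rad j + 2 * \<rho> j)" and ?B = "ball c (rad j + 3 * \<rho> j)"
  let ?e = "\<lambda>z. ennreal ((trunc_root \<alpha> (u t (fst z)) - trunc_root \<alpha> (u t (snd z)))\<^sup>2 * norm (fst z - snd z) powr (- p))"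
  let ?G = "\<lambda>x. \<integral>\<^sup>+y. ?e (x, y) * indicator (ball x (\<rho> j)) y \<partial>lborel"
  have m: "0 < ?m" using X(1)[of "Suc j"] by linarith
  have \<kappa>: "0 \<le> ?\<kappa>" using c0 by simp
  have pp: "real DIM('a) + 2 * s = p" by (simp add: p_def)
  have point: "ennreal ((1 + u t x) powr (1 + \<alpha>)) * indicator ?B' x \<le> ennreal (2 * h powr \<alpha>) * (ennreal (1 + u t x) * indicator (ball c 2) x)
     + ennreal ?\<kappa> * (\<integral>\<^sup>+y. ?e (x, y) * indicator (?B \<times> ?B) (x, y) \<partial>lborel)" for x
  proof (cases "x \<in> ?B'")
    case x: True
    have u0: "0 \<le> u t x" by (rule u_nonneg)
    have in2: "x \<in> ball c 2" using x rad(3)[of j] \<rho>[of j] by simp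
    have sub: "ball x (\<rho> j) \<subseteq> ?B"
    proof
      fix y assume "y \<in> ball x (\<rho> j)"
      then show "y \<in> ?B" using x dist_triangle[of c y x] by simp
    qed
    show ?thesis
    proof (cases "u t x \<le> h")
      case True
      have "(1 + u t x) powr (1 + \<alpha>) = (1 + u t x) powr \<alpha> * (1 + u t x)"
        using u0 by (simp add: powr_add mult.commute)
      also have "\<dots> \<le> (2 * h) powr \<alpha> * (1 + u t x)"
        using True u0 h \<alpha> by (intro mult_right_mono powr_mono2) auto
      also have "(2 * h) powr \<alpha> = 2 powr \<alpha> * h powr \<alpha>" using h by (subst powr_mult) auto
      also have "2 powr \<alpha> * h powr \<alpha> * (1 + u t x) \<le> 2 powr 1 * h powr \<alpha> * (1 + u t x)"
        using u0 \<alpha> by (intro mult_right_mono powr_mono) auto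
      finally have "ennreal ((1 + u t x) powr (1 + \<alpha>)) \<le> ennreal (2 * h powr \<alpha> * (1 + u t x))"
        by (intro ennreal_leI) simp
      also have "\<dots> = ennreal (2 * h powr \<alpha>) * ennreal (1 + u t x)"
        using u0 by (intro ennreal_mult) auto
      finally show ?thesis using x in2 by (simp add: add_increasing2)
    next
      case False
      have "ennreal ((1 + u t x) powr (1 + \<alpha>)) \<le> ennreal (?\<kappa> * (c0 * ((1 + u t x) powr (1 - \<alpha>) * (u t x / ?m) powr (2 * s / d))))"
        using False h m by (intro ennreal_leI pow_le_root_energy) auto
      also have "\<dots> = ennreal ?\<kappa> * ennreal (c0 * ((1 + u t x) powr (1 - \<alpha>) * (u t x / ?m) powr (2 * s / d)))"
        using \<kappa> c0 by (intro ennreal_mult) auto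
      also have "ennreal (c0 * ((1 + u t x) powr (1 - \<alpha>) * (u t x / ?m) powr (2 * s / d))) \<le> ?G x"
      proof -
        have mass: "(\<integral>\<^sup>+y. ennreal (u t y) * indicator (ball x (\<rho> j)) y \<partial>lborel) \<le> ennreal ?m"
          using sub rad(2)[of j] \<rho>[of j]
          by (intro order_trans[OF nn_integral_mono local_mass_le[OF t]]) (auto split: split_indicator)
        have "\<omega> * \<rho> j ^ DIM('a) * h \<le> \<omega> * \<rho> j ^ DIM('a) * u t x"
          using False \<omega> \<rho>[of j] by (intro mult_left_mono) auto
        then have r: "4 * ?m \<le> unit_ball_vol (real DIM('a)) * \<rho> j ^ DIM('a) * u t x" using h(2) unfolding \<omega>_def by linarith
        have "1 \<le> u t x" using False h by linarith
        from trunc_root_sobolev_pointwise[OF \<alpha> _ u_nonneg s(1) m \<rho>(1) this mass r]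
        show ?thesis unfolding c0_def \<omega>_def d_def pp by (simp add: mult.assoc)
      qed
      also have "?G x \<le> (\<integral>\<^sup>+y. ?e (x, y) * indicator (?B \<times> ?B) (x, y) \<partial>lborel)"
        using sub x \<rho>[of j] by (intro nn_integral_mono mult_left_mono) (auto split: split_indicator)
      finally have "ennreal ((1 + u t x) powr (1 + \<alpha>)) \<le> ennreal ?\<kappa> * (\<integral>\<^sup>+y. ?e (x, y) * indicator (?B \<times> ?B) (x, y) \<partial>lborel)"
        by (simp add: mult_left_mono)
      then show ?thesis using x by (simp add: add_increasing)
    qed
  qed simp
  have "pow_slice j t \<le> (\<integral>\<^sup>+x. ennreal (2 * h powr \<alpha>) * (ennreal (1 + u t x) * indicator (ball c 2) x)
     + ennreal ?\<kappa> * (\<integral>\<^sup>+y. ?e (x, y) * indicator (?B \<times> ?B) (x, y) \<partial>lborel) \<partial>lborel)"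
    unfolding pow_slice_def by (intro nn_integral_mono point)
  also have "\<dots> = ennreal (2 * h powr \<alpha>) * (\<integral>\<^sup>+x. ennreal (1 + u t x) * indicator (ball c 2) x \<partial>lborel)
     + ennreal ?\<kappa> * (\<integral>\<^sup>+x. \<integral>\<^sup>+y. ?e (x, y) * indicator (?B \<times> ?B) (x, y) \<partial>lborel \<partial>lborel)"
    by (simp add: nn_integral_add nn_integral_cmult)
  also have "(\<integral>\<^sup>+x. \<integral>\<^sup>+y. ?e (x, y) * indicator (?B \<times> ?B) (x, y) \<partial>lborel \<partial>lborel) = root_energy j t"
    unfolding root_energy_def by (rule nn_integral_lborel_pair[symmetric]) measurable
  finally show ?thesis .
qed

end

text \<open>The constants are written as explicit functions of the data outside the locale of a
  solution, so that they can be fixed before any solution is chosen.\<close>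

definition pow_const :: "nat \<Rightarrow> real \<Rightarrow> real \<Rightarrow> real \<Rightarrow> real" where
  "pow_const n s T lam = (let d = real n; \<alpha> = s / (2 * d); \<omega> = unit_ball_vol d;
      c0 = (1 - (3/4) powr ((1 - \<alpha>) / 2))\<^sup>2 * (\<omega> / 2) * (\<omega> / 4) powr (2 * s / d)
    in 2 * (4 / \<omega> + 1) * (T * (\<omega> * 2 ^ n) + 3 powr (d + 2 * s)) + 4 / (c0 * lam * \<alpha>))"

definition step_const :: "nat \<Rightarrow> real \<Rightarrow> real \<Rightarrow> real \<Rightarrow> real \<Rightarrow> real \<Rightarrow> real \<Rightarrow> real" where
  "step_const n s Lam T lam Cf Cn = 2 + 64 * real n / s * Lam * Cn * pow_const n s T lam + 8 * Lam * Cf"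

context nonlocal_local
begin

text \<open>This is the product of \<alpha> = s/(2d) with the exponent 1 + d/s of the threshold in
  \<open>Pow_le\<close>; it is below 1 because s < d.\<close>

definition \<gamma> :: real where "\<gamma> = (1 + s / d) / 2"

lemma \<gamma>: "0 < \<gamma>" "\<gamma> < 1" "s / d \<le> \<gamma>"
proof -
  define q where "q = s / d"
  have "0 < q" "q < 1" unfolding q_def using s d by auto
  then show "0 < \<gamma>" "\<gamma> < 1" "s / d \<le> \<gamma>" unfolding \<gamma>_def q_def[symmetric] by auto
qed

definition CQ :: real where "CQ = pow_const DIM('a) s T lam"

lemma CQ_eq: "CQ = 2 * (4 / \<omega> + 1) * (T * (\<omega> * 2 ^ DIM('a)) + 3 powr p) + 4 / (c0 * lam * \<alpha>)"
  by (simp add: CQ_def pow_const_def Let_def \<omega>_def c0_def \<alpha>_def d_def p_def)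

lemma T_pos: "0 < T" using ab by linarith

lemma CQ_nonneg: "0 \<le> CQ"
  unfolding CQ_eq using \<omega> c0 lam \<alpha> T_pos by (intro add_nonneg_nonneg mult_nonneg_nonneg) auto

text \<open>On the ball of radius 2 the weight centred at \<open>c\<close> is at least 3 powr (-p),
  so the normalised tail bounds the local mass integrated in time.\<close>

lemma total_local_mass:
  "(\<integral>\<^sup>+t. (\<integral>\<^sup>+x. ennreal (1 + u t x) * indicator (ball c 2) x \<partial>lborel) * indicator {a<..<b} t \<partial>lborel)
    \<le> ennreal (T * (\<omega> * 2 ^ DIM('a)) + 3 powr p)"
proof -
  let ?N = "\<lambda>t. \<integral>\<^sup>+x. ennreal (u t x) * ennreal ((1 + norm (x - c)) powr (- p)) \<partial>lborel"
  have slice: "(\<integral>\<^sup>+x. ennreal (1 + u t x) * indicator (ball c 2) x \<partial>lborel) \<le> ennreal (\<omega> * 2 ^ DIM('a)) + ennreal (3 powr p) * ?N t" for t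
  proof -
    have "(\<integral>\<^sup>+x. ennreal (1 + u t x) * indicator (ball c 2) x \<partial>lborel)
      \<le> (\<integral>\<^sup>+x. indicator (ball c 2) x + ennreal (3 powr p) * (ennreal (u t x) * ennreal ((1 + norm (x - c)) powr (- p))) \<partial>lborel)"
    proof (rule nn_integral_mono)
      fix x
      show "ennreal (1 + u t x) * indicator (ball c 2) x \<le> indicator (ball c 2) x + ennreal (3 powr p) * (ennreal (u t x) * ennreal ((1 + norm (x - c)) powr (- p)))"
      proof (cases "x \<in> ball c 2")
        case True
        then have "norm (x - c) < 2" by (simp add: dist_norm norm_minus_commute)
        then have "3 powr (-p) \<le> (1 + norm (x - c)) powr (-p)"
          using d_p by (intro powr_mono2') (auto intro: add_pos_nonneg)
        then have "3 powr p * 3 powr (-p) \<le> 3 powr p * (1 + norm (x - c)) powr (-p)" by (intro mult_left_mono) auto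
        moreover have "3 powr p * 3 powr (-p) = (1::real)" by (subst powr_add[symmetric]) simp
        ultimately have "1 \<le> 3 powr p * (1 + norm (x - c)) powr (-p)" by simp
        then have "u t x * 1 \<le> u t x * (3 powr p * (1 + norm (x - c)) powr (-p))" by (intro mult_left_mono u_nonneg)
        then have "ennreal (1 + u t x) \<le> ennreal (1 + u t x * (3 powr p * (1 + norm (x - c)) powr (-p)))" by (intro ennreal_leI) simp
        also have "\<dots> = 1 + ennreal (3 powr p) * (ennreal (u t x) * ennreal ((1 + norm (x - c)) powr (- p)))"
          using u_nonneg[of t x] by (simp add: ennreal_plus ennreal_mult mult_ac)
        finally show ?thesis using True by simp
      qed simp
    qed
    also have "\<dots> = ennreal (\<omega> * 2 ^ DIM('a)) + ennreal (3 powr p) * ?N t"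
      by (simp add: nn_integral_add nn_integral_cmult emeasure_ball \<omega>_def)
    finally show ?thesis .
  qed
  have "(\<integral>\<^sup>+t. (\<integral>\<^sup>+x. ennreal (1 + u t x) * indicator (ball c 2) x \<partial>lborel) * indicator {a<..<b} t \<partial>lborel)
     \<le> (\<integral>\<^sup>+t. ennreal (\<omega> * 2 ^ DIM('a)) * indicator {a<..<b} t + ennreal (3 powr p) * (?N t * indicator {a<..<b} t) \<partial>lborel)"
    using slice by (intro nn_integral_mono) (auto split: split_indicator)
  also have "\<dots> = ennreal (\<omega> * 2 ^ DIM('a)) * ennreal (b - a) + ennreal (3 powr p) * (\<integral>\<^sup>+t. ?N t * indicator {a<..<b} t \<partial>lborel)"
    using ab by (simp add: nn_integral_add nn_integral_cmult nn_integral_cmult_indicator)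
  also have "\<dots> \<le> ennreal (\<omega> * 2 ^ DIM('a)) * ennreal T + ennreal (3 powr p) * 1"
    using ab by (intro add_mono mult_left_mono tail ennreal_leI) auto
  also have "\<dots> = ennreal (T * (\<omega> * 2 ^ DIM('a)) + 3 powr p)"
    using \<omega> T_pos by (simp add: ennreal_mult[symmetric] ennreal_plus[symmetric] mult.commute del: ennreal_plus)
  finally show ?thesis .
qed

lemma Form_le_X: "Form j \<le> ennreal (X j / \<alpha>)"
proof -
  have "ennreal (1 / \<alpha>) * (ennreal \<alpha> * Form j) \<le> ennreal (1 / \<alpha>) * ennreal (X j)"
    using Form_le[of j] Dissip_le[of j] X(3)[of j] by (intro mult_left_mono) auto
  moreover have "ennreal (1 / \<alpha>) * ennreal \<alpha> = 1" using \<alpha> by (simp add: ennreal_mult[symmetric])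
  moreover have "ennreal (1 / \<alpha>) * ennreal (X j) = ennreal (X j / \<alpha>)"
    using \<alpha> X(1)[of j] by (simp add: ennreal_mult[symmetric])
  ultimately show ?thesis by (simp add: mult.assoc[symmetric])
qed

text \<open>The threshold \<open>h\<close> is the power of \<open>X (Suc j)\<close> for which both contributions are sublinear
  in \<open>X (Suc j)\<close>.\<close>

lemma Pow_le: "Pow j \<le> ennreal (CQ / \<rho> j ^ DIM('a) * X (Suc j) powr \<gamma>)"
proof -
  define m where "m = X (Suc j)"
  have m: "1 \<le> m" unfolding m_def by (rule X)
  \<comment> \<open>The summand 4/\<omega> makes the threshold large enough for the Sobolev balls,
    the summand 1 makes \<open>A\<close> at least 1.\<close>
  define A where "A = (4 / \<omega> + 1) / \<rho> j ^ DIM('a)"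
  have \<rho>d: "0 < \<rho> j ^ DIM('a)" "\<rho> j ^ DIM('a) \<le> 1" using \<rho>[of j] by (auto intro!: power_le_one)
  have "\<rho> j ^ DIM('a) \<le> 4 / \<omega> + 1" using \<rho>d(2) \<omega> by (intro add_increasing) auto
  then have A: "1 \<le> A" using \<rho>d unfolding A_def by (simp add: le_divide_eq)
  \<comment> \<open>With this exponent \<open>h powr \<alpha>\<close> is of order
    \<open>m powr \<gamma>\<close>, while \<open>h powr (- s / d) * m powr (2 * s / d) * m\<close>
    is of order \<open>m powr (s / d)\<close>, and s/d \<le> \<gamma>.\<close>
  define h where "h = A * m powr (1 + d / s)"
  have e: "1 \<le> 1 + d / s" using d s by simp
  have "m powr 1 \<le> m powr (1 + d / s)" using m e by (intro powr_mono) auto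
  then have mh: "m \<le> m powr (1 + d / s)" using m by simp
  have h1: "1 \<le> h" unfolding h_def using A mh m mult_mono[of 1 A 1 "m powr (1 + d / s)"] by auto
  have "\<omega> * \<rho> j ^ DIM('a) * h = (\<omega> * (4 / \<omega> + 1)) * m powr (1 + d / s)"
    using \<rho>[of j] by (simp add: h_def A_def)
  also have "\<omega> * (4 / \<omega> + 1) = 4 + \<omega>" using \<omega> by (simp add: distrib_left)
  finally have "\<omega> * \<rho> j ^ DIM('a) * h = (4 + \<omega>) * m powr (1 + d / s)" .
  moreover have "4 * m \<le> (4 + \<omega>) * m powr (1 + d / s)" using \<omega> mh m by (intro mult_mono) auto
  ultimately have h2: "4 * X (Suc j) \<le> \<omega> * \<rho> j ^ DIM('a) * h" by (simp add: m_def)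
  have ha: "h powr \<alpha> \<le> A * m powr \<gamma>"
  proof -
    have "h powr \<alpha> = A powr \<alpha> * (m powr (1 + d / s)) powr \<alpha>" unfolding h_def using A m by (subst powr_mult) auto
    also have "(m powr (1 + d / s)) powr \<alpha> = m powr \<gamma>"
    proof -
      have "(1 + d / s) * \<alpha> = \<gamma>" using d s by (simp add: \<alpha>_def \<gamma>_def d_def[symmetric] field_simps)
      then show ?thesis by (simp add: powr_powr)
    qed
    also have "A powr \<alpha> \<le> A powr 1" using A \<alpha> by (intro powr_mono) auto
    finally show ?thesis using A by (simp add: mult_right_mono)
  qed
  have hs: "h powr (- s / d) * m powr (2 * s / d) * m \<le> m powr \<gamma>"
  proof -
    have "h powr (- s / d) = A powr (- s / d) * (m powr (1 + d / s)) powr (- s / d)" unfolding h_def using A m by (subst powr_mult) auto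
    also have "(m powr (1 + d / s)) powr (- s / d) = m powr (- s / d - 1)"
    proof -
      have "(1 + d / s) * (- s / d) = - s / d - 1" using d s by (simp add: field_simps)
      then show ?thesis by (simp add: powr_powr)
    qed
    also have "A powr (- s / d) \<le> 1" using A s d powr_mono2'[of "- s / d" 1 A] by simp
    finally have "h powr (- s / d) \<le> m powr (- s / d - 1)" by (simp add: mult_right_mono)
    then have "h powr (- s / d) * (m powr (2 * s / d) * m powr 1) \<le> m powr (- s / d - 1) * (m powr (2 * s / d) * m powr 1)"
      by (intro mult_right_mono) auto
    also have "\<dots> = m powr (s / d)" by (simp only: powr_add[symmetric]) (simp add: field_simps)
    also have "\<dots> \<le> m powr \<gamma>" using m \<gamma> by (intro powr_mono) auto
    finally show ?thesis using m by (simp add: mult.assoc)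
  qed
  define \<kappa> where "\<kappa> = 4 * h powr (- s / d) * m powr (2 * s / d) / c0"
  have \<kappa>: "0 \<le> \<kappa>" using c0 by (simp add: \<kappa>_def)
  have "Pow j \<le> (\<integral>\<^sup>+t. ennreal (2 * h powr \<alpha>) * ((\<integral>\<^sup>+x. ennreal (1 + u t x) * indicator (ball c 2) x \<partial>lborel) * indicator {a<..<b} t)
      + ennreal (\<kappa> / lam) * ((\<integral>\<^sup>+z. ennreal (form_dens (Suc j) t z) \<partial>lborel) * indicator {a<..<b} t) \<partial>lborel)"
    unfolding Pow_def
  proof (rule nn_integral_mono_AE)
    show "AE t in lborel. pow_slice j t * indicator {a<..<b} t \<le> ennreal (2 * h powr \<alpha>) * ((\<integral>\<^sup>+x. ennreal (1 + u t x) * indicator (ball c 2) x \<partial>lborel) * indicator {a<..<b} t)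
      + ennreal (\<kappa> / lam) * ((\<integral>\<^sup>+z. ennreal (form_dens (Suc j) t z) \<partial>lborel) * indicator {a<..<b} t)"
      using AE_regular
    proof eventually_elim
      case (elim t)
      show ?case
      proof (cases "t \<in> {a<..<b}")
        case True
        then have t: "regular t" using elim by blast
        have "pow_slice j t \<le> ennreal (2 * h powr \<alpha>) * (\<integral>\<^sup>+x. ennreal (1 + u t x) * indicator (ball c 2) x \<partial>lborel) + ennreal \<kappa> * root_energy j t"
          using pow_slice_le[OF True t h1 h2] by (simp add: \<kappa>_def m_def)
        also have "ennreal \<kappa> * root_energy j t \<le> ennreal \<kappa> * (ennreal (1 / lam) * (\<integral>\<^sup>+z. ennreal (form_dens (Suc j) t z) \<partial>lborel))"
          by (intro mult_left_mono root_energy_le[OF True t]) simp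
        also have "\<dots> = ennreal (\<kappa> / lam) * (\<integral>\<^sup>+z. ennreal (form_dens (Suc j) t z) \<partial>lborel)"
          using \<kappa> lam by (simp add: mult.assoc[symmetric] ennreal_mult[symmetric])
        finally show ?thesis using True by (simp add: add_left_mono)
      qed simp
    qed
  qed
  also have "\<dots> = ennreal (2 * h powr \<alpha>) * (\<integral>\<^sup>+t. (\<integral>\<^sup>+x. ennreal (1 + u t x) * indicator (ball c 2) x \<partial>lborel) * indicator {a<..<b} t \<partial>lborel)
      + ennreal (\<kappa> / lam) * Form (Suc j)"
    unfolding Form_def by (simp add: nn_integral_add nn_integral_cmult)
  also have "\<dots> \<le> ennreal (2 * h powr \<alpha>) * ennreal (T * (\<omega> * 2 ^ DIM('a)) + 3 powr p) + ennreal (\<kappa> / lam) * ennreal (m / \<alpha>)"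
    unfolding m_def by (intro add_mono mult_left_mono total_local_mass Form_le_X) auto
  also have "\<dots> = ennreal (2 * h powr \<alpha> * (T * (\<omega> * 2 ^ DIM('a)) + 3 powr p) + \<kappa> / lam * (m / \<alpha>))"
    using \<kappa> lam m \<alpha> T_pos \<omega> by (simp add: ennreal_mult[symmetric] ennreal_plus[symmetric] add_nonneg_nonneg del: ennreal_plus)
  also have "\<dots> \<le> ennreal (CQ / \<rho> j ^ DIM('a) * m powr \<gamma>)"
  proof (rule ennreal_leI)
    let ?V = "T * (\<omega> * 2 ^ DIM('a)) + 3 powr p"
    have V: "0 \<le> ?V" using T_pos \<omega> by simp
    have 1: "2 * h powr \<alpha> * ?V \<le> 2 * (A * m powr \<gamma>) * ?V" using ha V by (intro mult_right_mono mult_left_mono) auto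
    have "\<kappa> / lam * (m / \<alpha>) = 4 / (c0 * lam * \<alpha>) * (h powr (- s / d) * m powr (2 * s / d) * m)" by (simp add: \<kappa>_def)
    also have "\<dots> \<le> 4 / (c0 * lam * \<alpha>) * m powr \<gamma>" using hs c0 lam \<alpha> by (intro mult_left_mono) auto
    also have "\<dots> \<le> 4 / (c0 * lam * \<alpha>) * (m powr \<gamma> / \<rho> j ^ DIM('a))"
      using \<rho>d c0 lam \<alpha> mult_left_mono[of "\<rho> j ^ DIM('a)" 1 "m powr \<gamma>"] by (intro mult_left_mono) (auto simp: field_simps)
    finally have 2: "\<kappa> / lam * (m / \<alpha>) \<le> 4 / (c0 * lam * \<alpha>) * (m powr \<gamma> / \<rho> j ^ DIM('a))" .
    have "2 * (A * m powr \<gamma>) * ?V + 4 / (c0 * lam * \<alpha>) * (m powr \<gamma> / \<rho> j ^ DIM('a)) = CQ / \<rho> j ^ DIM('a) * m powr \<gamma>"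
      unfolding CQ_eq A_def by (simp add: algebra_simps add_divide_distrib)
    then show "2 * h powr \<alpha> * ?V + \<kappa> / lam * (m / \<alpha>) \<le> CQ / \<rho> j ^ DIM('a) * m powr \<gamma>" using 1 2 by linarith
  qed
  finally show ?thesis by (simp add: m_def)
qed

text \<open>The form term costs X j / 4, the power term is sublinear in X (Suc j), and the tail term
  is a constant times a power of 1/\<rho> j. All negative powers of \<rho> j are collected in \<rho>
  j powr -(d + 2): this covers \<rho> j powr (-p) because p < d + 2, and it grows geometrically in
  j.\<close>

lemma X_step: "X j \<le> step_const DIM('a) s Lam T lam Cf Cn * (8 ^ (DIM('a) + 2)) * (2 ^ (DIM('a) + 2)) ^ j * X (Suc j) powr \<gamma>"
proof -
  define r where "r = enn2real (D j)"
  have r: "D j = ennreal r" "0 \<le> r" unfolding r_def using D_eq by auto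
  define P where "P = CQ / \<rho> j ^ DIM('a) * X (Suc j) powr \<gamma>"
  define B where "B = 4 / \<alpha> * Lam / (\<rho> j)\<^sup>2 * (2 * Cn)"
  define F where "F = 2 * Lam * Cf * \<rho> j powr (- p)"
  have P: "0 \<le> P" unfolding P_def using CQ_nonneg \<rho>[of j] by (intro mult_nonneg_nonneg divide_nonneg_nonneg) auto
  have B: "0 \<le> B" unfolding B_def using \<alpha> Lam Cn by simp
  have F: "0 \<le> F" unfolding F_def using Lam Cf(1) by simp
  have Xr: "X j = 1 + 2 * r" by (simp add: X_def r_def)
  have "ennreal r \<le> ennreal (\<alpha> / 4) * Form j + ennreal B * Pow j + ennreal F"
    using Drift_le_Form[of j] by (simp add: r B_def F_def)
  also have "\<dots> \<le> ennreal (\<alpha> / 4) * ennreal (X j / \<alpha>) + ennreal B * ennreal P + ennreal F"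
    unfolding P_def by (intro add_mono mult_left_mono Form_le_X Pow_le order_refl) auto
  also have "\<dots> = ennreal (X j / 4 + B * P + F)"
    using \<alpha> B P F X(1)[of j] by (simp add: ennreal_mult[symmetric] ennreal_plus[symmetric] del: ennreal_plus)
  finally have "r \<le> X j / 4 + B * P + F"
    using B P F X(1)[of j] by (subst (asm) ennreal_le_iff) auto
  \<comment> \<open>Since X j = 1 + 2 r, the term X j / 4 amounts to half of X j and moves to the
    left side.\<close>
  then have X_le: "X j \<le> 2 + 4 * B * P + 4 * F" unfolding Xr by (simp add: field_simps)
  define q where "q = 1 / \<rho> j ^ (DIM('a) + 2)"
  define m where "m = X (Suc j) powr \<gamma>"
  have m: "1 \<le> m" unfolding m_def using X(1)[of "Suc j"] \<gamma> by (intro ge_one_powr_ge_zero) auto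
  have q: "1 \<le> q" unfolding q_def using \<rho>[of j] power_le_one[of "\<rho> j" "DIM('a) + 2"] by simp
  have "\<rho> j powr (- p) \<le> \<rho> j powr (- real (DIM('a) + 2))"
    using \<rho>[of j] s by (intro powr_mono') (auto simp: p_def)
  also have "\<dots> = q" unfolding q_def using \<rho>[of j] by (simp only: powr_minus powr_realpow) (simp add: divide_simps)
  finally have \<rho>p: "\<rho> j powr (- p) \<le> q" .
  have qm: "1 \<le> q * m" "q \<le> q * m" using q m mult_mono[of 1 q 1 m] mult_left_mono[of 1 m q] by auto
  have "4 * B * P = 64 * real DIM('a) / s * Lam * Cn * CQ * (q * m)"
    using s d \<rho>[of j] unfolding B_def P_def q_def m_def \<alpha>_def d_def power_add by (simp add: field_simps power2_eq_square)
  moreover have "4 * F \<le> 8 * Lam * Cf * (q * m)"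
  proof -
    have "\<rho> j powr (- p) \<le> q * m" using \<rho>p qm by linarith
    then have "(8 * Lam * Cf) * \<rho> j powr (- p) \<le> (8 * Lam * Cf) * (q * m)" using Lam Cf(1) by (intro mult_left_mono) auto
    then show ?thesis by (simp add: F_def)
  qed
  ultimately have "X j \<le> 2 * (q * m) + 64 * real DIM('a) / s * Lam * Cn * CQ * (q * m) + 8 * Lam * Cf * (q * m)"
    using X_le qm by linarith
  also have "\<dots> = step_const DIM('a) s Lam T lam Cf Cn * q * m"
    by (simp add: step_const_def CQ_def algebra_simps)
  also have "q = 8 ^ (DIM('a) + 2) * (2 ^ (DIM('a) + 2)) ^ j"
  proof -
    have "q = (8 * 2 ^ j) ^ (DIM('a) + 2)" unfolding q_def \<rho>_def by (simp add: power_divide power_one_over field_simps)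
    also have "\<dots> = 8 ^ (DIM('a) + 2) * (2 ^ j) ^ (DIM('a) + 2)" by (rule power_mult_distrib)
    also have "((2::real) ^ j) ^ (DIM('a) + 2) = (2 ^ (DIM('a) + 2)) ^ j" by (simp only: power_mult[symmetric] mult.commute)
    finally show ?thesis .
  qed
  finally show ?thesis by (simp add: m_def mult.assoc)
qed

text \<open>The a priori growth required by the iteration lemma. The constant depends on the
  solution, and 4 is at most the base 2 ^ (d + 2) of the recursion.\<close>

lemma X_growth: "\<exists>C. \<forall>j. X j \<le> C * (2 ^ (DIM('a) + 2)) ^ j"
proof -
  obtain C where C: "\<And>j. D j \<le> ennreal (C * 4 ^ j)" using Drift_bound by blast
  have "X j \<le> (1 + 2 * \<bar>C\<bar>) * (2 ^ (DIM('a) + 2)) ^ j" for j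
  proof -
    have "D j \<le> ennreal (\<bar>C\<bar> * 4 ^ j)" by (rule order_trans[OF C]) (auto intro!: ennreal_leI mult_right_mono)
    then have "enn2real (D j) \<le> \<bar>C\<bar> * 4 ^ j" by (intro enn2real_leI) auto
    then have "X j \<le> 1 + 2 * \<bar>C\<bar> * 4 ^ j" by (simp add: X_def)
    also have "\<dots> \<le> 1 * 4 ^ j + 2 * \<bar>C\<bar> * 4 ^ j" using one_le_power[of "4::real" j] by (intro add_right_mono) auto
    also have "\<dots> = (1 + 2 * \<bar>C\<bar>) * 4 ^ j" by (simp add: algebra_simps)
    also have "\<dots> \<le> (1 + 2 * \<bar>C\<bar>) * (2 ^ (DIM('a) + 2)) ^ j"
      using power_increasing[of 2 "DIM('a) + 2" "2::real"] by (intro mult_left_mono power_mono) auto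
    finally show ?thesis .
  qed
  then show ?thesis by blast
qed

lemma ball_mass_le_X:
  assumes t: "t \<in> {a..b}"
  shows "(\<integral>\<^sup>+x. ennreal (v t x) * indicator (ball c 1) x \<partial>lborel) \<le> ennreal (X 0)"
proof -
  have "(\<integral>\<^sup>+x. ennreal (v t x) * indicator (ball c 1) x \<partial>lborel) \<le> (\<integral>\<^sup>+x. ennreal (v t x * W 0 x) \<partial>lborel)"
    by (intro nn_integral_mono) (auto simp: cut_eq_1 rad_def dist_norm norm_minus_commute split: split_indicator)
  also have "\<dots> \<le> 1 + D 0" using t by (rule mass_le)
  also have "\<dots> \<le> ennreal (X 0)" by (rule X)
  finally show ?thesis .
qed

end

text \<open>\<open>Cf\<close>, \<open>Cn\<close> and the constant of the recursion are fixed from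
  the data before a solution, a centre or an interval is given, and
  \<open>sublinear_iteration\<close> turns them into a bound of the same uniformity.\<close>

lemma local_mass_normalized:
  fixes s Lam T lam p :: real
  assumes s: "0 < s" "s < 1" and pos: "0 < Lam" "0 < T" "0 < lam" and p: "p = real DIM('a) + 2 * s"
  obtains M where "1 \<le> M"
    "\<And>u k v c a b t0 t. nonlocal_flow s Lam T u k lam v \<Longrightarrow> 0 < a \<Longrightarrow> a < b \<Longrightarrow> b < T \<Longrightarrow>
      t0 \<in> {a..b} \<Longrightarrow> t \<in> {a..b} \<Longrightarrow>
      (\<integral>\<^sup>+x. ennreal (v t0 x) * indicator (ball c 2) x \<partial>lborel) \<le> 1 \<Longrightarrow>
      (\<integral>\<^sup>+t. (\<integral>\<^sup>+x. ennreal (u t x) * ennreal ((1 + norm (x - c)) powr (- p)) \<partial>lborel) * indicator {a<..<b} t \<partial>lborel) \<le> 1 \<Longrightarrow>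
      (\<integral>\<^sup>+x. ennreal (v t x) * indicator (ball c 1) x \<partial>(lborel :: 'a::euclidean_space measure)) \<le> ennreal M"
proof -
  have dp: "real DIM('a) < p" "- real DIM('a) < 2 - p" using s p by auto
  have two: "(0::real) \<le> 2" by simp
  obtain Cf where Cf: "0 < Cf" "\<And>c \<delta> h. 0 < \<delta> \<Longrightarrow> \<delta> \<le> 1 \<Longrightarrow> h \<in> borel_measurable borel \<Longrightarrow>
      (\<integral>\<^sup>+x. \<integral>\<^sup>+y. h x * ennreal (norm (x - y) powr (-p)) *
         indicator {z. \<delta> \<le> norm (fst z - snd z) \<and> (fst z \<in> ball c 2 \<or> snd z \<in> ball c 2)} (x, y) \<partial>lborel \<partial>lborel)
      \<le> ennreal (Cf * \<delta> powr (-p)) * (\<integral>\<^sup>+x. h x * ennreal ((1 + norm (x - c)) powr (-p)) \<partial>(lborel::'a measure))"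
    by (rule nn_integral_far_le[OF dp(1) two], rule that)
  obtain Cn where Cn: "0 < Cn" "\<And>x::'a. (\<integral>\<^sup>+y. ennreal (norm (x - y) powr (2 - p)) * indicator (ball x 1) y \<partial>lborel) \<le> ennreal Cn"
    by (rule nn_integral_powr_ball_le[OF dp(2)], rule that)
  define C where "C = max 1 (step_const DIM('a) s Lam T lam Cf Cn * 8 ^ (DIM('a) + 2))"
  have step_le: "step_const DIM('a) s Lam T lam Cf Cn * 8 ^ (DIM('a) + 2) \<le> C"
    unfolding C_def by (rule max.cobounded2)
  define g where "g = (1 + s / real DIM('a)) / 2"
  have "1 \<le> real DIM('a)" by (simp add: Suc_le_eq)
  then have "s < real DIM('a)" using s by linarith
  then have "s / real DIM('a) < 1" "0 < s / real DIM('a)" using s by auto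
  then have g: "0 < g" "g < 1" by (auto simp: g_def)
  have b1: "(1::real) \<le> 2 ^ (DIM('a) + 2)" by (rule one_le_power) simp
  have C1: "1 \<le> C" by (simp add: C_def)
  obtain M where M: "1 \<le> M" "\<forall>X Cu. (\<forall>j. 1 \<le> X j) \<longrightarrow> (\<forall>j. X j \<le> C * (2 ^ (DIM('a) + 2)) ^ j * X (Suc j) powr g) \<longrightarrow>
       (\<forall>j. X j \<le> Cu * (2 ^ (DIM('a) + 2)) ^ j) \<longrightarrow> X 0 \<le> M"
  proof (rule sublinear_iteration[OF C1 b1 g])
    fix M :: real
    assume M: "1 \<le> M" "\<And>X Cu. (\<And>j. 1 \<le> X j) \<Longrightarrow> (\<And>j. X j \<le> C * (2 ^ (DIM('a) + 2)) ^ j * X (Suc j) powr g) \<Longrightarrow>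
       (\<And>j. X j \<le> Cu * (2 ^ (DIM('a) + 2)) ^ j) \<Longrightarrow> X 0 \<le> M"
    show thesis by (rule that[OF M(1)]) (intro allI impI, rule M(2), auto)
  qed
  show ?thesis
  proof (rule that[OF M(1)])
    fix u k v and c :: 'a and a b t0 t
    assume fl: "nonlocal_flow s Lam T u k lam v" and ab: "0 < a" "a < b" "b < T" and t: "t0 \<in> {a..b}" "t \<in> {a..b}"
      and mass: "(\<integral>\<^sup>+x. ennreal (v t0 x) * indicator (ball c 2) x \<partial>lborel) \<le> 1"
      and tail: "(\<integral>\<^sup>+t. (\<integral>\<^sup>+x. ennreal (u t x) * ennreal ((1 + norm (x - c)) powr (- p)) \<partial>lborel) * indicator {a<..<b} t \<partial>lborel) \<le> 1"
    interpret nonlocal_flow s Lam T u k p lam v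
      using fl by (simp_all add: p)
    interpret nonlocal_local s Lam T u k p lam v c a b t0 Cf Cn
      by unfold_locales (use ab t mass tail[unfolded p] Cf[unfolded p] Cn[unfolded p] in auto)
    have "X j \<le> C * (2 ^ (DIM('a) + 2)) ^ j * X (Suc j) powr g" for j
      using X_step[of j] unfolding \<gamma>_def d_def g_def[symmetric]
      by (rule order_trans) (intro mult_right_mono step_le, auto)
    moreover obtain Cu where "\<And>j. X j \<le> Cu * (2 ^ (DIM('a) + 2)) ^ j" using X_growth by blast
    ultimately have "X 0 \<le> M" using X(1) by (intro M(2)[rule_format, of X Cu])
    then show "(\<integral>\<^sup>+x. ennreal (v t x) * indicator (ball c 1) x \<partial>lborel) \<le> ennreal M"
      using ball_mass_le_X[OF t(2)] ennreal_leI order_trans by blast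
  qed
qed

section \<open>Scaling to the homogeneous estimate\<close>

lemma nonlocal_data_scale:
  assumes data: "nonlocal_data s Lam T (u :: real \<Rightarrow> 'a::euclidean_space \<Rightarrow> real) k" and \<kappa>: "0 < \<kappa>"
  shows "nonlocal_data s Lam T (\<lambda>t x. \<kappa> * u t x) k"
proof -
  define p where "p = real DIM('a) + 2 * s"
  interpret nonlocal_data s Lam T u k p using data by (simp_all add: p_def)
  show ?thesis
  proof (unfold_locales, goal_cases)
    case 4
    show ?case using u_meas by measurable
  next
    case 9
    have "(\<integral>\<^sup>+t. (\<integral>\<^sup>+x. ennreal (\<kappa> * u t x) * ennreal ((1 + norm x) powr (- p)) \<partial>lborel) * indicator {0<..<T} t \<partial>lborel)
      = ennreal \<kappa> * (\<integral>\<^sup>+t. (\<integral>\<^sup>+x. ennreal (u t x) * ennreal ((1 + norm x) powr (- p)) \<partial>lborel) * indicator {0<..<T} t \<partial>lborel)"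
      using \<kappa> u_nonneg by (simp add: ennreal_mult mult.assoc nn_integral_cmult)
    also have "\<dots> < \<infinity>" using u_tail by (simp add: ennreal_mult_less_top)
    finally show ?case by (simp add: p_def)
  next
    case (10 R)
    have "(\<kappa> * a - \<kappa> * b)\<^sup>2 = \<kappa>\<^sup>2 * (a - b)\<^sup>2" for a b :: real
      by (simp add: power_mult_distrib[symmetric] right_diff_distrib)
    then have "(\<integral>\<^sup>+t. (\<integral>\<^sup>+z. ennreal ((\<kappa> * u t (fst z) - \<kappa> * u t (snd z))\<^sup>2 * norm (fst z - snd z) powr (- p))
        * indicator (ball 0 R \<times> ball 0 R) z \<partial>lborel) * indicator {0<..<T} t \<partial>lborel)
      = (\<integral>\<^sup>+t. (\<integral>\<^sup>+z. ennreal (\<kappa>\<^sup>2) * (ennreal ((u t (fst z) - u t (snd z))\<^sup>2 * norm (fst z - snd z) powr (- p))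
        * indicator (ball 0 R \<times> ball 0 R) z) \<partial>lborel) * indicator {0<..<T} t \<partial>lborel)"
      by (simp add: mult.assoc ennreal_mult)
    also have "\<dots> = ennreal (\<kappa>\<^sup>2) * (\<integral>\<^sup>+t. (\<integral>\<^sup>+z. ennreal ((u t (fst z) - u t (snd z))\<^sup>2 * norm (fst z - snd z) powr (- p))
        * indicator (ball 0 R \<times> ball 0 R) z \<partial>lborel) * indicator {0<..<T} t \<partial>lborel)"
    proof -
      have [measurable]: "ball (0::'a) R \<times> ball (0::'a) R \<in> sets borel" by (intro borel_open open_Times) auto
      show ?thesis by (simp add: nn_integral_cmult mult.assoc)
    qed
    also have "\<dots> < \<infinity>" using u_Hs[OF 10] by (simp add: ennreal_mult_less_top)
    finally show ?case by (simp add: p_def)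
  qed (use s Lam k_meas u_nonneg k_nonneg k_le \<kappa> in \<open>auto simp: p_def\<close>)
qed

text \<open>The balance identity is linear in the solution, quadratic quantities acquire the factor
  \<kappa>^2, and the kernel with its coercivity is untouched. This removes the normalisation forced
  by the inhomogeneous truncation 1 + u.\<close>

lemma nonlocal_flow_scale:
  assumes flow: "nonlocal_flow s Lam T (u :: real \<Rightarrow> 'a::euclidean_space \<Rightarrow> real) k lam v" and \<kappa>: "0 < \<kappa>"
  shows "nonlocal_flow s Lam T (\<lambda>t x. \<kappa> * u t x) k lam (\<lambda>t x. \<kappa> * v t x)"
proof -
  define p where "p = real DIM('a) + 2 * s"
  interpret nonlocal_flow s Lam T u k p lam v using flow by (simp_all add: p_def)
  have data: "nonlocal_data s Lam T u k" by unfold_locales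
  interpret sc: nonlocal_data s Lam T "\<lambda>t x. \<kappa> * u t x" k p
    using nonlocal_data_scale[OF data \<kappa>] by (simp_all add: p_def)
  have fl: "sc.flux \<zeta> q = \<kappa> * flux \<zeta> q" for \<zeta> q
    unfolding sc.flux_def flux_def by (simp add: algebra_simps)
  have sq: "ennreal ((\<kappa> * r)\<^sup>2) = ennreal (\<kappa>\<^sup>2) * ennreal (r\<^sup>2)" for r
    by (simp add: power_mult_distrib ennreal_mult)
  show ?thesis
  proof (intro nonlocal_flow.intro nonlocal_data_scale[OF data \<kappa>] nonlocal_flow_axioms.intro, goal_cases)
    case 4
    show ?case using v_eq by eventually_elim auto
  next
    case (5 t R)
    then show ?case using v_sq[OF 5] by (simp add: sq mult.assoc nn_integral_cmult ennreal_mult_less_top)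
  next
    case (6 t R)
    have "((\<lambda>r. ennreal (\<kappa>\<^sup>2) * (\<integral>\<^sup>+x. ennreal ((v r x - v t x)\<^sup>2) * indicator (ball 0 R) x \<partial>lborel)) \<longlongrightarrow> ennreal (\<kappa>\<^sup>2) * 0) (at t)"
      by (intro ennreal_tendsto_cmult v_cont 6) auto
    then show ?case by (simp add: right_diff_distrib[symmetric] sq mult.assoc nn_integral_cmult)
  next
    case (7 a b R \<zeta>)
    have "(\<integral>x. v b x * \<zeta> x \<partial>lborel) - (\<integral>x. v a x * \<zeta> x \<partial>lborel) = - (\<integral>q. indicator {a<..<b} (fst q) * flux \<zeta> q \<partial>lborel)"
      using 7 by (intro weak[of a b R]) (auto simp: p_def)
    then have "\<kappa> * ((\<integral>x. v b x * \<zeta> x \<partial>lborel) - (\<integral>x. v a x * \<zeta> x \<partial>lborel)) = - (\<kappa> * (\<integral>q. indicator {a<..<b} (fst q) * flux \<zeta> q \<partial>lborel))"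
      by simp
    then show ?case by (simp add: fl right_diff_distrib mult.assoc mult.left_commute[of _ \<kappa>])
  next
    case 8
    show ?case using coercive by (simp add: p_def)
  qed (use lam \<kappa> v_nonneg in auto)
qed

lemma local_mass_estimate:
  fixes s Lam T lam p :: real
  assumes s: "0 < s" "s < 1" and pos: "0 < Lam" "0 < T" "0 < lam" and p: "p = real DIM('a) + 2 * s"
  obtains M where "1 \<le> M"
    "\<And>u k v c a b t0 t. nonlocal_flow s Lam T u k lam v \<Longrightarrow> 0 < a \<Longrightarrow> a < b \<Longrightarrow> b < T \<Longrightarrow>
      t0 \<in> {a..b} \<Longrightarrow> t \<in> {a..b} \<Longrightarrow>
      (\<integral>\<^sup>+x. ennreal (v t x) * indicator (ball c 1) x \<partial>(lborel :: 'a::euclidean_space measure))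
      \<le> ennreal M * ((\<integral>\<^sup>+x. ennreal (v t0 x) * indicator (ball c 2) x \<partial>lborel)
        + (\<integral>\<^sup>+t. (\<integral>\<^sup>+x. ennreal (u t x) * ennreal ((1 + norm (x - c)) powr (- p)) \<partial>lborel) * indicator {a<..<b} t \<partial>lborel))"
proof (rule local_mass_normalized[OF s pos p])
  fix M :: real
  assume M: "1 \<le> M"
    "\<And>u k v c a b t0 t. nonlocal_flow s Lam T u k lam v \<Longrightarrow> 0 < a \<Longrightarrow> a < b \<Longrightarrow> b < T \<Longrightarrow>
      t0 \<in> {a..b} \<Longrightarrow> t \<in> {a..b} \<Longrightarrow>
      (\<integral>\<^sup>+x. ennreal (v t0 x) * indicator (ball c 2) x \<partial>lborel) \<le> 1 \<Longrightarrow>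
      (\<integral>\<^sup>+t. (\<integral>\<^sup>+x. ennreal (u t x) * ennreal ((1 + norm (x - c)) powr (- p)) \<partial>lborel) * indicator {a<..<b} t \<partial>lborel) \<le> 1 \<Longrightarrow>
      (\<integral>\<^sup>+x. ennreal (v t x) * indicator (ball c 1) x \<partial>(lborel :: 'a measure)) \<le> ennreal M"
  show thesis
  proof (rule that[OF M(1)])
    fix u :: "real \<Rightarrow> 'a \<Rightarrow> real" and k v and c :: 'a and a b t0 t
    assume fl: "nonlocal_flow s Lam T u k lam v" and ab: "0 < a" "a < b" "b < T" and t: "t0 \<in> {a..b}" "t \<in> {a..b}"
    interpret nonlocal_flow s Lam T u k p lam v using fl by (simp_all add: p)
    let ?init = "\<integral>\<^sup>+x. ennreal (v t0 x) * indicator (ball c 2) x \<partial>lborel"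
    let ?tl = "\<integral>\<^sup>+t. (\<integral>\<^sup>+x. ennreal (u t x) * ennreal ((1 + norm (x - c)) powr (- p)) \<partial>lborel) * indicator {a<..<b} t \<partial>lborel"
    let ?m = "\<integral>\<^sup>+x. ennreal (v t x) * indicator (ball c 1) x \<partial>lborel"
    show "?m \<le> ennreal M * (?init + ?tl)"
    proof (cases "?init + ?tl")
      case top
      show ?thesis unfolding top using M(1) by (simp add: ennreal_mult_top)
    next
      case (real K)
      have eps: "?m \<le> ennreal M * (?init + ?tl) + ennreal e" if e: "0 < e" for e
      proof -
        \<comment> \<open>The extra e / M keeps the divisor positive when the right-hand side is
          zero; multiplied by M it adds exactly e, and e is arbitrary.\<close>
        define K' where "K' = K + e / M"
        have K': "0 < K'" using real e M(1) by (simp add: K'_def add_nonneg_pos)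
        define \<kappa> where "\<kappa> = 1 / K'"
        have \<kappa>: "0 < \<kappa>" using K' by (simp add: \<kappa>_def)
        have le1: "ennreal \<kappa> * y \<le> 1" if "y \<le> ?init + ?tl" for y
        proof -
          have "K \<le> K'" using e M(1) by (simp add: K'_def)
          then have "ennreal \<kappa> * y \<le> ennreal \<kappa> * ennreal K'"
            using that real by (intro mult_left_mono) (auto intro: order_trans ennreal_leI)
          also have "\<dots> = 1" using K' by (simp add: \<kappa>_def ennreal_mult[symmetric])
          finally show ?thesis .
        qed
        have "(\<integral>\<^sup>+x. ennreal (\<kappa> * v t x) * indicator (ball c 1) x \<partial>lborel) \<le> ennreal M"
        proof (rule M(2)[OF nonlocal_flow_scale[OF fl \<kappa>] ab t])
          have "(\<integral>\<^sup>+x. ennreal (\<kappa> * v t0 x) * indicator (ball c 2) x \<partial>lborel) = ennreal \<kappa> * ?init"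
            using \<kappa> v_nonneg by (simp add: ennreal_mult mult.assoc nn_integral_cmult)
          then show "(\<integral>\<^sup>+x. ennreal (\<kappa> * v t0 x) * indicator (ball c 2) x \<partial>lborel) \<le> 1" using le1[of ?init] by simp
          have "(\<integral>\<^sup>+t. (\<integral>\<^sup>+x. ennreal (\<kappa> * u t x) * ennreal ((1 + norm (x - c)) powr (- p)) \<partial>lborel) * indicator {a<..<b} t \<partial>lborel) = ennreal \<kappa> * ?tl"
            using \<kappa> u_nonneg by (simp add: ennreal_mult mult.assoc nn_integral_cmult)
          then show "(\<integral>\<^sup>+t. (\<integral>\<^sup>+x. ennreal (\<kappa> * u t x) * ennreal ((1 + norm (x - c)) powr (- p)) \<partial>lborel) * indicator {a<..<b} t \<partial>lborel) \<le> 1"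
            using le1[of ?tl] by simp
        qed
        also have "(\<integral>\<^sup>+x. ennreal (\<kappa> * v t x) * indicator (ball c 1) x \<partial>lborel) = ennreal \<kappa> * ?m"
          using \<kappa> v_nonneg by (simp add: ennreal_mult mult.assoc nn_integral_cmult)
        finally have "ennreal K' * (ennreal \<kappa> * ?m) \<le> ennreal K' * ennreal M" by (rule mult_left_mono) simp
        moreover have "ennreal K' * ennreal \<kappa> = 1" using K' by (simp add: \<kappa>_def ennreal_mult[symmetric])
        ultimately have "?m \<le> ennreal K' * ennreal M" by (simp add: mult.assoc[symmetric])
        also have "\<dots> = ennreal (M * K + e)"
        proof -
          have "M \<noteq> 0" using M(1) by auto
          then have "e / M * M = e" by simp
          then have "K' * M = M * K + e" unfolding K'_def distrib_right by (simp only: mult.commute)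
          then show ?thesis using K' M(1) by (simp add: ennreal_mult[symmetric])
        qed
        also have "\<dots> = ennreal M * ennreal K + ennreal e"
          using real e M(1) by (simp add: ennreal_mult ennreal_plus)
        finally show ?thesis using real by simp
      qed
      show ?thesis by (rule ennreal_le_epsilon) (rule eps)
    qed
  qed
qed

section \<open>Averaging over the centres\<close>

text \<open>One of c and x - c has norm at least |x|/2. Its weight is at most 2 powr p times the
  weight at x, and the other factor is integrable.\<close>

lemma weight_convolution_le:
  fixes p :: real
  assumes p: "real DIM('a) < p"
  obtains C where "0 < C"
    "\<And>x::'a::euclidean_space. (\<integral>\<^sup>+c. ennreal ((1 + norm c) powr (- p)) * ennreal ((1 + norm (x - c)) powr (- p)) \<partial>lborel)
      \<le> ennreal (C * (1 + norm x) powr (- p))"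
proof -
  obtain Cw where Cw: "0 < Cw" "\<And>c::'a. (\<integral>\<^sup>+y. ennreal ((1 + norm (c - y)) powr (- p)) \<partial>lborel) \<le> ennreal Cw"
    by (rule nn_integral_decay_le[OF p], rule that)
  have p0: "0 < p" using p by (meson DIM_positive less_trans of_nat_0_less_iff)
  let ?w = "\<lambda>x::'a. (1 + norm x) powr (- p)"
  have "(\<integral>\<^sup>+c. ennreal (?w c) * ennreal (?w (x - c)) \<partial>lborel) \<le> ennreal (2 * 2 powr p * Cw * ?w x)" for x
  proof -
    have half: "?w y \<le> 2 powr p * ?w x" if "norm x / 2 \<le> norm y" for y
    proof -
      have "?w y \<le> ((1 + norm x) / 2) powr (- p)" using that p0 by (intro powr_mono2') (auto simp: add_pos_nonneg)
      also have "\<dots> = 2 powr p * ?w x" by (simp add: powr_divide powr_minus field_simps)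
      finally show ?thesis .
    qed
    have point: "?w c * ?w (x - c) \<le> (2 powr p * ?w x) * (?w (x - c) + ?w c)" for c
    proof (cases "norm x / 2 \<le> norm c")
      case True
      have "?w c * ?w (x - c) \<le> (2 powr p * ?w x) * ?w (x - c)" using half[OF True] by (intro mult_right_mono) auto
      also have "\<dots> \<le> (2 powr p * ?w x) * (?w (x - c) + ?w c)" by (intro mult_left_mono) auto
      finally show ?thesis .
    next
      case False
      have "norm x / 2 \<le> norm (x - c)" using False norm_triangle_ineq2[of x c] by linarith
      from half[OF this] have "?w (x - c) * ?w c \<le> (2 powr p * ?w x) * ?w c" by (intro mult_right_mono) auto
      also have "\<dots> \<le> (2 powr p * ?w x) * (?w (x - c) + ?w c)" by (intro mult_left_mono) auto
      finally show ?thesis by (simp add: mult.commute)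
    qed
    have "(\<integral>\<^sup>+c. ennreal (?w c) * ennreal (?w (x - c)) \<partial>lborel)
      \<le> (\<integral>\<^sup>+c. ennreal (2 powr p * ?w x) * (ennreal (?w (x - c)) + ennreal (?w (0 - c))) \<partial>lborel)"
      using point by (intro nn_integral_mono) (simp add: ennreal_mult[symmetric] ennreal_plus[symmetric] ennreal_leI del: ennreal_plus)
    also have "\<dots> = ennreal (2 powr p * ?w x) * ((\<integral>\<^sup>+c. ennreal (?w (x - c)) \<partial>lborel) + (\<integral>\<^sup>+c. ennreal (?w (0 - c)) \<partial>lborel))"
      by (simp add: nn_integral_cmult nn_integral_add)
    also have "\<dots> \<le> ennreal (2 powr p * ?w x) * (ennreal Cw + ennreal Cw)"
      by (intro mult_left_mono add_mono Cw) auto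
    also have "\<dots> = ennreal (2 * 2 powr p * Cw * ?w x)"
      using Cw(1) by (simp add: ennreal_mult[symmetric] ennreal_plus[symmetric] mult_ac del: ennreal_plus)
    finally show ?thesis .
  qed
  then show ?thesis using that[of "2 * 2 powr p * Cw"] Cw(1) by auto
qed

text \<open>Weights at points closer than r differ at most by the factor (1 + r) powr p, in both
  directions, so averaging over a ball reproduces the weight up to constants.\<close>

lemma weight_ball_average:
  fixes x :: "'a::euclidean_space" and p r :: real
  assumes p: "0 < p" and r: "0 < r"
  shows "(\<integral>\<^sup>+c. ennreal ((1 + norm c) powr (- p)) * indicator (ball c r) x \<partial>lborel)
      \<le> ennreal ((1 + r) powr p * (unit_ball_vol (real DIM('a)) * r ^ DIM('a)) * (1 + norm x) powr (- p))"
    and "ennreal ((1 + r) powr (- p) * (unit_ball_vol (real DIM('a)) * r ^ DIM('a)) * (1 + norm x) powr (- p))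
      \<le> (\<integral>\<^sup>+c. ennreal ((1 + norm c) powr (- p)) * indicator (ball c r) x \<partial>lborel)"
proof -
  let ?V = "unit_ball_vol (real DIM('a)) * r ^ DIM('a)"
  have V: "emeasure lborel (ball x r) = ennreal ?V" using r by (simp add: emeasure_ball)
  have sym: "indicator (ball c r) x = (indicator (ball x r) c :: ennreal)" for c
    by (simp add: dist_commute split: split_indicator)
  have compare: "(1 + norm a) powr (- p) \<le> (1 + r) powr p * (1 + norm b) powr (- p)" if "norm (a - b) < r" for a b :: 'a
  proof -
    have "norm b \<le> norm a + norm (a - b)" using norm_triangle_ineq4[of a "a - b"] by simp
    then have "1 + norm b \<le> 1 + norm a + r * 1" using that by simp
    also have "\<dots> \<le> 1 + norm a + r * (1 + norm a)" using r by (intro add_left_mono mult_left_mono) auto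
    also have "\<dots> = (1 + r) * (1 + norm a)" by (simp add: algebra_simps)
    finally have "((1 + r) * (1 + norm a)) powr (- p) \<le> (1 + norm b) powr (- p)"
      using p by (intro powr_mono2') (auto simp: add_pos_nonneg)
    then have "(1 + r) powr p * ((1 + r) powr (- p) * (1 + norm a) powr (- p)) \<le> (1 + r) powr p * (1 + norm b) powr (- p)"
      using r by (subst (asm) powr_mult) (auto intro: mult_left_mono)
    moreover have "(1 + r) powr p * (1 + r) powr (- p) = 1" using r by (subst powr_add[symmetric]) simp
    ultimately show ?thesis by (simp add: mult.assoc[symmetric])
  qed
  have "(\<integral>\<^sup>+c. ennreal ((1 + norm c) powr (- p)) * indicator (ball c r) x \<partial>lborel)
    \<le> (\<integral>\<^sup>+c. ennreal ((1 + r) powr p * (1 + norm x) powr (- p)) * indicator (ball x r) c \<partial>lborel)"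
    unfolding sym using compare
    by (intro nn_integral_mono) (auto simp: dist_norm norm_minus_commute intro!: ennreal_leI split: split_indicator)
  also have "\<dots> = ennreal ((1 + r) powr p * ?V * (1 + norm x) powr (- p))"
    using r V by (subst nn_integral_cmult_indicator) (auto simp: ennreal_mult[symmetric] mult_ac)
  finally show "(\<integral>\<^sup>+c. ennreal ((1 + norm c) powr (- p)) * indicator (ball c r) x \<partial>lborel) \<le> ennreal ((1 + r) powr p * ?V * (1 + norm x) powr (- p))" .
  have "ennreal ((1 + r) powr (- p) * ?V * (1 + norm x) powr (- p)) = (\<integral>\<^sup>+c. ennreal ((1 + r) powr (- p) * (1 + norm x) powr (- p)) * indicator (ball x r) c \<partial>lborel)"
    using r V by (subst nn_integral_cmult_indicator) (auto simp: ennreal_mult[symmetric] mult_ac)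
  also have "\<dots> \<le> (\<integral>\<^sup>+c. ennreal ((1 + norm c) powr (- p)) * indicator (ball c r) x \<partial>lborel)"
    unfolding sym
  proof (rule nn_integral_mono)
    fix c
    have "(1 + r) powr (- p) * (1 + norm x) powr (- p) \<le> (1 + norm c) powr (- p)" if "norm (x - c) < r"
    proof -
      have "(1 + r) powr (- p) * (1 + norm x) powr (- p) \<le> (1 + r) powr (- p) * ((1 + r) powr p * (1 + norm c) powr (- p))"
        using compare[OF that] by (intro mult_left_mono) auto
      moreover have "(1 + r) powr (- p) * (1 + r) powr p = 1" using r by (subst powr_add[symmetric]) simp
      ultimately show ?thesis by (simp add: mult.assoc[symmetric])
    qed
    then show "ennreal ((1 + r) powr (- p) * (1 + norm x) powr (- p)) * indicator (ball x r) c \<le> ennreal ((1 + norm c) powr (- p)) * indicator (ball x r) c"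
      by (auto simp: dist_norm intro!: ennreal_leI split: split_indicator)
  qed
  finally show "ennreal ((1 + r) powr (- p) * ?V * (1 + norm x) powr (- p))
      \<le> (\<integral>\<^sup>+c. ennreal ((1 + norm c) powr (- p)) * indicator (ball c r) x \<partial>lborel)" .
qed

text \<open>For nonnegative \<open>f\<close> this is the norm of L1(\<mu>), with the weight as a
  factor instead of a divisor.\<close>

definition wmass :: "real \<Rightarrow> ('a::euclidean_space \<Rightarrow> real) \<Rightarrow> ennreal" where
  "wmass p f = (\<integral>\<^sup>+x. ennreal (f x) * ennreal ((1 + norm x) powr (- p)) \<partial>lborel)"

text \<open>Fubini turns the weighted average of the local masses into the local average of the
  weight.\<close>

lemma wmass_average:
  fixes f :: "'a::euclidean_space \<Rightarrow> real"
  assumes [measurable]: "f \<in> borel_measurable borel" and r: "0 < r" and p: "0 < p"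
  shows "(\<integral>\<^sup>+c. ennreal ((1 + norm c) powr (- p)) * (\<integral>\<^sup>+x. ennreal (f x) * indicator (ball c r) x \<partial>lborel) \<partial>lborel)
      \<le> ennreal ((1 + r) powr p * (unit_ball_vol (real DIM('a)) * r ^ DIM('a))) * wmass p f" (is "?A \<le> ?U")
    and "ennreal ((1 + r) powr (- p) * (unit_ball_vol (real DIM('a)) * r ^ DIM('a))) * wmass p f
      \<le> (\<integral>\<^sup>+c. ennreal ((1 + norm c) powr (- p)) * (\<integral>\<^sup>+x. ennreal (f x) * indicator (ball c r) x \<partial>lborel) \<partial>lborel)" (is "?L \<le> ?A")
proof -
  let ?V = "unit_ball_vol (real DIM('a)) * r ^ DIM('a)"
  let ?w = "\<lambda>x::'a. (1 + norm x) powr (- p)"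
  have V: "0 \<le> ?V" using r by (simp add: unit_ball_vol_nonneg)
  have ind: "indicator (ball c r) x = (indicator {z. dist (fst z) (snd z) < r} (c, x) :: ennreal)" for c x :: 'a
    by (simp split: split_indicator)
  have "?A = (\<integral>\<^sup>+c. \<integral>\<^sup>+x. ennreal (?w c) * (ennreal (f x) * indicator (ball c r) x) \<partial>lborel \<partial>lborel)"
    by (simp add: nn_integral_cmult)
  also have "\<dots> = (\<integral>\<^sup>+x. \<integral>\<^sup>+c. ennreal (?w c) * (ennreal (f x) * indicator (ball c r) x) \<partial>lborel \<partial>lborel)"
    unfolding ind by (rule lborel_pair.Fubini'[symmetric]) measurable
  also have "\<dots> = (\<integral>\<^sup>+x. ennreal (f x) * (\<integral>\<^sup>+c. ennreal (?w c) * indicator (ball c r) x \<partial>lborel) \<partial>lborel)"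
    unfolding ind by (subst nn_integral_cmult[symmetric]) (auto simp: mult_ac)
  finally have A: "?A = (\<integral>\<^sup>+x. ennreal (f x) * (\<integral>\<^sup>+c. ennreal (?w c) * indicator (ball c r) x \<partial>lborel) \<partial>lborel)" .
  have W: "ennreal (q * ?V) * wmass p f = (\<integral>\<^sup>+x. ennreal (f x) * ennreal (q * ?V * ?w x) \<partial>lborel)" if "0 \<le> q" for q
  proof -
    have "ennreal (f x) * ennreal (q * ?V * ?w x) = ennreal (q * ?V) * (ennreal (f x) * ennreal (?w x))" for x
      using that V by (subst ennreal_mult) (auto simp: mult_ac)
    then show ?thesis unfolding wmass_def by (simp add: nn_integral_cmult)
  qed
  show "?A \<le> ?U" unfolding A by (subst W) (auto intro!: nn_integral_mono mult_left_mono weight_ball_average p r)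
  show "?L \<le> ?A" unfolding A by (subst W) (auto intro!: nn_integral_mono mult_left_mono weight_ball_average p r)
qed

lemma wmass_estimate:
  fixes s Lam T lam p :: real
  assumes s: "0 < s" "s < 1" and pos: "0 < Lam" "0 < T" "0 < lam" and p: "p = real DIM('a) + 2 * s"
  obtains A where "1 \<le> A"
    "\<And>(u :: real \<Rightarrow> 'a::euclidean_space \<Rightarrow> real) k v a b t0 t. nonlocal_flow s Lam T u k lam v \<Longrightarrow> 0 < a \<Longrightarrow> a < b \<Longrightarrow> b < T \<Longrightarrow>
      t0 \<in> {a..b} \<Longrightarrow> t \<in> {a..b} \<Longrightarrow>
      wmass p (v t) \<le> ennreal A * (wmass p (v t0) + (\<integral>\<^sup>+r. wmass p (u r) * indicator {a<..<b} r \<partial>lborel))"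
proof -
  have dp: "real DIM('a) < p" "0 < p" using s p by (auto simp: add_pos_pos)
  obtain M where M: "1 \<le> M"
    "\<And>(u :: real \<Rightarrow> 'a \<Rightarrow> real) k v c a b t0 t. nonlocal_flow s Lam T u k lam v \<Longrightarrow> 0 < a \<Longrightarrow> a < b \<Longrightarrow> b < T \<Longrightarrow>
      t0 \<in> {a..b} \<Longrightarrow> t \<in> {a..b} \<Longrightarrow>
      (\<integral>\<^sup>+x. ennreal (v t x) * indicator (ball c 1) x \<partial>lborel)
      \<le> ennreal M * ((\<integral>\<^sup>+x. ennreal (v t0 x) * indicator (ball c 2) x \<partial>lborel)
        + (\<integral>\<^sup>+t. (\<integral>\<^sup>+x. ennreal (u t x) * ennreal ((1 + norm (x - c)) powr (- p)) \<partial>lborel) * indicator {a<..<b} t \<partial>lborel))"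
    by (rule local_mass_estimate[OF s pos p], rule that, assumption, blast)
  obtain Cc where Cc: "0 < Cc" "\<And>x::'a. (\<integral>\<^sup>+c. ennreal ((1 + norm c) powr (- p)) * ennreal ((1 + norm (x - c)) powr (- p)) \<partial>lborel)
      \<le> ennreal (Cc * (1 + norm x) powr (- p))"
    by (rule weight_convolution_le[OF dp(1)], rule that)
  let ?w = "\<lambda>x::'a. (1 + norm x) powr (- p)"
  let ?\<omega> = "unit_ball_vol (real DIM('a))"
  have \<omega>: "0 < ?\<omega>" by simp
  \<comment> \<open>\<open>q1\<close> is the lower constant of the average over radius 1, the radius
    of the estimated mass; \<open>q2\<close> is the upper constant for radius 2, the radius of the
    given mass.\<close>
  define q1 where "q1 = (1 + 1) powr (- p) * (?\<omega> * 1 ^ DIM('a))"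
  define q2 where "q2 = (1 + 2) powr p * (?\<omega> * 2 ^ DIM('a))"
  have q: "0 < q1" "0 < q2" using \<omega> by (auto simp: q1_def q2_def)
  define A where "A = max 1 (M * (q2 + Cc) / q1)"
  show ?thesis
  proof (rule that[of A])
    show "1 \<le> A" by (simp add: A_def)
    fix u :: "real \<Rightarrow> 'a \<Rightarrow> real" and k v a b t0 t
    assume fl: "nonlocal_flow s Lam T u k lam v" and ab: "0 < a" "a < b" "b < T" and t: "t0 \<in> {a..b}" "t \<in> {a..b}"
    interpret nonlocal_flow s Lam T u k p lam v using fl by (simp_all add: p)
    let ?I = "\<integral>\<^sup>+r. wmass p (u r) * indicator {a<..<b} r \<partial>lborel"
    let ?tl = "\<lambda>c. \<integral>\<^sup>+t. (\<integral>\<^sup>+x. ennreal (u t x) * ennreal (?w (x - c)) \<partial>lborel) * indicator {a<..<b} t \<partial>lborel"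
    have conv: "(\<integral>\<^sup>+c. ennreal (?w c) * ?tl c \<partial>lborel) \<le> ennreal Cc * ?I"
    proof -
      have "(\<integral>\<^sup>+c. ennreal (?w c) * ?tl c \<partial>lborel) = (\<integral>\<^sup>+c. \<integral>\<^sup>+t. (\<integral>\<^sup>+x. ennreal (?w c) * (ennreal (u t x) * ennreal (?w (x - c))) \<partial>lborel) * indicator {a<..<b} t \<partial>lborel \<partial>lborel)"
        by (simp add: nn_integral_cmult mult.assoc)
      also have "\<dots> = (\<integral>\<^sup>+t. \<integral>\<^sup>+c. (\<integral>\<^sup>+x. ennreal (?w c) * (ennreal (u t x) * ennreal (?w (x - c))) \<partial>lborel) * indicator {a<..<b} t \<partial>lborel \<partial>lborel)"
        by (rule lborel_pair.Fubini'[symmetric]) measurable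
      also have "\<dots> = (\<integral>\<^sup>+t. (\<integral>\<^sup>+c. \<integral>\<^sup>+x. ennreal (?w c) * (ennreal (u t x) * ennreal (?w (x - c))) \<partial>lborel \<partial>lborel) * indicator {a<..<b} t \<partial>lborel)"
        by (simp add: nn_integral_multc)
      also have "\<dots> = (\<integral>\<^sup>+t. (\<integral>\<^sup>+x. \<integral>\<^sup>+c. ennreal (?w c) * (ennreal (u t x) * ennreal (?w (x - c))) \<partial>lborel \<partial>lborel) * indicator {a<..<b} t \<partial>lborel)"
        by (subst lborel_pair.Fubini') auto
      also have "\<dots> \<le> (\<integral>\<^sup>+t. (ennreal Cc * wmass p (u t)) * indicator {a<..<b} t \<partial>lborel)"
      proof (intro nn_integral_mono mult_right_mono)
        fix t
        have "(\<integral>\<^sup>+x. \<integral>\<^sup>+c. ennreal (?w c) * (ennreal (u t x) * ennreal (?w (x - c))) \<partial>lborel \<partial>lborel)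
          = (\<integral>\<^sup>+x. ennreal (u t x) * (\<integral>\<^sup>+c. ennreal (?w c) * ennreal (?w (x - c)) \<partial>lborel) \<partial>lborel)"
          by (subst nn_integral_cmult[symmetric]) (auto simp: mult_ac)
        also have "\<dots> \<le> (\<integral>\<^sup>+x. ennreal (u t x) * ennreal (Cc * ?w x) \<partial>lborel)"
          by (intro nn_integral_mono mult_left_mono Cc) auto
        also have "\<dots> = (\<integral>\<^sup>+x. ennreal Cc * (ennreal (u t x) * ennreal (?w x)) \<partial>lborel)"
          using Cc(1) by (intro nn_integral_cong) (simp add: ennreal_mult mult_ac)
        also have "\<dots> = ennreal Cc * wmass p (u t)"
          unfolding wmass_def by (rule nn_integral_cmult) measurable
        finally show "(\<integral>\<^sup>+x. \<integral>\<^sup>+c. ennreal (?w c) * (ennreal (u t x) * ennreal (?w (x - c))) \<partial>lborel \<partial>lborel) \<le> ennreal Cc * wmass p (u t)" .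
      qed auto
      also have "\<dots> = ennreal Cc * ?I"
        unfolding wmass_def by (simp add: nn_integral_cmult mult.assoc)
      finally show ?thesis .
    qed
    have ind: "indicator (ball c r) x = (indicator {z. dist (fst z) (snd z) < r} (c, x) :: ennreal)" for c x :: 'a and r
      by (simp split: split_indicator)
    have "ennreal q1 * wmass p (v t) \<le> (\<integral>\<^sup>+c. ennreal (?w c) * (\<integral>\<^sup>+x. ennreal (v t x) * indicator (ball c 1) x \<partial>lborel) \<partial>lborel)"
      unfolding q1_def by (rule wmass_average(2)) (use dp in auto)
    also have "\<dots> \<le> (\<integral>\<^sup>+c. ennreal (?w c) * (ennreal M * ((\<integral>\<^sup>+x. ennreal (v t0 x) * indicator (ball c 2) x \<partial>lborel) + ?tl c)) \<partial>lborel)"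
      by (intro nn_integral_mono mult_left_mono M(2)[OF fl ab t]) auto
    also have "\<dots> = (\<integral>\<^sup>+c. ennreal M * (ennreal (?w c) * (\<integral>\<^sup>+x. ennreal (v t0 x) * indicator (ball c 2) x \<partial>lborel) + ennreal (?w c) * ?tl c) \<partial>lborel)"
      by (intro nn_integral_cong) (simp add: algebra_simps)
    also have "\<dots> = ennreal M * ((\<integral>\<^sup>+c. ennreal (?w c) * (\<integral>\<^sup>+x. ennreal (v t0 x) * indicator (ball c 2) x \<partial>lborel) \<partial>lborel) + (\<integral>\<^sup>+c. ennreal (?w c) * ?tl c \<partial>lborel))"
      unfolding ind by (simp add: nn_integral_cmult nn_integral_add)
    also have "\<dots> \<le> ennreal M * (ennreal q2 * wmass p (v t0) + ennreal Cc * ?I)"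
      unfolding q2_def by (intro mult_left_mono add_mono wmass_average(1) conv) (use dp in auto)
    also have "\<dots> \<le> ennreal M * (ennreal (q2 + Cc) * wmass p (v t0) + ennreal (q2 + Cc) * ?I)"
      using q Cc(1) by (intro mult_left_mono add_mono mult_right_mono ennreal_leI) auto
    also have "\<dots> = ennreal (M * (q2 + Cc)) * (wmass p (v t0) + ?I)"
    proof -
      have "ennreal (M * (q2 + Cc)) = ennreal M * ennreal (q2 + Cc)"
        using M(1) q Cc(1) by (intro ennreal_mult) auto
      then show ?thesis by (simp only: distrib_left mult.assoc)
    qed
    finally have "ennreal (1 / q1) * (ennreal q1 * wmass p (v t)) \<le> ennreal (1 / q1) * (ennreal (M * (q2 + Cc)) * (wmass p (v t0) + ?I))"
      by (rule mult_left_mono) simp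
    moreover have "ennreal (1 / q1) * ennreal q1 = 1" using q by (simp add: ennreal_mult[symmetric])
    moreover have "ennreal (1 / q1) * ennreal (M * (q2 + Cc)) \<le> ennreal A"
      using q M(1) Cc(1) by (simp add: ennreal_mult[symmetric] A_def ennreal_leI)
    ultimately show "wmass p (v t) \<le> ennreal A * (wmass p (v t0) + ?I)"
      by (simp add: mult.assoc[symmetric]) (meson mult_right_mono order_trans zero_le)
  qed
qed

lemma wmass_comparable:
  fixes s Lam T lam p :: real
  assumes s: "0 < s" "s < 1" and pos: "0 < Lam" "0 < T" "0 < lam" and p: "p = real DIM('a) + 2 * s"
  obtains c where "1 < c"
    "\<And>(u :: real \<Rightarrow> 'a::euclidean_space \<Rightarrow> real) k v t \<tau>. nonlocal_flow s Lam T u k lam v \<Longrightarrow>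
      t \<in> {0<..<T} \<Longrightarrow> \<tau> \<in> {0<..<T} \<Longrightarrow> wmass p (v t) \<le> ennreal c * wmass p (v \<tau>)"
proof -
  obtain A where A: "1 \<le> A"
    "\<And>(u :: real \<Rightarrow> 'a \<Rightarrow> real) k v a b t0 t. nonlocal_flow s Lam T u k lam v \<Longrightarrow> 0 < a \<Longrightarrow> a < b \<Longrightarrow> b < T \<Longrightarrow>
      t0 \<in> {a..b} \<Longrightarrow> t \<in> {a..b} \<Longrightarrow>
      wmass p (v t) \<le> ennreal A * (wmass p (v t0) + (\<integral>\<^sup>+r. wmass p (u r) * indicator {a<..<b} r \<partial>lborel))"
    by (rule wmass_estimate[OF s pos p], rule that, assumption, blast)
  \<comment> \<open>On an interval of length \<delta> the factor \<open>A\<close> in front of the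
    time integral becomes A \<delta> = 1/2.\<close>
  define \<delta> where "\<delta> = 1 / (2 * A)"
  have \<delta>: "0 < \<delta>" using A(1) by (simp add: \<delta>_def)
  obtain n :: nat where n: "T / \<delta> < real n" using reals_Archimedean2 by blast
  have nT: "T < real n * \<delta>" using n \<delta> by (simp add: divide_less_eq)
  define c where "c = (2 * A) ^ Suc n"
  show ?thesis
  proof (rule that[of c])
    have "1 < 2 * A" using A(1) by simp
    then show "1 < c" unfolding c_def by (rule one_less_power) simp
    fix u :: "real \<Rightarrow> 'a \<Rightarrow> real" and k v t \<tau>
    assume fl: "nonlocal_flow s Lam T u k lam v" and t: "t \<in> {0<..<T}" and \<tau>: "\<tau> \<in> {0<..<T}"
    interpret nonlocal_flow s Lam T u k p lam v using fl by (simp_all add: p)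
    have fin: "(\<integral>\<^sup>+r. wmass p (u r) * indicator {0<..<T} r \<partial>lborel) < \<infinity>"
      using u_tail unfolding wmass_def .
    have short: "wmass p (v t) \<le> ennreal (2 * A) * wmass p (v t0)"
      if ab: "0 < a" "a < b" "b < T" "b - a \<le> \<delta>" and t: "t \<in> {a..b}" "t0 \<in> {a..b}" for a b t t0
    proof (cases "wmass p (v t0) = \<infinity>")
      case True
      then show ?thesis using A(1) by (simp add: ennreal_mult_top)
    next
      case False
      let ?I = "\<integral>\<^sup>+r. wmass p (u r) * indicator {a<..<b} r \<partial>lborel"
      \<comment> \<open>The time integral is at most S times the length of the interval. The
        estimate from \<open>t0\<close> reaches every time of the interval, earlier or later, so it
        also bounds S.\<close>
      define S where "S = (SUP r\<in>{a..b}. wmass p (v r))"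
      have SI: "S \<le> ennreal A * (wmass p (v t0) + ?I)"
        unfolding S_def using A(2)[OF fl ab(1-3) t(2)] by (intro SUP_least)
      have "?I \<le> (\<integral>\<^sup>+r. wmass p (u r) * indicator {0<..<T} r \<partial>lborel)"
        using ab by (intro nn_integral_mono) (auto split: split_indicator)
      then have I: "?I < \<infinity>" using fin by (rule le_less_trans)
      \<comment> \<open>Absorption needs S to be finite. It is, because the bound \<open>SI\<close>
        contains only the given mass at \<open>t0\<close> and a time integral that is finite by
        \<open>u_tail\<close>.\<close>
      have S: "S < \<infinity>" using SI I False by (auto simp: ennreal_mult_less_top less_top intro: le_less_trans)
      then obtain S' where S': "S = ennreal S'" "0 \<le> S'" by (cases S) auto
      obtain N where N: "wmass p (v t0) = ennreal N" "0 \<le> N" using False by (cases "wmass p (v t0)") auto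
      have "?I \<le> (\<integral>\<^sup>+r. S * indicator {a<..<b} r \<partial>lborel)"
      proof (rule nn_integral_mono_AE)
        show "AE r in lborel. wmass p (u r) * indicator {a<..<b} r \<le> S * indicator {a<..<b} r"
          using v_eq
        proof eventually_elim
          case (elim r)
          show ?case
          proof (cases "r \<in> {a<..<b}")
            case True
            then have "AE x in lborel. v r x = u r x" using elim ab by auto
            then have "wmass p (u r) = wmass p (v r)" unfolding wmass_def by (intro nn_integral_cong_AE) auto
            also have "\<dots> \<le> S" unfolding S_def using True by (intro SUP_upper) auto
            finally show ?thesis using True by simp
          qed simp
        qed
      qed
      also have "\<dots> = S * ennreal (b - a)" using ab by (subst nn_integral_cmult_indicator) auto
      also have "\<dots> \<le> S * ennreal \<delta>" using ab by (intro mult_left_mono ennreal_leI) auto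
      finally have "S \<le> ennreal A * (wmass p (v t0) + S * ennreal \<delta>)"
        using SI by (meson add_left_mono mult_left_mono order_trans zero_le)
      also have "\<dots> = ennreal (A * (N + S' * \<delta>))"
        using A(1) \<delta> S' N by (simp add: ennreal_mult[symmetric] ennreal_plus[symmetric] del: ennreal_plus)
      finally have "S' \<le> A * (N + S' * \<delta>)" using S' N A(1) \<delta> by (simp add: ennreal_le_iff)
      also have "A * (N + S' * \<delta>) = A * N + S' / 2" using A(1) by (simp add: \<delta>_def field_simps)
      finally have "S' \<le> 2 * A * N" by simp
      then have "S \<le> ennreal (2 * A) * wmass p (v t0)"
        using S' N A(1) by (simp add: ennreal_mult[symmetric] ennreal_leI)
      moreover have "wmass p (v t) \<le> S" unfolding S_def using t by (intro SUP_upper) auto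
      ultimately show ?thesis by (rule order_trans[rotated])
    qed
    have step: "wmass p (v t) \<le> ennreal (2 * A) * wmass p (v t0)"
      if "t \<in> {0<..<T}" "t0 \<in> {0<..<T}" "\<bar>t - t0\<bar> \<le> \<delta>" for t t0
    proof (cases "t = t0")
      case True
      have "1 * wmass p (v t0) \<le> ennreal (2 * A) * wmass p (v t0)" using A(1) by (intro mult_right_mono) auto
      then show ?thesis using True by simp
    next
      case False
      then show ?thesis using that by (intro short[of "min t t0" "max t t0"]) auto
    qed
    have chain: "wmass p (v t) \<le> ennreal ((2 * A) ^ Suc m) * wmass p (v \<tau>)"
      if "t \<in> {0<..<T}" "\<bar>t - \<tau>\<bar> \<le> real (Suc m) * \<delta>" for m t
      using that
    proof (induction m arbitrary: t)
      case 0
      then show ?case using step[of t \<tau>] \<tau> by simp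
    next
      case (Suc m)
      \<comment> \<open>The new point \<open>t'\<close> lies the fraction 1/N of the way from t to
        \<tau>. The step to it has length at most \<delta>, and the remaining distance is at most N
        - 1 = Suc m steps.\<close>
      define N where "N = real (Suc (Suc m))"
      define \<theta> where "\<theta> = 1 / N"
      have N: "N = real (Suc m) + 1" "1 < N" by (auto simp: N_def)
      have \<theta>: "0 < \<theta>" "\<theta> < 1" "\<theta> * N = 1" using N(2) by (auto simp: \<theta>_def)
      define t' where "t' = (1 - \<theta>) * t + \<theta> * \<tau>"
      have t': "t' \<in> {0<..<T}"
      proof -
        have "0 < (1 - \<theta>) * t" "0 < \<theta> * \<tau>" using \<theta> Suc.prems(1) \<tau> by auto
        moreover have "(1 - \<theta>) * t < (1 - \<theta>) * T" "\<theta> * \<tau> < \<theta> * T" using \<theta> Suc.prems(1) \<tau> by auto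
        moreover have "(1 - \<theta>) * T + \<theta> * T = T" by (simp add: algebra_simps)
        ultimately have "0 < t'" "t' < T" unfolding t'_def by linarith+
        then show ?thesis by simp
      qed
      have N\<delta>: "\<bar>t - \<tau>\<bar> \<le> N * \<delta>" using Suc.prems(2) unfolding N_def .
      have "t - t' = \<theta> * (t - \<tau>)" by (simp add: t'_def algebra_simps)
      then have "\<bar>t - t'\<bar> = \<theta> * \<bar>t - \<tau>\<bar>" using \<theta> by (simp add: abs_mult)
      also have "\<dots> \<le> \<theta> * (N * \<delta>)" using \<theta> by (intro mult_left_mono N\<delta>) auto
      also have "\<dots> = \<delta>" using \<theta>(3) by (simp add: mult.assoc[symmetric])
      finally have d1: "\<bar>t - t'\<bar> \<le> \<delta>" .
      have "t' - \<tau> = (1 - \<theta>) * (t - \<tau>)" by (simp add: t'_def algebra_simps)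
      then have "\<bar>t' - \<tau>\<bar> = (1 - \<theta>) * \<bar>t - \<tau>\<bar>" using \<theta> by (simp add: abs_mult)
      also have "\<dots> \<le> (1 - \<theta>) * (N * \<delta>)" using \<theta> by (intro mult_left_mono N\<delta>) auto
      also have "\<dots> = (N - \<theta> * N) * \<delta>" by (simp add: algebra_simps)
      also have "N - \<theta> * N = real (Suc m)" using \<theta>(3) N(1) by linarith
      finally have "wmass p (v t') \<le> ennreal ((2 * A) ^ Suc m) * wmass p (v \<tau>)" by (intro Suc.IH t')
      then have "ennreal (2 * A) * wmass p (v t') \<le> ennreal (2 * A) * (ennreal ((2 * A) ^ Suc m) * wmass p (v \<tau>))"
        by (rule mult_left_mono) simp
      with step[OF Suc.prems(1) t' d1] have "wmass p (v t) \<le> ennreal (2 * A) * (ennreal ((2 * A) ^ Suc m) * wmass p (v \<tau>))" by (rule order_trans)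
      also have "\<dots> = ennreal ((2 * A) ^ Suc (Suc m)) * wmass p (v \<tau>)"
        using A(1) by (simp add: ennreal_mult[symmetric] mult.assoc[symmetric])
      finally show ?case .
    qed
    have "\<bar>t - \<tau>\<bar> \<le> T" using t \<tau> by auto
    also have "T \<le> real (Suc n) * \<delta>" using nT \<delta> by (simp add: algebra_simps)
    finally show "wmass p (v t) \<le> ennreal c * wmass p (v \<tau>)" unfolding c_def by (intro chain t)
  qed
qed

section \<open>Borel representatives of weak solutions\<close>

lemma AE_lborel_pairD:
  fixes P :: "'a::euclidean_space \<times> 'b::euclidean_space \<Rightarrow> bool"
  assumes "AE z in lborel. P z"
  shows "AE x in lborel. AE y in lborel. P (x, y)"
proof -
  have "AE z in lborel \<Otimes>\<^sub>M lborel. P z" using assms by (subst lborel_prod)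
  then show ?thesis by (rule lborel_pair.AE_pair)
qed

text \<open>Completeness makes \<open>g\<close> measurable. The integrals agree also when the
  functions are not integrable, since both are then 0.\<close>

lemma integral_lebesgue_AE_borel:
  fixes f g :: "'a::euclidean_space \<Rightarrow> real"
  assumes f: "f \<in> borel_measurable borel" and eq: "AE x in lborel. g x = f x"
  shows "(LINT x|lebesgue. g x) = (\<integral>x. f x \<partial>lborel)"
proof -
  have f': "f \<in> borel_measurable lebesgue" using f by (intro measurable_completion) simp
  have eq': "AE x in lebesgue. f x = g x" using AE_completion[OF eq] by eventually_elim simp
  have g: "g \<in> borel_measurable lebesgue" by (rule borel_measurable_AE[OF f' eq'])
  have "(LINT x|lebesgue. g x) = (LINT x|lebesgue. f x)"
    using eq' by (intro integral_cong_AE g f') auto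
  also have "\<dots> = (\<integral>x. f x \<partial>lborel)" by (rule integral_completion) (use f in simp)
  finally show ?thesis .
qed

lemma integral_lebesgue_on_AE_borel:
  fixes f g :: "'a::euclidean_space \<Rightarrow> real"
  assumes f: "f \<in> borel_measurable borel" and S: "S \<in> sets borel" and eq: "AE x in lborel. x \<in> S \<longrightarrow> g x = f x"
  shows "(LINT x|lebesgue_on S. g x) = (\<integral>x. indicator S x * f x \<partial>lborel)"
proof -
  have "(LINT x|lebesgue_on S. g x) = (LINT x|lebesgue. indicator S x *\<^sub>R g x)"
    using S by (intro integral_restrict_space) auto
  also have "\<dots> = (\<integral>x. indicator S x * f x \<partial>lborel)"
  proof (rule integral_lebesgue_AE_borel)
    show "(\<lambda>x. indicator S x * f x) \<in> borel_measurable borel" using f S by measurable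
    show "AE x in lborel. indicator S x *\<^sub>R g x = indicator S x * f x"
      using eq by eventually_elim (auto split: split_indicator)
  qed
  finally show ?thesis .
qed

lemma nn_integral_lebesgue_on:
  fixes f :: "'a::euclidean_space \<Rightarrow> ennreal"
  assumes S: "S \<in> sets borel"
  shows "(\<integral>\<^sup>+x. f x \<partial>lebesgue_on S) = (\<integral>\<^sup>+x. f x * indicator S x \<partial>lborel)"
  using S by (subst nn_integral_restrict_space) (auto simp: nn_integral_completion)

lemma AE_lebesgue_on_iff:
  fixes S :: "'a::euclidean_space set"
  assumes S: "S \<in> sets borel"
  shows "(AE x in lebesgue_on S. P x) \<longleftrightarrow> (AE x in lborel. x \<in> S \<longrightarrow> P x)"
  using S by (subst AE_restrict_space_iff) (auto simp: AE_completion_iff)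

lemma borel_measurable_lebesgue_on:
  fixes f :: "'a::euclidean_space \<Rightarrow> real"
  assumes "f \<in> borel_measurable borel"
  shows "f \<in> borel_measurable (lebesgue_on S)"
  using assms by (intro measurable_restrict_space1 measurable_completion) simp

text \<open>The difference of two ramps is a trapezoid that rises just after a and falls just after
  b. It serves as a weakly differentiable substitute for the indicator of the time interval between
  a and b.\<close>

definition ramp :: "real \<Rightarrow> real \<Rightarrow> real \<Rightarrow> real" where
  "ramp c h t = max 0 (min 1 ((t - c) / h))"

definition ramp_deriv :: "real \<Rightarrow> real \<Rightarrow> real \<Rightarrow> real" where
  "ramp_deriv c h t = 1 / h * indicator {c<..<c + h} t"

lemma ramp_measurable [measurable]: "ramp c h \<in> borel_measurable borel" "ramp_deriv c h \<in> borel_measurable borel"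
  unfolding ramp_def[abs_def] ramp_deriv_def[abs_def] by measurable

lemma ramp_bounds: "0 \<le> ramp c h t" "ramp c h t \<le> 1" by (auto simp: ramp_def)

lemma ramp_eq:
  assumes "0 < h"
  shows "t \<le> c \<Longrightarrow> ramp c h t = 0" "c + h \<le> t \<Longrightarrow> ramp c h t = 1"
  using assms by (auto simp: ramp_def field_simps max_def min_def)

lemma ramp_mono: "0 < h \<Longrightarrow> c \<le> c' \<Longrightarrow> ramp c' h t \<le> ramp c h t"
  unfolding ramp_def by (intro max.mono min.mono order_refl divide_right_mono) auto

lemma ramp_has_derivative:
  assumes h: "0 < h" and t: "t \<noteq> c" "t \<noteq> c + h"
  shows "(ramp c h has_real_derivative ramp_deriv c h t) (at t)"
proof -
  consider "t < c" | "c < t" "t < c + h" | "c + h < t" using t by linarith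
  then show ?thesis
  proof cases
    case 1
    have "((\<lambda>_. 0) has_real_derivative 0) (at t)" by simp
    moreover have "eventually (\<lambda>x. 0 = ramp c h x) (nhds t)"
      using eventually_nhds_in_open[of "{..<c}" t] 1 by (auto elim!: eventually_mono simp: ramp_eq[OF h])
    ultimately have "(ramp c h has_real_derivative 0) (at t)" by (subst (asm) DERIV_cong_ev[OF refl _ refl]) auto
    then show ?thesis using 1 by (simp add: ramp_deriv_def)
  next
    case 2
    have "((\<lambda>x. (x - c) / h) has_real_derivative 1 / h) (at t)"
      using h by (auto intro!: derivative_eq_intros)
    moreover have "eventually (\<lambda>x. (x - c) / h = ramp c h x) (nhds t)"
      using eventually_nhds_in_open[of "{c<..<c + h}" t] 2 h by (auto elim!: eventually_mono simp: ramp_def field_simps)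
    ultimately have "(ramp c h has_real_derivative 1 / h) (at t)" by (subst (asm) DERIV_cong_ev[OF refl _ refl]) auto
    then show ?thesis using 2 by (simp add: ramp_deriv_def)
  next
    case 3
    have "((\<lambda>_. 1) has_real_derivative 0) (at t)" by simp
    moreover have "eventually (\<lambda>x. 1 = ramp c h x) (nhds t)"
      using eventually_nhds_in_open[of "{c + h<..}" t] 3 by (auto elim!: eventually_mono simp: ramp_eq[OF h])
    ultimately have "(ramp c h has_real_derivative 0) (at t)" by (subst (asm) DERIV_cong_ev[OF refl _ refl]) auto
    then show ?thesis using 3 by (simp add: ramp_deriv_def)
  qed
qed

text \<open>The fundamental theorem of calculus for the continuous function
  \<open>g * ramp c h\<close>, with the two kinks as exceptional points. The boundary terms vanish
  because the support of \<open>g\<close> lies in the open interval.\<close>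

lemma ramp_integration_by_parts:
  assumes h: "0 < h" and c: "0 < c" "c + h < T" and g: "g \<in> Cc_infty {0<..<T}"
  shows "integrable lborel (\<lambda>t. indicator {0..T} t * (deriv g t * ramp c h t))"
    and "integrable lborel (\<lambda>t. indicator {0..T} t * (g t * ramp_deriv c h t))"
    and "(\<integral>t. indicator {0..T} t * (deriv g t * ramp c h t) \<partial>lborel) = - (\<integral>t. indicator {0..T} t * (g t * ramp_deriv c h t) \<partial>lborel)"
proof -
  have T: "0 < T" using h c by linarith
  have diff: "(deriv ^^ n) g field_differentiable at t" for n t using g by (simp add: Cc_infty_def)
  have dg: "(g has_real_derivative deriv g t) (at t)" for t
    using diff[of 0 t] by (simp add: field_differentiable_derivI)
  have dg2: "deriv g field_differentiable at t" for t using diff[of 1 t] by simp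
  have cg: "continuous_on S g" for S
    by (meson dg DERIV_isCont continuous_at_imp_continuous_on)
  have cdg: "continuous_on S (deriv g)" for S
    by (meson dg2 field_differentiable_imp_continuous_at continuous_at_imp_continuous_on)
  have [measurable]: "g \<in> borel_measurable borel" "deriv g \<in> borel_measurable borel"
    using cg cdg by (auto intro: borel_measurable_continuous_onI)
  have g0: "g 0 = 0" "g T = 0"
  proof -
    have "closure {t. g t \<noteq> 0} \<subseteq> {0<..<T}" using g by (simp add: Cc_infty_def)
    then have sub: "{t. g t \<noteq> 0} \<subseteq> {0<..<T}" by (rule order_trans[OF closure_subset])
    have z: "g t = 0" if "t \<notin> {0<..<T}" for t
    proof (rule ccontr)
      assume "g t \<noteq> 0"
      then have "t \<in> {0<..<T}" by (intro subsetD[OF sub]) simp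
      then show False using that by simp
    qed
    show "g 0 = 0" "g T = 0" by (rule z, simp)+
  qed
  have bdd: "\<exists>B. \<forall>t\<in>{0..T}. \<bar>f t\<bar> \<le> B" if "continuous_on {0..T} f" for f :: "real \<Rightarrow> real"
    using compact_imp_bounded[OF compact_continuous_image[OF that compact_Icc]] by (auto simp: bounded_iff)
  obtain B1 where B1: "\<forall>t\<in>{0..T}. \<bar>g t\<bar> \<le> B1" using bdd[OF cg] ..
  obtain B2 where B2: "\<forall>t\<in>{0..T}. \<bar>deriv g t\<bar> \<le> B2" using bdd[OF cdg] ..
  have int: "integrable lborel (\<lambda>t. indicator {0..T} t * f t)"
    if [measurable]: "f \<in> borel_measurable borel" and B: "\<And>t. t \<in> {0..T} \<Longrightarrow> \<bar>f t\<bar> \<le> B" for f :: "real \<Rightarrow> real" and B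
  proof (rule Bochner_Integration.integrable_bound)
    show "integrable lborel (\<lambda>t. B * indicator {0..T} t)" using T by simp
    show "AE t in lborel. norm (indicator {0..T} t * f t) \<le> norm (B * indicator {0..T} t)"
      using B by (intro AE_I2) (fastforce split: split_indicator)
  qed measurable
  show i1: "integrable lborel (\<lambda>t. indicator {0..T} t * (deriv g t * ramp c h t))"
  proof (rule int)
    show "\<bar>deriv g t * ramp c h t\<bar> \<le> B2" if "t \<in> {0..T}" for t
      using mult_mono[OF bspec[OF B2 that], of "ramp c h t" 1] ramp_bounds[of c h t] bspec[OF B2 that] by (auto simp: abs_mult)
  qed measurable
  show i2: "integrable lborel (\<lambda>t. indicator {0..T} t * (g t * ramp_deriv c h t))"
  proof (rule int)
    show "\<bar>g t * ramp_deriv c h t\<bar> \<le> B1 * (1 / h)" if "t \<in> {0..T}" for t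
      unfolding abs_mult using bspec[OF B1 that] h by (intro mult_mono) (auto simp: ramp_deriv_def split: split_indicator)
  qed measurable
  let ?F = "\<lambda>t. deriv g t * ramp c h t + g t * ramp_deriv c h t"
  have "(?F has_integral g T * ramp c h T - g 0 * ramp c h 0) {0..T}"
  proof (rule fundamental_theorem_of_calculus_interior_strong[where S="{c, c + h}"])
    show "((\<lambda>t. g t * ramp c h t) has_vector_derivative ?F t) (at t)" if "t \<in> {0<..<T} - {c, c + h}" for t
    proof -
      have "((\<lambda>t. g t * ramp c h t) has_real_derivative ?F t) (at t)"
        using DERIV_mult[OF dg ramp_has_derivative[OF h, of t c]] that by (simp add: algebra_simps)
      then show ?thesis by (simp add: has_real_derivative_iff_has_vector_derivative)
    qed
    show "continuous_on {0..T} (\<lambda>t. g t * ramp c h t)"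
      unfolding ramp_def using h by (intro continuous_intros cg) auto
  qed (use T in auto)
  then have "(?F has_integral 0) {0..T}" using g0 by simp
  then have F: "((\<lambda>t. if t \<in> {0..T} then ?F t else 0) has_integral 0) UNIV" by (subst has_integral_restrict_UNIV)
  have "integrable lborel (\<lambda>t. indicator {0..T} t * (deriv g t * ramp c h t) + indicator {0..T} t * (g t * ramp_deriv c h t))"
    by (intro Bochner_Integration.integrable_add i1 i2)
  from has_integral_integral_lborel[OF this]
  have "((\<lambda>t. if t \<in> {0..T} then ?F t else 0) has_integral (\<integral>t. indicator {0..T} t * (deriv g t * ramp c h t) + indicator {0..T} t * (g t * ramp_deriv c h t) \<partial>lborel)) UNIV"
    by (rule has_integral_eq[rotated]) (auto split: split_indicator)
  then have "(\<integral>t. indicator {0..T} t * (deriv g t * ramp c h t) + indicator {0..T} t * (g t * ramp_deriv c h t) \<partial>lborel) = 0"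
    using F by (rule has_integral_unique)
  then show "(\<integral>t. indicator {0..T} t * (deriv g t * ramp c h t) \<partial>lborel) = - (\<integral>t. indicator {0..T} t * (g t * ramp_deriv c h t) \<partial>lborel)"
    using i1 i2 by simp
qed

lemma ramp_difference_by_parts:
  assumes h: "0 < h" and a: "0 < a" "a + h < T" and b: "0 < b" "b + h < T" and g: "g \<in> Cc_infty {0<..<T}"
  shows "(LINT t|lebesgue_on {0<..T}. deriv g t * ((ramp a h t - ramp b h t) * y))
    = - (LINT t|lebesgue_on {0<..T}. g t * ((ramp_deriv a h t - ramp_deriv b h t) * y))"
proof -
  have dg: "g field_differentiable at t" "deriv g field_differentiable at t" for t
    using g[unfolded Cc_infty_def] by (auto dest: spec[of _ 0] spec[of _ "Suc 0"])
  have [measurable]: "g \<in> borel_measurable borel" "deriv g \<in> borel_measurable borel"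
    using dg by (auto intro!: borel_measurable_continuous_onI continuous_at_imp_continuous_on field_differentiable_imp_continuous_at)
  have S: "{0<..T} \<in> sets borel" by simp
  have AE0: "AE t in lborel. indicator {0<..T} t = (indicator {0..T} t :: real)"
    using AE_lborel_singleton[of "0::real"] by eventually_elim (auto split: split_indicator)
  note ia = ramp_integration_by_parts[OF h a g] and ib = ramp_integration_by_parts[OF h b g]
  have l: "(LINT t|lebesgue_on {0<..T}. f t) = (\<integral>t. indicator {0..T} t * f t \<partial>lborel)"
    if [measurable]: "f \<in> borel_measurable borel" for f :: "real \<Rightarrow> real"
  proof -
    have "(LINT t|lebesgue_on {0<..T}. f t) = (\<integral>t. indicator {0<..T} t * f t \<partial>lborel)"
      by (rule integral_lebesgue_on_AE_borel) auto
    also have "\<dots> = (\<integral>t. indicator {0..T} t * f t \<partial>lborel)"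
      using AE0 by (intro integral_cong_AE) auto
    finally show ?thesis .
  qed
  have "(LINT t|lebesgue_on {0<..T}. deriv g t * ((ramp a h t - ramp b h t) * y))
     = (\<integral>t. (indicator {0..T} t * (deriv g t * ramp a h t) - indicator {0..T} t * (deriv g t * ramp b h t)) * y \<partial>lborel)"
    by (subst l) (auto intro!: Bochner_Integration.integral_cong simp: algebra_simps)
  also have "\<dots> = ((\<integral>t. indicator {0..T} t * (deriv g t * ramp a h t) \<partial>lborel) - (\<integral>t. indicator {0..T} t * (deriv g t * ramp b h t) \<partial>lborel)) * y"
    using ia(1) ib(1) by simp
  also have "\<dots> = - (((\<integral>t. indicator {0..T} t * (g t * ramp_deriv a h t) \<partial>lborel) - (\<integral>t. indicator {0..T} t * (g t * ramp_deriv b h t) \<partial>lborel)) * y)"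
    unfolding ia(3) ib(3) by (simp add: algebra_simps)
  also have "\<dots> = - (\<integral>t. (indicator {0..T} t * (g t * ramp_deriv a h t) - indicator {0..T} t * (g t * ramp_deriv b h t)) * y \<partial>lborel)"
    using ia(2) ib(2) by simp
  also have "\<dots> = - (LINT t|lebesgue_on {0<..T}. g t * ((ramp_deriv a h t - ramp_deriv b h t) * y))"
    by (subst l) (auto intro!: Bochner_Integration.integral_cong simp: algebra_simps)
  finally show ?thesis .
qed

section \<open>Borel versions of the solution and of the kernel\<close>

lemma powr_divide_eq: "0 < y \<Longrightarrow> x / y powr p = x * y powr (- p)" for x y p :: real
  by (simp add: powr_minus divide_inverse)

lemma borel_representative_exists:
  fixes u :: "real \<Rightarrow> 'a::euclidean_space \<Rightarrow> real"
  assumes meas: "(\<lambda>(t, x). u t x) \<in> borel_measurable (lebesgue_on (I \<times> UNIV))" and I: "I \<in> sets borel"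
    and nn: "ae_nonneg I u"
  obtains u' where "(\<lambda>(t, x). u' t x) \<in> borel_measurable borel" "\<And>t x. (0::real) \<le> u' t x"
    "AE t in lborel. t \<in> I \<longrightarrow> (AE x in lborel. u t x = u' t x)"
proof -
  have S: "I \<times> (UNIV :: 'a set) \<in> sets borel"
    using I by (simp add: borel_prod[symmetric])
  then have S': "I \<times> (UNIV :: 'a set) \<in> sets lebesgue" by simp
  have "(\<lambda>q. if q \<in> I \<times> UNIV then (case q of (t, x) \<Rightarrow> u t x) else 0) \<in> borel_measurable lebesgue"
    by (rule borel_measurable_if_I[OF meas S'])
  then obtain g where g: "g \<in> borel_measurable lborel" and eq: "AE q in lborel. (if q \<in> I \<times> UNIV then (case q of (t, x) \<Rightarrow> u t x) else 0) = g q"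
    using completion_ex_borel_measurable_real[of _ lborel] by blast
  have [measurable]: "g \<in> borel_measurable borel" using g by simp
  define u' where "u' t x = max 0 (g (t, x))" for t x
  have "AE q in lborel. q \<in> I \<times> UNIV \<longrightarrow> (case q of (t, x) \<Rightarrow> 0 \<le> u t x)"
    using nn unfolding ae_nonneg_def by (subst (asm) AE_lebesgue_on_iff[OF S])
  with eq have "AE q in lborel. fst q \<in> I \<longrightarrow> u (fst q) (snd q) = u' (fst q) (snd q)"
    by eventually_elim (auto simp: u'_def mem_Times_iff split: prod.splits)
  from AE_lborel_pairD[OF this] have "AE t in lborel. AE x in lborel. t \<in> I \<longrightarrow> u t x = u' t x" by simp
  then have "AE t in lborel. t \<in> I \<longrightarrow> (AE x in lborel. u t x = u' t x)" by eventually_elim auto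
  moreover have "(\<lambda>(t, x). u' t x) \<in> borel_measurable borel" unfolding u'_def split_beta by measurable
  moreover have "0 \<le> u' t x" for t x by (simp add: u'_def)
  ultimately show ?thesis using that by blast
qed

text \<open>Taking the minimum with the upper bound makes it hold everywhere. On the diagonal this
  sets the kernel to 0, as \<open>0 powr a = 0\<close>, although \<open>K\<close> may be infinite
  there; the diagonal is a null set.\<close>

lemma borel_kernel_exists:
  fixes K :: "real \<Rightarrow> 'a::euclidean_space \<Rightarrow> 'a \<Rightarrow> ennreal"
  assumes K: "admissible_kernel s lam Lam K" and Lam: "0 < Lam" and p: "p = real DIM('a) + 2 * s"
  obtains k where "(\<lambda>(t, x, y). k t x y) \<in> borel_measurable borel" "\<And>t x y. (0::real) \<le> k t x y"
    "\<And>t x y. k t x y \<le> Lam * norm (x - y) powr (- p)"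
    "AE t in lborel. AE z in lborel. K t (fst z) (snd z) = ennreal (k t (fst z) (snd z))"
proof -
  have "(\<lambda>(t, x, y). K t x y) \<in> borel_measurable lebesgue" using K by (simp add: admissible_kernel_def)
  then obtain g where g: "g \<in> borel_measurable lborel" and eq: "AE q in lborel. (case q of (t, x, y) \<Rightarrow> K t x y) = g q"
    using completion_ex_borel_measurable[of _ lborel] by blast
  have [measurable]: "g \<in> borel_measurable borel" using g by simp
  define k where "k t x y = min (enn2real (g (t, x, y))) (Lam * norm (x - y) powr (- p))" for t x y
  have diag: "AE z in lborel. fst z \<noteq> (snd z :: 'a)"
  proof -
    have "AE x in lborel. AE y in lborel. x \<noteq> (y::'a)"
    proof (rule AE_I2)
      fix x :: 'a
      show "AE y in lborel. x \<noteq> y" using AE_lborel_singleton[of x] by eventually_elim auto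
    qed
    moreover have "{z \<in> space (lborel \<Otimes>\<^sub>M lborel). fst z \<noteq> (snd z :: 'a)} \<in> sets (lborel \<Otimes>\<^sub>M lborel)"
      by measurable
    ultimately have "AE z in lborel \<Otimes>\<^sub>M lborel. fst z \<noteq> (snd z :: 'a)"
      by (intro lborel_pair.AE_pair_measure) simp_all
    then show ?thesis by (subst (asm) lborel_prod)
  qed
  have "AE t in lborel. AE z in lborel. K t (fst z) (snd z) = g (t, z)"
    using AE_lborel_pairD[OF eq] by (simp add: split_beta)
  then have "AE t in lborel. AE z in lborel. K t (fst z) (snd z) = ennreal (k t (fst z) (snd z))"
  proof eventually_elim
    case (elim t)
    from elim diag show ?case
    proof eventually_elim
      case (elim z)
      have pe: "- real DIM('a) - 2 * s = - p" by (simp add: p)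
      have "K t (fst z) (snd z) \<le> ennreal (Lam * norm (fst z - snd z) powr (- p))"
        using K elim(2) unfolding admissible_kernel_def pe by blast
      then show ?case
        using elim(1) Lam by (cases "g (t, z)") (auto simp: k_def min_def top_unique ennreal_le_iff2)
    qed
  qed
  moreover have "(\<lambda>(t, x, y). k t x y) \<in> borel_measurable borel" unfolding k_def split_beta by measurable
  moreover have "0 \<le> k t x y" "k t x y \<le> Lam * norm (x - y) powr (- p)" for t x y using Lam by (auto simp: k_def)
  ultimately show ?thesis using that by blast
qed

lemma L1mu_norm_eq_wmass:
  fixes f g :: "'a::euclidean_space \<Rightarrow> real"
  assumes eq: "AE x in lborel. f x = g x" and g: "\<And>x. 0 \<le> g x" and p: "p = real DIM('a) + 2 * s"
  shows "L1mu_norm s f = wmass p g"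
  unfolding L1mu_norm_def wmass_def nn_integral_completion
proof (rule nn_integral_cong_AE)
  show "AE x in lborel. ennreal (\<bar>f x\<bar> / (1 + norm x) powr (real DIM('a) + 2 * s)) = ennreal (g x) * ennreal ((1 + norm x) powr (- p))"
    using eq
  proof eventually_elim
    case (elim x)
    have "0 < 1 + norm x" by (simp add: add_pos_nonneg)
    then show ?case using elim g by (simp add: p[symmetric] powr_divide_eq ennreal_mult)
  qed
qed

text \<open>An exceptional null set of points, enlarged to a Borel set, yields by Fubini a null set
  of pairs. On the diagonal both integrands vanish because the increments do.\<close>

lemma Hs_seminorm_sq_eq:
  fixes f g :: "'a::euclidean_space \<Rightarrow> real"
  assumes eq: "AE x in lborel. f x = g x" and B: "B \<in> sets borel" and p: "p = real DIM('a) + 2 * s"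
    and [measurable]: "g \<in> borel_measurable borel"
  shows "Hs_seminorm_sq s B f = (\<integral>\<^sup>+z. ennreal ((g (fst z) - g (snd z))\<^sup>2 * norm (fst z - snd z) powr (- p)) * indicator (B \<times> B) z \<partial>lborel)"
proof -
  have BB: "B \<times> B \<in> sets borel" using B by (simp add: borel_prod[symmetric])
  have pair: "AE z in lborel. f (fst z) = g (fst z) \<and> f (snd z) = g (snd z)"
  proof -
    obtain N where N: "N \<in> null_sets lborel" "{x. f x \<noteq> g x} \<subseteq> N" using eq by (auto elim!: AE_E simp: null_sets_def)
    have [measurable]: "N \<in> sets borel" using N(1) by auto
    have A: "AE x in lborel. x \<notin> N" using N(1) by (rule AE_not_in)
    have "AE x in lborel. AE y in lborel. x \<notin> N \<and> y \<notin> N" using A by eventually_elim (use A in auto)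
    moreover have "{z \<in> space (lborel \<Otimes>\<^sub>M lborel). fst z \<notin> N \<and> snd z \<notin> N} \<in> sets (lborel \<Otimes>\<^sub>M lborel)"
      by measurable
    ultimately have "AE z in lborel \<Otimes>\<^sub>M lborel. fst z \<notin> N \<and> snd z \<notin> N"
      by (intro lborel_pair.AE_pair_measure) simp_all
    then have "AE z in lborel. fst z \<notin> N \<and> snd z \<notin> N" by (subst (asm) lborel_prod)
    then show ?thesis by eventually_elim (use N(2) in auto)
  qed
  have "Hs_seminorm_sq s B f = (\<integral>\<^sup>+z. (case z of (x, y) \<Rightarrow> ennreal ((f x - f y)\<^sup>2 / norm (x - y) powr (real DIM('a) + 2 * s))) * indicator (B \<times> B) z \<partial>lborel)"
    unfolding Hs_seminorm_sq_def by (rule nn_integral_lebesgue_on[OF BB])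
  also have "\<dots> = (\<integral>\<^sup>+z. ennreal ((g (fst z) - g (snd z))\<^sup>2 * norm (fst z - snd z) powr (- p)) * indicator (B \<times> B) z \<partial>lborel)"
  proof (rule nn_integral_cong_AE)
    show "AE z in lborel. (case z of (x, y) \<Rightarrow> ennreal ((f x - f y)\<^sup>2 / norm (x - y) powr (real DIM('a) + 2 * s))) * indicator (B \<times> B) z
      = ennreal ((g (fst z) - g (snd z))\<^sup>2 * norm (fst z - snd z) powr (- p)) * indicator (B \<times> B) z"
      using pair
    proof eventually_elim
      case (elim z)
      show ?case
        using elim by (cases "fst z = snd z") (auto simp: split_beta p[symmetric] powr_divide_eq)
    qed
  qed
  finally show ?thesis .
qed

lemma L2_norm_sq_eq:
  fixes f g :: "'a::euclidean_space \<Rightarrow> real"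
  assumes eq: "AE x in lborel. f x = g x" and B: "B \<in> sets borel"
  shows "L2_norm_sq B f = (\<integral>\<^sup>+x. ennreal ((g x)\<^sup>2) * indicator B x \<partial>lborel)"
proof -
  have "L2_norm_sq B f = (\<integral>\<^sup>+x. ennreal ((f x)\<^sup>2) * indicator B x \<partial>lborel)"
    unfolding L2_norm_sq_def by (rule nn_integral_lebesgue_on[OF B])
  also have "\<dots> = (\<integral>\<^sup>+x. ennreal ((g x)\<^sup>2) * indicator B x \<partial>lborel)"
    by (rule nn_integral_cong_AE) (use eq in eventually_elim, simp)
  finally show ?thesis .
qed

text \<open>Sections of Lebesgue measurable functions are measurable only almost everywhere, so the
  analysis is done for the Borel versions \<open>u'\<close> and \<open>k\<close>. They are linked to
  \<open>u\<close> and \<open>K\<close> at almost every time, which is all that the weak formulation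
  sees.\<close>

locale weak_problem =
  fixes s lam Lam T p :: real
    and K :: "real \<Rightarrow> 'a::euclidean_space \<Rightarrow> 'a \<Rightarrow> ennreal"
    and u u' :: "real \<Rightarrow> 'a \<Rightarrow> real" and k :: "real \<Rightarrow> 'a \<Rightarrow> 'a \<Rightarrow> real"
  assumes s: "0 < s" "s < 1" and lam: "0 < lam" and Lam: "0 < Lam" and T: "0 < T"
    and p: "p = real DIM('a) + 2 * s"
    and K: "admissible_kernel s lam Lam K"
    and sol: "global_weak_solution s K {0<..T} u"
    and u': "(\<lambda>(t, x). u' t x) \<in> borel_measurable borel" "\<And>t x. 0 \<le> u' t x"
    "AE t in lborel. t \<in> {0<..T} \<longrightarrow> (AE x in lborel. u t x = u' t x)"
    and k: "(\<lambda>(t, x, y). k t x y) \<in> borel_measurable borel" "\<And>t x y. 0 \<le> k t x y"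
    "\<And>t x y. k t x y \<le> Lam * norm (x - y) powr (- p)"
    "AE t in lborel. AE z in lborel. K t (fst z) (snd z) = ennreal (k t (fst z) (snd z))"
begin

lemma u'_slice [measurable]: "u' t \<in> borel_measurable borel"
proof -
  have "(\<lambda>x. (\<lambda>(t, x). u' t x) (t, x)) \<in> borel_measurable borel"
    by (rule measurable_compose[OF _ u'(1)]) measurable
  then show ?thesis by simp
qed

lemma data: "nonlocal_data s Lam T u' k"
proof (rule nonlocal_data.intro)
  show "(\<integral>\<^sup>+t. (\<integral>\<^sup>+x. ennreal (u' t x) * ennreal ((1 + norm x) powr (- (real DIM('a) + 2 * s))) \<partial>lborel) * indicator {0<..<T} t \<partial>lborel) < \<infinity>"
  proof -
    have "(\<integral>\<^sup>+t. (\<integral>\<^sup>+x. ennreal (u' t x) * ennreal ((1 + norm x) powr (- (real DIM('a) + 2 * s))) \<partial>lborel) * indicator {0<..<T} t \<partial>lborel)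
      \<le> (\<integral>\<^sup>+t. L1mu_norm s (u t) * indicator {0<..T} t \<partial>lborel)"
    proof (rule nn_integral_mono_AE)
      show "AE t in lborel. (\<integral>\<^sup>+x. ennreal (u' t x) * ennreal ((1 + norm x) powr (- (real DIM('a) + 2 * s))) \<partial>lborel) * indicator {0<..<T} t
         \<le> L1mu_norm s (u t) * indicator {0<..T} t"
        using u'(3)
      proof eventually_elim
        case (elim t)
        show ?case
        proof (cases "t \<in> {0<..<T}")
          case True
          then have "AE x in lborel. u t x = u' t x" using elim by simp
          then have "L1mu_norm s (u t) = wmass p (u' t)" by (rule L1mu_norm_eq_wmass[OF _ u'(2) p])
          then show ?thesis using True by (simp add: wmass_def p)
        qed simp
      qed
    qed
    also have "\<dots> = (\<integral>\<^sup>+t. L1mu_norm s (u t) \<partial>lebesgue_on {0<..T})"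
      by (rule nn_integral_lebesgue_on[symmetric]) simp
    also have "\<dots> < \<infinity>" using sol by (simp add: global_weak_solution_def solution_space_def L1_L1mu_def)
    finally show ?thesis .
  qed
  show "(\<integral>\<^sup>+t. (\<integral>\<^sup>+z. ennreal ((u' t (fst z) - u' t (snd z))\<^sup>2 * norm (fst z - snd z) powr (- (real DIM('a) + 2 * s)))
        * indicator (ball 0 R \<times> ball 0 R) z \<partial>lborel) * indicator {0<..<T} t \<partial>lborel) < \<infinity>" if R: "0 < R" for R
  proof -
    have "(\<integral>\<^sup>+t. (\<integral>\<^sup>+z. ennreal ((u' t (fst z) - u' t (snd z))\<^sup>2 * norm (fst z - snd z) powr (- (real DIM('a) + 2 * s)))
        * indicator (ball 0 R \<times> ball 0 R) z \<partial>lborel) * indicator {0<..<T} t \<partial>lborel)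
      \<le> (\<integral>\<^sup>+t. Hs_norm_sq s (ball 0 R) (u t) * indicator {0<..T} t \<partial>lborel)"
    proof (rule nn_integral_mono_AE)
      show "AE t in lborel. (\<integral>\<^sup>+z. ennreal ((u' t (fst z) - u' t (snd z))\<^sup>2 * norm (fst z - snd z) powr (- (real DIM('a) + 2 * s)))
        * indicator (ball 0 R \<times> ball 0 R) z \<partial>lborel) * indicator {0<..<T} t \<le> Hs_norm_sq s (ball 0 R) (u t) * indicator {0<..T} t"
        using u'(3)
      proof eventually_elim
        case (elim t)
        show ?case
        proof (cases "t \<in> {0<..<T}")
          case True
          then have "AE x in lborel. u t x = u' t x" using elim by simp
          from Hs_seminorm_sq_eq[OF this _ p u'_slice, of "ball 0 R"] True show ?thesis
            by (simp add: Hs_norm_sq_def p add_increasing)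
        qed simp
      qed
    qed
    also have "\<dots> = (\<integral>\<^sup>+t. Hs_norm_sq s (ball 0 R) (u t) \<partial>lebesgue_on {0<..T})"
      by (rule nn_integral_lebesgue_on[symmetric]) simp
    also have "\<dots> < \<infinity>"
      using sol R unfolding global_weak_solution_def solution_space_def L2_Hsloc_def
      by (elim conjE allE[of _ "ball 0 R"]) auto
    finally show ?thesis .
  qed
qed (use s Lam u' k p in auto)

sublocale nonlocal_data s Lam T u' k p
  using data by (simp_all add: p)

end

section \<open>The weak formulation with ramps in time\<close>

context weak_problem
begin

context
  fixes \<zeta> :: "'a \<Rightarrow> real" and R :: real
  assumes R: "0 < R" and \<zeta>[measurable]: "\<zeta> \<in> borel_measurable borel"
    and \<zeta>b: "\<And>x. 0 \<le> \<zeta> x" "\<And>x. \<zeta> x \<le> 1" "\<And>x. R \<le> norm x \<Longrightarrow> \<zeta> x = 0"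
    and fin: "(\<integral>\<^sup>+z. ennreal ((\<zeta> (fst z) - \<zeta> (snd z))\<^sup>2 * norm (fst z - snd z) powr (- p)) \<partial>lborel) < \<infinity>"
begin

text \<open>In time the support lies in [a, b + h], inside the open interval; in space it lies in
  the closed ball of radius R, and the radius R + 1 of the domain makes this containment
  compact.\<close>

lemma ramp_test_function:
  assumes ab: "0 < a" "a < b" "0 < h" "b + h < T"
  shows "test_function s {0<..T} (ball 0 (R + 1)) (\<lambda>t x. (ramp a h t - ramp b h t) * \<zeta> x)
    (\<lambda>t x. (ramp_deriv a h t - ramp_deriv b h t) * \<zeta> x)"
proof -
  let ?I = "{0<..T}" and ?\<Omega> = "ball (0::'a) (R + 1)"
  let ?\<eta> = "\<lambda>t. ramp a h t - ramp b h t" and ?\<eta>' = "\<lambda>t. ramp_deriv a h t - ramp_deriv b h t"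
  have \<eta>: "0 \<le> ?\<eta> t" "?\<eta> t \<le> 1" for t
    using ramp_mono[OF ab(3), of a b t] ramp_bounds[of a h t] ramp_bounds[of b h t] ab by auto
  have int: "interior ?I = {0<..<T}" by simp
  have meas: "(\<lambda>(t, x). ?\<eta> t * \<zeta> x) \<in> borel_measurable borel" "(\<lambda>(t, x). ?\<eta>' t * \<zeta> x) \<in> borel_measurable borel"
    unfolding split_beta by measurable
  have L2: "L2_norm_sq S (\<lambda>x. c * \<zeta> x) \<le> ennreal (c\<^sup>2) * emeasure lborel (ball (0::'a) R)" if "S \<in> sets borel" for S c
  proof -
    have "L2_norm_sq S (\<lambda>x. c * \<zeta> x) = (\<integral>\<^sup>+x. ennreal ((c * \<zeta> x)\<^sup>2) * indicator S x \<partial>lborel)"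
      using that by (intro L2_norm_sq_eq) auto
    also have "\<dots> \<le> (\<integral>\<^sup>+x. ennreal (c\<^sup>2) * indicator (ball (0::'a) R) x \<partial>lborel)"
    proof (rule nn_integral_mono)
      fix x
      have "(\<zeta> x)\<^sup>2 \<le> 1" using \<zeta>b(1,2)[of x] by (simp add: power_le_one)
      then have "(c * \<zeta> x)\<^sup>2 \<le> c\<^sup>2" unfolding power_mult_distrib using mult_left_mono[of "(\<zeta> x)\<^sup>2" 1 "c\<^sup>2"] by simp
      then show "ennreal ((c * \<zeta> x)\<^sup>2) * indicator S x \<le> ennreal (c\<^sup>2) * indicator (ball (0::'a) R) x"
        using \<zeta>b(3)[of x] by (auto intro: ennreal_leI split: split_indicator)
    qed
    also have "\<dots> = ennreal (c\<^sup>2) * emeasure lborel (ball (0::'a) R)" by (rule nn_integral_cmult_indicator) simp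
    finally show ?thesis .
  qed
  have vol: "emeasure lborel (ball (0::'a) R) < \<infinity>" using R by (simp add: emeasure_ball)
  have const: "(\<integral>\<^sup>+t. f t \<partial>lebesgue_on ?I) < \<infinity>" if "\<And>t. f t \<le> C" "C < \<infinity>" for f and C :: ennreal
  proof -
    have "(\<integral>\<^sup>+t. f t \<partial>lebesgue_on ?I) = (\<integral>\<^sup>+t. f t * indicator ?I t \<partial>lborel)" by (rule nn_integral_lebesgue_on) simp
    also have "\<dots> \<le> (\<integral>\<^sup>+t. C * indicator ?I t \<partial>lborel)" using that by (intro nn_integral_mono mult_right_mono) auto
    also have "\<dots> = C * ennreal T" using T by (subst nn_integral_cmult_indicator) auto
    also have "\<dots> < \<infinity>" using that(2) by (simp add: ennreal_mult_less_top)
    finally show ?thesis .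
  qed
  have L2_fin: "(\<integral>\<^sup>+t. L2_norm_sq S (\<lambda>x. g t * \<zeta> x) \<partial>lebesgue_on ?I) < \<infinity>"
    if "S \<in> sets borel" and g: "\<And>t. \<bar>g t\<bar> \<le> B" for S g B
  proof (rule const)
    fix t
    have "(g t)\<^sup>2 \<le> B\<^sup>2" using power_mono[OF g[of t], of 2] by simp
    then show "L2_norm_sq S (\<lambda>x. g t * \<zeta> x) \<le> ennreal (B\<^sup>2) * emeasure lborel (ball (0::'a) R)"
      by (intro order_trans[OF L2[OF that(1)]] mult_right_mono ennreal_leI) auto
  qed (use vol in \<open>simp add: ennreal_mult_less_top\<close>)
  have \<eta>'b: "\<bar>?\<eta>' t\<bar> \<le> 1 / h" for t
    using ab(3) by (auto simp: ramp_deriv_def split: split_indicator)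
  have \<eta>b: "\<bar>?\<eta> t\<bar> \<le> 1" for t using \<eta>[of t] by simp
  have H1: "H1_L2_deriv ?I ?\<Omega> (\<lambda>t x. ?\<eta> t * \<zeta> x) (\<lambda>t x. ?\<eta>' t * \<zeta> x)"
    unfolding H1_L2_deriv_def int
  proof (intro conjI ballI borel_measurable_lebesgue_on meas AE_I2)
    show "(\<integral>\<^sup>+t. L2_norm_sq ?\<Omega> (\<lambda>x. ?\<eta> t * \<zeta> x) \<partial>lebesgue_on ?I) < \<infinity>"
      by (rule L2_fin[of _ ?\<eta>, OF _ \<eta>b]) simp
    show "(\<integral>\<^sup>+t. L2_norm_sq ?\<Omega> (\<lambda>x. ?\<eta>' t * \<zeta> x) \<partial>lebesgue_on ?I) < \<infinity>"
      by (rule L2_fin[of _ ?\<eta>', OF _ \<eta>'b]) simp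
    fix g x assume "g \<in> Cc_infty {0<..<T}"
    then show "(LINT t|lebesgue_on ?I. deriv g t * (?\<eta> t * \<zeta> x)) = - (LINT t|lebesgue_on ?I. g t * (?\<eta>' t * \<zeta> x))"
      using ab by (intro ramp_difference_by_parts) auto
  qed
  have Hs: "(\<integral>\<^sup>+t. Hs_norm_sq s UNIV (\<lambda>x. ?\<eta> t * \<zeta> x) \<partial>lebesgue_on ?I) < \<infinity>"
  proof (rule const)
    fix t
    have "(?\<eta> t)\<^sup>2 \<le> 1" using \<eta>[of t] by (simp add: power_le_one)
    have "Hs_seminorm_sq s UNIV (\<lambda>x. ?\<eta> t * \<zeta> x) = (\<integral>\<^sup>+z. ennreal ((?\<eta> t * \<zeta> (fst z) - ?\<eta> t * \<zeta> (snd z))\<^sup>2 * norm (fst z - snd z) powr (- p)) * indicator (UNIV \<times> UNIV) z \<partial>lborel)"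
      by (rule Hs_seminorm_sq_eq[OF _ _ p]) auto
    also have "\<dots> \<le> (\<integral>\<^sup>+z. ennreal ((\<zeta> (fst z) - \<zeta> (snd z))\<^sup>2 * norm (fst z - snd z) powr (- p)) \<partial>lborel)"
    proof (rule nn_integral_mono)
      fix z :: "'a \<times> 'a"
      have "(?\<eta> t * \<zeta> (fst z) - ?\<eta> t * \<zeta> (snd z))\<^sup>2 = (?\<eta> t)\<^sup>2 * (\<zeta> (fst z) - \<zeta> (snd z))\<^sup>2"
        by (simp add: right_diff_distrib[symmetric] power_mult_distrib)
      also have "\<dots> \<le> 1 * (\<zeta> (fst z) - \<zeta> (snd z))\<^sup>2" using \<open>(?\<eta> t)\<^sup>2 \<le> 1\<close> by (intro mult_right_mono) auto
      finally show "ennreal ((?\<eta> t * \<zeta> (fst z) - ?\<eta> t * \<zeta> (snd z))\<^sup>2 * norm (fst z - snd z) powr (- p)) * indicator (UNIV \<times> UNIV) z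
        \<le> ennreal ((\<zeta> (fst z) - \<zeta> (snd z))\<^sup>2 * norm (fst z - snd z) powr (- p))"
        by (auto intro!: ennreal_leI mult_right_mono)
    qed
    finally have 1: "Hs_seminorm_sq s UNIV (\<lambda>x. ?\<eta> t * \<zeta> x) \<le> \<dots>" .
    have "L2_norm_sq UNIV (\<lambda>x. ?\<eta> t * \<zeta> x) \<le> ennreal ((?\<eta> t)\<^sup>2) * emeasure lborel (ball (0::'a) R)" by (rule L2) simp
    also have "\<dots> \<le> ennreal 1 * emeasure lborel (ball (0::'a) R)"
      using \<open>(?\<eta> t)\<^sup>2 \<le> 1\<close> by (intro mult_right_mono ennreal_leI) auto
    finally show "Hs_norm_sq s UNIV (\<lambda>x. ?\<eta> t * \<zeta> x) \<le> emeasure lborel (ball (0::'a) R) + (\<integral>\<^sup>+z. ennreal ((\<zeta> (fst z) - \<zeta> (snd z))\<^sup>2 * norm (fst z - snd z) powr (- p)) \<partial>lborel)"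
      unfolding Hs_norm_sq_def using 1 by (intro add_mono) auto
  qed (use vol fin in simp)
  have sub: "closure {(t, x). ?\<eta> t * \<zeta> x \<noteq> 0} \<subseteq> {a..b + h} \<times> cball 0 R"
  proof (rule closure_minimal)
    show "{(t, x). ?\<eta> t * \<zeta> x \<noteq> 0} \<subseteq> {a..b + h} \<times> cball 0 R"
    proof
      fix q assume "q \<in> {(t, x). ?\<eta> t * \<zeta> x \<noteq> 0}"
      then obtain t x where q: "q = (t, x)" and nz: "?\<eta> t * \<zeta> x \<noteq> 0" by blast
      have "norm x < R" using \<zeta>b(3)[of x] nz by force
      moreover have "a \<le> t"
        using nz ramp_eq(1)[OF ab(3), of t a] ramp_eq(1)[OF ab(3), of t b] ab by force
      moreover have "t \<le> b + h"
        using nz ramp_eq(2)[OF ab(3), of a t] ramp_eq(2)[OF ab(3), of b t] ab by force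
      ultimately show "q \<in> {a..b + h} \<times> cball 0 R" by (simp add: q)
    qed
  qed (intro closed_Times closed_atLeastAtMost closed_cball)
  have "compact (({a..b + h} \<times> cball 0 R) \<inter> closure {(t, x). ?\<eta> t * \<zeta> x \<noteq> 0})"
    by (intro compact_Int_closed compact_Times compact_Icc compact_cball closed_closure)
  then have "compact (closure {(t, x). ?\<eta> t * \<zeta> x \<noteq> 0})"
    using sub by (simp add: Int_absorb1)
  moreover have "closure {(t, x). ?\<eta> t * \<zeta> x \<noteq> 0} \<subseteq> {0<..<T} \<times> ?\<Omega>"
    using ab R by (intro order_trans[OF sub]) auto
  ultimately show ?thesis
    unfolding test_function_def int using H1 Hs \<eta>(1) \<zeta>b(1) meas(1)
    by (auto intro!: borel_measurable_lebesgue_on)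
qed

text \<open>Joint integrability of the flux gives an integrable slice at almost every time, so the
  iterated integral in \<open>energy\<close> is a double integral. The factor \<open>c\<close> is
  quantified inside the almost everywhere statement because it will be the value of the ramps at
  that very time.\<close>

lemma AE_energy_eq:
  "AE t in lborel. t \<in> {0<..<T} \<longrightarrow> (\<forall>c. energy (K t) (u t) (\<lambda>x. c * \<zeta> x) = c * (\<integral>z. flux \<zeta> (t, z) \<partial>lborel))"
proof -
  have "integrable (lborel \<Otimes>\<^sub>M lborel) (\<lambda>q. indicator {0<..<T} (fst q) * flux \<zeta> q)"
    unfolding lborel_prod using fin by (intro flux_integrable[OF R \<zeta> \<zeta>b]) auto
  from lborel_pair.AE_integrable_fst'[OF this]
  have "AE t in lborel. integrable lborel (\<lambda>z. indicator {0<..<T} t * flux \<zeta> (t, z))" by simp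
  then show ?thesis using u'(3) k(4)
  proof eventually_elim
    case (elim t)
    show ?case
    proof (intro impI allI)
      fix c assume t: "t \<in> {0<..<T}"
      have int: "integrable lborel (\<lambda>z. flux \<zeta> (t, z))" using elim(1) t by simp
      have ut: "AE x in lborel. u t x = u' t x" using elim(2) t by simp
      have kt: "AE x in lborel. AE y in lborel. K t x y = ennreal (k t x y)"
        using AE_lborel_pairD[OF elim(3)] by simp
      have "energy (K t) (u t) (\<lambda>x. c * \<zeta> x) = (\<integral>x. (\<integral>y. c * flux \<zeta> (t, x, y) \<partial>lborel) \<partial>lborel)"
        unfolding energy_def
      proof (rule integral_lebesgue_AE_borel)
        show "(\<lambda>x. \<integral>y. c * flux \<zeta> (t, x, y) \<partial>lborel) \<in> borel_measurable borel" by measurable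
        show "AE x in lborel. (LINT y|lebesgue. (u t x - u t y) * (c * \<zeta> x - c * \<zeta> y) * enn2real (K t x y)) = (\<integral>y. c * flux \<zeta> (t, x, y) \<partial>lborel)"
          using ut kt
        proof eventually_elim
          case (elim x)
          show ?case
          proof (rule integral_lebesgue_AE_borel)
            show "(\<lambda>y. c * flux \<zeta> (t, x, y)) \<in> borel_measurable borel" by measurable
            show "AE y in lborel. (u t x - u t y) * (c * \<zeta> x - c * \<zeta> y) * enn2real (K t x y) = c * flux \<zeta> (t, x, y)"
              using ut elim(2) by eventually_elim (simp add: elim(1) flux_def k(2) algebra_simps)
          qed
        qed
      qed
      also have "\<dots> = c * (\<integral>x. (\<integral>y. flux \<zeta> (t, x, y) \<partial>lborel) \<partial>lborel)" by simp
      also have "(\<integral>x. (\<integral>y. flux \<zeta> (t, x, y) \<partial>lborel) \<partial>lborel) = (\<integral>z. flux \<zeta> (t, z) \<partial>lborel)"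
        using lborel_pair.integral_fst'[of "\<lambda>z. flux \<zeta> (t, z)"] int by (simp add: lborel_prod)
      finally show "energy (K t) (u t) (\<lambda>x. c * \<zeta> x) = c * (\<integral>z. flux \<zeta> (t, z) \<partial>lborel)" .
    qed
  qed
qed

text \<open>Both \<open>u\<close> and \<open>- u\<close> are supersolutions, and the nonnegative
  trapezoid times \<zeta> is admissible for both, so the two inequalities combine to an
  equality.\<close>

lemma ramp_identity:
  assumes ab: "0 < a" "a < b" "0 < h" "b + h < T"
  shows "(\<integral>t. (ramp_deriv a h t - ramp_deriv b h t) * (\<integral>x. u' t x * \<zeta> x \<partial>lborel) \<partial>lborel)
    = (\<integral>q. (ramp a h (fst q) - ramp b h (fst q)) * flux \<zeta> q \<partial>lborel)"
proof -
  let ?\<eta> = "\<lambda>t. ramp a h t - ramp b h t" and ?\<eta>' = "\<lambda>t. ramp_deriv a h t - ramp_deriv b h t"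
  let ?I = "{0<..T}" and ?\<Omega> = "ball (0::'a) (R + 1)"
  have test: "test_function s ?I ?\<Omega> (\<lambda>t x. ?\<eta> t * \<zeta> x) (\<lambda>t x. ?\<eta>' t * \<zeta> x)"
    by (rule ramp_test_function[OF ab])
  have ws: "weak_solution s K ?I ?\<Omega> u" using sol R by (simp add: global_weak_solution_def)
  let ?A = "LINT t|lebesgue_on ?I. LINT x|lebesgue_on ?\<Omega>. u t x * (?\<eta>' t * \<zeta> x)"
  let ?B = "LINT t|lebesgue_on ?I. energy (K t) (u t) (\<lambda>x. ?\<eta> t * \<zeta> x)"
  have 1: "- ?A + ?B \<ge> 0"
    using ws test unfolding weak_solution_def weak_supersolution_def by blast
  have "- (LINT t|lebesgue_on ?I. LINT x|lebesgue_on ?\<Omega>. - u t x * (?\<eta>' t * \<zeta> x))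
     + (LINT t|lebesgue_on ?I. energy (K t) (\<lambda>x. - u t x) (\<lambda>x. ?\<eta> t * \<zeta> x)) \<ge> 0"
    using ws test unfolding weak_solution_def weak_subsolution_def weak_supersolution_def by blast
  moreover have "energy (K t) (\<lambda>x. - u t x) w = - energy (K t) (u t) w" for t w
  proof -
    have "energy (K t) (\<lambda>x. - u t x) w = (LINT x|lebesgue. LINT y|lebesgue. - ((u t x - u t y) * (w x - w y) * enn2real (K t x y)))"
      unfolding energy_def by (intro Bochner_Integration.integral_cong refl) (simp add: algebra_simps)
    then show ?thesis by (simp add: energy_def)
  qed
  ultimately have 2: "?A - ?B \<ge> 0" by simp
  have AB: "?A = ?B" using 1 2 by linarith
  have supp: "?\<eta> t = 0" "?\<eta>' t = 0" if "t \<notin> {0<..<T}" for t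
  proof -
    consider "t \<le> 0" | "T \<le> t" using \<open>t \<notin> {0<..<T}\<close> by force
    then show "?\<eta> t = 0" using ab by cases (auto simp: ramp_eq)
    show "?\<eta>' t = 0" using that ab by (auto simp: ramp_deriv_def split: split_indicator)
  qed
  have A: "?A = (\<integral>t. indicator ?I t * (?\<eta>' t * (\<integral>x. u' t x * \<zeta> x \<partial>lborel)) \<partial>lborel)"
  proof (rule integral_lebesgue_on_AE_borel)
    show "AE t in lborel. t \<in> ?I \<longrightarrow> (LINT x|lebesgue_on ?\<Omega>. u t x * (?\<eta>' t * \<zeta> x)) = ?\<eta>' t * (\<integral>x. u' t x * \<zeta> x \<partial>lborel)"
      using u'(3)
    proof eventually_elim
      case (elim t)
      show ?case
      proof
        assume "t \<in> ?I"
        then have ut: "AE x in lborel. u t x = u' t x" using elim by simp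
        have "(LINT x|lebesgue_on ?\<Omega>. u t x * (?\<eta>' t * \<zeta> x)) = (\<integral>x. indicator ?\<Omega> x * (?\<eta>' t * (u' t x * \<zeta> x)) \<partial>lborel)"
          by (rule integral_lebesgue_on_AE_borel) (measurable, use ut in \<open>eventually_elim, simp\<close>)
        also have "\<dots> = (\<integral>x. ?\<eta>' t * (u' t x * \<zeta> x) \<partial>lborel)"
          using \<zeta>b(3) by (intro Bochner_Integration.integral_cong refl) (auto split: split_indicator)
        also have "\<dots> = ?\<eta>' t * (\<integral>x. u' t x * \<zeta> x \<partial>lborel)" by simp
        finally show "(LINT x|lebesgue_on ?\<Omega>. u t x * (?\<eta>' t * \<zeta> x)) = ?\<eta>' t * (\<integral>x. u' t x * \<zeta> x \<partial>lborel)" .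
      qed
    qed
  qed measurable
  also have "\<dots> = (\<integral>t. ?\<eta>' t * (\<integral>x. u' t x * \<zeta> x \<partial>lborel) \<partial>lborel)"
    using supp(2) by (intro Bochner_Integration.integral_cong refl) (auto split: split_indicator)
  finally have A': "?A = \<dots>" .
  have B: "?B = (\<integral>t. indicator ?I t * (?\<eta> t * (\<integral>z. flux \<zeta> (t, z) \<partial>lborel)) \<partial>lborel)"
  proof (rule integral_lebesgue_on_AE_borel)
    show "AE t in lborel. t \<in> ?I \<longrightarrow> energy (K t) (u t) (\<lambda>x. ?\<eta> t * \<zeta> x) = ?\<eta> t * (\<integral>z. flux \<zeta> (t, z) \<partial>lborel)"
      using AE_energy_eq AE_lborel_singleton[of T] by eventually_elim auto
  qed measurable
  also have "\<dots> = (\<integral>t. (\<integral>z. ?\<eta> t * flux \<zeta> (t, z) \<partial>lborel) \<partial>lborel)"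
    using supp(1) by (intro Bochner_Integration.integral_cong refl) (auto split: split_indicator)
  also have "\<dots> = (\<integral>q. ?\<eta> (fst q) * flux \<zeta> q \<partial>lborel)"
  proof -
    have "integrable lborel (\<lambda>q. indicator {0<..<T} (fst q) * flux \<zeta> q)"
      using fin by (intro flux_integrable[OF R \<zeta> \<zeta>b]) auto
    then have "integrable lborel (\<lambda>q. ?\<eta> (fst q) * flux \<zeta> q)"
    proof (rule Bochner_Integration.integrable_bound)
      show "AE q in lborel. norm (?\<eta> (fst q) * flux \<zeta> q) \<le> norm (indicator {0<..<T} (fst q) * flux \<zeta> q)"
      proof (intro AE_I2)
        fix q :: "real \<times> 'a \<times> 'a"
        have "\<bar>?\<eta> (fst q)\<bar> \<le> 1" using ramp_bounds[of a h "fst q"] ramp_bounds[of b h "fst q"] by linarith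
        then have "\<bar>?\<eta> (fst q)\<bar> * \<bar>flux \<zeta> q\<bar> \<le> 1 * \<bar>flux \<zeta> q\<bar>" by (intro mult_right_mono) auto
        then show "norm (?\<eta> (fst q) * flux \<zeta> q) \<le> norm (indicator {0<..<T} (fst q) * flux \<zeta> q)"
          using supp(1)[of "fst q"] by (cases "fst q \<in> {0<..<T}") (auto simp: abs_mult)
      qed
    qed measurable
    then show ?thesis
      using lborel_pair.integral_fst'[of "\<lambda>q. ?\<eta> (fst q) * flux \<zeta> q"] by (simp add: lborel_prod)
  qed
  finally show ?thesis using A' AB by simp
qed

end

end

section \<open>The balance of mass between two times\<close>

text \<open>The integral against \<open>ramp_deriv\<close> is the mean over (a, a + h), and \<mu>
  agrees almost everywhere with a function continuous at a. Integrability is recorded separately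
  because it is what allows the difference of two such means to be formed under one
  integral.\<close>

lemma ramp_deriv_average:
  fixes \<mu> m :: "real \<Rightarrow> real"
  assumes [measurable]: "\<mu> \<in> borel_measurable borel" and \<delta>: "0 < \<delta>"
    and eq: "AE t in lborel. t \<in> {a<..<a + \<delta>} \<longrightarrow> \<mu> t = m t"
    and cont: "(m \<longlongrightarrow> m a) (at a)"
  shows "eventually (\<lambda>h. integrable lborel (\<lambda>t. ramp_deriv a h t * \<mu> t)) (at_right 0)"
    and "((\<lambda>h. \<integral>t. ramp_deriv a h t * \<mu> t \<partial>lborel) \<longlongrightarrow> m a) (at_right 0)"
proof -
  have rd: "integrable lborel (\<lambda>t. ramp_deriv a h t * c)" "(\<integral>t. ramp_deriv a h t * c \<partial>lborel) = c" if "0 < h" for h c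
    using that unfolding ramp_deriv_def by (simp_all add: mult_ac)
  have key: "eventually (\<lambda>h. 0 < h \<and> (AE t in lborel. \<bar>ramp_deriv a h t * \<mu> t - ramp_deriv a h t * m a\<bar> \<le> ramp_deriv a h t * e)) (at_right 0)" if e: "0 < e" for e
  proof -
    obtain d where d: "0 < d" "\<And>t. t \<noteq> a \<Longrightarrow> dist t a < d \<Longrightarrow> dist (m t) (m a) < e"
      using tendstoD[OF cont e] unfolding eventually_at by auto
    have "eventually (\<lambda>h. h \<in> {0<..<min d \<delta>}) (at_right (0::real))"
      using d \<delta> by (intro eventually_at_right_real) simp
    then show ?thesis
    proof eventually_elim
      case (elim h)
      have "AE t in lborel. \<bar>ramp_deriv a h t * \<mu> t - ramp_deriv a h t * m a\<bar> \<le> ramp_deriv a h t * e"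
        using eq
      proof eventually_elim
        case (elim t)
        show ?case
        proof (cases "t \<in> {a<..<a + h}")
          case True
          then have "\<mu> t = m t" "\<bar>m t - m a\<bar> \<le> e"
            using elim \<open>h \<in> {0<..<min d \<delta>}\<close> d(2)[of t] by (auto simp: dist_real_def)
          moreover have "\<bar>1 / h * m t - 1 / h * m a\<bar> = 1 / h * \<bar>m t - m a\<bar>"
            using \<open>h \<in> {0<..<min d \<delta>}\<close> by (simp add: right_diff_distrib[symmetric] abs_mult diff_divide_distrib[symmetric])
          moreover have "1 / h * \<bar>m t - m a\<bar> \<le> 1 / h * e"
            using \<open>\<bar>m t - m a\<bar> \<le> e\<close> \<open>h \<in> {0<..<min d \<delta>}\<close> by (intro mult_left_mono) auto
          ultimately show ?thesis using True by (simp add: ramp_deriv_def)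
        qed (simp add: ramp_deriv_def)
      qed
      then show ?case using elim by simp
    qed
  qed
  have int: "integrable lborel (\<lambda>t. ramp_deriv a h t * \<mu> t)"
    if "0 < h" "AE t in lborel. \<bar>ramp_deriv a h t * \<mu> t - ramp_deriv a h t * m a\<bar> \<le> ramp_deriv a h t * e" for h e
  proof -
    have "integrable lborel (\<lambda>t. ramp_deriv a h t * \<mu> t - ramp_deriv a h t * m a)"
    proof (rule Bochner_Integration.integrable_bound[OF rd(1)[of h e]])
      show "AE t in lborel. norm (ramp_deriv a h t * \<mu> t - ramp_deriv a h t * m a) \<le> norm (ramp_deriv a h t * e)"
        using that(2) by eventually_elim auto
    qed (use that in auto)
    from Bochner_Integration.integrable_add[OF this rd(1)[of h "m a"]] that show ?thesis by simp
  qed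
  show "eventually (\<lambda>h. integrable lborel (\<lambda>t. ramp_deriv a h t * \<mu> t)) (at_right 0)"
    using key[of 1, simplified] by eventually_elim (rule int[of _ 1], simp_all)
  show "((\<lambda>h. \<integral>t. ramp_deriv a h t * \<mu> t \<partial>lborel) \<longlongrightarrow> m a) (at_right 0)"
  proof (rule tendstoI)
    fix e :: real assume e: "0 < e"
    then have "0 < e / 2" by simp
    from key[OF this] show "eventually (\<lambda>h. dist (\<integral>t. ramp_deriv a h t * \<mu> t \<partial>lborel) (m a) < e) (at_right 0)"
    proof eventually_elim
      case (elim h)
      then have h: "0 < h" by simp
      have I: "integrable lborel (\<lambda>t. ramp_deriv a h t * \<mu> t)" by (rule int[OF h, of "e / 2"]) (use elim in blast)
      have "(\<integral>t. ramp_deriv a h t * \<mu> t \<partial>lborel) - m a = (\<integral>t. ramp_deriv a h t * \<mu> t - ramp_deriv a h t * m a \<partial>lborel)"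
        using I rd[OF h, of "m a"] by (subst Bochner_Integration.integral_diff) auto
      moreover have "\<bar>\<integral>t. ramp_deriv a h t * \<mu> t - ramp_deriv a h t * m a \<partial>lborel\<bar> \<le> (\<integral>t. \<bar>ramp_deriv a h t * \<mu> t - ramp_deriv a h t * m a\<bar> \<partial>lborel)"
        by (rule integral_abs_bound)
      moreover have "\<dots> \<le> (\<integral>t. ramp_deriv a h t * (e / 2) \<partial>lborel)"
        using elim I rd(1)[OF h] by (intro integral_mono_AE) auto
      moreover have "(\<integral>t. ramp_deriv a h t * (e / 2) \<partial>lborel) = e / 2" by (rule rd(2)[OF h])
      ultimately show ?case using e unfolding dist_real_def by linarith
    qed
  qed
qed

locale represented_weak_problem = weak_problem s lam Lam T p K u u' k
  for s lam Lam T p :: real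
    and K :: "real \<Rightarrow> 'a::euclidean_space \<Rightarrow> 'a \<Rightarrow> ennreal"
    and u u' :: "real \<Rightarrow> 'a \<Rightarrow> real" and k :: "real \<Rightarrow> 'a \<Rightarrow> 'a \<Rightarrow> real" +
  fixes v :: "real \<Rightarrow> 'a \<Rightarrow> real"
  assumes v_meas [measurable]: "\<And>t. v t \<in> borel_measurable borel"
    and v_nonneg: "\<And>t x. 0 \<le> v t x"
    and v_eq: "AE t in lborel. t \<in> {0<..<T} \<longrightarrow> (AE x in lborel. v t x = u' t x)"
    and v_sq: "\<And>t R. t \<in> {0<..<T} \<Longrightarrow> 0 < R \<Longrightarrow> (\<integral>\<^sup>+x. ennreal ((v t x)\<^sup>2) * indicator (ball 0 R) x \<partial>lborel) < \<infinity>"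
    and v_cont: "\<And>t R. t \<in> {0<..<T} \<Longrightarrow> 0 < R \<Longrightarrow>
      ((\<lambda>r. \<integral>\<^sup>+x. ennreal ((v r x - v t x)\<^sup>2) * indicator (ball 0 R) x \<partial>lborel) \<longlongrightarrow> 0) (at t)"
begin

context
  fixes \<zeta> :: "'a \<Rightarrow> real" and R :: real
  assumes R: "0 < R" and \<zeta>[measurable]: "\<zeta> \<in> borel_measurable borel"
    and \<zeta>b: "\<And>x. 0 \<le> \<zeta> x" "\<And>x. \<zeta> x \<le> 1" "\<And>x. R \<le> norm x \<Longrightarrow> \<zeta> x = 0"
    and fin: "(\<integral>\<^sup>+z. ennreal ((\<zeta> (fst z) - \<zeta> (snd z))\<^sup>2 * norm (fst z - snd z) powr (- p)) \<partial>lborel) < \<infinity>"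
begin

lemma test_integrable:
  assumes t: "t \<in> {0<..<T}" shows "integrable lborel (\<lambda>x. v t x * \<zeta> x)"
proof (rule integrableI_bounded)
  have "(\<integral>\<^sup>+x. ennreal (norm (v t x * \<zeta> x)) \<partial>lborel) \<le> (\<integral>\<^sup>+x. ennreal (v t x) * indicator (ball 0 R) x \<partial>lborel)"
  proof (rule nn_integral_mono)
    fix x
    have "v t x * \<zeta> x \<le> v t x * 1" using v_nonneg \<zeta>b by (intro mult_left_mono) auto
    then show "ennreal (norm (v t x * \<zeta> x)) \<le> ennreal (v t x) * indicator (ball 0 R) x"
      using v_nonneg[of t x] \<zeta>b[of x] by (auto intro: ennreal_leI simp: abs_mult split: split_indicator)
  qed
  also have "\<dots> < \<infinity>" by (rule L1_ball_finite[OF v_meas v_nonneg v_sq[OF t R]])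
  finally show "(\<integral>\<^sup>+x. ennreal (norm (v t x * \<zeta> x)) \<partial>lborel) < \<infinity>" .
qed measurable

lemma test_continuous:
  assumes t: "t \<in> {0<..<T}"
  shows "((\<lambda>r. \<integral>x. v r x * \<zeta> x \<partial>lborel) \<longlongrightarrow> (\<integral>x. v t x * \<zeta> x \<partial>lborel)) (at t)"
proof -
  have L1: "((\<lambda>r. \<integral>\<^sup>+x. ennreal \<bar>v r x - v t x\<bar> * indicator (ball 0 R) x \<partial>lborel) \<longlongrightarrow> 0) (at t)"
    by (rule L1_ball_tendsto[OF _ R v_cont[OF t R]]) measurable
  have ev: "eventually (\<lambda>r. r \<in> {0<..<T}) (at t)"
    using t by (intro eventually_at_in_open') auto
  have "((\<lambda>r. ennreal \<bar>(\<integral>x. v r x * \<zeta> x \<partial>lborel) - (\<integral>x. v t x * \<zeta> x \<partial>lborel)\<bar>) \<longlongrightarrow> ennreal 0) (at t)"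
  proof (rule tendsto_sandwich[OF _ _ tendsto_const])
    show "((\<lambda>r. \<integral>\<^sup>+x. ennreal \<bar>v r x - v t x\<bar> * indicator (ball 0 R) x \<partial>lborel) \<longlongrightarrow> ennreal 0) (at t)"
      using L1 by simp
    show "eventually (\<lambda>r. ennreal \<bar>(\<integral>x. v r x * \<zeta> x \<partial>lborel) - (\<integral>x. v t x * \<zeta> x \<partial>lborel)\<bar>
       \<le> (\<integral>\<^sup>+x. ennreal \<bar>v r x - v t x\<bar> * indicator (ball 0 R) x \<partial>lborel)) (at t)"
      using ev
    proof eventually_elim
      case (elim r)
      have "(\<integral>x. v r x * \<zeta> x \<partial>lborel) - (\<integral>x. v t x * \<zeta> x \<partial>lborel) = (\<integral>x. v r x * \<zeta> x - v t x * \<zeta> x \<partial>lborel)"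
        using test_integrable[OF elim] test_integrable[OF t] by simp
      then have "ennreal \<bar>(\<integral>x. v r x * \<zeta> x \<partial>lborel) - (\<integral>x. v t x * \<zeta> x \<partial>lborel)\<bar> = ennreal (norm (\<integral>x. v r x * \<zeta> x - v t x * \<zeta> x \<partial>lborel))"
        by simp
      also have "\<dots> \<le> (\<integral>\<^sup>+x. ennreal (norm (v r x * \<zeta> x - v t x * \<zeta> x)) \<partial>lborel)"
        using test_integrable[OF elim] test_integrable[OF t] by (intro integral_norm_bound_ennreal) auto
      also have "\<dots> \<le> (\<integral>\<^sup>+x. ennreal \<bar>v r x - v t x\<bar> * indicator (ball 0 R) x \<partial>lborel)"
      proof (rule nn_integral_mono)
        fix x
        have *: "norm (v r x * \<zeta> x - v t x * \<zeta> x) = \<bar>v r x - v t x\<bar> * \<zeta> x"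
          using \<zeta>b(1)[of x] by (simp add: left_diff_distrib[symmetric] abs_mult)
        show "ennreal (norm (v r x * \<zeta> x - v t x * \<zeta> x)) \<le> ennreal \<bar>v r x - v t x\<bar> * indicator (ball 0 R) x"
        proof (cases "x \<in> ball 0 R")
          case True
          then show ?thesis unfolding * using \<zeta>b(1,2)[of x] by (simp add: ennreal_leI mult_left_le)
        next
          case False
          then show ?thesis unfolding * using \<zeta>b(3)[of x] by simp
        qed
      qed
      finally show ?case .
    qed
  qed simp
  then have "((\<lambda>r. \<bar>(\<integral>x. v r x * \<zeta> x \<partial>lborel) - (\<integral>x. v t x * \<zeta> x \<partial>lborel)\<bar>) \<longlongrightarrow> 0) (at t)"
    by (rule tendsto_ennrealD) auto
  then show ?thesis by (simp only: tendsto_rabs_zero_iff LIM_zero_iff)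
qed

text \<open>The width of the ramps tends to 0. On the left the means converge to the values of the
  continuous representative at a and at b; on the right dominated convergence replaces the trapezoid
  by the indicator of the time interval.\<close>

lemma test_balance:
  assumes ab: "0 < a" "a < b" "b < T"
  shows "(\<integral>x. v b x * \<zeta> x \<partial>lborel) - (\<integral>x. v a x * \<zeta> x \<partial>lborel) = - (\<integral>q. indicator {a<..<b} (fst q) * flux \<zeta> q \<partial>lborel)"
proof -
  define m where "m t = (\<integral>x. v t x * \<zeta> x \<partial>lborel)" for t
  define \<mu> where "\<mu> t = (\<integral>x. u' t x * \<zeta> x \<partial>lborel)" for t
  have \<mu>[measurable]: "\<mu> \<in> borel_measurable borel" unfolding \<mu>_def[abs_def] by measurable
  have eq: "AE t in lborel. t \<in> {0<..<T} \<longrightarrow> \<mu> t = m t"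
    using v_eq
  proof eventually_elim
    case (elim t)
    show ?case
    proof
      assume "t \<in> {0<..<T}"
      then have "AE x in lborel. v t x = u' t x" using elim by simp
      then show "\<mu> t = m t" unfolding \<mu>_def m_def
        by (intro integral_cong_AE) (auto elim!: eventually_mono)
    qed
  qed
  have avg: "eventually (\<lambda>h. integrable lborel (\<lambda>t. ramp_deriv c h t * \<mu> t)) (at_right 0)"
    "((\<lambda>h. \<integral>t. ramp_deriv c h t * \<mu> t \<partial>lborel) \<longlongrightarrow> m c) (at_right 0)" if c: "c \<in> {0<..<T}" for c
  proof -
    have "AE t in lborel. t \<in> {c<..<c + (T - c)} \<longrightarrow> \<mu> t = m t"
      using eq by eventually_elim (use c in auto)
    from ramp_deriv_average[OF \<mu> _ this] test_continuous[OF c] c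
    show "eventually (\<lambda>h. integrable lborel (\<lambda>t. ramp_deriv c h t * \<mu> t)) (at_right 0)"
      "((\<lambda>h. \<integral>t. ramp_deriv c h t * \<mu> t \<partial>lborel) \<longlongrightarrow> m c) (at_right 0)"
      by (simp_all add: m_def[abs_def])
  qed
  have a: "a \<in> {0<..<T}" and b: "b \<in> {0<..<T}" using ab by auto
  have small: "eventually (\<lambda>h. h \<in> {0<..<T - b}) (at_right (0::real))"
    using ab by (intro eventually_at_right_real) simp
  have "((\<lambda>h. (\<integral>t. ramp_deriv a h t * \<mu> t \<partial>lborel) - (\<integral>t. ramp_deriv b h t * \<mu> t \<partial>lborel)) \<longlongrightarrow> m a - m b) (at_right 0)"
    by (intro tendsto_diff avg a b)
  moreover have "eventually (\<lambda>h. (\<integral>t. ramp_deriv a h t * \<mu> t \<partial>lborel) - (\<integral>t. ramp_deriv b h t * \<mu> t \<partial>lborel)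
     = (\<integral>q. (ramp a h (fst q) - ramp b h (fst q)) * flux \<zeta> q \<partial>lborel)) (at_right 0)"
    using avg(1)[OF a] avg(1)[OF b] small
  proof eventually_elim
    case (elim h)
    have "(\<integral>t. ramp_deriv a h t * \<mu> t \<partial>lborel) - (\<integral>t. ramp_deriv b h t * \<mu> t \<partial>lborel)
       = (\<integral>t. (ramp_deriv a h t - ramp_deriv b h t) * \<mu> t \<partial>lborel)"
      using elim by (simp add: left_diff_distrib)
    also have "\<dots> = (\<integral>q. (ramp a h (fst q) - ramp b h (fst q)) * flux \<zeta> q \<partial>lborel)"
      unfolding \<mu>_def using ab elim fin by (intro ramp_identity[OF R \<zeta> \<zeta>b]) auto
    finally show ?case .
  qed
  ultimately have lim1: "((\<lambda>h. \<integral>q. (ramp a h (fst q) - ramp b h (fst q)) * flux \<zeta> q \<partial>lborel) \<longlongrightarrow> m a - m b) (at_right 0)"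
    by (rule Lim_transform_eventually)
  \<comment> \<open>A sequence of widths, as dominated convergence is sequential; the factor (T -
    b)/2 keeps the support before T.\<close>
  define h where "h n = (T - b) / 2 * inverse (real (Suc n))" for n
  have h: "0 < h n" "b + h n < T" for n
  proof -
    show "0 < h n" using ab by (simp add: h_def)
    have "h n \<le> (T - b) / 2 * 1" unfolding h_def using ab by (intro mult_left_mono inverse_le_1_iff[THEN iffD2]) auto
    then show "b + h n < T" using ab by (simp add: field_simps)
  qed
  have h0: "h \<longlonglongrightarrow> 0" unfolding h_def by (rule tendsto_mult_right_zero[OF LIMSEQ_inverse_real_of_nat])
  then have h_right: "filterlim h (at_right 0) sequentially"
    using h by (intro tendsto_imp_filterlim_at_right) auto
  have lim2: "(\<lambda>n. \<integral>q. (ramp a (h n) (fst q) - ramp b (h n) (fst q)) * flux \<zeta> q \<partial>lborel) \<longlonglongrightarrow> (\<integral>q. indicator {a<..b} (fst q) * flux \<zeta> q \<partial>lborel)"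
  proof (rule integral_dominated_convergence[where w = "\<lambda>q. \<bar>indicator {0<..<T} (fst q) * flux \<zeta> q\<bar>"])
    show "integrable lborel (\<lambda>q. \<bar>indicator {0<..<T} (fst q) * flux \<zeta> q\<bar>)"
      using fin by (intro integrable_abs flux_integrable[OF R \<zeta> \<zeta>b]) auto
    have ramp_lim: "(\<lambda>n. ramp c (h n) t) \<longlonglongrightarrow> (if c < t then 1 else 0)" for c t
    proof (cases "c < t")
      case True
      then have "eventually (\<lambda>n. h n < t - c) sequentially" using h0 by (intro order_tendstoD(2)) auto
      then have "eventually (\<lambda>n. ramp c (h n) t = 1) sequentially"
        by eventually_elim (use h(1) in \<open>auto intro: ramp_eq(2)\<close>)
      then show ?thesis using True by (simp add: tendsto_eventually)
    next
      case False
      then show ?thesis by (simp add: ramp_eq(1)[OF h(1)])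
    qed
    show "AE q in lborel. (\<lambda>n. (ramp a (h n) (fst q) - ramp b (h n) (fst q)) * flux \<zeta> q) \<longlonglongrightarrow> indicator {a<..b} (fst q) * flux \<zeta> q"
    proof (intro AE_I2 tendsto_mult tendsto_const)
      fix q :: "real \<times> 'a \<times> 'a"
      have "(\<lambda>n. ramp a (h n) (fst q) - ramp b (h n) (fst q)) \<longlonglongrightarrow> (if a < fst q then 1 else 0) - (if b < fst q then 1 else 0)"
        by (intro tendsto_diff ramp_lim)
      also have "(if a < fst q then 1 else 0) - (if b < fst q then 1 else 0) = (indicator {a<..b} (fst q) :: real)"
        using ab by (auto split: split_indicator)
      finally show "(\<lambda>n. ramp a (h n) (fst q) - ramp b (h n) (fst q)) \<longlonglongrightarrow> indicator {a<..b} (fst q)" .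
    qed
    show "AE q in lborel. norm ((ramp a (h n) (fst q) - ramp b (h n) (fst q)) * flux \<zeta> q) \<le> \<bar>indicator {0<..<T} (fst q) * flux \<zeta> q\<bar>" for n
    proof (intro AE_I2)
      fix q :: "real \<times> 'a \<times> 'a"
      have "\<bar>ramp a (h n) (fst q) - ramp b (h n) (fst q)\<bar> \<le> indicator {0<..<T} (fst q)"
      proof (cases "fst q \<in> {0<..<T}")
        case True
        then show ?thesis
          using ramp_bounds[of a "h n" "fst q"] ramp_bounds[of b "h n" "fst q"] by simp
      next
        case False
        then consider "fst q \<le> 0" | "T \<le> fst q" by force
        then show ?thesis using ab h[of n] by cases (auto simp: ramp_eq)
      qed
      then show "norm ((ramp a (h n) (fst q) - ramp b (h n) (fst q)) * flux \<zeta> q) \<le> \<bar>indicator {0<..<T} (fst q) * flux \<zeta> q\<bar>"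
        unfolding norm_mult abs_mult real_norm_def by (simp add: mult_right_mono)
    qed
  qed measurable
  have lim3: "(\<lambda>n. \<integral>q. (ramp a (h n) (fst q) - ramp b (h n) (fst q)) * flux \<zeta> q \<partial>lborel) \<longlonglongrightarrow> m a - m b"
    by (rule filterlim_compose[OF lim1 h_right])
  have "m a - m b = (\<integral>q. indicator {a<..b} (fst q) * flux \<zeta> q \<partial>lborel)"
    by (rule LIMSEQ_unique[OF lim3 lim2])
  also have "\<dots> = (\<integral>q. indicator {a<..<b} (fst q) * flux \<zeta> q \<partial>lborel)"
  \<comment> \<open>The limit of the trapezoids equals 1 at time b, because the second ramp still
    vanishes there; this single time slice is a null set.\<close>
  proof (rule integral_cong_AE)
    have "AE q in lborel \<Otimes>\<^sub>M lborel. fst (q :: real \<times> 'a \<times> 'a) \<noteq> b"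
    proof (rule lborel_pair.AE_pair_measure)
      show "AE x in lborel. AE y in lborel. fst (x, y :: 'a \<times> 'a) \<noteq> b"
        using AE_lborel_singleton[of b] by eventually_elim simp
    qed measurable
    then have "AE q in (lborel :: (real \<times> 'a \<times> 'a) measure). fst q \<noteq> b" by (subst (asm) lborel_prod)
    then show "AE q in lborel. indicator {a<..b} (fst q) * flux \<zeta> q = indicator {a<..<b} (fst q) * flux \<zeta> q"
      by eventually_elim (auto split: split_indicator)
  qed measurable
  finally show ?thesis by (simp add: m_def)
qed

end

end

section \<open>From almost every time to every time\<close>

lemma AE_lborel_dense:
  fixes a b :: real
  assumes P: "AE r in lborel. P r" and ab: "a < b"
  obtains r where "a < r" "r < b" "P r"
proof -
  have "\<exists>r. a < r \<and> r < b \<and> P r"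
  proof (rule ccontr)
    assume *: "\<not> ?thesis"
    have "AE r in lborel. r \<notin> {a<..<b}" using P by eventually_elim (use * in auto)
    then have "{a<..<b} \<in> null_sets lborel" by (subst AE_iff_null_sets) auto
    then have "emeasure lborel {a<..<b} = 0" by auto
    then show False using ab by (simp add: ennreal_eq_0_iff)
  qed
  then show thesis using that by blast
qed

text \<open>For times r arbitrarily close to t the function v r is nonnegative almost everywhere, so
  the negative part of v t is at most |v r - v t|. Its L2 norm over any ball is therefore smaller
  than every positive number.\<close>

lemma L2_limit_nonneg:
  fixes v :: "real \<Rightarrow> 'a::euclidean_space \<Rightarrow> real"
  assumes t: "t \<in> {0<..<T}" and meas: "v t \<in> borel_measurable lebesgue"
    and nonneg: "AE r in lborel. r \<in> {0<..<T} \<longrightarrow> (AE x in lborel. 0 \<le> v r x)"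
    and cont: "\<And>R. 0 < R \<Longrightarrow> ((\<lambda>r. L2_norm_sq (ball 0 R) (\<lambda>x. v r x - v t x)) \<longlongrightarrow> 0) (at t)"
  shows "AE x in lborel. 0 \<le> v t x"
proof -
  obtain g where g: "g \<in> borel_measurable lborel" and vg: "AE x in lborel. v t x = g x"
    using completion_ex_borel_measurable_real[OF meas] by blast
  have [measurable]: "g \<in> borel_measurable borel" using g by simp
  have zero: "AE x in lborel. x \<in> ball 0 R \<longrightarrow> 0 \<le> g x" if R: "0 < R" for R
  proof -
    let ?N = "\<integral>\<^sup>+x. ennreal ((max 0 (- g x))\<^sup>2) * indicator (ball 0 R) x \<partial>lborel"
    have eps: "?N \<le> 0 + ennreal e" if e: "0 < e" for e
    proof -
      have "eventually (\<lambda>r. L2_norm_sq (ball 0 R) (\<lambda>x. v r x - v t x) < ennreal e) (at t)"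
        using cont[OF R] e by (intro order_tendstoD(2)) auto
      then obtain d where d: "0 < d" "\<And>r. r \<noteq> t \<Longrightarrow> dist r t < d \<Longrightarrow> L2_norm_sq (ball 0 R) (\<lambda>x. v r x - v t x) < ennreal e"
        unfolding eventually_at by auto
      obtain r where r: "t < r" "r < min T (t + d)" "r \<in> {0<..<T} \<longrightarrow> (AE x in lborel. 0 \<le> v r x)"
        using t d(1) by (auto intro: AE_lborel_dense[OF nonneg, of t "min T (t + d)"])
      have "AE x in lborel. 0 \<le> v r x" using r t by auto
      then have "?N \<le> (\<integral>\<^sup>+x. ennreal ((v r x - v t x)\<^sup>2) * indicator (ball 0 R) x \<partial>lborel)"
        using vg
      proof (intro nn_integral_mono_AE, eventually_elim)
        case (elim x)
        have "max 0 (- g x) \<le> \<bar>v r x - v t x\<bar>" using elim by auto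
        then have "(max 0 (- g x))\<^sup>2 \<le> \<bar>v r x - v t x\<bar>\<^sup>2" by (intro power_mono) auto
        then show ?case by (auto intro!: mult_right_mono ennreal_leI)
      qed
      also have "\<dots> = L2_norm_sq (ball 0 R) (\<lambda>x. v r x - v t x)"
        unfolding L2_norm_sq_def by (rule nn_integral_lebesgue_on[symmetric]) simp
      also have "\<dots> \<le> ennreal e" using d(2)[of r] r by (auto simp: dist_real_def)
      finally show ?thesis by simp
    qed
    have "?N \<le> 0" by (rule ennreal_le_epsilon) (rule eps)
    then have "?N = 0" by simp
    then have "AE x in lborel. ennreal ((max 0 (- g x))\<^sup>2) * indicator (ball 0 R) x = 0"
      by (subst (asm) nn_integral_0_iff_AE) simp_all
    then show ?thesis by eventually_elim (auto simp: max_def split: if_splits)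
  qed
  have "AE x in lborel. \<forall>n::nat. x \<in> ball 0 (real (Suc n)) \<longrightarrow> 0 \<le> g x"
    unfolding AE_all_countable by (intro allI zero) simp
  then show ?thesis using vg
  proof eventually_elim
    case (elim x)
    obtain n where "norm x < real n" using reals_Archimedean2 by blast
    then have "x \<in> ball 0 (real (Suc n))" by simp
    then show ?case using elim by auto
  qed
qed

context represented_weak_problem
begin

text \<open>The exceptional times are those at which \<open>K\<close> and \<open>k\<close> differ on
  more than a null set of pairs. They do not depend on the ball or on the function, so coercivity
  transfers to \<open>k\<close> for all of these at once.\<close>

lemma AE_coercive:
  "AE t in lborel. t \<in> {0<..<T} \<longrightarrow> (\<forall>c r g. 0 < r \<longrightarrow> g \<in> borel_measurable borel \<longrightarrow>
      (\<integral>\<^sup>+x. ennreal ((g x)\<^sup>2) * indicator (ball c r) x \<partial>lborel) < \<infinity> \<longrightarrow>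
      (\<integral>\<^sup>+z. ennreal ((g (fst z) - g (snd z))\<^sup>2 * norm (fst z - snd z) powr (- p)) * indicator (ball c r \<times> ball c r) z \<partial>lborel) < \<infinity> \<longrightarrow>
      ennreal lam * (\<integral>\<^sup>+z. ennreal ((g (fst z) - g (snd z))\<^sup>2 * norm (fst z - snd z) powr (- p)) * indicator (ball c r \<times> ball c r) z \<partial>lborel)
      \<le> (\<integral>\<^sup>+z. ennreal ((g (fst z) - g (snd z))\<^sup>2 * k t (fst z) (snd z)) * indicator (ball c r \<times> ball c r) z \<partial>lborel))"
  using k(4)
proof eventually_elim
  case (elim t)
  show ?case
  proof (intro impI allI)
    fix c r and g :: "'a \<Rightarrow> real"
    assume r: "0 < r" and g[measurable]: "g \<in> borel_measurable borel"
      and L2: "(\<integral>\<^sup>+x. ennreal ((g x)\<^sup>2) * indicator (ball c r) x \<partial>lborel) < \<infinity>"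
      and H: "(\<integral>\<^sup>+z. ennreal ((g (fst z) - g (snd z))\<^sup>2 * norm (fst z - snd z) powr (- p)) * indicator (ball c r \<times> ball c r) z \<partial>lborel) < \<infinity>"
    have L2eq: "L2_norm_sq (ball c r) g = (\<integral>\<^sup>+x. ennreal ((g x)\<^sup>2) * indicator (ball c r) x \<partial>lborel)"
      by (rule L2_norm_sq_eq) auto
    have Heq: "Hs_seminorm_sq s (ball c r) g = (\<integral>\<^sup>+z. ennreal ((g (fst z) - g (snd z))\<^sup>2 * norm (fst z - snd z) powr (- p)) * indicator (ball c r \<times> ball c r) z \<partial>lborel)"
      by (rule Hs_seminorm_sq_eq[OF _ _ p g]) auto
    have "g \<in> Hs_space s (ball c r)"
      using L2 H by (simp add: Hs_space_def Hs_norm_sq_def L2eq Heq borel_measurable_lebesgue_on[OF g])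
    then have "ennreal lam * Hs_seminorm_sq s (ball c r) g
        \<le> (\<integral>\<^sup>+(x, y). ennreal (\<bar>g x - g y\<bar>\<^sup>2) * K t x y \<partial>lebesgue_on (ball c r \<times> ball c r))"
      using K r unfolding admissible_kernel_def by blast
    also have "\<dots> = (\<integral>\<^sup>+z. (case z of (x, y) \<Rightarrow> ennreal (\<bar>g x - g y\<bar>\<^sup>2) * K t x y) * indicator (ball c r \<times> ball c r) z \<partial>lborel)"
      by (rule nn_integral_lebesgue_on) (intro borel_open open_Times open_ball)
    also have "\<dots> = (\<integral>\<^sup>+z. ennreal ((g (fst z) - g (snd z))\<^sup>2 * k t (fst z) (snd z)) * indicator (ball c r \<times> ball c r) z \<partial>lborel)"
      using elim
    proof (intro nn_integral_cong_AE, eventually_elim)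
      case (elim z)
      then show ?case using k(2)[of t "fst z" "snd z"] by (simp add: split_beta ennreal_mult)
    qed
    finally show "ennreal lam * (\<integral>\<^sup>+z. ennreal ((g (fst z) - g (snd z))\<^sup>2 * norm (fst z - snd z) powr (- p)) * indicator (ball c r \<times> ball c r) z \<partial>lborel)
      \<le> (\<integral>\<^sup>+z. ennreal ((g (fst z) - g (snd z))\<^sup>2 * k t (fst z) (snd z)) * indicator (ball c r \<times> ball c r) z \<partial>lborel)"
      by (simp only: Heq)
  qed
qed

lemma flow: "nonlocal_flow s Lam T u' k lam v"
proof (rule nonlocal_flow.intro[OF data], rule nonlocal_flow_axioms.intro, unfold p[symmetric])
  show "AE t in lborel. t \<in> {0<..<T} \<longrightarrow> (\<forall>c r g. 0 < r \<longrightarrow> g \<in> borel_measurable borel \<longrightarrow>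
      (\<integral>\<^sup>+x. ennreal ((g x)\<^sup>2) * indicator (ball c r) x \<partial>lborel) < \<infinity> \<longrightarrow>
      (\<integral>\<^sup>+z. ennreal ((g (fst z) - g (snd z))\<^sup>2 * norm (fst z - snd z) powr (- p)) * indicator (ball c r \<times> ball c r) z \<partial>lborel) < \<infinity> \<longrightarrow>
      ennreal lam * (\<integral>\<^sup>+z. ennreal ((g (fst z) - g (snd z))\<^sup>2 * norm (fst z - snd z) powr (- p)) * indicator (ball c r \<times> ball c r) z \<partial>lborel)
      \<le> (\<integral>\<^sup>+z. ennreal ((g (fst z) - g (snd z))\<^sup>2 * k t (fst z) (snd z)) * indicator (ball c r \<times> ball c r) z \<partial>lborel))"
    by (rule AE_coercive)
  show "(\<integral>x. v b x * \<zeta> x \<partial>lborel) - (\<integral>x. v a x * \<zeta> x \<partial>lborel) = - (\<integral>q. indicator {a<..<b} (fst q) * flux \<zeta> q \<partial>lborel)"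
    if "0 < a" "a < b" "b < T" "0 < R" "\<zeta> \<in> borel_measurable borel" "\<And>x. 0 \<le> \<zeta> x" "\<And>x. \<zeta> x \<le> 1" "\<And>x. R \<le> norm x \<Longrightarrow> \<zeta> x = 0"
      "(\<integral>\<^sup>+z. ennreal ((\<zeta> (fst z) - \<zeta> (snd z))\<^sup>2 * norm (fst z - snd z) powr (- p)) \<partial>lborel) < \<infinity>" for a b R \<zeta>
    by (rule test_balance[OF that(4-9,1-3)])
qed (use lam v_meas v_nonneg v_eq v_sq v_cont in auto)

end

text \<open>The representative \<open>v\<close> comes with Lebesgue measurability and no sign. L2
  continuity transports the sign from almost every time to every time, after which a Borel and
  pointwise nonnegative version is chosen time by time. Its norm in L1(\<mu>) is unchanged.\<close>

lemma nonlocal_flow_exists: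
  fixes K :: "real \<Rightarrow> 'a::euclidean_space \<Rightarrow> 'a \<Rightarrow> ennreal" and u v :: "real \<Rightarrow> 'a \<Rightarrow> real"
  assumes s: "0 < s" "s < 1" and pos: "0 < lam" "0 < Lam" "0 < T"
    and p: "p = real DIM('a) + 2 * s"
    and K: "admissible_kernel s lam Lam K" and sol: "global_weak_solution s K {0<..T} u"
    and nonneg: "ae_nonneg {0<..T} u" and rep: "continuous_representative {0<..T} u v"
  obtains u' k and w :: "real \<Rightarrow> 'a \<Rightarrow> real" where "nonlocal_flow s Lam T u' k lam w"
    "\<And>t. t \<in> {0<..<T} \<Longrightarrow> L1mu_norm s (v t) = wmass p (w t)"
proof -
  have "(\<lambda>(t, x). u t x) \<in> borel_measurable (lebesgue_on ({0<..T} \<times> UNIV))"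
    using sol by (simp add: global_weak_solution_def solution_space_def)
  then obtain u' where u': "(\<lambda>(t, x). u' t x) \<in> borel_measurable borel" "\<And>t x. (0::real) \<le> u' t x"
    "AE t in lborel. t \<in> {0<..T} \<longrightarrow> (AE x in lborel. u t x = u' t x)"
    by (rule borel_representative_exists[OF _ _ nonneg]) auto
  obtain k where k: "(\<lambda>(t, x, y). k t x y) \<in> borel_measurable borel" "\<And>t x y. (0::real) \<le> k t x y"
    "\<And>t x y. k t x y \<le> Lam * norm (x - y) powr (- p)"
    "AE t in lborel. AE z in lborel. K t (fst z) (snd z) = ennreal (k t (fst z) (snd z))"
  proof (rule borel_kernel_exists[OF K pos(2) p], goal_cases)
    case (1 k)
    show ?case by (rule that) (fact 1)+
  qed
  have vu: "AE t in lborel. t \<in> {0<..T} \<longrightarrow> (AE x in lborel. v t x = u' t x)"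
  proof -
    have S: "{0<..T} \<times> (UNIV :: 'a set) \<in> sets borel" by (simp add: borel_prod[symmetric])
    have "AE q in lborel. q \<in> {0<..T} \<times> UNIV \<longrightarrow> (case q of (t, x) \<Rightarrow> v t x = u t x)"
      using rep unfolding continuous_representative_def by (subst AE_lebesgue_on_iff[OF S, symmetric]) blast
    from AE_lborel_pairD[OF this] u'(3) show ?thesis
    proof eventually_elim
      case (elim t)
      show ?case
      proof
        assume "t \<in> {0<..T}"
        then have "AE x in lborel. v t x = u t x" "AE x in lborel. u t x = u' t x" using elim by auto
        then show "AE x in lborel. v t x = u' t x" by eventually_elim simp
      qed
    qed
  qed
  have meas: "v t \<in> borel_measurable lebesgue" if "t \<in> {0<..<T}" for t
    using rep that by (simp add: continuous_representative_def)
  have cont: "((\<lambda>r. L2_norm_sq (ball 0 R) (\<lambda>x. v r x - v t x)) \<longlongrightarrow> 0) (at t)" if "t \<in> {0<..<T}" "0 < R" for t R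
  proof -
    have "at t within {0<..T} = at t" using that(1) by (intro at_within_interior) simp
    moreover have "((\<lambda>r. L2_norm_sq (ball 0 R) (\<lambda>x. v r x - v t x)) \<longlongrightarrow> 0) (at t within {0<..T})"
      using rep that by (simp add: continuous_representative_def)
    ultimately show ?thesis by simp
  qed
  have "AE r in lborel. r \<in> {0<..<T} \<longrightarrow> (AE x in lborel. 0 \<le> v r x)"
    using vu
  proof eventually_elim
    case (elim r)
    show ?case
    proof
      assume "r \<in> {0<..<T}"
      then have "AE x in lborel. v r x = u' r x" using elim by simp
      then show "AE x in lborel. 0 \<le> v r x" by eventually_elim (simp add: u'(2))
    qed
  qed
  then have v_nonneg: "AE x in lborel. 0 \<le> v t x" if "t \<in> {0<..<T}" for t
    by (rule L2_limit_nonneg[OF that meas[OF that] _ cont[OF that]])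
  \<comment> \<open>Outside (0, T) the version is set to 0, since measurability and sign are
    required at all real times.\<close>
  have "\<exists>g. g \<in> borel_measurable borel \<and> (\<forall>x. 0 \<le> g x) \<and> (t \<in> {0<..<T} \<longrightarrow> (AE x in lborel. v t x = g x))" for t
  proof (cases "t \<in> {0<..<T}")
    case True
    obtain g where g: "g \<in> borel_measurable lborel" and vg: "AE x in lborel. v t x = g x"
      using completion_ex_borel_measurable_real[OF meas[OF True]] by blast
    have "AE x in lborel. v t x = max 0 (g x)"
      using vg v_nonneg[OF True] by eventually_elim simp
    moreover have "(\<lambda>x. max 0 (g x)) \<in> borel_measurable borel" using g by simp
    ultimately show ?thesis by (intro exI[of _ "\<lambda>x. max 0 (g x)"]) auto
  next
    case False
    then show ?thesis by (intro exI[of _ "\<lambda>x. 0"]) auto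
  qed
  then obtain w where w: "\<And>t. w t \<in> borel_measurable borel" "\<And>t x. 0 \<le> w t x"
    "\<And>t. t \<in> {0<..<T} \<Longrightarrow> AE x in lborel. v t x = w t x"
    by metis
  interpret weak_problem s lam Lam T p K u u' k
    by (rule weak_problem.intro) (fact s pos p K sol u' k)+
  interpret represented_weak_problem s lam Lam T p K u u' k w
  proof
    show "AE t in lborel. t \<in> {0<..<T} \<longrightarrow> (AE x in lborel. w t x = u' t x)"
      using vu
    proof eventually_elim
      case (elim t)
      show ?case
      proof
        assume t: "t \<in> {0<..<T}"
        then have "AE x in lborel. v t x = u' t x" using elim by simp
        then show "AE x in lborel. w t x = u' t x" using w(3)[OF t] by eventually_elim simp
      qed
    qed
    show "(\<integral>\<^sup>+x. ennreal ((w t x)\<^sup>2) * indicator (ball 0 R) x \<partial>lborel) < \<infinity>" if t: "t \<in> {0<..<T}" and "0 < R" for t R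
    proof -
      have "L2_norm_sq (ball 0 R) (v t) < \<infinity>" using rep that by (simp add: continuous_representative_def)
      then show ?thesis by (simp add: L2_norm_sq_eq[OF w(3)[OF t]])
    qed
    show "((\<lambda>r. \<integral>\<^sup>+x. ennreal ((w r x - w t x)\<^sup>2) * indicator (ball 0 R) x \<partial>lborel) \<longlongrightarrow> 0) (at t)"
      if t: "t \<in> {0<..<T}" and R: "0 < R" for t R
    proof (rule Lim_transform_eventually[OF cont[OF t R]])
      have "eventually (\<lambda>r. r \<in> {0<..<T}) (at t)" using t by (intro eventually_at_in_open') auto
      then show "eventually (\<lambda>r. L2_norm_sq (ball 0 R) (\<lambda>x. v r x - v t x) = (\<integral>\<^sup>+x. ennreal ((w r x - w t x)\<^sup>2) * indicator (ball 0 R) x \<partial>lborel)) (at t)"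
      proof eventually_elim
        case (elim r)
        show ?case
          by (rule L2_norm_sq_eq) (use w(3)[OF elim] w(3)[OF t] in \<open>eventually_elim, simp\<close>, simp)
      qed
    qed
  qed (fact w)+
  show thesis
  proof (rule that[OF flow])
    show "L1mu_norm s (v t) = wmass p (w t)" if "t \<in> {0<..<T}" for t
      by (rule L1mu_norm_eq_wmass[OF w(3)[OF that] w(2) p])
  qed
qed

theorem proposition6p1:
  fixes s lam Lam T :: real
  assumes "0 < s" and "s < 1" and "0 < lam" and "lam \<le> Lam" and "0 < T"
  shows "\<exists>c>1. \<forall>(K :: real \<Rightarrow> 'a::euclidean_space \<Rightarrow> 'a \<Rightarrow> ennreal) u v t \<tau>.
           admissible_kernel s lam Lam K \<longrightarrow>
           global_weak_solution s K {0<..T} u \<longrightarrow>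
           ae_nonneg {0<..T} u \<longrightarrow>
           continuous_representative {0<..T} u v \<longrightarrow>
           t \<in> {0<..<T} \<longrightarrow> \<tau> \<in> {0<..<T} \<longrightarrow>
           ennreal (1 / c) * L1mu_norm s (v \<tau>) \<le> L1mu_norm s (v t) \<and>
           L1mu_norm s (v t) \<le> ennreal c * L1mu_norm s (v \<tau>)"
proof -
  define p where "p = real DIM('a) + 2 * s"
  have Lam: "0 < Lam" using assms by simp
  obtain c where c: "1 < c"
    "\<And>(u :: real \<Rightarrow> 'a \<Rightarrow> real) k v t \<tau>. nonlocal_flow s Lam T u k lam v \<Longrightarrow>
      t \<in> {0<..<T} \<Longrightarrow> \<tau> \<in> {0<..<T} \<Longrightarrow> wmass p (v t) \<le> ennreal c * wmass p (v \<tau>)"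
    by (rule wmass_comparable[OF assms(1,2) Lam assms(5,3) p_def], rule that, assumption, blast)
  show ?thesis
  proof (intro exI[of _ c] conjI allI impI)
    fix K :: "real \<Rightarrow> 'a \<Rightarrow> 'a \<Rightarrow> ennreal" and u v t \<tau>
    assume data: "admissible_kernel s lam Lam K" "global_weak_solution s K {0<..T} u"
      "ae_nonneg {0<..T} u" "continuous_representative {0<..T} u v"
      and t: "t \<in> {0<..<T}" and \<tau>: "\<tau> \<in> {0<..<T}"
    obtain u' k and w :: "real \<Rightarrow> 'a \<Rightarrow> real" where flow: "nonlocal_flow s Lam T u' k lam w"
      and eq: "\<And>t. t \<in> {0<..<T} \<Longrightarrow> L1mu_norm s (v t) = wmass p (w t)"
      using nonlocal_flow_exists[OF assms(1,2,3) Lam assms(5) p_def data] by blast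
    show "L1mu_norm s (v t) \<le> ennreal c * L1mu_norm s (v \<tau>)"
      using c(2)[OF flow t \<tau>] unfolding eq[OF t] eq[OF \<tau>] .
    \<comment> \<open>The lower bound is the upper bound with the two times exchanged.\<close>
    have "ennreal (1 / c) * L1mu_norm s (v \<tau>) \<le> ennreal (1 / c) * (ennreal c * L1mu_norm s (v t))"
      using c(2)[OF flow \<tau> t] unfolding eq[OF t] eq[OF \<tau>] by (intro mult_left_mono) auto
    also have "\<dots> = L1mu_norm s (v t)"
    proof -
      have "ennreal (1 / c) * ennreal c = 1" using c(1) by (simp add: ennreal_mult[symmetric])
      then show ?thesis by (simp add: mult.assoc[symmetric])
    qed
    finally show "ennreal (1 / c) * L1mu_norm s (v \<tau>) \<le> L1mu_norm s (v t)" .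
  qed (fact c(1))
qed

end
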